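(* Let the standing assumptions (L1) and (L2) listed in the context hold. Let $(u_1(\cdot),u_2(\cdot))\in\mathcal A_1^S\times\mathcal A_2^S$ with corresponding state $X(\cdot)$, and let $(p(\cdot),q(\cdot),\tilde q(\cdot))$ be the solution of the adjoint equation (Adj) in the context. Then $(u_1,u_2;X)$ is an optimal pair (i.e. $(u_1,u_2)$ is an open-loop saddle) of the linear-quadratic game described in the context if and only if, for a.e. $t\in[0,T]$, almost surely, $$\begin{aligned}&2N_{11}(t)u_1(t)+2N_{12}(t)\mathbb E[u_1(t)]+(B_{11}^\top(t)-h(t)G_{11}^\top(t))\mathbb E[p(t)|\mathscr F^Y_t]+(B_{12}^\top(t)-h(t)G_{12}^\top(t))\mathbb E[p(t)]\\&\quad+D_{11}^\top(t)\mathbb E[q(t)|\mathscr F^Y_t]+D_{12}^\top(t)\mathbb E[q(t)]=0\end{aligned}$$ and $$\begin{aligned}&2N_{21}(t)u_2(t)+2N_{22}(t)\mathbb E[u_2(t)]+(B_{21}^\top(t)-h(t)G_{21}^\top(t))\mathbb E[p(t)|\mathscr F^Y_t]+(B_{22}^\top(t)-h(t)G_{22}^\top(t))\mathbb E[p(t)]\\&\quad+D_{21}^\top(t)\mathbb E[q(t)|\mathscr F^Y_t]+D_{22}^\top(t)\mathbb E[q(t)]=0.\end{aligned}$$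
   Context: **Setting.** $0<T<\infty$; $(\Omega,\mathscr F,\mathbb P)$ is a complete probability space with two independent one-dimensional standard Brownian motions $W,Y$; $\mathscr F^W_t,\mathscr F^Y_t$ are their $\mathbb P$-completed natural filtrations, $\mathscr F_t=\mathscr F^W_t\vee\mathscr F^Y_t$, $\mathscr F=\mathscr F_T$; $\mathbb E$ is expectation under $\mathbb P$. For $i=1,2$, $\mathcal A_i^S=M^2_{\mathscr F^Y}(0,T;\mathbb R^{k_i})$ is the space of $\{\mathscr F^Y_t\}$-adapted $\mathbb R^{k_i}$-valued processes $u$ with $\mathbb E\int_0^T|u(t)|^2dt<\infty$. $S^2_{\mathscr F}(0,T;\mathbb R^n)$: $\mathscr F_t$-adapted càdlàg processes with $\mathbb E[\sup_t|f(t)|^2]<\infty$; $M^2_{\mathscr F}(0,T;\mathbb R^n)$: $\mathscr F_t$-adapted processes with $\mathbb E\int_0^T|f|^2dt<\infty$. **Assumption (L1).** $A_1,A_2,C_1,C_2,F_1,F_2:[0,T]\to\mathbb R^{n\times n}$; $B_{11},B_{12},D_{11},D_{12},G_{11},G_{12}:[0,T]\to\mathbb R^{n\times k_1}$; $B_{21},B_{22},D_{21},D_{22},G_{21},G_{22}:[0,T]\to\mathbb R^{n\times k_2}$; symmetric-matrix-valued $N_{11},N_{12}:[0,T]\to\mathbb R^{k_1\times k_1}$ and $N_{21},N_{22}:[0,T]\to\mathbb R^{k_2\times k_2}$; $Q:[0,T]\to\mathbb R^n$; $h:[0,T]\to\mathbb R$ are uniformly bounded measurable (deterministic) functions, and $M\in\mathbb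 R^n$ is a vector. **Assumption (L2).** There is $\delta>0$ such that for a.e. $t\in[0,T]$: for all $u_1\in\mathbb R^{k_1}$, $\langle N_{11}(t)u_1,u_1\rangle\ge\delta|u_1|^2$ and $\langle(N_{11}(t)+N_{12}(t))u_1,u_1\rangle\ge\delta|u_1|^2$; for all $u_2\in\mathbb R^{k_2}$, $\langle N_{21}(t)u_2,u_2\rangle\le-\delta|u_2|^2$ and $\langle(N_{21}(t)+N_{22}(t))u_2,u_2\rangle\le-\delta|u_2|^2$. **State.** Let $x_0\in\mathbb R^n$. For $(u_1,u_2)\in\mathcal A_1^S\times\mathcal A_2^S$ the state $X$ solves $$\begin{aligned}dX(t)=&\big(A_1X+A_2\mathbb E[X]+B_{11}u_1+B_{12}\mathbb E[u_1]+B_{21}u_2+B_{22}\mathbb E[u_2]\big)(t)\,dt\\&+\big(C_1X+C_2\mathbb E[X]+D_{11}u_1+D_{12}\mathbb E[u_1]+D_{21}u_2+D_{22}\mathbb E[u_2]\big)(t)\,dW(t)\\&+\big(F_1X+F_2\mathbb E[X]+G_{11}u_1+G_{12}\mathbb E[u_1]+G_{21}u_2+G_{22}\mathbb E[u_2]\big)(t)\,dW^{(u_1,u_2)}(t),\quad X(0)=x_0,\end{aligned}$$ where $W^{(u_1,u_2)}$ is determined by the observation equation $dY(t)=h(t)dt+dW^{(u_1,u_2)}(t)$, $Y(0)=0$; i.e. $dW^{(u_1,u_2)}(t)=dY(t)-h(t)dt$, with $Y$ a Brownian motion under $\mathbb P$. **Cost.** (Player 1 minimizes, Player 2 maximizes;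 expectations are under $\mathbb P$.) $$\begin{aligned}J(u_1,u_2)=\mathbb E\Big[&\langle M,X(T)\rangle+\int_0^T\langle Q(s),X(s)\rangle ds\\&+\int_0^T\big(\langle N_{11}(s)u_1(s),u_1(s)\rangle+\langle N_{12}(s)\mathbb E[u_1(s)],\mathbb E[u_1(s)]\rangle\big)ds\\&+\int_0^T\big(\langle N_{21}(s)u_2(s),u_2(s)\rangle+\langle N_{22}(s)\mathbb E[u_2(s)],\mathbb E[u_2(s)]\rangle\big)ds\Big].\end{aligned}$$ **Optimality.** $(\bar u_1,\bar u_2)\in\mathcal A_1^S\times\mathcal A_2^S$ is an optimal open-loop control (open-loop saddle) if $J(\bar u_1,u_2)\le J(\bar u_1,\bar u_2)\le J(u_1,\bar u_2)$ for all $(u_1,u_2)\in\mathcal A_1^S\times\mathcal A_2^S$; together with its state it is an optimal pair. **Adjoint equation (Adj).** $(p,q,\tilde q)\in S^2_{\mathscr F}(0,T;\mathbb R^n)\times M^2_{\mathscr F}(0,T;\mathbb R^n)\times M^2_{\mathscr F}(0,T;\mathbb R^n)$ is the unique solution of $$\begin{aligned}dp(t)=&-\Big[(A_1^\top-hF_1^\top)p+(A_2^\top-hF_2^\top)\mathbb E[p]+C_1^\top q+C_2^\top\mathbb E[q]+F_1^\top\tilde q+F_2^\top\mathbb E[\tilde q]+Q\Big](t)\,dt\\&+q(t)dW(t)+\tilde q(t)dY(t),\qquad p(T)=M.\end{aligned}$$ *)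

theory Defs
  imports "HOL-Probability.Probability"
begin

section \<open>Filtrations and Brownian motions on a finite horizon\<close>

text \<open>Processes are curried functions \<open>u t \<omega>\<close>; only their values for \<open>0 \<le> t \<le> T\<close> matter.\<close>

definition history :: "'a measure \<Rightarrow> (real \<Rightarrow> 'a \<Rightarrow> real) \<Rightarrow> real \<Rightarrow> 'a measure" where
  "history M Z t = sigma (space M) {Z s -` B \<inter> space M | s B. s \<in> {0..t} \<and> B \<in> sets borel}"

definition natural_filtration :: "'a measure \<Rightarrow> (real \<Rightarrow> 'a \<Rightarrow> real) \<Rightarrow> real \<Rightarrow> 'a measure" where
  "natural_filtration M Z t = sigma (space M) (sets (history M Z t) \<union> null_sets M)"

definition joint_filtration ::
  "'a measure \<Rightarrow> (real \<Rightarrow> 'a \<Rightarrow> real) \<Rightarrow> (real \<Rightarrow> 'a \<Rightarrow> real) \<Rightarrow> real \<Rightarrow> 'a measure" where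
  "joint_filtration M W Y t =
     sigma (space M) (sets (natural_filtration M W t) \<union> sets (natural_filtration M Y t))"

definition brownian_motion :: "'a measure \<Rightarrow> real \<Rightarrow> (real \<Rightarrow> 'a \<Rightarrow> real) \<Rightarrow> bool" where
  "brownian_motion M T W \<longleftrightarrow>
     (\<forall>t\<in>{0..T}. W t \<in> borel_measurable M) \<and>
     (AE \<omega> in M. W 0 \<omega> = 0) \<and>
     (AE \<omega> in M. continuous_on {0..T} (\<lambda>t. W t \<omega>)) \<and>
     (\<forall>s t. 0 \<le> s \<and> s < t \<and> t \<le> T \<longrightarrow>
        distributed M lborel (\<lambda>\<omega>. W t \<omega> - W s \<omega>) (normal_density 0 (sqrt (t - s))) \<and>
        prob_space.indep_set M (sets (history M W s))
          {(\<lambda>\<omega>. W t \<omega> - W s \<omega>) -` B \<inter> space M | B. B \<in> sets borel})"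

definition independent_processes ::
  "'a measure \<Rightarrow> real \<Rightarrow> (real \<Rightarrow> 'a \<Rightarrow> real) \<Rightarrow> (real \<Rightarrow> 'a \<Rightarrow> real) \<Rightarrow> bool" where
  "independent_processes M T W Y \<longleftrightarrow>
     prob_space.indep_set M (sets (history M W T)) (sets (history M Y T))"


section \<open>Spaces of processes\<close>

definition adapted :: "real \<Rightarrow> (real \<Rightarrow> 'a measure) \<Rightarrow> (real \<Rightarrow> 'a \<Rightarrow> 'b::euclidean_space) \<Rightarrow> bool" where
  "adapted T F u \<longleftrightarrow> (\<forall>t\<in>{0..T}. u t \<in> borel_measurable (F t))"

text \<open>
  Joint measurability in \<open>(t, \<omega>)\<close> is the usual implicit requirement that makes the
  integral over \<open>[0, T] \<times> \<Omega>\<close> meaningful. As in the literature, elements are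
  processes rather than equivalence classes modulo \<open>dt \<otimes> dP\<close>.
\<close>

definition M2_space ::
  "'a measure \<Rightarrow> real \<Rightarrow> (real \<Rightarrow> 'a measure) \<Rightarrow> (real \<Rightarrow> 'a \<Rightarrow> 'b::euclidean_space) set" where
  "M2_space M T F = {u. adapted T F u \<and>
     (\<lambda>(t, \<omega>). u t \<omega>) \<in> borel_measurable (restrict_space borel {0..T} \<Otimes>\<^sub>M M) \<and>
     (\<integral>\<^sup>+\<omega>. (\<integral>\<^sup>+t\<in>{0..T}. ennreal ((norm (u t \<omega>))\<^sup>2) \<partial>lborel) \<partial>M) < \<infinity>}"

definition cadlag_on :: "real \<Rightarrow> (real \<Rightarrow> 'b::euclidean_space) \<Rightarrow> bool" where
  "cadlag_on T f \<longleftrightarrow>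
     (\<forall>t\<in>{0..<T}. (f \<longlongrightarrow> f t) (at_right t)) \<and>
     (\<forall>t\<in>{0<..T}. \<exists>l. (f \<longlongrightarrow> l) (at_left t))"

definition S2_space ::
  "'a measure \<Rightarrow> real \<Rightarrow> (real \<Rightarrow> 'a measure) \<Rightarrow> (real \<Rightarrow> 'a \<Rightarrow> 'b::euclidean_space) set" where
  "S2_space M T F = {f. adapted T F f \<and> (\<forall>\<omega>\<in>space M. cadlag_on T (\<lambda>t. f t \<omega>)) \<and>
     (\<integral>\<^sup>+\<omega>. (SUP t\<in>{0..T}. ennreal ((norm (f t \<omega>))\<^sup>2)) \<partial>M) < \<infinity>}"


section \<open>The stochastic integral\<close>

definition elementary_process ::
  "'a measure \<Rightarrow> real \<Rightarrow> (real \<Rightarrow> 'a measure) \<Rightarrow> nat \<Rightarrow> (nat \<Rightarrow> real) \<Rightarrow>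
   (nat \<Rightarrow> 'a \<Rightarrow> 'b::euclidean_space) \<Rightarrow> bool" where
  "elementary_process M T F m \<tau> \<xi> \<longleftrightarrow>
     0 \<le> \<tau> 0 \<and> \<tau> m \<le> T \<and> (\<forall>i<m. \<tau> i \<le> \<tau> (Suc i)) \<and>
     (\<forall>i<m. \<xi> i \<in> borel_measurable (F (\<tau> i)) \<and> (\<exists>K. \<forall>\<omega>\<in>space M. norm (\<xi> i \<omega>) \<le> K))"

definition elementary_val ::
  "nat \<Rightarrow> (nat \<Rightarrow> real) \<Rightarrow> (nat \<Rightarrow> 'a \<Rightarrow> 'b::euclidean_space) \<Rightarrow> real \<Rightarrow> 'a \<Rightarrow> 'b" where
  "elementary_val m \<tau> \<xi> t \<omega> = (\<Sum>i<m. indicator {\<tau> i<..\<tau> (Suc i)} t *\<^sub>R \<xi> i \<omega>)"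

definition elementary_integral ::
  "(real \<Rightarrow> 'a \<Rightarrow> real) \<Rightarrow> nat \<Rightarrow> (nat \<Rightarrow> real) \<Rightarrow> (nat \<Rightarrow> 'a \<Rightarrow> 'b::euclidean_space) \<Rightarrow>
   real \<Rightarrow> 'a \<Rightarrow> 'b" where
  "elementary_integral Z m \<tau> \<xi> t \<omega> =
     (\<Sum>i<m. (Z (min t (\<tau> (Suc i))) \<omega> - Z (min t (\<tau> i)) \<omega>) *\<^sub>R \<xi> i \<omega>)"

text \<open>
  \<open>I\<close> is (a version of) the process \<open>t \<mapsto> \<integral>\<^sub>0\<^sup>t H dZ\<close>, \<open>0 \<le> t \<le> T\<close>: the adapted process with
  almost surely continuous paths that is the mean-square limit of the integrals of elementary
  processes approximating \<open>H\<close> in \<open>M\<^sup>2\<close>. The integrators used below are Brownian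
  motions, possibly with a bounded deterministic drift; for these the limit does not depend on
  the approximating sequence, and \<open>I\<close> is determined up to indistinguishability.
\<close>

definition has_stoch_integral ::
  "'a measure \<Rightarrow> real \<Rightarrow> (real \<Rightarrow> 'a measure) \<Rightarrow> (real \<Rightarrow> 'a \<Rightarrow> real) \<Rightarrow>
   (real \<Rightarrow> 'a \<Rightarrow> 'b::euclidean_space) \<Rightarrow> (real \<Rightarrow> 'a \<Rightarrow> 'b) \<Rightarrow> bool" where
  "has_stoch_integral M T F Z H I \<longleftrightarrow>
     H \<in> M2_space M T F \<and> adapted T F I \<and>
     (AE \<omega> in M. continuous_on {0..T} (\<lambda>t. I t \<omega>)) \<and>
     (\<exists>m \<tau> \<xi>. (\<forall>j. elementary_process M T F (m j) (\<tau> j) (\<xi> j)) \<and>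
        ((\<lambda>j::nat. \<integral>\<^sup>+\<omega>. (\<integral>\<^sup>+t\<in>{0..T}.
             ennreal ((norm (elementary_val (m j) (\<tau> j) (\<xi> j) t \<omega> - H t \<omega>))\<^sup>2) \<partial>lborel) \<partial>M)
           \<longlonglongrightarrow> 0) \<and>
        (\<forall>t\<in>{0..T}. (\<lambda>j. \<integral>\<^sup>+\<omega>.
             ennreal ((norm (elementary_integral Z (m j) (\<tau> j) (\<xi> j) t \<omega> - I t \<omega>))\<^sup>2) \<partial>M)
           \<longlonglongrightarrow> 0))"


section \<open>Data of the linear-quadratic game\<close>

text \<open>
  The vector-valued weight \<open>Q\<close>, the observation drift \<open>h\<close> and the terminal weight \<open>M\<close>
  are the fields \<open>Q_run\<close>, \<open>h_obs\<close> and \<open>M_term\<close>; \<open>M\<close> is reserved for the probability space.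
  A value of type \<open>real^'k^'n\<close> is a matrix with rows indexed by \<open>'n\<close> and columns by \<open>'k\<close>.
\<close>

record ('n, 'k1, 'k2) lq_data =
  A1 :: "real \<Rightarrow> real^'n^'n"
  A2 :: "real \<Rightarrow> real^'n^'n"
  C1 :: "real \<Rightarrow> real^'n^'n"
  C2 :: "real \<Rightarrow> real^'n^'n"
  F1 :: "real \<Rightarrow> real^'n^'n"
  F2 :: "real \<Rightarrow> real^'n^'n"
  B11 :: "real \<Rightarrow> real^'k1^'n"
  B12 :: "real \<Rightarrow> real^'k1^'n"
  D11 :: "real \<Rightarrow> real^'k1^'n"
  D12 :: "real \<Rightarrow> real^'k1^'n"
  G11 :: "real \<Rightarrow> real^'k1^'n"
  G12 :: "real \<Rightarrow> real^'k1^'n"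
  B21 :: "real \<Rightarrow> real^'k2^'n"
  B22 :: "real \<Rightarrow> real^'k2^'n"
  D21 :: "real \<Rightarrow> real^'k2^'n"
  D22 :: "real \<Rightarrow> real^'k2^'n"
  G21 :: "real \<Rightarrow> real^'k2^'n"
  G22 :: "real \<Rightarrow> real^'k2^'n"
  N11 :: "real \<Rightarrow> real^'k1^'k1"
  N12 :: "real \<Rightarrow> real^'k1^'k1"
  N21 :: "real \<Rightarrow> real^'k2^'k2"
  N22 :: "real \<Rightarrow> real^'k2^'k2"
  Q_run :: "real \<Rightarrow> real^'n"
  h_obs :: "real \<Rightarrow> real"
  M_term :: "real^'n"

definition bdd_meas :: "real \<Rightarrow> (real \<Rightarrow> 'b::euclidean_space) \<Rightarrow> bool" where
  "bdd_meas T f \<longleftrightarrow> f \<in> borel_measurable (restrict_space borel {0..T}) \<and> bounded (f ` {0..T})"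

definition sym_valued :: "real \<Rightarrow> (real \<Rightarrow> real^'k^'k) \<Rightarrow> bool" where
  "sym_valued T N \<longleftrightarrow> (\<forall>t\<in>{0..T}. transpose (N t) = N t)"

definition L1 :: "real \<Rightarrow> ('n::finite, 'k1::finite, 'k2::finite) lq_data \<Rightarrow> bool" where
  "L1 T \<Gamma> \<longleftrightarrow>
     bdd_meas T (A1 \<Gamma>) \<and> bdd_meas T (A2 \<Gamma>) \<and> bdd_meas T (C1 \<Gamma>) \<and> bdd_meas T (C2 \<Gamma>) \<and>
     bdd_meas T (F1 \<Gamma>) \<and> bdd_meas T (F2 \<Gamma>) \<and>
     bdd_meas T (B11 \<Gamma>) \<and> bdd_meas T (B12 \<Gamma>) \<and> bdd_meas T (D11 \<Gamma>) \<and> bdd_meas T (D12 \<Gamma>) \<and>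
     bdd_meas T (G11 \<Gamma>) \<and> bdd_meas T (G12 \<Gamma>) \<and>
     bdd_meas T (B21 \<Gamma>) \<and> bdd_meas T (B22 \<Gamma>) \<and> bdd_meas T (D21 \<Gamma>) \<and> bdd_meas T (D22 \<Gamma>) \<and>
     bdd_meas T (G21 \<Gamma>) \<and> bdd_meas T (G22 \<Gamma>) \<and>
     bdd_meas T (N11 \<Gamma>) \<and> bdd_meas T (N12 \<Gamma>) \<and> bdd_meas T (N21 \<Gamma>) \<and> bdd_meas T (N22 \<Gamma>) \<and>
     sym_valued T (N11 \<Gamma>) \<and> sym_valued T (N12 \<Gamma>) \<and> sym_valued T (N21 \<Gamma>) \<and> sym_valued T (N22 \<Gamma>) \<and>
     bdd_meas T (Q_run \<Gamma>) \<and> bdd_meas T (h_obs \<Gamma>)"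

definition L2 :: "real \<Rightarrow> ('n::finite, 'k1::finite, 'k2::finite) lq_data \<Rightarrow> bool" where
  "L2 T \<Gamma> \<longleftrightarrow> (\<exists>\<delta>>0. AE t in lborel. t \<in> {0..T} \<longrightarrow>
     (\<forall>u. (N11 \<Gamma> t *v u) \<bullet> u \<ge> \<delta> * (norm u)\<^sup>2 \<and>
          ((N11 \<Gamma> t + N12 \<Gamma> t) *v u) \<bullet> u \<ge> \<delta> * (norm u)\<^sup>2) \<and>
     (\<forall>u. (N21 \<Gamma> t *v u) \<bullet> u \<le> - \<delta> * (norm u)\<^sup>2 \<and>
          ((N21 \<Gamma> t + N22 \<Gamma> t) *v u) \<bullet> u \<le> - \<delta> * (norm u)\<^sup>2))"


section \<open>State equation, cost, saddle points\<close>

abbreviation mean :: "'a measure \<Rightarrow> (real \<Rightarrow> 'a \<Rightarrow> 'b::euclidean_space) \<Rightarrow> real \<Rightarrow> 'b" where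
  "mean M u t \<equiv> (\<integral>\<omega>. u t \<omega> \<partial>M)"

text \<open>The process \<open>W\<^sup>(\<^sup>u\<^sup>1\<^sup>,\<^sup>u\<^sup>2\<^sup>)\<close> given by the observation equation
  \<open>dY = h dt + dW\<^sup>(\<^sup>u\<^sup>1\<^sup>,\<^sup>u\<^sup>2\<^sup>)\<close>, \<open>Y(0) = 0\<close>.\<close>

definition obs_noise ::
  "('n::finite, 'k1::finite, 'k2::finite) lq_data \<Rightarrow> (real \<Rightarrow> 'a \<Rightarrow> real) \<Rightarrow> real \<Rightarrow> 'a \<Rightarrow> real" where
  "obs_noise \<Gamma> Y t \<omega> = Y t \<omega> - (LBINT s:{0..t}. h_obs \<Gamma> s)"

definition drift_coeff where
  "drift_coeff M \<Gamma> X u1 u2 t \<omega> =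
     A1 \<Gamma> t *v X t \<omega> + A2 \<Gamma> t *v mean M X t +
     B11 \<Gamma> t *v u1 t \<omega> + B12 \<Gamma> t *v mean M u1 t +
     B21 \<Gamma> t *v u2 t \<omega> + B22 \<Gamma> t *v mean M u2 t"

definition W_coeff where
  "W_coeff M \<Gamma> X u1 u2 t \<omega> =
     C1 \<Gamma> t *v X t \<omega> + C2 \<Gamma> t *v mean M X t +
     D11 \<Gamma> t *v u1 t \<omega> + D12 \<Gamma> t *v mean M u1 t +
     D21 \<Gamma> t *v u2 t \<omega> + D22 \<Gamma> t *v mean M u2 t"

definition obs_coeff where
  "obs_coeff M \<Gamma> X u1 u2 t \<omega> =
     F1 \<Gamma> t *v X t \<omega> + F2 \<Gamma> t *v mean M X t +
     G11 \<Gamma> t *v u1 t \<omega> + G12 \<Gamma> t *v mean M u1 t +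
     G21 \<Gamma> t *v u2 t \<omega> + G22 \<Gamma> t *v mean M u2 t"

definition is_state ::
  "'a measure \<Rightarrow> real \<Rightarrow> (real \<Rightarrow> 'a \<Rightarrow> real) \<Rightarrow> (real \<Rightarrow> 'a \<Rightarrow> real) \<Rightarrow>
   ('n::finite, 'k1::finite, 'k2::finite) lq_data \<Rightarrow> real^'n \<Rightarrow>
   (real \<Rightarrow> 'a \<Rightarrow> real^'k1) \<Rightarrow> (real \<Rightarrow> 'a \<Rightarrow> real^'k2) \<Rightarrow> (real \<Rightarrow> 'a \<Rightarrow> real^'n) \<Rightarrow> bool" where
  "is_state M T W Y \<Gamma> x0 u1 u2 X \<longleftrightarrow>
     X \<in> S2_space M T (joint_filtration M W Y) \<and>
     (\<exists>I J. has_stoch_integral M T (joint_filtration M W Y) W (W_coeff M \<Gamma> X u1 u2) I \<and>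
            has_stoch_integral M T (joint_filtration M W Y) (obs_noise \<Gamma> Y)
              (obs_coeff M \<Gamma> X u1 u2) J \<and>
            (AE \<omega> in M. \<forall>t\<in>{0..T}.
               X t \<omega> = x0 + (LBINT s:{0..t}. drift_coeff M \<Gamma> X u1 u2 s \<omega>) + I t \<omega> + J t \<omega>))"

text \<open>The state is unique up to indistinguishability, so the choice below does not affect the cost.\<close>

definition state_of ::
  "'a measure \<Rightarrow> real \<Rightarrow> (real \<Rightarrow> 'a \<Rightarrow> real) \<Rightarrow> (real \<Rightarrow> 'a \<Rightarrow> real) \<Rightarrow>
   ('n::finite, 'k1::finite, 'k2::finite) lq_data \<Rightarrow> real^'n \<Rightarrow>
   (real \<Rightarrow> 'a \<Rightarrow> real^'k1) \<Rightarrow> (real \<Rightarrow> 'a \<Rightarrow> real^'k2) \<Rightarrow> real \<Rightarrow> 'a \<Rightarrow> real^'n" where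
  "state_of M T W Y \<Gamma> x0 u1 u2 = (SOME X. is_state M T W Y \<Gamma> x0 u1 u2 X)"

definition cost ::
  "'a measure \<Rightarrow> real \<Rightarrow> (real \<Rightarrow> 'a \<Rightarrow> real) \<Rightarrow> (real \<Rightarrow> 'a \<Rightarrow> real) \<Rightarrow>
   ('n::finite, 'k1::finite, 'k2::finite) lq_data \<Rightarrow> real^'n \<Rightarrow>
   (real \<Rightarrow> 'a \<Rightarrow> real^'k1) \<Rightarrow> (real \<Rightarrow> 'a \<Rightarrow> real^'k2) \<Rightarrow> real" where
  "cost M T W Y \<Gamma> x0 u1 u2 = (let X = state_of M T W Y \<Gamma> x0 u1 u2 in
     \<integral>\<omega>. M_term \<Gamma> \<bullet> X T \<omega> + (LBINT s:{0..T}. Q_run \<Gamma> s \<bullet> X s \<omega>)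
       + (LBINT s:{0..T}. (N11 \<Gamma> s *v u1 s \<omega>) \<bullet> u1 s \<omega> + (N12 \<Gamma> s *v mean M u1 s) \<bullet> mean M u1 s)
       + (LBINT s:{0..T}. (N21 \<Gamma> s *v u2 s \<omega>) \<bullet> u2 s \<omega> + (N22 \<Gamma> s *v mean M u2 s) \<bullet> mean M u2 s)
     \<partial>M)"

definition controls ::
  "'a measure \<Rightarrow> real \<Rightarrow> (real \<Rightarrow> 'a \<Rightarrow> real) \<Rightarrow> (real \<Rightarrow> 'a \<Rightarrow> real^'k::finite) set" where
  "controls M T Y = M2_space M T (natural_filtration M Y)"

definition open_loop_saddle ::
  "'a measure \<Rightarrow> real \<Rightarrow> (real \<Rightarrow> 'a \<Rightarrow> real) \<Rightarrow> (real \<Rightarrow> 'a \<Rightarrow> real) \<Rightarrow>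
   ('n::finite, 'k1::finite, 'k2::finite) lq_data \<Rightarrow> real^'n \<Rightarrow>
   (real \<Rightarrow> 'a \<Rightarrow> real^'k1) \<Rightarrow> (real \<Rightarrow> 'a \<Rightarrow> real^'k2) \<Rightarrow> bool" where
  "open_loop_saddle M T W Y \<Gamma> x0 v1 v2 \<longleftrightarrow>
     v1 \<in> controls M T Y \<and> v2 \<in> controls M T Y \<and>
     (\<forall>u1 \<in> controls M T Y. \<forall>u2 \<in> controls M T Y.
        cost M T W Y \<Gamma> x0 v1 u2 \<le> cost M T W Y \<Gamma> x0 v1 v2 \<and>
        cost M T W Y \<Gamma> x0 v1 v2 \<le> cost M T W Y \<Gamma> x0 u1 v2)"

definition optimal_pair ::
  "'a measure \<Rightarrow> real \<Rightarrow> (real \<Rightarrow> 'a \<Rightarrow> real) \<Rightarrow> (real \<Rightarrow> 'a \<Rightarrow> real) \<Rightarrow>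
   ('n::finite, 'k1::finite, 'k2::finite) lq_data \<Rightarrow> real^'n \<Rightarrow>
   (real \<Rightarrow> 'a \<Rightarrow> real^'k1) \<Rightarrow> (real \<Rightarrow> 'a \<Rightarrow> real^'k2) \<Rightarrow> (real \<Rightarrow> 'a \<Rightarrow> real^'n) \<Rightarrow> bool" where
  "optimal_pair M T W Y \<Gamma> x0 v1 v2 X \<longleftrightarrow>
     open_loop_saddle M T W Y \<Gamma> x0 v1 v2 \<and> is_state M T W Y \<Gamma> x0 v1 v2 X"


section \<open>Adjoint equation\<close>

definition adjoint_drift where
  "adjoint_drift M \<Gamma> p q qt t \<omega> =
     (transpose (A1 \<Gamma> t) - h_obs \<Gamma> t *\<^sub>R transpose (F1 \<Gamma> t)) *v p t \<omega> +
     (transpose (A2 \<Gamma> t) - h_obs \<Gamma> t *\<^sub>R transpose (F2 \<Gamma> t)) *v mean M p t +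
     transpose (C1 \<Gamma> t) *v q t \<omega> + transpose (C2 \<Gamma> t) *v mean M q t +
     transpose (F1 \<Gamma> t) *v qt t \<omega> + transpose (F2 \<Gamma> t) *v mean M qt t +
     Q_run \<Gamma> t"

definition adjoint_solution ::
  "'a measure \<Rightarrow> real \<Rightarrow> (real \<Rightarrow> 'a \<Rightarrow> real) \<Rightarrow> (real \<Rightarrow> 'a \<Rightarrow> real) \<Rightarrow>
   ('n::finite, 'k1::finite, 'k2::finite) lq_data \<Rightarrow>
   (real \<Rightarrow> 'a \<Rightarrow> real^'n) \<Rightarrow> (real \<Rightarrow> 'a \<Rightarrow> real^'n) \<Rightarrow> (real \<Rightarrow> 'a \<Rightarrow> real^'n) \<Rightarrow> bool" where
  "adjoint_solution M T W Y \<Gamma> p q qt \<longleftrightarrow>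
     p \<in> S2_space M T (joint_filtration M W Y) \<and>
     q \<in> M2_space M T (joint_filtration M W Y) \<and>
     qt \<in> M2_space M T (joint_filtration M W Y) \<and>
     (\<exists>I J. has_stoch_integral M T (joint_filtration M W Y) W q I \<and>
            has_stoch_integral M T (joint_filtration M W Y) Y qt J \<and>
            (AE \<omega> in M. \<forall>t\<in>{0..T}.
               p t \<omega> = M_term \<Gamma> + (LBINT s:{t..T}. adjoint_drift M \<Gamma> p q qt s \<omega>)
                       - (I T \<omega> - I t \<omega>) - (J T \<omega> - J t \<omega>)))"


section \<open>Conditional expectation of random vectors\<close>

definition vec_cond_exp ::
  "'a measure \<Rightarrow> 'a measure \<Rightarrow> ('a \<Rightarrow> real^'n::finite) \<Rightarrow> 'a \<Rightarrow> real^'n" where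
  "vec_cond_exp M F f \<omega> = (\<chi> i. real_cond_exp M F (\<lambda>x. f x $ i) \<omega>)"

end

theory Submission
  imports Defs
begin

text \<open>
  The cost is affine in the state, and the coefficients are deterministic, so the state enters the
  cost only through its mean. Under \<open>P\<close> the observation \<open>Y\<close> is a Brownian motion and the observation
  noise is \<open>Y\<close> minus \<open>\<integral> h\<close>; taking expectations in the state equation removes both stochastic
  integrals, and \<open>m = E X\<close> solves the linear equation
  \<open>m' = \<A> m + \<B>\<^sub>1 E u\<^sub>1 + \<B>\<^sub>2 E u\<^sub>2\<close> with \<open>\<A> = A\<^sub>1 + A\<^sub>2 - h (F\<^sub>1 + F\<^sub>2)\<close> and
  \<open>\<B>\<^sub>i = B\<^sub>i\<^sub>1 + B\<^sub>i\<^sub>2 - h (G\<^sub>i\<^sub>1 + G\<^sub>i\<^sub>2)\<close> (\<open>state_mean\<close>).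

  The adjoint equation has deterministic data as well. The difference \<open>p - E p\<close> solves a linear
  backward equation without source and with terminal value zero, hence vanishes together with \<open>q\<close>
  and \<open>qt\<close> (\<open>backward_equation_trivial\<close>, \<open>adjoint_deterministic\<close>). So \<open>p\<close> may be replaced by its
  mean, which solves \<open>p' = - (\<A>\<^sup>T p + Q)\<close>, \<open>p(T) = M\<close>. In the two optimality conditions the
  conditional expectations of \<open>p\<close> and \<open>q\<close> become \<open>E p\<close> and \<open>0\<close>; they say
  \<open>2 N\<^sub>i\<^sub>1 u\<^sub>i + 2 N\<^sub>i\<^sub>2 E u\<^sub>i + \<B>\<^sub>i\<^sup>T E p = 0\<close> (\<open>optimality_condition\<close>). A term with \<open>qt\<close> would
  vanish, too.

  Integrating by parts the product of \<open>m\<close> and \<open>E p\<close> gives the cost as a constant plus a function of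
  \<open>u\<^sub>1\<close> plus a function of \<open>u\<^sub>2\<close>; the \<open>i\<close>-th function is the quadratic
  functional \<open>E \<integral> \<langle>N\<^sub>i\<^sub>1 u, u\<rangle> + \<langle>N\<^sub>i\<^sub>2 E u, E u\<rangle> + \<langle>\<B>\<^sub>i\<^sup>T E p, u\<rangle> dt\<close> (\<open>cost_decomposition\<close>). Hence a saddle
  point is a pair consisting of a minimizer of the first and a maximizer of the second functional.
  Splitting \<open>u\<close> into \<open>E u\<close> and \<open>u - E u\<close> shows that the definiteness conditions on \<open>N\<^sub>i\<^sub>1\<close> and
  \<open>N\<^sub>i\<^sub>1 + N\<^sub>i\<^sub>2\<close> make the first functional convex and the second concave. An extremum is therefore
  the same as a zero of the gradient (\<open>mean_field_quadratic_minimum\<close>), which is the condition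
  above.

  The cost refers to a state chosen for each pair of controls, so states must exist. The larger
  part of the text constructs the Ito integral with respect to Brownian motion (Doob's inequality,
  density of elementary processes, isometry) and solves the state equation by Picard iteration
  (\<open>stoch_integral_exists\<close>, \<open>mean_field_sde_exists\<close>).
\<close>

type_synonym ('a, 'b) process = "real \<Rightarrow> 'a \<Rightarrow> 'b"

section \<open>Square integrable functions and augmented sub-sigma-algebras\<close>

definition sq_int :: "'a measure \<Rightarrow> ('a \<Rightarrow> 'b::euclidean_space) \<Rightarrow> bool" where
  "sq_int M f \<longleftrightarrow> f \<in> borel_measurable M \<and> integrable M (\<lambda>x. (norm (f x))\<^sup>2)"

definition l2norm :: "'a measure \<Rightarrow> ('a \<Rightarrow> 'b::euclidean_space) \<Rightarrow> real" where
  "l2norm M f = sqrt (\<integral>x. (norm (f x))\<^sup>2 \<partial>M)"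

lemma sq_int_measurable [measurable_dest]: "sq_int M f \<Longrightarrow> f \<in> borel_measurable M"
  by (simp add: sq_int_def)

lemma sq_intD: "sq_int M f \<Longrightarrow> integrable M (\<lambda>x. (norm (f x))\<^sup>2)"
  by (simp add: sq_int_def)

lemma l2norm_nonneg [simp]: "0 \<le> l2norm M f"
  by (simp add: l2norm_def)

lemma l2norm_sq: "(l2norm M f)\<^sup>2 = (\<integral>x. (norm (f x))\<^sup>2 \<partial>M)"
  by (simp add: l2norm_def)

lemma sq_int_iff_nn_integral:
  assumes "f \<in> borel_measurable M"
  shows "sq_int M f \<longleftrightarrow> (\<integral>\<^sup>+x. ennreal ((norm (f x))\<^sup>2) \<partial>M) < \<infinity>"
  using assms unfolding sq_int_def by (simp add: integrable_iff_bounded)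

lemma nn_integral_sq:
  assumes "sq_int M f"
  shows "(\<integral>\<^sup>+x. ennreal ((norm (f x))\<^sup>2) \<partial>M) = ennreal ((l2norm M f)\<^sup>2)"
  unfolding l2norm_sq by (rule nn_integral_eq_integral) (use assms in \<open>auto simp: sq_int_def\<close>)

lemma l2norm_le_if_nn_integral_le:
  assumes "(\<integral>\<^sup>+x. ennreal ((norm (f x))\<^sup>2) \<partial>M) \<le> ennreal (c\<^sup>2)" "0 \<le> c" "f \<in> borel_measurable M"
  shows "sq_int M f \<and> l2norm M f \<le> c"
proof -
  have *: "sq_int M f"
    using assms by (subst sq_int_iff_nn_integral) (auto simp: order_le_less_trans)
  have "ennreal ((l2norm M f)\<^sup>2) \<le> ennreal (c\<^sup>2)"
    using assms(1) nn_integral_sq[OF *] by simp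
  then have "(l2norm M f)\<^sup>2 \<le> c\<^sup>2" by (simp add: ennreal_le_iff)
  then show ?thesis using * assms(2) by (auto simp: power2_le_iff_abs_le)
qed

lemma sq_int_norm_mult:
  fixes f :: "'a \<Rightarrow> 'b::euclidean_space" and g :: "'a \<Rightarrow> 'c::euclidean_space"
  assumes "sq_int M f" "sq_int M g"
  shows "integrable M (\<lambda>x. norm (f x) * norm (g x))"
proof (rule Bochner_Integration.integrable_bound)
  show "integrable M (\<lambda>x. (norm (f x))\<^sup>2 + (norm (g x))\<^sup>2)"
    using assms by (auto simp: sq_int_def)
  show "AE x in M. norm (norm (f x) * norm (g x)) \<le> norm ((norm (f x))\<^sup>2 + (norm (g x))\<^sup>2)"
  proof (intro AE_I2)
    fix x
    have "0 \<le> (norm (f x) - norm (g x))\<^sup>2" by simp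
    then have "2 * (norm (f x) * norm (g x)) \<le> (norm (f x))\<^sup>2 + (norm (g x))\<^sup>2"
      by (simp add: power2_diff)
    moreover have "0 \<le> norm (f x) * norm (g x)" by simp
    ultimately have "norm (f x) * norm (g x) \<le> (norm (f x))\<^sup>2 + (norm (g x))\<^sup>2"
      by linarith
    then show "norm (norm (f x) * norm (g x)) \<le> norm ((norm (f x))\<^sup>2 + (norm (g x))\<^sup>2)"
      by simp
  qed
qed (use assms in \<open>auto simp: sq_int_def\<close>)

lemma sq_int_inner:
  assumes "sq_int M f" "sq_int M g"
  shows "integrable M (\<lambda>x. f x \<bullet> g x)"
  by (rule Bochner_Integration.integrable_bound[OF sq_int_norm_mult[OF assms]])
     (use assms in \<open>auto simp: sq_int_def Cauchy_Schwarz_ineq2\<close>)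

lemma sq_int_add [intro]:
  assumes "sq_int M f" "sq_int M g"
  shows "sq_int M (\<lambda>x. f x + g x)"
proof -
  have "integrable M (\<lambda>x. (norm (f x + g x))\<^sup>2)"
  proof (rule Bochner_Integration.integrable_bound)
    show "integrable M (\<lambda>x. 2 * (norm (f x))\<^sup>2 + 2 * (norm (g x))\<^sup>2)"
      using assms by (auto simp: sq_int_def)
    show "AE x in M. norm ((norm (f x + g x))\<^sup>2) \<le> norm (2 * (norm (f x))\<^sup>2 + 2 * (norm (g x))\<^sup>2)"
    proof (intro AE_I2)
      fix x
      have "(norm (f x + g x))\<^sup>2 \<le> (norm (f x) + norm (g x))\<^sup>2"
        by (intro power_mono norm_triangle_ineq) auto
      also have "\<dots> \<le> 2 * (norm (f x))\<^sup>2 + 2 * (norm (g x))\<^sup>2"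
        using sum_squares_bound[of "norm (f x)" "norm (g x)"] by (simp add: power2_sum)
      finally show "norm ((norm (f x + g x))\<^sup>2) \<le> norm (2 * (norm (f x))\<^sup>2 + 2 * (norm (g x))\<^sup>2)"
        by simp
    qed
  qed (use assms in \<open>auto simp: sq_int_def\<close>)
  then show ?thesis using assms by (auto simp: sq_int_def)
qed

lemma sq_int_minus [intro]: "sq_int M f \<Longrightarrow> sq_int M (\<lambda>x. - f x)"
  by (auto simp: sq_int_def)

lemma sq_int_diff [intro]:
  assumes "sq_int M f" "sq_int M g"
  shows "sq_int M (\<lambda>x. f x - g x)"
  using sq_int_add[OF assms(1) sq_int_minus[OF assms(2)]] by simp

lemma sq_int_zero [simp, intro]: "sq_int M (\<lambda>x. 0)"
  by (simp add: sq_int_def)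

lemma sq_int_scaleR [intro]: "sq_int M f \<Longrightarrow> sq_int M (\<lambda>x. c *\<^sub>R f x)"
  by (auto simp: sq_int_def power_mult_distrib)

lemma sq_int_cong_AE:
  assumes "sq_int M f" "g \<in> borel_measurable M" "AE x in M. f x = g x"
  shows "sq_int M g"
proof -
  have "integrable M (\<lambda>x. (norm (g x))\<^sup>2)"
    by (rule integrable_cong_AE_imp[of M "\<lambda>x. (norm (f x))\<^sup>2"])
       (use assms in \<open>auto simp: sq_int_def\<close>)
  then show ?thesis using assms by (simp add: sq_int_def)
qed

lemma sq_int_bound:
  assumes "sq_int M g" "f \<in> borel_measurable M" "AE x in M. norm (f x) \<le> c * norm (g x)"
  shows "sq_int M f"
proof -
  have "integrable M (\<lambda>x. (norm (f x))\<^sup>2)"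
  proof (rule Bochner_Integration.integrable_bound)
    show "integrable M (\<lambda>x. c\<^sup>2 * (norm (g x))\<^sup>2)"
      using assms by (auto simp: sq_int_def)
    show "AE x in M. norm ((norm (f x))\<^sup>2) \<le> norm (c\<^sup>2 * (norm (g x))\<^sup>2)"
      using assms(3)
    proof eventually_elim
      case (elim x)
      have "(norm (f x))\<^sup>2 \<le> (c * norm (g x))\<^sup>2"
        using elim by (intro power_mono) auto
      then show ?case by (simp add: power_mult_distrib)
    qed
  qed (use assms in auto)
  then show ?thesis using assms by (simp add: sq_int_def)
qed

lemma l2norm_mono:
  assumes "sq_int M g" "f \<in> borel_measurable M" "AE x in M. norm (f x) \<le> c * norm (g x)" "0 \<le> c"
  shows "l2norm M f \<le> c * l2norm M g"
proof -
  have f: "sq_int M f" using assms(1-3) by (rule sq_int_bound)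
  have "(l2norm M f)\<^sup>2 \<le> (\<integral>x. c\<^sup>2 * (norm (g x))\<^sup>2 \<partial>M)"
    unfolding l2norm_sq
  proof (rule integral_mono_AE)
    show "AE x in M. (norm (f x))\<^sup>2 \<le> c\<^sup>2 * (norm (g x))\<^sup>2"
      using assms(3)
    proof eventually_elim
      case (elim x)
      have "(norm (f x))\<^sup>2 \<le> (c * norm (g x))\<^sup>2"
        using elim by (intro power_mono) auto
      then show ?case by (simp add: power_mult_distrib)
    qed
  qed (use f assms in \<open>auto simp: sq_int_def\<close>)
  also have "\<dots> = (c * l2norm M g)\<^sup>2" by (simp add: l2norm_sq power_mult_distrib)
  finally show ?thesis using assms(4) by (simp add: power2_le_iff_abs_le)
qed

lemma l2norm_cong_AE:
  assumes "f \<in> borel_measurable M" "g \<in> borel_measurable M" "AE x in M. f x = g x"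
  shows "l2norm M f = l2norm M g"
proof -
  have "(\<integral>x. (norm (f x))\<^sup>2 \<partial>M) = (\<integral>x. (norm (g x))\<^sup>2 \<partial>M)"
    by (rule integral_cong_AE) (use assms in auto)
  then show ?thesis by (simp add: l2norm_def)
qed

lemma integral_norm_mult_le:
  fixes f :: "'a \<Rightarrow> 'b::euclidean_space" and g :: "'a \<Rightarrow> 'c::euclidean_space"
  assumes f: "sq_int M f" and g: "sq_int M g"
  shows "(\<integral>x. norm (f x) * norm (g x) \<partial>M) \<le> l2norm M f * l2norm M g"
proof -
  define a b c where "a = (\<integral>x. (norm (f x))\<^sup>2 \<partial>M)" and "b = (\<integral>x. (norm (g x))\<^sup>2 \<partial>M)"
    and "c = (\<integral>x. norm (f x) * norm (g x) \<partial>M)"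
  note [simp] = sq_intD[OF f] sq_intD[OF g] sq_int_norm_mult[OF f g]
  have [measurable]: "f \<in> borel_measurable M" "g \<in> borel_measurable M" using f g by auto
  have ab: "0 \<le> a" "0 \<le> b" "0 \<le> c" by (simp_all add: a_def b_def c_def)
  have "c\<^sup>2 \<le> a * b"
  proof (cases "b = 0")
    case True
    then have "AE x in M. (norm (g x))\<^sup>2 = 0"
      using integral_nonneg_eq_0_iff_AE[of M "\<lambda>x. (norm (g x))\<^sup>2"] by (simp add: b_def)
    then have "c = (\<integral>x. 0 \<partial>M)"
      unfolding c_def by (intro integral_cong_AE) auto
    then show ?thesis using True by simp
  next
    case False
    have "0 \<le> (\<integral>x. (b * norm (f x) - c * norm (g x))\<^sup>2 \<partial>M)" by simp
    also have "\<dots> = (\<integral>x. b\<^sup>2 * (norm (f x))\<^sup>2 - 2 * b * c * (norm (f x) * norm (g x)) + c\<^sup>2 * (norm (g x))\<^sup>2 \<partial>M)"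
      by (intro Bochner_Integration.integral_cong) (auto simp: power2_diff power_mult_distrib algebra_simps)
    also have "\<dots> = b\<^sup>2 * a - 2 * b * c * c + c\<^sup>2 * b"
      by (simp add: a_def b_def c_def)
    also have "\<dots> = b * (a * b - c\<^sup>2)" by (simp add: algebra_simps power2_eq_square)
    finally show ?thesis using False ab by (simp add: zero_le_mult_iff)
  qed
  then have "sqrt (c\<^sup>2) \<le> sqrt (a * b)" by (rule real_sqrt_le_mono)
  then show ?thesis using ab by (simp add: a_def b_def c_def l2norm_def real_sqrt_mult)
qed

text \<open>Cauchy-Schwarz in the space of square integrable vector-valued functions.\<close>

lemma abs_integral_inner_le:
  assumes f: "sq_int M f" and g: "sq_int M g"
  shows "\<bar>\<integral>x. f x \<bullet> g x \<partial>M\<bar> \<le> l2norm M f * l2norm M g"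
proof -
  have "\<bar>\<integral>x. f x \<bullet> g x \<partial>M\<bar> \<le> (\<integral>x. \<bar>f x \<bullet> g x\<bar> \<partial>M)" by (rule integral_abs_bound)
  also have "\<dots> \<le> (\<integral>x. norm (f x) * norm (g x) \<partial>M)"
    by (intro integral_mono_AE) (auto intro: sq_int_inner[OF f g] sq_int_norm_mult[OF f g] Cauchy_Schwarz_ineq2)
  also have "\<dots> \<le> l2norm M f * l2norm M g" by (rule integral_norm_mult_le[OF f g])
  finally show ?thesis .
qed

lemma l2norm_sq_add:
  assumes f: "sq_int M f" and g: "sq_int M g"
  shows "(l2norm M (\<lambda>x. f x + g x))\<^sup>2 = (l2norm M f)\<^sup>2 + 2 * (\<integral>x. f x \<bullet> g x \<partial>M) + (l2norm M g)\<^sup>2"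
proof -
  have "(\<integral>x. (norm (f x + g x))\<^sup>2 \<partial>M) = (\<integral>x. (norm (f x))\<^sup>2 + 2 * (f x \<bullet> g x) + (norm (g x))\<^sup>2 \<partial>M)"
    by (intro Bochner_Integration.integral_cong) (auto simp: power2_norm_eq_inner algebra_simps inner_commute)
  then show ?thesis
    using sq_intD[OF f] sq_intD[OF g] sq_int_inner[OF f g]
    by (simp add: l2norm_sq)
qed

lemma l2norm_minus [simp]: "l2norm M (\<lambda>x. - f x) = l2norm M f"
  by (simp add: l2norm_def)

lemma l2norm_triangle:
  assumes f: "sq_int M f" and g: "sq_int M g"
  shows "l2norm M (\<lambda>x. f x + g x) \<le> l2norm M f + l2norm M g"
proof -
  have "(l2norm M (\<lambda>x. f x + g x))\<^sup>2 \<le> (l2norm M f + l2norm M g)\<^sup>2"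
    using abs_integral_inner_le[OF f g] unfolding l2norm_sq_add[OF f g] by (simp add: power2_sum)
  then show ?thesis by (simp add: power2_le_iff_abs_le)
qed

lemma l2norm_triangle_diff:
  assumes f: "sq_int M f" and g: "sq_int M g"
  shows "l2norm M (\<lambda>x. f x - g x) \<le> l2norm M f + l2norm M g"
  using l2norm_triangle[OF f sq_int_minus[OF g]] by simp

lemma l2norm_commute: "l2norm M (\<lambda>x. f x - g x) = l2norm M (\<lambda>x. g x - f x)"
  by (simp add: l2norm_def norm_minus_commute)

lemma l2norm_triangle3:
  assumes f: "sq_int M f" and g: "sq_int M g" and h: "sq_int M h"
  shows "l2norm M (\<lambda>x. f x - h x) \<le> l2norm M (\<lambda>x. f x - g x) + l2norm M (\<lambda>x. g x - h x)"
  using l2norm_triangle[OF sq_int_diff[OF f g] sq_int_diff[OF g h]] by simp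

lemma l2norm_zeroD:
  assumes f: "sq_int M f" and "l2norm M f = 0" shows "AE x in M. f x = 0"
proof -
  have "AE x in M. (norm (f x))\<^sup>2 = 0"
    using integral_nonneg_eq_0_iff_AE[of M "\<lambda>x. (norm (f x))\<^sup>2"] assms l2norm_sq[of M f]
    by (simp add: sq_intD)
  then show ?thesis by simp
qed

lemma l2norm_converges:
  assumes f: "\<And>n. sq_int M (f n)" "sq_int M g"
    and l: "(\<lambda>n. l2norm M (\<lambda>x. f n x - g x)) \<longlonglongrightarrow> 0"
  shows "(\<lambda>n. l2norm M (f n)) \<longlonglongrightarrow> l2norm M g"
proof (rule LIM_zero_cancel, rule Lim_null_comparison[OF always_eventually l], rule allI)
  fix n
  have "l2norm M (f n) \<le> l2norm M (\<lambda>x. f n x - g x) + l2norm M g"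
    using l2norm_triangle[of M "\<lambda>x. f n x - g x" g] f by auto
  moreover have "l2norm M g \<le> l2norm M (\<lambda>x. g x - f n x) + l2norm M (f n)"
    using l2norm_triangle[of M "\<lambda>x. g x - f n x" "f n"] f by auto
  ultimately show "norm (l2norm M (f n) - l2norm M g) \<le> l2norm M (\<lambda>x. f n x - g x)"
    using l2norm_commute[of M "f n" g] by simp
qed

lemma l2_inner_converges:
  assumes f: "\<And>n. sq_int M (f n)" "sq_int M f'"
    and l: "(\<lambda>n. l2norm M (\<lambda>x. f n x - f' x)) \<longlonglongrightarrow> 0"
    and g: "\<And>n. sq_int M (g n)" "sq_int M g'"
    and k: "(\<lambda>n. l2norm M (\<lambda>x. g n x - g' x)) \<longlonglongrightarrow> 0"
  shows "(\<lambda>n. \<integral>x. f n x \<bullet> g n x \<partial>M) \<longlonglongrightarrow> (\<integral>x. f' x \<bullet> g' x \<partial>M)"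
proof (rule LIM_zero_cancel, rule Lim_null_comparison[OF always_eventually], rule allI)
  fix n
  have "(\<integral>x. f n x \<bullet> g n x \<partial>M) - (\<integral>x. f' x \<bullet> g' x \<partial>M)
     = (\<integral>x. (f n x - f' x) \<bullet> g n x \<partial>M) + (\<integral>x. f' x \<bullet> (g n x - g' x) \<partial>M)"
    using f g by (simp add: inner_diff_left inner_diff_right sq_int_inner)
  moreover have "\<bar>\<integral>x. (f n x - f' x) \<bullet> g n x \<partial>M\<bar> \<le> l2norm M (\<lambda>x. f n x - f' x) * l2norm M (g n)"
    using f g by (intro abs_integral_inner_le) auto
  moreover have "\<bar>\<integral>x. f' x \<bullet> (g n x - g' x) \<partial>M\<bar> \<le> l2norm M f' * l2norm M (\<lambda>x. g n x - g' x)"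
    using f g by (intro abs_integral_inner_le) auto
  ultimately show "norm ((\<integral>x. f n x \<bullet> g n x \<partial>M) - (\<integral>x. f' x \<bullet> g' x \<partial>M))
    \<le> l2norm M (\<lambda>x. f n x - f' x) * l2norm M (g n) + l2norm M f' * l2norm M (\<lambda>x. g n x - g' x)"
    by simp
next
  show "(\<lambda>n. l2norm M (\<lambda>x. f n x - f' x) * l2norm M (g n) + l2norm M f' * l2norm M (\<lambda>x. g n x - g' x)) \<longlonglongrightarrow> 0"
    by (rule tendsto_eq_intros refl l k l2norm_converges[OF g k] | simp)+
qed

lemma l2_tendsto_iff_nn_integral:
  assumes "\<And>n. sq_int M (f n)" "sq_int M g"
  shows "(\<lambda>n. \<integral>\<^sup>+x. ennreal ((norm (f n x - g x))\<^sup>2) \<partial>M) \<longlonglongrightarrow> 0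
     \<longleftrightarrow> (\<lambda>n. l2norm M (\<lambda>x. f n x - g x)) \<longlonglongrightarrow> 0" (is "?A \<longleftrightarrow> ?B")
proof -
  have "(\<integral>\<^sup>+x. ennreal ((norm (f n x - g x))\<^sup>2) \<partial>M) = ennreal ((l2norm M (\<lambda>x. f n x - g x))\<^sup>2)" for n
    using assms by (intro nn_integral_sq) auto
  then have "?A \<longleftrightarrow> (\<lambda>n. ennreal ((l2norm M (\<lambda>x. f n x - g x))\<^sup>2)) \<longlonglongrightarrow> ennreal 0" by simp
  also have "\<dots> \<longleftrightarrow> (\<lambda>n. (l2norm M (\<lambda>x. f n x - g x))\<^sup>2) \<longlonglongrightarrow> 0"
    by (intro tendsto_ennreal_iff) auto
  also have "\<dots> \<longleftrightarrow> ?B"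
    using tendsto_real_sqrt[of "\<lambda>n. (l2norm M (\<lambda>x. f n x - g x))\<^sup>2" 0 sequentially]
      tendsto_power[of "\<lambda>n. l2norm M (\<lambda>x. f n x - g x)" 0 sequentially 2] by auto
  finally show ?thesis .
qed

lemma (in finite_measure) sq_int_const [simp, intro]: "sq_int M (\<lambda>x. c)"
  by (simp add: sq_int_def)

lemma (in finite_measure) sq_int_integrable:
  assumes "sq_int M f" shows "integrable M f"
proof (rule Bochner_Integration.integrable_bound)
  show "integrable M (\<lambda>x. 1 + (norm (f x))\<^sup>2)" using assms by (auto simp: sq_int_def)
  show "AE x in M. norm (f x) \<le> norm (1 + (norm (f x))\<^sup>2)"
  proof (intro AE_I2)
    fix x
    have "0 \<le> (norm (f x) - 1)\<^sup>2" by simp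
    then have "2 * norm (f x) \<le> 1 + (norm (f x))\<^sup>2" by (simp add: power2_diff)
    then have "norm (f x) \<le> 1 + (norm (f x))\<^sup>2" using norm_ge_zero[of "f x"] by linarith
    then show "norm (f x) \<le> norm (1 + (norm (f x))\<^sup>2)" by simp
  qed
qed (use assms in auto)

lemma (in finite_measure) sq_int_bounded:
  assumes "f \<in> borel_measurable M" "\<And>x. x \<in> space M \<Longrightarrow> norm (f x) \<le> K"
  shows "sq_int M f"
proof -
  have "integrable M (\<lambda>x. (norm (f x))\<^sup>2)"
    by (rule integrable_const_bound[where B="K\<^sup>2"])
       (use assms in \<open>auto intro!: power_mono AE_I2\<close>)
  then show ?thesis using assms by (simp add: sq_int_def)
qed

lemma (in finite_measure) norm_integral_le_l2norm:
  assumes "sq_int M f"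
  shows "norm (\<integral>x. f x \<partial>M) \<le> sqrt (measure M (space M)) * l2norm M f"
proof -
  have "norm (\<integral>x. f x \<partial>M) \<le> (\<integral>x. norm (f x) * norm (1::real) \<partial>M)"
    using integral_norm_bound[of M f] by simp
  also have "\<dots> \<le> l2norm M f * l2norm M (\<lambda>x. 1::real)"
    by (rule integral_norm_mult_le) (use assms in auto)
  finally show ?thesis by (simp add: l2norm_def mult.commute)
qed

lemma (in prob_space) norm_expectation_le_l2norm:
  assumes "sq_int M f"
  shows "norm (\<integral>x. f x \<partial>M) \<le> l2norm M f"
  using norm_integral_le_l2norm[OF assms] by (simp add: prob_space)

lemma (in prob_space) l2norm_const [simp]: "l2norm M (\<lambda>x. c) = norm c"
  by (simp add: l2norm_def prob_space)

text \<open>With all null sets in the smaller sigma-algebra, measurability survives modification on a null set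
  and therefore passes to mean-square limits.\<close>

definition augmented :: "'a measure \<Rightarrow> 'a measure \<Rightarrow> bool" where
  "augmented M F \<longleftrightarrow> subalgebra M F \<and> null_sets M \<subseteq> sets F"

lemma augmented_measurableD: "augmented M F \<Longrightarrow> f \<in> borel_measurable F \<Longrightarrow> f \<in> borel_measurable M"
  unfolding augmented_def by (blast intro: measurable_from_subalg)

lemma augmented_space: "augmented M F \<Longrightarrow> space F = space M"
  by (simp add: augmented_def subalgebra_def)

lemma augmented_cong_AE:
  fixes f g :: "'a \<Rightarrow> 'b::euclidean_space"
  assumes F: "augmented M F" and f: "f \<in> borel_measurable F" and g: "g \<in> borel_measurable M"
    and eq: "AE x in M. f x = g x"
  shows "g \<in> borel_measurable F"
proof (rule measurableI)
  fix A :: "'b set" assume A: "A \<in> sets borel"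
  have [measurable]: "f \<in> borel_measurable M" "g \<in> borel_measurable M"
    using f g F by (auto intro: augmented_measurableD)
  define N where "N = {x\<in>space M. f x \<noteq> g x}"
  have "N \<in> sets M" unfolding N_def by measurable
  then have N: "N \<in> null_sets M" using eq by (auto simp: N_def AE_iff_null)
  have "g -` A \<inter> N \<in> null_sets M"
  proof (rule null_sets_subset[OF N])
    have "g -` A \<inter> N = (g -` A \<inter> space M) \<inter> N" by (auto simp: N_def)
    also have "\<dots> \<in> sets M" using measurable_sets[OF g A] \<open>N \<in> sets M\<close> by simp
    finally show "g -` A \<inter> N \<in> sets M" .
  qed auto
  then have 1: "g -` A \<inter> N \<in> sets F" "N \<in> sets F"
    using N F by (auto simp: augmented_def)
  have "g -` A \<inter> space F = ((f -` A \<inter> space F) - N) \<union> (g -` A \<inter> N)"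
    using augmented_space[OF F] by (auto simp: N_def)
  then show "g -` A \<inter> space F \<in> sets F"
    using 1 measurable_sets[OF f A] by auto
qed auto

text \<open>A subsequence converges almost surely, and its pointwise limit is measurable.\<close>

lemma augmented_l2_limit:
  assumes M: "finite_measure M" and F: "augmented M F" and f: "\<And>n. f n \<in> borel_measurable F" "\<And>n. sq_int M (f n)"
    and g: "sq_int M g" and l: "(\<lambda>n. l2norm M (\<lambda>x. f n x - g x)) \<longlonglongrightarrow> 0"
  shows "g \<in> borel_measurable F"
proof -
  interpret finite_measure M by fact
  have d: "sq_int M (\<lambda>x. f n x - g x)" for n using f g by auto
  have "(\<lambda>n. \<integral>x. norm (f n x - g x) \<partial>M) \<longlonglongrightarrow> 0"
  proof (rule Lim_null_comparison[OF always_eventually], rule allI)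
    fix n
    have "sq_int M (\<lambda>x. norm (f n x - g x))"
      using d[of n] by (auto simp: sq_int_def)
    from norm_integral_le_l2norm[OF this]
    show "norm (\<integral>x. norm (f n x - g x) \<partial>M) \<le> sqrt (measure M (space M)) * l2norm M (\<lambda>x. f n x - g x)"
      by (simp add: l2norm_def)
    show "(\<lambda>n. sqrt (measure M (space M)) * l2norm M (\<lambda>x. f n x - g x)) \<longlonglongrightarrow> 0"
      by (rule tendsto_eq_intros refl l | simp)+
  qed
  from tendsto_L1_AE_subseq[OF _ this] obtain r :: "nat \<Rightarrow> nat"
    where r: "strict_mono r" "AE x in M. (\<lambda>n. f (r n) x - g x) \<longlonglongrightarrow> 0"
    using sq_int_integrable[OF d] by blast
  define h where "h = (\<lambda>x. lim (\<lambda>n. f (r n) x))"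
  have [measurable]: "\<And>n. f n \<in> borel_measurable F" using f by auto
  have h: "h \<in> borel_measurable F" unfolding h_def by (rule borel_measurable_lim_metric) (rule f)
  have "AE x in M. h x = g x"
    using r(2)
  proof eventually_elim
    case (elim x)
    then have "(\<lambda>n. f (r n) x) \<longlonglongrightarrow> g x" by (rule LIM_zero_cancel)
    then show ?case unfolding h_def by (rule limI)
  qed
  then show ?thesis
    by (rule augmented_cong_AE[OF F h sq_int_measurable[OF g]])
qed

section \<open>Filtrations and Brownian increments\<close>

lemma space_history [simp]: "space (history M Z t) = space M"
  by (simp add: history_def space_measure_of_conv)

lemma space_natural_filtration [simp]: "space (natural_filtration M Z t) = space M"
  by (simp add: natural_filtration_def space_measure_of_conv)

lemma space_joint_filtration [simp]: "space (joint_filtration M W Y t) = space M"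
  by (simp add: joint_filtration_def space_measure_of_conv)

lemma sets_history:
  "sets (history M Z t) = sigma_sets (space M) {Z s -` B \<inter> space M | s B. s \<in> {0..t} \<and> B \<in> sets borel}"
  unfolding history_def by (rule sets_measure_of) auto

lemma sets_natural_filtration:
  "sets (natural_filtration M Z t) = sigma_sets (space M) (sets (history M Z t) \<union> null_sets M)"
  unfolding natural_filtration_def
  using sets.space_closed[of "history M Z t"] sets.space_closed[of M]
  by (intro sets_measure_of) (auto simp: null_sets_def)

lemma sets_joint_filtration:
  "sets (joint_filtration M W Y t) =
     sigma_sets (space M) (sets (natural_filtration M W t) \<union> sets (natural_filtration M Y t))"
  unfolding joint_filtration_def
  using sets.space_closed[of "natural_filtration M W t"] sets.space_closed[of "natural_filtration M Y t"]
  by (intro sets_measure_of) auto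

lemma history_mono: "s \<le> t \<Longrightarrow> sets (history M Z s) \<subseteq> sets (history M Z t)"
  unfolding sets_history by (intro sigma_sets_mono') force

lemma natural_filtration_mono: "s \<le> t \<Longrightarrow> sets (natural_filtration M Z s) \<subseteq> sets (natural_filtration M Z t)"
  unfolding sets_natural_filtration using history_mono[of s t M Z] by (intro sigma_sets_mono') auto

lemma joint_filtration_mono: "s \<le> t \<Longrightarrow> sets (joint_filtration M W Y s) \<subseteq> sets (joint_filtration M W Y t)"
  unfolding sets_joint_filtration using natural_filtration_mono[of s t M] by (intro sigma_sets_mono') blast

lemma history_subset_events:
  assumes "\<forall>s\<in>{0..T}. Z s \<in> borel_measurable M" "t \<le> T"
  shows "sets (history M Z t) \<subseteq> sets M"
  unfolding sets_history
proof (rule sets.sigma_sets_subset, safe)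
  fix s and B :: "real set" assume "s \<in> {0..t}" "B \<in> sets borel"
  then show "Z s -` B \<inter> space M \<in> sets M"
    using assms by (intro measurable_sets[of "Z s" M borel]) auto
qed

lemma natural_filtration_augmented:
  assumes "\<forall>s\<in>{0..T}. Z s \<in> borel_measurable M" "t \<le> T"
  shows "augmented M (natural_filtration M Z t)"
  unfolding augmented_def subalgebra_def
proof (intro conjI)
  show "sets (natural_filtration M Z t) \<subseteq> sets M"
    unfolding sets_natural_filtration using history_subset_events[OF assms]
    by (intro sets.sigma_sets_subset) auto
  show "null_sets M \<subseteq> sets (natural_filtration M Z t)"
    unfolding sets_natural_filtration by (auto intro: sigma_sets.Basic)
qed simp

lemma joint_filtration_augmented:
  assumes "\<forall>s\<in>{0..T}. W s \<in> borel_measurable M" "\<forall>s\<in>{0..T}. Y s \<in> borel_measurable M" "t \<le> T"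
  shows "augmented M (joint_filtration M W Y t)"
  using natural_filtration_augmented[OF assms(1,3)] natural_filtration_augmented[OF assms(2,3)]
  unfolding augmented_def subalgebra_def
proof (intro conjI; elim conjE)
  assume 1: "sets (natural_filtration M W t) \<subseteq> sets M" "sets (natural_filtration M Y t) \<subseteq> sets M"
    and 2: "null_sets M \<subseteq> sets (natural_filtration M W t)"
  show "sets (joint_filtration M W Y t) \<subseteq> sets M"
    unfolding sets_joint_filtration using 1 by (intro sets.sigma_sets_subset) auto
  show "null_sets M \<subseteq> sets (joint_filtration M W Y t)"
    unfolding sets_joint_filtration using 2 by (auto intro: sigma_sets.Basic)
qed simp

lemma measurable_natural_filtration:
  assumes "0 \<le> s" "s \<le> t"
  shows "Z s \<in> borel_measurable (natural_filtration M Z t)"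
proof (rule measurableI)
  fix B :: "real set" assume "B \<in> sets borel"
  then have "Z s -` B \<inter> space M \<in> sets (history M Z t)"
    unfolding sets_history using assms by (intro sigma_sets.Basic) auto
  then show "Z s -` B \<inter> space (natural_filtration M Z t) \<in> sets (natural_filtration M Z t)"
    unfolding sets_natural_filtration by (auto intro: sigma_sets.Basic)
qed auto

lemma measurable_history:
  assumes "0 \<le> s" "s \<le> t"
  shows "Z s \<in> borel_measurable (history M Z t)"
proof (rule measurableI)
  fix B :: "real set" assume "B \<in> sets borel"
  then show "Z s -` B \<inter> space (history M Z t) \<in> sets (history M Z t)"
    unfolding sets_history using assms by (auto intro!: sigma_sets.Basic)
qed auto

lemma joint_filtration_commute: "sets (joint_filtration M W Y t) = sets (joint_filtration M Y W t)"
  unfolding sets_joint_filtration by (simp add: Un_commute)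

text \<open>The past of \<open>W\<close> at time \<open>s\<close> together with the whole path of \<open>Y\<close>. By independence of \<open>W\<close> and \<open>Y\<close>,
  increments of \<open>W\<close> after \<open>s\<close> are independent even of this larger sigma-algebra. It contains the joint
  past at time \<open>s\<close>, and it makes later increments of \<open>Y\<close> known, which settles the covariation of
  \<open>W\<close> and \<open>Y\<close>.\<close>

definition enlarged_filtration ::
  "'a measure \<Rightarrow> real \<Rightarrow> ('a, real) process \<Rightarrow> ('a, real) process \<Rightarrow> real \<Rightarrow> 'a measure" where
  "enlarged_filtration M T W Y s =
     sigma (space M) (sets (natural_filtration M W s) \<union> sets (natural_filtration M Y T))"

lemma space_enlarged_filtration [simp]: "space (enlarged_filtration M T W Y s) = space M"
  by (simp add: enlarged_filtration_def space_measure_of_conv)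

lemma sets_enlarged_filtration:
  "sets (enlarged_filtration M T W Y s) =
     sigma_sets (space M) (sets (natural_filtration M W s) \<union> sets (natural_filtration M Y T))"
  unfolding enlarged_filtration_def
  using sets.space_closed[of "natural_filtration M W s"] sets.space_closed[of "natural_filtration M Y T"]
  by (intro sets_measure_of) auto

lemma joint_subset_enlarged: "s \<le> T \<Longrightarrow> sets (joint_filtration M W Y s) \<subseteq> sets (enlarged_filtration M T W Y s)"
  unfolding sets_joint_filtration sets_enlarged_filtration
  using natural_filtration_mono[of s T M Y] by (intro sigma_sets_mono') blast

lemma enlarged_filtration_augmented:
  assumes "\<forall>s\<in>{0..T}. W s \<in> borel_measurable M" "\<forall>s\<in>{0..T}. Y s \<in> borel_measurable M" "t \<le> T"
  shows "augmented M (enlarged_filtration M T W Y t)"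
  using natural_filtration_augmented[OF assms(1,3)] natural_filtration_augmented[OF assms(2) order_refl]
  unfolding augmented_def subalgebra_def
proof (intro conjI; elim conjE)
  assume 1: "sets (natural_filtration M W t) \<subseteq> sets M" "sets (natural_filtration M Y T) \<subseteq> sets M"
    and 2: "null_sets M \<subseteq> sets (natural_filtration M W t)"
  show "sets (enlarged_filtration M T W Y t) \<subseteq> sets M"
    unfolding sets_enlarged_filtration using 1 by (intro sets.sigma_sets_subset) auto
  show "null_sets M \<subseteq> sets (enlarged_filtration M T W Y t)"
    unfolding sets_enlarged_filtration using 2 by (auto intro: sigma_sets.Basic)
qed simp

lemma (in prob_space) indep_set_mono:
  assumes "indep_set A B" "A' \<subseteq> A" "B' \<subseteq> B"
  shows "indep_set A' B'"
  using indep_setD[OF assms(1)] indep_setD_ev1[OF assms(1)] indep_setD_ev2[OF assms(1)] assms(2,3)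
  unfolding indep_sets2_eq by (meson subset_trans subsetD)

text \<open>A generating class closed under intersections: events that agree almost surely with \<open>A \<inter> B\<close>, where
  \<open>A\<close> is in the past of \<open>W\<close> and \<open>B\<close> depends on \<open>Y\<close>. Admitting the agreement almost surely puts the
  null sets of the completed filtrations into the class. On the class, independence follows from
  independence of \<open>W\<close> and \<open>Y\<close> and then from that of the increments of \<open>W\<close>.\<close>

lemma increment_indep_enlarged:
  assumes "prob_space M" and W: "brownian_motion M T W" and Y: "\<forall>s\<in>{0..T}. Y s \<in> borel_measurable M"
    and ind: "independent_processes M T W Y" and st: "0 \<le> s" "s < t" "t \<le> T"
  shows "prob_space.indep_set M (sets (enlarged_filtration M T W Y s))
           {(\<lambda>w. W t w - W s w) -` B \<inter> space M | B. B \<in> sets borel}"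
proof -
  interpret prob_space M by fact
  have Wm: "\<forall>s\<in>{0..T}. W s \<in> borel_measurable M" using W by (simp add: brownian_motion_def)
  define D where "D = {(\<lambda>w. W t w - W s w) -` B \<inter> space M | B. B \<in> sets borel}"
  define P where "P = {E\<in>sets M. \<exists>A\<in>sets (history M W s). \<exists>B\<in>sets (history M Y T).
      AE x in M. x \<in> E \<longleftrightarrow> x \<in> A \<inter> B}"
  have subW: "sets (history M W s) \<subseteq> sets M" "sets (history M W T) \<subseteq> sets M"
    and subY: "sets (history M Y T) \<subseteq> sets M"
    using history_subset_events[OF Wm] history_subset_events[OF Y] st by auto
  have iD: "indep_set (sets (history M W s)) D"
    using W st unfolding brownian_motion_def D_def by auto
  have iWY: "indep_set (sets (history M W T)) (sets (history M Y T))"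
    using ind by (simp add: independent_processes_def)
  have D_ev: "D \<subseteq> sets M" using indep_setD_ev2[OF iD] .
  have [measurable]: "W s \<in> borel_measurable (history M W T)" "W t \<in> borel_measurable (history M W T)"
    using st by (auto intro!: measurable_history)
  have D_W: "D \<subseteq> sets (history M W T)"
  proof
    fix C assume "C \<in> D"
    then obtain B where B: "C = (\<lambda>w. W t w - W s w) -` B \<inter> space M" "B \<in> sets borel" by (auto simp: D_def)
    have "(\<lambda>w. W t w - W s w) \<in> borel_measurable (history M W T)" by measurable
    from measurable_sets[OF this B(2)] show "C \<in> sets (history M W T)" using B(1) by simp
  qed
  have "indep_set P D"
    unfolding indep_sets2_eq
  proof (intro conjI ballI)
    show "P \<subseteq> events" by (auto simp: P_def)
    show "D \<subseteq> events" by fact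
  next
    fix E C assume "E \<in> P" and C: "C \<in> D"
    then obtain A B where AB: "E \<in> sets M" "A \<in> sets (history M W s)" "B \<in> sets (history M Y T)"
      and eq: "AE x in M. x \<in> E \<longleftrightarrow> x \<in> A \<inter> B" by (auto simp: P_def)
    have A': "A \<in> sets (history M W T)" using AB history_mono[of s T M W] st by auto
    have ev: "A \<in> events" "B \<in> events" "C \<in> events" using AB subW subY D_ev C by auto
    have "prob (E \<inter> C) = prob ((A \<inter> C) \<inter> B)"
      by (rule finite_measure_eq_AE) (use eq ev AB in auto)
    also have "\<dots> = prob (A \<inter> C) * prob B"
      using A' C D_W AB by (intro indep_setD[OF iWY]) auto
    also have "prob (A \<inter> C) = prob A * prob C" using AB C by (intro indep_setD[OF iD]) auto
    finally have 1: "prob (E \<inter> C) = prob A * prob C * prob B" .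
    have "prob E = prob (A \<inter> B)"
      by (rule finite_measure_eq_AE) (use eq ev AB in auto)
    also have "\<dots> = prob A * prob B" using A' AB by (intro indep_setD[OF iWY]) auto
    finally show "prob (E \<inter> C) = prob E * prob C" using 1 by simp
  qed
  moreover have "Int_stable P"
  proof (rule Int_stableI)
    fix E E' assume "E \<in> P" "E' \<in> P"
    then obtain A B A' B' where *: "E \<in> sets M" "E' \<in> sets M"
      "A \<in> sets (history M W s)" "B \<in> sets (history M Y T)"
      "A' \<in> sets (history M W s)" "B' \<in> sets (history M Y T)"
      and eq: "AE x in M. x \<in> E \<longleftrightarrow> x \<in> A \<inter> B" "AE x in M. x \<in> E' \<longleftrightarrow> x \<in> A' \<inter> B'"
      by (auto simp: P_def)
    have "AE x in M. x \<in> E \<inter> E' \<longleftrightarrow> x \<in> (A \<inter> A') \<inter> (B \<inter> B')" using eq by eventually_elim auto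
    with * show "E \<inter> E' \<in> P" unfolding P_def
      by (intro CollectI conjI bexI[of _ "A \<inter> A'"] bexI[of _ "B \<inter> B'"]) auto
  qed
  moreover have "Int_stable D"
  proof (rule Int_stableI)
    fix a b assume "a \<in> D" "b \<in> D"
    then obtain A B where "A \<in> sets borel" "B \<in> sets borel"
      "a = (\<lambda>w. W t w - W s w) -` A \<inter> space M" "b = (\<lambda>w. W t w - W s w) -` B \<inter> space M"
      by (auto simp: D_def)
    then have "a \<inter> b = (\<lambda>w. W t w - W s w) -` (A \<inter> B) \<inter> space M" "A \<inter> B \<in> sets borel" by auto
    then show "a \<inter> b \<in> D" unfolding D_def by blast
  qed
  ultimately have i: "indep_set (sigma_sets (space M) P) (sigma_sets (space M) D)"
    by (rule indep_set_sigma_sets)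
  have hW: "sets (history M W s) \<subseteq> P"
  proof
    fix A assume A: "A \<in> sets (history M W s)"
    then have "A \<subseteq> space M" using sets.sets_into_space by fastforce
    then have "AE x in M. x \<in> A \<longleftrightarrow> x \<in> A \<inter> space M" by (intro AE_I2) auto
    moreover have "space M \<in> sets (history M Y T)" using sets.top[of "history M Y T"] by simp
    moreover have "A \<in> sets M" using A subW by blast
    ultimately show "A \<in> P" unfolding P_def using A by blast
  qed
  have hY: "sets (history M Y T) \<subseteq> P"
  proof
    fix A assume A: "A \<in> sets (history M Y T)"
    then have "A \<subseteq> space M" using sets.sets_into_space by fastforce
    then have "AE x in M. x \<in> A \<longleftrightarrow> x \<in> space M \<inter> A" by (intro AE_I2) auto
    moreover have "space M \<in> sets (history M W s)" using sets.top[of "history M W s"] by simp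
    moreover have "A \<in> sets M" using A subY by blast
    ultimately show "A \<in> P" unfolding P_def using A by blast
  qed
  have hN: "null_sets M \<subseteq> P"
  proof
    fix A assume A: "A \<in> null_sets M"
    have "AE x in M. x \<in> A \<longleftrightarrow> x \<in> {} \<inter> {}" using AE_not_in[OF A] by auto
    with A show "A \<in> P" unfolding P_def by (intro CollectI conjI bexI[of _ "{}"]) auto
  qed
  have "sets (enlarged_filtration M T W Y s) \<subseteq> sigma_sets (space M) P"
    unfolding sets_enlarged_filtration sets_natural_filtration
    using hW hY hN by (intro sigma_sets_mono Un_least) (auto intro: sigma_sets.Basic)
  moreover have "D \<subseteq> sigma_sets (space M) D" by (auto intro: sigma_sets.Basic)
  ultimately show ?thesis
    unfolding D_def[symmetric] by (rule indep_set_mono[OF i])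
qed

lemma integral_mult_indep:
  fixes f g :: "'a \<Rightarrow> real"
  assumes "prob_space M" and G: "subalgebra M G"
    and i: "prob_space.indep_set M (sets G) {g -` B \<inter> space M | B. B \<in> sets borel}"
    and f: "f \<in> borel_measurable G" "integrable M f" and g: "integrable M g"
    and h: "h \<in> borel_measurable borel" "integrable M (\<lambda>x. h (g x))"
  shows "integrable M (\<lambda>x. f x * h (g x))" "(\<integral>x. f x * h (g x) \<partial>M) = (\<integral>x. f x \<partial>M) * (\<integral>x. h (g x) \<partial>M)"
proof -
  interpret prob_space M by fact
  have sp: "space G = space M" using G by (simp add: subalgebra_def)
  have "indep_var borel f borel (\<lambda>x. h (g x))"
    unfolding indep_var_eq
  proof (intro conjI)
    show "f \<in> borel_measurable M" "(\<lambda>x. h (g x)) \<in> borel_measurable M" using f h by auto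
    have 1: "{f -` A \<inter> space M |A. A \<in> sets borel} \<subseteq> sets G"
      using measurable_sets[OF f(1)] sp by auto
    have 2: "{(\<lambda>x. h (g x)) -` A \<inter> space M |A. A \<in> sets borel} \<subseteq> {g -` B \<inter> space M | B. B \<in> sets borel}"
    proof safe
      fix A :: "real set" assume "A \<in> sets borel"
      then have "h -` A \<in> sets borel" using measurable_sets[OF h(1)] by simp
      then show "\<exists>B. (\<lambda>x. h (g x)) -` A \<inter> space M = g -` B \<inter> space M \<and> B \<in> sets borel"
        by (intro exI[of _ "h -` A"]) auto
    qed
    have "indep_set {f -` A \<inter> space M |A. A \<in> sets borel} {(\<lambda>x. h (g x)) -` A \<inter> space M |A. A \<in> sets borel}"
      by (rule indep_set_mono[OF i 1 2])
    then show "indep_set (sigma_sets (space M) {f -` A \<inter> space M |A. A \<in> sets borel})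
       (sigma_sets (space M) {(\<lambda>x. h (g x)) -` A \<inter> space M |A. A \<in> sets borel})"
    proof (rule indep_set_sigma_sets)
      have *: "Int_stable {k -` A \<inter> space M |A. A \<in> sets borel}" for k :: "'a \<Rightarrow> real"
      proof (rule Int_stableI)
        fix a b assume "a \<in> {k -` A \<inter> space M |A. A \<in> sets borel}" "b \<in> {k -` A \<inter> space M |A. A \<in> sets borel}"
        then obtain A B where "A \<in> sets borel" "B \<in> sets borel" "a = k -` A \<inter> space M" "b = k -` B \<inter> space M"
          by auto
        then have "a \<inter> b = k -` (A \<inter> B) \<inter> space M" "A \<inter> B \<in> sets borel" by auto
        then show "a \<inter> b \<in> {k -` A \<inter> space M |A. A \<in> sets borel}" by blast
      qed
      show "Int_stable {f -` A \<inter> space M |A. A \<in> sets borel}" by (rule *)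
      show "Int_stable {(\<lambda>x. h (g x)) -` A \<inter> space M |A. A \<in> sets borel}" by (rule *)
    qed
  qed
  from indep_var_integrable[OF this f(2) h(2)] indep_var_lebesgue_integral[OF this f(2) h(2)]
  show "integrable M (\<lambda>x. f x * h (g x))" "(\<integral>x. f x * h (g x) \<partial>M) = (\<integral>x. f x \<partial>M) * (\<integral>x. h (g x) \<partial>M)"
    by auto
qed

lemma normal_moments:
  assumes "prob_space M" "0 < \<sigma>" and D: "distributed M lborel X (normal_density 0 \<sigma>)"
  shows "integrable M X" "(\<integral>x. X x \<partial>M) = 0" "integrable M (\<lambda>x. (X x)\<^sup>2)" "(\<integral>x. (X x)\<^sup>2 \<partial>M) = \<sigma>\<^sup>2"
proof -
  interpret prob_space M by fact
  have n: "integrable lborel (\<lambda>x. normal_density 0 \<sigma> x * x ^ k)" for k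
    using integrable_normal_moment[OF assms(2), of 0 k] by simp
  show "integrable M X"
    using distributed_integrable[OF D, of "\<lambda>x. x"] n[of 1] by auto
  show E: "(\<integral>x. X x \<partial>M) = 0" using normal_distributed_expectation[OF assms(2) D] .
  show "integrable M (\<lambda>x. (X x)\<^sup>2)"
    using distributed_integrable[OF D, of "\<lambda>x. x\<^sup>2"] n[of 2] by auto
  show "(\<integral>x. (X x)\<^sup>2 \<partial>M) = \<sigma>\<^sup>2" using normal_distributed_variance[OF assms(2) D] E by simp
qed

text \<open>The filtration stays a parameter: the state lives on the joint filtration, the controls on that
  of the observation.\<close>

locale filtered_space = prob_space M for M :: "'a measure" +
  fixes T :: real and F :: "real \<Rightarrow> 'a measure"
  assumes T_pos: "0 < T"
    and F_augmented: "\<And>t. t \<le> T \<Longrightarrow> augmented M (F t)"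
    and F_mono: "\<And>s t. s \<le> t \<Longrightarrow> sets (F s) \<subseteq> sets (F t)"
begin

text \<open>The Ito calculus below uses only first and second conditional moments of increments. This
  definition and the next record them, tested against the integrable functions of the past; both Brownian
  motions have them with respect to the joint filtration.\<close>

definition integrator :: "('a, real) process \<Rightarrow> bool" where
  "integrator Z \<longleftrightarrow>
     (\<forall>t\<in>{0..T}. Z t \<in> borel_measurable (F t)) \<and>
     (AE w in M. continuous_on {0..T} (\<lambda>t. Z t w)) \<and>
     (\<forall>s t \<zeta>. 0 \<le> s \<longrightarrow> s \<le> t \<longrightarrow> t \<le> T \<longrightarrow> \<zeta> \<in> borel_measurable (F s) \<longrightarrow> integrable M \<zeta> \<longrightarrow>
        integrable M (\<lambda>w. \<zeta> w * (Z t w - Z s w)) \<and> (\<integral>w. \<zeta> w * (Z t w - Z s w) \<partial>M) = 0)"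

text \<open>The bracket of \<open>Z\<close> and \<open>Z'\<close> is \<open>\<rho> t\<close>. The value \<open>\<rho> = 1\<close>, \<open>Z = Z'\<close> leads to the isometry, and
  \<open>\<rho> = 0\<close> to orthogonality of the integrals with respect to \<open>W\<close> and \<open>Y\<close>.\<close>

definition covariation :: "real \<Rightarrow> ('a, real) process \<Rightarrow> ('a, real) process \<Rightarrow> bool" where
  "covariation \<rho> Z Z' \<longleftrightarrow>
     (\<forall>s t \<zeta>. 0 \<le> s \<longrightarrow> s \<le> t \<longrightarrow> t \<le> T \<longrightarrow> \<zeta> \<in> borel_measurable (F s) \<longrightarrow> integrable M \<zeta> \<longrightarrow>
        integrable M (\<lambda>w. \<zeta> w * ((Z t w - Z s w) * (Z' t w - Z' s w))) \<and>
        (\<integral>w. \<zeta> w * ((Z t w - Z s w) * (Z' t w - Z' s w)) \<partial>M) = \<rho> * (t - s) * (\<integral>w. \<zeta> w \<partial>M))"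

end

lemma measurable_sub_sets:
  assumes "f \<in> borel_measurable F" "sets F \<subseteq> sets G" "space F = space G"
  shows "f \<in> borel_measurable G"
  using assms unfolding measurable_def by auto

lemma increments_orthogonal_enlarged:
  assumes "prob_space M" and W: "brownian_motion M T W" and Y: "brownian_motion M T Y"
    and ind: "independent_processes M T W Y" and st: "0 \<le> s" "s \<le> t" "t \<le> T"
    and z: "\<zeta> \<in> borel_measurable (enlarged_filtration M T W Y s)" "integrable M \<zeta>"
  shows "integrable M (\<lambda>w. \<zeta> w * (W t w - W s w))" "(\<integral>w. \<zeta> w * (W t w - W s w) \<partial>M) = 0"
    "integrable M (\<lambda>w. \<zeta> w * (W t w - W s w)\<^sup>2)"
    "(\<integral>w. \<zeta> w * (W t w - W s w)\<^sup>2 \<partial>M) = (t - s) * (\<integral>w. \<zeta> w \<partial>M)"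
proof -
  interpret prob_space M by fact
  have "(integrable M (\<lambda>w. \<zeta> w * (W t w - W s w)) \<and> (\<integral>w. \<zeta> w * (W t w - W s w) \<partial>M) = 0) \<and>
    integrable M (\<lambda>w. \<zeta> w * (W t w - W s w)\<^sup>2) \<and>
    (\<integral>w. \<zeta> w * (W t w - W s w)\<^sup>2 \<partial>M) = (t - s) * (\<integral>w. \<zeta> w \<partial>M)"
  proof (cases "s = t")
    case True then show ?thesis by simp
  next
    case False
    then have st': "s < t" using st by simp
    have Wm: "\<forall>s\<in>{0..T}. W s \<in> borel_measurable M" and Ym: "\<forall>s\<in>{0..T}. Y s \<in> borel_measurable M"
      using W Y by (auto simp: brownian_motion_def)
    have sub: "subalgebra M (enlarged_filtration M T W Y s)"
      using enlarged_filtration_augmented[OF Wm Ym, of s] st by (simp add: augmented_def)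
    note i = increment_indep_enlarged[OF \<open>prob_space M\<close> W Ym ind st(1) st' st(3)]
    have d: "distributed M lborel (\<lambda>w. W t w - W s w) (normal_density 0 (sqrt (t - s)))"
      using W st st' by (auto simp: brownian_motion_def)
    note n = normal_moments[OF \<open>prob_space M\<close> _ d]
    have n': "integrable M (\<lambda>w. W t w - W s w)" "(\<integral>w. W t w - W s w \<partial>M) = 0"
       "integrable M (\<lambda>w. (W t w - W s w)\<^sup>2)" "(\<integral>w. (W t w - W s w)\<^sup>2 \<partial>M) = t - s"
      using n st' by auto
    note r = integral_mult_indep[OF \<open>prob_space M\<close> sub i z n'(1)]
    show ?thesis
      using r[of "\<lambda>x. x"] r[of "\<lambda>x. x\<^sup>2"] n' by simp
  qed
  then show "integrable M (\<lambda>w. \<zeta> w * (W t w - W s w))" "(\<integral>w. \<zeta> w * (W t w - W s w) \<partial>M) = 0"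
    "integrable M (\<lambda>w. \<zeta> w * (W t w - W s w)\<^sup>2)"
    "(\<integral>w. \<zeta> w * (W t w - W s w)\<^sup>2 \<partial>M) = (t - s) * (\<integral>w. \<zeta> w \<partial>M)" by auto
qed

lemma joint_filtration_filtered_space:
  assumes "prob_space M" "0 < T" "brownian_motion M T W" "brownian_motion M T Y"
  shows "filtered_space M T (joint_filtration M W Y)"
proof -
  interpret prob_space M by fact
  show ?thesis
  proof
    show "augmented M (joint_filtration M W Y t)" if "t \<le> T" for t
      using assms that by (intro joint_filtration_augmented[of T]) (auto simp: brownian_motion_def)
    show "sets (joint_filtration M W Y s) \<subseteq> sets (joint_filtration M W Y t)" if "s \<le> t" for s t
      by (rule joint_filtration_mono[OF that])
  qed (use assms in auto)
qed

text \<open>The filtration is fixed only through its events, so that \<open>W\<close> and \<open>Y\<close> can be exchanged, the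
  sigma-algebra generated by both being symmetric in them.\<close>

lemma brownian_integrator:
  assumes M: "prob_space M" and T: "0 < T" and W: "brownian_motion M T W" and Y: "brownian_motion M T Y"
    and ind: "independent_processes M T W Y"
    and F: "\<And>t. sets (F t) = sets (joint_filtration M W Y t)" and fs: "filtered_space M T F"
  shows "filtered_space.integrator M T F W" "filtered_space.covariation M T F 1 W W"
proof -
  interpret filtered_space M T F by fact
  have sp: "space (F t) = space M" for t using sets_eq_imp_space_eq[OF F[of t]] by simp
  have m: "f \<in> borel_measurable (enlarged_filtration M T W Y s)" if "f \<in> borel_measurable (F s)" "s \<le> T" for f s
    using that joint_subset_enlarged[of s T M W Y] F[of s] sp by (intro measurable_sub_sets[OF that(1)]) auto
  note o = increments_orthogonal_enlarged[OF M W Y ind]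
  show "integrator W"
    unfolding integrator_def
  proof (intro conjI ballI allI impI)
    fix t assume t: "t \<in> {0..T}"
    have "W t \<in> borel_measurable (natural_filtration M W t)"
      using t by (intro measurable_natural_filtration) auto
    moreover have "sets (natural_filtration M W t) \<subseteq> sets (F t)"
      unfolding F sets_joint_filtration by (rule subsetI, rule sigma_sets.Basic) simp
    ultimately show "W t \<in> borel_measurable (F t)"
      by (rule measurable_sub_sets) (simp add: sp)
  next
    show "AE w in M. continuous_on {0..T} (\<lambda>t. W t w)" using W by (simp add: brownian_motion_def)
  next
    fix s t and \<zeta> :: "'a \<Rightarrow> real"
    assume st: "0 \<le> s" "s \<le> t" "t \<le> T" and z: "\<zeta> \<in> borel_measurable (F s)" "integrable M \<zeta>"
    have "\<zeta> \<in> borel_measurable (enlarged_filtration M T W Y s)" using m[OF z(1)] st by simp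
    note o' = o[OF st this z(2)]
    show "integrable M (\<lambda>w. \<zeta> w * (W t w - W s w))" "(\<integral>w. \<zeta> w * (W t w - W s w) \<partial>M) = 0"
      by (fact o')+
  qed
  show "covariation 1 W W"
    unfolding covariation_def
  proof (intro allI impI)
    fix s t and \<zeta> :: "'a \<Rightarrow> real"
    assume st: "0 \<le> s" "s \<le> t" "t \<le> T" and z: "\<zeta> \<in> borel_measurable (F s)" "integrable M \<zeta>"
    have "\<zeta> \<in> borel_measurable (enlarged_filtration M T W Y s)" using m[OF z(1)] st by simp
    note o' = o[OF st this z(2)]
    show "integrable M (\<lambda>w. \<zeta> w * ((W t w - W s w) * (W t w - W s w))) \<and>
      (\<integral>w. \<zeta> w * ((W t w - W s w) * (W t w - W s w)) \<partial>M) = 1 * (t - s) * (\<integral>w. \<zeta> w \<partial>M)"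
      using o'(3,4) by (simp add: power2_eq_square)
  qed
qed

lemma (in prob_space) independent_processes_commute:
  assumes ind: "independent_processes M T W Y" shows "independent_processes M T Y W"
  unfolding independent_processes_def indep_sets2_eq
proof (intro conjI ballI)
  note i = ind[unfolded independent_processes_def]
  show "sets (history M Y T) \<subseteq> events" "sets (history M W T) \<subseteq> events"
    using indep_setD_ev1[OF i] indep_setD_ev2[OF i] by auto
  fix a b assume "a \<in> sets (history M Y T)" "b \<in> sets (history M W T)"
  then show "prob (a \<inter> b) = prob a * prob b"
    using indep_setD[OF i, of b a] by (simp add: Int_commute mult.commute)
qed

text \<open>Relative to the past of \<open>W\<close> and the whole of \<open>Y\<close>, the increment of \<open>Y\<close> is known and that of \<open>W\<close>
  has mean zero.\<close>

lemma independent_brownian_covariation: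
  assumes M: "prob_space M" and T: "0 < T" and W: "brownian_motion M T W" and Y: "brownian_motion M T Y"
    and ind: "independent_processes M T W Y"
  shows "filtered_space.covariation M T (joint_filtration M W Y) 0 W Y"
proof -
  interpret filtered_space M T "joint_filtration M W Y"
    using joint_filtration_filtered_space[OF M T W Y] .
  note ind' = independent_processes_commute[OF ind]
  have Y_int: "integrator Y"
    by (rule brownian_integrator(1)[OF M T Y W ind' joint_filtration_commute])
       (rule joint_filtration_filtered_space[OF M T W Y])
  show ?thesis
    unfolding covariation_def
  proof (intro allI impI)
    fix s t :: real and \<zeta> :: "'a \<Rightarrow> real"
    assume st: "0 \<le> s" "s \<le> t" "t \<le> T" and z: "\<zeta> \<in> borel_measurable (joint_filtration M W Y s)" "integrable M \<zeta>"
    let ?G = "enlarged_filtration M T W Y s"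
    have [measurable]: "\<zeta> \<in> borel_measurable ?G"
      using joint_subset_enlarged[of s T M W Y] st by (intro measurable_sub_sets[OF z(1)]) auto
    have y: "Y r \<in> borel_measurable ?G" if "0 \<le> r" "r \<le> T" for r
      using measurable_natural_filtration[OF that, of Y M]
      by (rule measurable_sub_sets) (auto simp: sets_enlarged_filtration intro: sigma_sets.Basic)
    have [measurable]: "Y t \<in> borel_measurable ?G" "Y s \<in> borel_measurable ?G" using y st by auto
    have int: "integrable M (\<lambda>w. \<zeta> w * (Y t w - Y s w))" using Y_int st z by (auto simp: integrator_def)
    have "(\<lambda>w. \<zeta> w * (Y t w - Y s w)) \<in> borel_measurable ?G" by measurable
    from increments_orthogonal_enlarged(1,2)[OF M W Y ind st this int]
    show "integrable M (\<lambda>w. \<zeta> w * ((W t w - W s w) * (Y t w - Y s w))) \<and>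
       (\<integral>w. \<zeta> w * ((W t w - W s w) * (Y t w - Y s w)) \<partial>M) = 0 * (t - s) * (\<integral>w. \<zeta> w \<partial>M)"
      by (simp add: mult_ac)
  qed
qed

section \<open>Square integrable processes and simple integrals\<close>

abbreviation leb :: "real \<Rightarrow> real measure" where
  "leb T \<equiv> restrict_space lborel {0..T}"

lemma finite_leb: "finite_measure (leb T)"
  by (rule finite_measureI) (simp add: emeasure_restrict_space space_restrict_space emeasure_lborel_Icc_eq)

lemma space_leb [simp]: "space (leb T) = {0..T}"
  by (simp add: space_restrict_space)

lemma sets_PM_borel: "sets (restrict_space borel {0..T} \<Otimes>\<^sub>M M) = sets (leb T \<Otimes>\<^sub>M M)"
  by (rule sets_pair_measure_cong) (auto simp: sets_restrict_space)

lemma measurable_leb: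
  "f \<in> borel_measurable borel \<Longrightarrow> f \<in> borel_measurable (leb T)"
  by (simp add: measurable_restrict_space1)

lemma bdd_meas_measurable: "bdd_meas T f \<Longrightarrow> f \<in> borel_measurable (leb T)"
  unfolding bdd_meas_def
  by (subst measurable_cong_sets[OF sets_restrict_space_cong[OF sets_lborel] refl]) blast

lemma measure_Ioc_Int:
  "measure lborel ({a<..b} \<inter> {c<..d::real}) = max 0 (min b d - max a c)"
proof -
  have "{a<..b} \<inter> {c<..d} = {max a c<..min b d}" by auto
  then show ?thesis by (cases "max a c \<le> min b d") (auto simp: max_def)
qed

context filtered_space
begin

abbreviation "PM \<equiv> leb T \<Otimes>\<^sub>M M"

sublocale tm: finite_measure "leb T" by (rule finite_leb)
sublocale TM: pair_sigma_finite "leb T" M ..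
sublocale PM: finite_measure PM
  by (rule finite_measure_pair_measure) (rule finite_measure_axioms, rule finite_leb)

lemma F_space: "t \<le> T \<Longrightarrow> space (F t) = space M"
  using F_augmented augmented_space by blast

lemma F_measurableD: "f \<in> borel_measurable (F t) \<Longrightarrow> t \<le> T \<Longrightarrow> f \<in> borel_measurable M"
  using F_augmented augmented_measurableD by blast

lemma F_measurable_mono: "f \<in> borel_measurable (F s) \<Longrightarrow> s \<le> t \<Longrightarrow> t \<le> T \<Longrightarrow> f \<in> borel_measurable (F t)"
  using F_mono F_space by (intro measurable_sub_sets[of f "F s" "F t"]) auto

text \<open>Tonelli turns the iterated integral in the definition of the space into one integral over the product of
  time and probability space.\<close>

lemma M2_space_iff:
  "H \<in> M2_space M T F \<longleftrightarrow> adapted T F H \<and> sq_int PM (case_prod H)"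
proof -
  have "(\<integral>\<^sup>+w. (\<integral>\<^sup>+t\<in>{0..T}. ennreal ((norm (H t w))\<^sup>2) \<partial>lborel) \<partial>M) = (\<integral>\<^sup>+x. ennreal ((norm (case_prod H x))\<^sup>2) \<partial>PM)"
    if [measurable]: "case_prod H \<in> borel_measurable PM"
  proof -
    have "(\<integral>\<^sup>+w. (\<integral>\<^sup>+t\<in>{0..T}. ennreal ((norm (H t w))\<^sup>2) \<partial>lborel) \<partial>M)
      = (\<integral>\<^sup>+w. (\<integral>\<^sup>+t. ennreal ((norm (case_prod H (t, w)))\<^sup>2) \<partial>leb T) \<partial>M)"
      by (simp add: nn_integral_restrict_space)
    also have "\<dots> = (\<integral>\<^sup>+x. ennreal ((norm (case_prod H x))\<^sup>2) \<partial>PM)"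
      by (rule TM.nn_integral_snd) measurable
    finally show ?thesis .
  qed
  moreover have "case_prod H \<in> borel_measurable (restrict_space borel {0..T} \<Otimes>\<^sub>M M) \<longleftrightarrow> case_prod H \<in> borel_measurable PM"
    by (subst measurable_cong_sets[OF sets_PM_borel refl]) (rule refl)
  ultimately show ?thesis
    unfolding M2_space_def mem_Collect_eq
    using sq_int_iff_nn_integral[of "case_prod H" PM] sq_int_measurable[of PM "case_prod H"]
    by (metis (lifting))
qed

lemma bounded_integrable:
  fixes f :: "'a \<Rightarrow> 'b::euclidean_space"
  assumes "f \<in> borel_measurable M" "\<And>w. w \<in> space M \<Longrightarrow> norm (f w) \<le> K"
  shows "integrable M f"
  using sq_int_integrable[OF sq_int_bounded[OF assms]] .

lemma bounded_mult_integrable: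
  fixes f g :: "'a \<Rightarrow> real"
  assumes "f \<in> borel_measurable M" "\<And>w. w \<in> space M \<Longrightarrow> \<bar>f w\<bar> \<le> K" "integrable M g"
  shows "integrable M (\<lambda>w. f w * g w)"
proof (rule Bochner_Integration.integrable_bound)
  show "integrable M (\<lambda>w. K * g w)" using assms(3) by (rule integrable_mult_right)
  show "AE w in M. norm (f w * g w) \<le> norm (K * g w)"
  proof (intro AE_I2)
    fix w assume "w \<in> space M"
    then have "\<bar>f w\<bar> \<le> \<bar>K\<bar>" using assms(2)[of w] by linarith
    then show "norm (f w * g w) \<le> norm (K * g w)" by (simp add: abs_mult mult_right_mono)
  qed
  show "(\<lambda>w. f w * g w) \<in> borel_measurable M"
    by (rule borel_measurable_times[OF assms(1) borel_measurable_integrable[OF assms(3)]])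
qed

lemma integratorD:
  assumes "integrator Z" 
  shows "\<And>t. 0 \<le> t \<Longrightarrow> t \<le> T \<Longrightarrow> Z t \<in> borel_measurable (F t)"
    and "AE w in M. continuous_on {0..T} (\<lambda>t. Z t w)"
    and "\<And>s t \<zeta>. 0 \<le> s \<Longrightarrow> s \<le> t \<Longrightarrow> t \<le> T \<Longrightarrow> \<zeta> \<in> borel_measurable (F s) \<Longrightarrow> integrable M \<zeta>
      \<Longrightarrow> integrable M (\<lambda>w. \<zeta> w * (Z t w - Z s w))"
    and "\<And>s t \<zeta>. 0 \<le> s \<Longrightarrow> s \<le> t \<Longrightarrow> t \<le> T \<Longrightarrow> \<zeta> \<in> borel_measurable (F s) \<Longrightarrow> integrable M \<zeta>
      \<Longrightarrow> (\<integral>w. \<zeta> w * (Z t w - Z s w) \<partial>M) = 0"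
  using assms unfolding integrator_def by auto

lemma integrator_measurable:
  assumes "integrator Z" "0 \<le> t" "t \<le> T" shows "Z t \<in> borel_measurable M"
  using F_measurableD[OF integratorD(1)[OF assms]] assms by auto

lemma increment_sq_int:
  fixes \<xi> :: "'a \<Rightarrow> 'b::euclidean_space"
  assumes Z: "integrator Z" "covariation 1 Z Z" and ab: "0 \<le> a" "a \<le> b" "b \<le> T"
    and \<xi>: "\<xi> \<in> borel_measurable (F a)" "\<And>w. w \<in> space M \<Longrightarrow> norm (\<xi> w) \<le> K"
  shows "sq_int M (\<lambda>w. (Z b w - Z a w) *\<^sub>R \<xi> w)"
proof -
  have [measurable]: "Z a \<in> borel_measurable M" "Z b \<in> borel_measurable M" "\<xi> \<in> borel_measurable M"
    using integrator_measurable[OF Z(1)] ab F_measurableD[OF \<xi>(1)] by auto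
  have [measurable]: "\<xi> \<in> borel_measurable (F a)" by fact
  have "integrable M (\<lambda>w. (norm (\<xi> w))\<^sup>2)"
    using sq_int_bounded[of \<xi> K] \<xi> by (auto simp: sq_int_def)
  moreover have "(\<lambda>w. (norm (\<xi> w))\<^sup>2) \<in> borel_measurable (F a)" by measurable
  ultimately have "integrable M (\<lambda>w. (norm (\<xi> w))\<^sup>2 * ((Z b w - Z a w) * (Z b w - Z a w)))"
    using Z(2) ab unfolding covariation_def by blast
  then have "integrable M (\<lambda>w. (norm ((Z b w - Z a w) *\<^sub>R \<xi> w))\<^sup>2)"
    by (simp add: power_mult_distrib power2_eq_square mult_ac)
  then show ?thesis by (simp add: sq_int_def)
qed

lemma increment_sq_int_real:
  assumes Z: "integrator Z" "covariation 1 Z Z" and ab: "0 \<le> a" "a \<le> b" "b \<le> T"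
  shows "sq_int M (\<lambda>w. Z b w - Z a w)"
  using increment_sq_int[OF assms, of "\<lambda>_. 1::real" 1] by simp

lemma increment_orthogonal:
  fixes \<xi> :: "'a \<Rightarrow> 'b::euclidean_space"
  assumes Z: "integrator Z" and ab: "0 \<le> a" "a \<le> b" "b \<le> T"
    and \<xi>: "\<xi> \<in> borel_measurable (F a)" "\<And>w. w \<in> space M \<Longrightarrow> norm (\<xi> w) \<le> K"
    and \<eta>: "\<eta> \<in> borel_measurable (F a)" "sq_int M \<eta>"
  shows "(\<integral>w. \<eta> w \<bullet> ((Z b w - Z a w) *\<^sub>R \<xi> w) \<partial>M) = 0"
proof -
  have [measurable]: "\<xi> \<in> borel_measurable (F a)" "\<eta> \<in> borel_measurable (F a)" by fact+
  have m: "(\<lambda>w. \<eta> w \<bullet> \<xi> w) \<in> borel_measurable (F a)" by measurable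
  have i: "integrable M (\<lambda>w. \<eta> w \<bullet> \<xi> w)"
    using \<xi> \<eta> ab F_measurableD[OF \<xi>(1)] by (intro sq_int_inner sq_int_bounded[of \<xi> K]) auto
  have "(\<integral>w. \<eta> w \<bullet> ((Z b w - Z a w) *\<^sub>R \<xi> w) \<partial>M) = (\<integral>w. (\<eta> w \<bullet> \<xi> w) * (Z b w - Z a w) \<partial>M)"
    by (intro Bochner_Integration.integral_cong) (auto simp: mult.commute)
  also have "\<dots> = 0" using integratorD(4)[OF Z ab m i] .
  finally show ?thesis .
qed

lemma covariation_commute: "covariation \<rho> Z Z' \<Longrightarrow> covariation \<rho> Z' Z"
  unfolding covariation_def by (simp add: mult.commute)

text \<open>Only the overlap of the two intervals contributes, because an increment over a later piece has
  conditional mean zero. The next lemma treats the two orders of the left end points.\<close>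

lemma increment_pair_le:
  fixes \<zeta> :: "'a \<Rightarrow> real"
  assumes Z: "integrator Z" "covariation 1 Z Z" and Z': "integrator Z'" "covariation 1 Z' Z'"
    and cov: "covariation \<rho> Z Z'"
    and ab: "0 \<le> a" "a \<le> b" "b \<le> T" and cd: "a \<le> c" "c \<le> d" "d \<le> T"
    and \<zeta>: "\<zeta> \<in> borel_measurable (F c)" "\<And>w. w \<in> space M \<Longrightarrow> \<bar>\<zeta> w\<bar> \<le> K"
  shows "(\<integral>w. \<zeta> w * ((Z b w - Z a w) * (Z' d w - Z' c w)) \<partial>M)
     = \<rho> * measure lborel ({a<..b} \<inter> {c<..d}) * (\<integral>w. \<zeta> w \<partial>M)"
proof -
  have \<zeta>M: "\<zeta> \<in> borel_measurable M" using F_measurableD[OF \<zeta>(1)] cd by simp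
  have prod: "integrable M (\<lambda>w. \<zeta> w * ((Z v w - Z u w) * (Z' y w - Z' x w)))"
    if "0 \<le> u" "u \<le> v" "v \<le> T" "0 \<le> x" "x \<le> y" "y \<le> T" for u v x y
    using sq_int_inner[OF increment_sq_int_real[OF Z, of u v] increment_sq_int_real[OF Z', of x y]] that
    by (intro bounded_mult_integrable[OF \<zeta>M \<zeta>(2)]) (auto simp: mult.commute)
  have orth: "(\<integral>w. \<zeta> w * ((Z v w - Z u w) * (Z' y w - Z' x w)) \<partial>M) = 0"
    if "0 \<le> u" "u \<le> v" "v \<le> x" "x \<le> y" "y \<le> T" "c \<le> x" for u v x y
  proof -
    have "(\<lambda>w. \<zeta> w * (Z v w - Z u w)) \<in> borel_measurable (F x)"
      using that by (intro borel_measurable_times borel_measurable_diff F_measurable_mono[OF \<zeta>(1)]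
        F_measurable_mono[OF integratorD(1)[OF Z(1)]]) auto
    moreover have "integrable M (\<lambda>w. \<zeta> w * (Z v w - Z u w))"
      using that by (intro bounded_mult_integrable[OF \<zeta>M \<zeta>(2)] sq_int_integrable increment_sq_int_real[OF Z]) auto
    ultimately show ?thesis
      using integratorD(4)[OF Z'(1), of x y "\<lambda>w. \<zeta> w * (Z v w - Z u w)"] that by (simp add: mult.assoc)
  qed
  have orth': "(\<integral>w. \<zeta> w * ((Z v w - Z u w) * (Z' y w - Z' x w)) \<partial>M) = 0"
    if "0 \<le> x" "x \<le> y" "y \<le> u" "u \<le> v" "v \<le> T" "c \<le> u" for u v x y
  proof -
    have "(\<lambda>w. \<zeta> w * (Z' y w - Z' x w)) \<in> borel_measurable (F u)"
      using that by (intro borel_measurable_times borel_measurable_diff F_measurable_mono[OF \<zeta>(1)]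
        F_measurable_mono[OF integratorD(1)[OF Z'(1)]]) auto
    moreover have "integrable M (\<lambda>w. \<zeta> w * (Z' y w - Z' x w))"
      using that by (intro bounded_mult_integrable[OF \<zeta>M \<zeta>(2)] sq_int_integrable increment_sq_int_real[OF Z']) auto
    ultimately show ?thesis
      using integratorD(4)[OF Z(1), of u v "\<lambda>w. \<zeta> w * (Z' y w - Z' x w)"] that by (simp add: mult_ac)
  qed
  show ?thesis
  proof (cases "b \<le> c")
    case True
    then have "{a<..b} \<inter> {c<..d} = {}" by auto
    then show ?thesis using orth[of a b c d] ab cd True by simp
  next
    case False
    define e where "e = min b d"
    have e: "c \<le> e" "e \<le> b" "e \<le> d" "e \<le> T" using False cd ab by (auto simp: e_def)
    let ?I = "\<lambda>u v x y. \<integral>w. \<zeta> w * ((Z v w - Z u w) * (Z' y w - Z' x w)) \<partial>M"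
    have "?I a b c d = (\<integral>w. \<zeta> w * ((Z c w - Z a w) * (Z' d w - Z' c w))
        + \<zeta> w * ((Z e w - Z c w) * (Z' e w - Z' c w)) + \<zeta> w * ((Z e w - Z c w) * (Z' d w - Z' e w))
        + \<zeta> w * ((Z b w - Z e w) * (Z' e w - Z' c w)) + \<zeta> w * ((Z b w - Z e w) * (Z' d w - Z' e w)) \<partial>M)"
      by (intro Bochner_Integration.integral_cong) (auto simp: algebra_simps)
    also have "\<dots> = ?I a c c d + ?I c e c e + ?I c e e d + ?I e b c e + ?I e b e d"
      using prod[of a c c d] prod[of c e c e] prod[of c e e d] prod[of e b c e] prod[of e b e d] e ab cd
      by simp
    also have "?I a c c d = 0" using e ab cd by (intro orth) auto
    also have "?I c e e d = 0" using e ab cd by (intro orth) auto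
    also have "?I e b c e = 0" using e ab cd by (intro orth') auto
    also have "?I e b e d = 0" by (cases "e = b") (auto simp: e_def min_def)
    also have "?I c e c e = \<rho> * (e - c) * (\<integral>w. \<zeta> w \<partial>M)"
      using cov \<zeta>(1) bounded_integrable[OF \<zeta>M, of K] \<zeta>(2) e ab cd unfolding covariation_def by auto
    also have "e - c = measure lborel ({a<..b} \<inter> {c<..d})"
      unfolding measure_Ioc_Int using e ab cd by (simp add: e_def max_def min_def)
    finally show ?thesis by simp
  qed
qed

lemma increment_pair:
  fixes \<xi> \<eta> :: "'a \<Rightarrow> 'b::euclidean_space"
  assumes Z: "integrator Z" "covariation 1 Z Z" and Z': "integrator Z'" "covariation 1 Z' Z'"
    and cov: "covariation \<rho> Z Z'"
    and ab: "0 \<le> a" "a \<le> b" "b \<le> T" and cd: "0 \<le> c" "c \<le> d" "d \<le> T"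
    and \<xi>: "\<xi> \<in> borel_measurable (F a)" "\<And>w. w \<in> space M \<Longrightarrow> norm (\<xi> w) \<le> K"
    and \<eta>: "\<eta> \<in> borel_measurable (F c)" "\<And>w. w \<in> space M \<Longrightarrow> norm (\<eta> w) \<le> L"
  shows "(\<integral>w. ((Z b w - Z a w) *\<^sub>R \<xi> w) \<bullet> ((Z' d w - Z' c w) *\<^sub>R \<eta> w) \<partial>M)
     = \<rho> * measure lborel ({a<..b} \<inter> {c<..d}) * (\<integral>w. \<xi> w \<bullet> \<eta> w \<partial>M)"
proof -
  have bd: "\<bar>\<xi> w \<bullet> \<eta> w\<bar> \<le> K * L" if "w \<in> space M" for w
  proof -
    have "\<bar>\<xi> w \<bullet> \<eta> w\<bar> \<le> norm (\<xi> w) * norm (\<eta> w)" by (rule Cauchy_Schwarz_ineq2)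
    also have "\<dots> \<le> K * L" using \<xi>(2)[OF that] \<eta>(2)[OF that]
      by (intro mult_mono) (auto intro: order_trans[OF norm_ge_zero])
    finally show ?thesis .
  qed
  show ?thesis
  proof (cases "a \<le> c")
    case True
    have "(\<lambda>w. \<xi> w \<bullet> \<eta> w) \<in> borel_measurable (F c)"
      using True cd by (intro borel_measurable_inner F_measurable_mono[OF \<xi>(1)] \<eta>(1)) auto
    from increment_pair_le[OF Z Z' cov ab True cd(2,3) this bd]
    show ?thesis by (simp add: mult_ac)
  next
    case False
    have "(\<lambda>w. \<xi> w \<bullet> \<eta> w) \<in> borel_measurable (F a)"
      using False ab by (intro borel_measurable_inner F_measurable_mono[OF \<eta>(1)] \<xi>(1)) auto
    from increment_pair_le[OF Z' Z covariation_commute[OF cov] cd _ ab(2,3) this bd] False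
    show ?thesis by (simp add: mult_ac Int_commute)
  qed
qed

text \<open>Summands are added one by one, over intervals that may overlap. Sums of such integrals are again
  of this form without refining partitions, and identities reduce to single summands by
  induction.\<close>

inductive simple_integral :: "('a, real) process \<Rightarrow> ('a, 'b::euclidean_space) process \<Rightarrow> ('a, 'b) process \<Rightarrow> bool"
  for Z where
  zero: "simple_integral Z (\<lambda>t w. 0) (\<lambda>t w. 0)"
| step: "\<lbrakk>simple_integral Z V E; 0 \<le> a; a \<le> b; b \<le> T; \<xi> \<in> borel_measurable (F a);
     \<And>w. w \<in> space M \<Longrightarrow> norm (\<xi> w) \<le> K\<rbrakk> \<Longrightarrow>
   simple_integral Z (\<lambda>t w. V t w + indicator {a<..b} t *\<^sub>R \<xi> w)
     (\<lambda>t w. E t w + (Z (min t b) w - Z (min t a) w) *\<^sub>R \<xi> w)"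

lemma simple_integral_add:
  assumes "simple_integral Z V' E'" "simple_integral Z V E"
  shows "simple_integral Z (\<lambda>t w. V t w + V' t w) (\<lambda>t w. E t w + E' t w)"
  using assms(1)
proof induction
  case zero then show ?case using assms(2) by simp
next
  case (step V' E' a b \<xi> K)
  from simple_integral.step[OF step.IH step.hyps(2-)] show ?case by (simp add: add.assoc)
qed

lemma simple_integral_minus:
  assumes "simple_integral Z V E"
  shows "simple_integral Z (\<lambda>t w. - V t w) (\<lambda>t w. - E t w)"
  using assms
proof induction
  case zero show ?case using simple_integral.zero by simp
next
  case (step V E a b \<xi> K)
  have "simple_integral Z (\<lambda>t w. - V t w + indicator {a<..b} t *\<^sub>R - \<xi> w)
     (\<lambda>t w. - E t w + (Z (min t b) w - Z (min t a) w) *\<^sub>R - \<xi> w)"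
    by (rule simple_integral.step[OF step.IH step.hyps(2-4), of _ K]) (use step.hyps in auto)
  then show ?case by simp
qed

lemma simple_integral_diff:
  assumes "simple_integral Z V' E'" "simple_integral Z V E"
  shows "simple_integral Z (\<lambda>t w. V t w - V' t w) (\<lambda>t w. E t w - E' t w)"
  using simple_integral_add[OF simple_integral_minus[OF assms(1)] assms(2)] by simp

lemma elementary_simple_integral:
  assumes "elementary_process M T F m \<tau> \<xi>"
  shows "simple_integral Z (elementary_val m \<tau> \<xi>) (elementary_integral Z m \<tau> \<xi>)"
proof -
  have e: "0 \<le> \<tau> 0" "\<tau> m \<le> T" "\<And>i. i < m \<Longrightarrow> \<tau> i \<le> \<tau> (Suc i)"
    "\<And>i. i < m \<Longrightarrow> \<xi> i \<in> borel_measurable (F (\<tau> i)) \<and> (\<exists>K. \<forall>w\<in>space M. norm (\<xi> i w) \<le> K)"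
    using assms by (auto simp: elementary_process_def)
  have pos: "0 \<le> \<tau> i" if "i \<le> m" for i
    using that by (induction i) (use e in \<open>auto intro: order_trans\<close>)
  have le: "\<tau> (m - k) \<le> T" if "k \<le> m" for k
    using that
  proof (induction k)
    case (Suc k)
    then have "\<tau> (m - Suc k) \<le> \<tau> (Suc (m - Suc k))" by (intro e(3)) auto
    also have "Suc (m - Suc k) = m - k" using Suc by simp
    finally show ?case using Suc by simp
  qed (use e in simp)
  have le': "\<tau> i \<le> T" if "i \<le> m" for i using le[of "m - i"] that by simp
  have "n \<le> m \<Longrightarrow> simple_integral Z (\<lambda>t w. \<Sum>i<n. indicator {\<tau> i<..\<tau> (Suc i)} t *\<^sub>R \<xi> i w)
     (\<lambda>t w. \<Sum>i<n. (Z (min t (\<tau> (Suc i))) w - Z (min t (\<tau> i)) w) *\<^sub>R \<xi> i w)" for n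
  proof (induction n)
    case 0 show ?case using simple_integral.zero by simp
  next
    case (Suc n)
    then obtain K where "\<And>w. w \<in> space M \<Longrightarrow> norm (\<xi> n w) \<le> K" using e(4)[of n] by auto
    with Suc show ?case
      using e(3,4)[of n] pos[of n] le'[of "Suc n"]
      by (simp only: sum.lessThan_Suc) (intro simple_integral.step[of Z _ _ "\<tau> n" "\<tau> (Suc n)" "\<xi> n" K], auto)
  qed
  from this[of m] show ?thesis
    by (simp add: elementary_val_def[abs_def] elementary_integral_def[abs_def])
qed

end

section \<open>Doob's maximal inequality\<close>

lemma (in pair_sigma_finite) integral_product_pair:
  fixes f :: "'a \<Rightarrow> real" and g :: "'b \<Rightarrow> real"
  assumes f: "integrable M1 f" and g: "integrable M2 g"
  shows "integrable (M1 \<Otimes>\<^sub>M M2) (\<lambda>(x, y). f x * g y)"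
    "(\<integral>(x, y). f x * g y \<partial>(M1 \<Otimes>\<^sub>M M2)) = (\<integral>x. f x \<partial>M1) * (\<integral>y. g y \<partial>M2)"
proof -
  have [measurable]: "f \<in> borel_measurable M1" "g \<in> borel_measurable M2" using f g by auto
  show i: "integrable (M1 \<Otimes>\<^sub>M M2) (\<lambda>(x, y). f x * g y)"
  proof (rule Fubini_integrable)
    show "integrable M1 (\<lambda>x. \<integral>y. norm (case (x, y) of (x, y) \<Rightarrow> f x * g y) \<partial>M2)"
      using f g by (simp add: abs_mult)
    show "AE x in M1. integrable M2 (\<lambda>y. case (x, y) of (x, y) \<Rightarrow> f x * g y)" using g by simp
  qed measurable
  show "(\<integral>(x, y). f x * g y \<partial>(M1 \<Otimes>\<^sub>M M2)) = (\<integral>x. f x \<partial>M1) * (\<integral>y. g y \<partial>M2)"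
    using integral_fst'[OF i] by simp
qed

fun runmax :: "(nat \<Rightarrow> real) \<Rightarrow> nat \<Rightarrow> real" where
  "runmax s 0 = s 0"
| "runmax s (Suc n) = max (runmax s n) (s (Suc n))"

lemma runmax_ge: "k \<le> n \<Longrightarrow> s k \<le> runmax s n"
  by (induction n) (auto simp: le_Suc_eq)

text \<open>A pathwise form of Doob's inequality: where the running maximum changes, it equals the
  sequence itself.\<close>

lemma runmax_pathwise:
  "(\<Sum>k<n. runmax s k * (s (Suc k) - s k)) \<le> runmax s n * s n - (runmax s n)\<^sup>2 / 2"
proof (induction n)
  case (Suc n)
  let ?m = "runmax s n" and ?x = "s (Suc n)"
  have "(\<Sum>k<Suc n. runmax s k * (s (Suc k) - s k)) \<le> ?m * ?x - ?m\<^sup>2 / 2"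
    using Suc by (simp add: algebra_simps)
  also have "\<dots> \<le> max ?m ?x * ?x - (max ?m ?x)\<^sup>2 / 2"
    using zero_le_power2[of "?m - ?x"] by (simp add: max_def power2_diff) (simp add: power2_eq_square)
  finally show ?case by simp
qed (simp add: power2_eq_square)

text \<open>The martingale property is tested with \<open>\<eta>\<^sub>k\<close>, the running maximum times the direction of \<open>S\<^sub>k\<close>.
  Together with the pathwise inequality this bounds half the second moment of the maximum by the mean of
  the maximum times \<open>|S\<^sub>n|\<close>, and Cauchy-Schwarz finishes.\<close>

lemma doob_l2_discrete:
  fixes S :: "nat \<Rightarrow> 'a \<Rightarrow> 'b::euclidean_space" and G :: "nat \<Rightarrow> 'a measure"
  assumes S: "\<And>k. sq_int M (S k)" "\<And>k. S k \<in> borel_measurable (G k)"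
    and G: "\<And>j k. j \<le> k \<Longrightarrow> sets (G j) \<subseteq> sets (G k)" "\<And>k. space (G k) = space M"
    and orth: "\<And>k \<eta>. k < n \<Longrightarrow> \<eta> \<in> borel_measurable (G k) \<Longrightarrow> sq_int M \<eta> \<Longrightarrow>
       (\<integral>w. \<eta> w \<bullet> (S (Suc k) w - S k w) \<partial>M) = 0"
  shows "sq_int M (\<lambda>w. runmax (\<lambda>i. norm (S i w)) n)"
    "l2norm M (\<lambda>w. runmax (\<lambda>i. norm (S i w)) n) \<le> 2 * l2norm M (S n)"
proof -
  let ?R = "\<lambda>k w. runmax (\<lambda>i. norm (S i w)) k"
  have nn: "0 \<le> ?R k w" for k w
    using runmax_ge[of 0 k "\<lambda>i. norm (S i w)"] by (intro order_trans[OF norm_ge_zero[of "S 0 w"]]) simp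
  have [measurable]: "S k \<in> borel_measurable M" for k using S(1) by (rule sq_int_measurable)
  have R: "sq_int M (?R k)" for k
  proof (induction k)
    case 0 show ?case using S(1)[of 0] by (simp add: sq_int_def)
  next
    case (Suc k)
    have 1: "sq_int M (\<lambda>w. ?R k w + norm (S (Suc k) w))"
      using Suc S(1)[of "Suc k"] by (intro sq_int_add) (auto simp: sq_int_def)
    have [measurable]: "?R k \<in> borel_measurable M" using Suc by (rule sq_int_measurable)
    show ?case
      by (rule sq_int_bound[OF 1, of _ 1]) (use nn[of _ k] in \<open>auto simp: max_def\<close>)
  qed
  have RG: "?R k \<in> borel_measurable (G k)" for k
  proof (induction k)
    case 0 show ?case using S(2)[of 0] by simp
  next
    case (Suc k)
    have "?R k \<in> borel_measurable (G (Suc k))"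
      using G(1)[of k "Suc k"] by (intro measurable_sub_sets[OF Suc]) (simp_all add: G(2))
    with S(2)[of "Suc k"] show ?case by simp
  qed
  define \<eta> where "\<eta> k w = ?R k w *\<^sub>R sgn (S k w)" for k w
  have \<eta>G: "\<eta> k \<in> borel_measurable (G k)" for k
    unfolding \<eta>_def sgn_div_norm using RG[of k] S(2)[of k] by measurable
  have \<eta>: "sq_int M (\<eta> k)" for k
  proof (rule sq_int_bound[OF R[of k], where c=1])
    have "?R k \<in> borel_measurable M" using R by (rule sq_int_measurable)
    then show "\<eta> k \<in> borel_measurable M" unfolding \<eta>_def sgn_div_norm by measurable
    show "AE w in M. norm (\<eta> k w) \<le> 1 * norm (?R k w)"
      by (intro AE_I2) (auto simp: \<eta>_def norm_sgn)
  qed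
  have step: "\<eta> k w \<bullet> (S (Suc k) w - S k w) \<le> ?R k w * (norm (S (Suc k) w) - norm (S k w))" for k w
  proof -
    have "sgn (S k w) \<bullet> S (Suc k) w \<le> norm (sgn (S k w)) * norm (S (Suc k) w)"
      by (rule norm_cauchy_schwarz)
    also have "\<dots> \<le> norm (S (Suc k) w)" by (simp add: norm_sgn)
    finally have "sgn (S k w) \<bullet> S (Suc k) w \<le> norm (S (Suc k) w)" .
    moreover have "sgn (S k w) \<bullet> S k w = norm (S k w)"
      by (cases "S k w = 0") (auto simp: sgn_div_norm power2_norm_eq_inner[symmetric] power2_eq_square)
    ultimately show ?thesis unfolding \<eta>_def
      using nn[of w k] by (simp add: inner_diff_right right_diff_distrib mult_left_mono)
  qed
  have path: "(\<Sum>k<n. \<eta> k w \<bullet> (S (Suc k) w - S k w)) + (?R n w)\<^sup>2 / 2 \<le> norm (?R n w) * norm (S n w)" for w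
    using runmax_pathwise[of "\<lambda>i. norm (S i w)" n] nn[of w n]
      sum_mono[of "{..<n}" "\<lambda>k. \<eta> k w \<bullet> (S (Suc k) w - S k w)", OF step] by simp
  have iR: "integrable M (\<lambda>w. (?R n w)\<^sup>2)" using sq_intD[OF R[of n]] by simp
  have i\<eta>: "integrable M (\<lambda>w. \<eta> k w \<bullet> (S (Suc k) w - S k w))" for k
    using \<eta> S(1) by (intro sq_int_inner sq_int_diff)
  have "(l2norm M (?R n))\<^sup>2 / 2 = (\<integral>w. (\<Sum>k<n. \<eta> k w \<bullet> (S (Suc k) w - S k w)) + (?R n w)\<^sup>2 / 2 \<partial>M)"
    using orth[OF _ \<eta>G \<eta>] i\<eta> iR by (simp add: l2norm_sq)
  also have "\<dots> \<le> (\<integral>w. norm (?R n w) * norm (S n w) \<partial>M)"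
    using path i\<eta> iR by (intro integral_mono sq_int_norm_mult R S(1)) auto
  also have "\<dots> \<le> l2norm M (?R n) * l2norm M (S n)" by (rule integral_norm_mult_le[OF R S(1)])
  finally have "l2norm M (?R n) * l2norm M (?R n) \<le> l2norm M (?R n) * (2 * l2norm M (S n))"
    by (simp add: power2_eq_square)
  then show "l2norm M (?R n) \<le> 2 * l2norm M (S n)"
    using l2norm_nonneg[of M "?R n"] l2norm_nonneg[of M "S n"]
    by (cases "l2norm M (?R n) = 0") (auto simp: mult_le_cancel_left)
  show "sq_int M (?R n)" by (rule R)
qed

text \<open>Over dyadic times the supremum is measurable for any process, and for a continuous path it is the
  full supremum.\<close>

definition dyadic_sup :: "real \<Rightarrow> ('a, 'b::euclidean_space) process \<Rightarrow> 'a \<Rightarrow> ennreal" where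
  "dyadic_sup T E w = (SUP n. SUP k\<in>{..2 ^ n}. ennreal ((norm (E (real k * T / 2 ^ n) w))\<^sup>2))"

lemma dyadic_time_bounds: "0 \<le> T \<Longrightarrow> k \<le> 2 ^ n \<Longrightarrow> 0 \<le> real k * T / 2 ^ n \<and> real k * T / 2 ^ n \<le> T"
proof -
  assume "0 \<le> T" "k \<le> 2 ^ n"
  then have "real k \<le> 2 ^ n" by (metis of_nat_le_iff of_nat_numeral of_nat_power)
  then have "real k * T \<le> 2 ^ n * T" using \<open>0 \<le> T\<close> by (intro mult_right_mono)
  then show ?thesis using \<open>0 \<le> T\<close> by (simp add: divide_simps mult.commute)
qed

lemma norm_le_dyadic_sup:
  assumes T: "0 < T" and c: "continuous_on {0..T} (\<lambda>t. E t w)" and t: "0 \<le> t" "t \<le> T"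
  shows "ennreal ((norm (E t w))\<^sup>2) \<le> dyadic_sup T E w"
proof -
  define k where "k n = nat \<lfloor>t / T * 2 ^ n\<rfloor>" for n :: nat
  have r: "0 \<le> t / T" "t / T \<le> 1" using T t by auto
  have k: "k n \<le> 2 ^ n" for n
  proof -
    have "t / T * 2 ^ n \<le> 2 ^ n" using mult_right_mono[OF r(2), of "2 ^ n"] by simp
    then have "\<lfloor>t / T * 2 ^ n\<rfloor> \<le> \<lfloor>(2::real) ^ n\<rfloor>" by (rule floor_mono)
    also have "\<lfloor>(2::real) ^ n\<rfloor> = 2 ^ n" by (metis floor_of_int of_int_numeral of_int_power)
    finally have "\<lfloor>t / T * 2 ^ n\<rfloor> \<le> 2 ^ n" .
    then show ?thesis by (simp add: k_def nat_le_iff)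
  qed
  let ?u = "\<lambda>n. real (k n) * T / 2 ^ n"
  have rk: "real (k n) = of_int \<lfloor>t / T * 2 ^ n\<rfloor>" for n
    unfolding k_def using r by (intro of_nat_nat) (simp only: zero_le_floor, intro mult_nonneg_nonneg, auto)
  have "?u \<longlonglongrightarrow> t"
  proof (rule LIM_zero_cancel, rule Lim_null_comparison[OF always_eventually], rule allI)
    fix n
    have "\<bar>real (k n) - t / T * 2 ^ n\<bar> \<le> 1" unfolding rk by linarith
    then have "\<bar>real (k n) - t / T * 2 ^ n\<bar> * (T / 2 ^ n) \<le> 1 * (T / 2 ^ n)"
      using T by (intro mult_right_mono) auto
    moreover have "\<bar>real (k n) - t / T * 2 ^ n\<bar> * (T / 2 ^ n) = \<bar>(real (k n) - t / T * 2 ^ n) * (T / 2 ^ n)\<bar>"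
      using T by (simp add: abs_mult)
    moreover have "(real (k n) - t / T * 2 ^ n) * (T / 2 ^ n) = ?u n - t" using T by (simp add: field_simps)
    ultimately have "\<bar>?u n - t\<bar> \<le> T / 2 ^ n" by (metis mult_1)
    then show "norm (?u n - t) \<le> T * (1/2) ^ n" by (simp add: power_divide)
    show "(\<lambda>n. T * (1/2) ^ n) \<longlonglongrightarrow> 0" by (intro tendsto_mult_right_zero LIMSEQ_realpow_zero) auto
  qed
  then have "(\<lambda>n. E (?u n) w) \<longlonglongrightarrow> E t w"
    using continuous_on_tendsto_compose[OF c, of ?u t sequentially] t k dyadic_time_bounds[of T] T
    by (simp add: always_eventually)
  then have "(\<lambda>n. ennreal ((norm (E (?u n) w))\<^sup>2)) \<longlonglongrightarrow> ennreal ((norm (E t w))\<^sup>2)"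
    by (intro tendsto_intros)
  moreover have "ennreal ((norm (E (?u n) w))\<^sup>2) \<le> dyadic_sup T E w" for n
    unfolding dyadic_sup_def using k[of n] by (intro SUP_upper2[of n] SUP_upper) auto
  ultimately show ?thesis by (meson LIMSEQ_le_const2)
qed

context filtered_space
begin

text \<open>Conditional mean zero of increments, stated as orthogonality to square integrable functions of
  the past.\<close>

definition l2_martingale :: "('a, 'b::euclidean_space) process \<Rightarrow> bool" where
  "l2_martingale E \<longleftrightarrow>
     (\<forall>t\<in>{0..T}. E t \<in> borel_measurable (F t) \<and> sq_int M (E t)) \<and>
     (\<forall>s t \<eta>. 0 \<le> s \<longrightarrow> s \<le> t \<longrightarrow> t \<le> T \<longrightarrow> \<eta> \<in> borel_measurable (F s) \<longrightarrow> sq_int M \<eta> \<longrightarrow>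
        (\<integral>w. \<eta> w \<bullet> (E t w - E s w) \<partial>M) = 0)"

lemma l2_martingaleD:
  assumes "l2_martingale E"
  shows "\<And>t. 0 \<le> t \<Longrightarrow> t \<le> T \<Longrightarrow> E t \<in> borel_measurable (F t)"
    and "\<And>t. 0 \<le> t \<Longrightarrow> t \<le> T \<Longrightarrow> sq_int M (E t)"
    and "\<And>s t \<eta>. 0 \<le> s \<Longrightarrow> s \<le> t \<Longrightarrow> t \<le> T \<Longrightarrow> \<eta> \<in> borel_measurable (F s) \<Longrightarrow> sq_int M \<eta> \<Longrightarrow>
        (\<integral>w. \<eta> w \<bullet> (E t w - E s w) \<partial>M) = 0"
  using assms unfolding l2_martingale_def by auto

lemma dyadic_sup_measurable:
  assumes "\<And>t. 0 \<le> t \<Longrightarrow> t \<le> T \<Longrightarrow> E t \<in> borel_measurable M"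
  shows "dyadic_sup T E \<in> borel_measurable M"
proof -
  have "(\<lambda>w. ennreal ((norm (E (real k * T / 2 ^ n) w))\<^sup>2)) \<in> borel_measurable M" if "k \<le> 2 ^ n" for n k
    using assms[of "real k * T / 2 ^ n"] dyadic_time_bounds[OF less_imp_le[OF T_pos] that] by simp
  then show ?thesis unfolding dyadic_sup_def[abs_def] by (intro borel_measurable_SUP) auto
qed

theorem doob_l2:
  assumes E: "l2_martingale E"
  shows "(\<integral>\<^sup>+w. dyadic_sup T E w \<partial>M) \<le> ennreal (4 * (l2norm M (E T))\<^sup>2)"
proof -
  let ?g = "\<lambda>n w. SUP k\<in>{..2 ^ n}. ennreal ((norm (E (real k * T / 2 ^ n) w))\<^sup>2)"
  have tb: "0 \<le> real k * T / 2 ^ n" "real k * T / 2 ^ n \<le> T" if "k \<le> 2 ^ n" for k n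
    using dyadic_time_bounds[of T k n] that T_pos by auto
  have meas: "(\<lambda>w. ennreal ((norm (E (real k * T / 2 ^ n) w))\<^sup>2)) \<in> borel_measurable M" if "k \<le> 2 ^ n" for n k
    using sq_int_measurable[OF l2_martingaleD(2)[OF E tb[OF that]]] by simp
  have inc: "incseq ?g"
  proof (rule incseq_SucI, rule le_funI)
    fix n w
    show "?g n w \<le> ?g (Suc n) w"
    proof (rule SUP_mono, safe)
      fix k :: nat assume "k \<le> 2 ^ n"
      then show "\<exists>j\<in>{..2 ^ Suc n}. ennreal ((norm (E (real k * T / 2 ^ n) w))\<^sup>2)
          \<le> ennreal ((norm (E (real j * T / 2 ^ Suc n) w))\<^sup>2)"
        by (intro bexI[of _ "2 * k"]) auto
    qed
  qed
  have bd: "(\<integral>\<^sup>+w. ?g n w \<partial>M) \<le> ennreal (4 * (l2norm M (E T))\<^sup>2)" for n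
  proof -
    let ?t = "\<lambda>k. min T (real k * T / 2 ^ n)"
    let ?S = "\<lambda>k. E (?t k)"
    have t: "0 \<le> ?t k" "?t k \<le> T" "?t k = real k * T / 2 ^ n \<or> \<not> k \<le> 2 ^ n" for k
      using T_pos tb[of k n] by auto
    have tm: "?t j \<le> ?t k" if "j \<le> k" for j k
      using that T_pos by (intro min.mono order_refl divide_right_mono mult_right_mono) auto
    have 1: "sq_int M (?S k)" for k using l2_martingaleD(2)[OF E] t by simp
    have 2: "?S k \<in> borel_measurable (F (?t k))" for k using l2_martingaleD(1)[OF E] t by simp
    have 3: "sets (F (?t j)) \<subseteq> sets (F (?t k))" if "j \<le> k" for j k using F_mono tm[OF that] by simp
    have 4: "space (F (?t k)) = space M" for k using t by (intro F_space) simp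
    have 5: "(\<integral>w. \<eta> w \<bullet> (?S (Suc k) w - ?S k w) \<partial>M) = 0"
      if "k < 2 ^ n" "\<eta> \<in> borel_measurable (F (?t k))" "sq_int M \<eta>" for k \<eta>
      using l2_martingaleD(3)[OF E t(1) tm t(2) that(2,3), of "Suc k"] by simp
    note d = doob_l2_discrete[of M ?S "\<lambda>k. F (?t k)" "2 ^ n", OF 1 2 3 4 5]
    have d1: "sq_int M (\<lambda>w. runmax (\<lambda>i. norm (?S i w)) (2 ^ n))"
      using d(1) by blast
    have tT: "?t (2 ^ n) = T" by simp
    then have d2: "l2norm M (\<lambda>w. runmax (\<lambda>i. norm (?S i w)) (2 ^ n)) \<le> 2 * l2norm M (E T)"
      using d(2) unfolding tT by blast
    have "(\<integral>\<^sup>+w. ?g n w \<partial>M) \<le> (\<integral>\<^sup>+w. ennreal ((norm (runmax (\<lambda>i. norm (?S i w)) (2 ^ n)))\<^sup>2) \<partial>M)"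
    proof (intro nn_integral_mono SUP_least ennreal_leI power_mono)
      fix w k assume k: "k \<in> {..(2::nat) ^ n}"
      have "norm (?S k w) \<le> runmax (\<lambda>i. norm (?S i w)) (2 ^ n)"
        using k by (intro runmax_ge[of k _ "\<lambda>i. norm (?S i w)"]) auto
      then show "norm (E (real k * T / 2 ^ n) w) \<le> norm (runmax (\<lambda>i. norm (?S i w)) (2 ^ n))"
        using t(3)[of k] k by auto
    qed simp
    also have "\<dots> = ennreal ((l2norm M (\<lambda>w. runmax (\<lambda>i. norm (?S i w)) (2 ^ n)))\<^sup>2)"
      by (rule nn_integral_sq[OF d1])
    also have "\<dots> \<le> ennreal ((2 * l2norm M (E T))\<^sup>2)"
      using d2 by (intro ennreal_leI power_mono) auto
    finally show ?thesis by (simp add: power_mult_distrib)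
  qed
  have "(\<integral>\<^sup>+w. dyadic_sup T E w \<partial>M) = (SUP n. \<integral>\<^sup>+w. ?g n w \<partial>M)"
    unfolding dyadic_sup_def
    by (rule nn_integral_monotone_convergence_SUP[OF inc]) (intro borel_measurable_SUP meas; auto)
  also have "\<dots> \<le> ennreal (4 * (l2norm M (E T))\<^sup>2)" using bd by (intro SUP_least)
  finally show ?thesis .
qed

text \<open>An increment from \<open>s\<close> to \<open>t\<close> of the integral of one summand is again an increment of the
  integrator, between times after \<open>s\<close>.\<close>

lemma clamp_increment:
  fixes Z :: "real \<Rightarrow> 'c::ab_group_add"
  assumes "s \<le> t" "a \<le> b"
  shows "(Z (min t b) - Z (min t a)) - (Z (min s b) - Z (min s a)) = Z (max s (min t b)) - Z (max s (min t a))"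
  using assms by (auto simp: min_def max_def)

lemma simple_integral_measurable:
  assumes "simple_integral Z V E" and Z: "integrator Z" and t: "0 \<le> t" "t \<le> T"
  shows "E t \<in> borel_measurable (F t)"
  using assms(1)
proof induction
  case (step V E a b \<xi> K)
  have [measurable]: "Z (min t b) \<in> borel_measurable (F t)" "Z (min t a) \<in> borel_measurable (F t)"
    using step t by (auto intro!: F_measurable_mono[OF integratorD(1)[OF Z]])
  have [measurable]: "E t \<in> borel_measurable (F t)" by fact
  show ?case
  proof (cases "a \<le> t")
    case True
    then have [measurable]: "\<xi> \<in> borel_measurable (F t)" using F_measurable_mono[OF step.hyps(5)] t by auto
    show ?thesis by measurable
  next
    case False
    then have "min t b = min t a" using step.hyps by auto
    then show ?thesis by simp
  qed
qed simp

lemma simple_piece_sq_int: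
  fixes \<xi> :: "'a \<Rightarrow> 'b::euclidean_space"
  assumes Z: "integrator Z" "covariation 1 Z Z" and s: "0 \<le> s" "s \<le> t" "t \<le> T" and ab: "0 \<le> a" "a \<le> b" "b \<le> T"
    and \<xi>: "\<xi> \<in> borel_measurable (F a)" "\<And>w. w \<in> space M \<Longrightarrow> norm (\<xi> w) \<le> K"
  shows "sq_int M (\<lambda>w. (Z (max s (min t b)) w - Z (max s (min t a)) w) *\<^sub>R \<xi> w)"
    and "\<eta> \<in> borel_measurable (F s) \<Longrightarrow> sq_int M \<eta> \<Longrightarrow>
      (\<integral>w. \<eta> w \<bullet> ((Z (max s (min t b)) w - Z (max s (min t a)) w) *\<^sub>R \<xi> w) \<partial>M) = 0"
proof -
  let ?a = "max s (min t a)" and ?b = "max s (min t b)"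
  have o: "0 \<le> ?a" "?a \<le> ?b" "?b \<le> T" "?a \<le> T" "s \<le> ?a" using s ab by auto
  have *: "\<xi> \<in> borel_measurable (F ?a)" if "a \<le> t"
    using F_measurable_mono[OF \<xi>(1), of ?a] that o by auto
  show "sq_int M (\<lambda>w. (Z ?b w - Z ?a w) *\<^sub>R \<xi> w)"
  proof (cases "a \<le> t")
    case True
    from increment_sq_int[OF Z o(1-3) *[OF this] \<xi>(2)] show ?thesis .
  next
    case False
    then have "?b = ?a" using ab by auto
    then show ?thesis by simp
  qed
  assume \<eta>: "\<eta> \<in> borel_measurable (F s)" "sq_int M \<eta>"
  show "(\<integral>w. \<eta> w \<bullet> ((Z ?b w - Z ?a w) *\<^sub>R \<xi> w) \<partial>M) = 0"
  proof (cases "a \<le> t")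
    case True
    show ?thesis
      by (rule increment_orthogonal[OF Z(1) o(1-3) *[OF True] \<xi>(2) F_measurable_mono[OF \<eta>(1) o(5,4)] \<eta>(2)])
  next
    case False
    then have "?b = ?a" using ab by auto
    then show ?thesis by simp
  qed
qed

lemma simple_integral_sq_int:
  assumes "simple_integral Z V E" and Z: "integrator Z" "covariation 1 Z Z" and t: "0 \<le> t" "t \<le> T"
  shows "sq_int M (E t)"
  using assms(1)
proof induction
  case (step V E a b \<xi> K)
  have "max 0 (min t a) = min t a" "max 0 (min t b) = min t b" using t step by auto
  then show ?case
    using simple_piece_sq_int(1)[OF Z order_refl t step.hyps(2-6)] step.IH
    by (intro sq_int_add) auto
qed simp

lemma simple_integral_martingale:
  fixes E :: "('a, 'b::euclidean_space) process"
  assumes VE: "simple_integral Z V E" and Z: "integrator Z" "covariation 1 Z Z"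
  shows "l2_martingale E"
  unfolding l2_martingale_def
proof (intro conjI ballI allI impI)
  show "E t \<in> borel_measurable (F t)" "sq_int M (E t)" if "t \<in> {0..T}" for t
    using simple_integral_measurable[OF VE Z(1)] simple_integral_sq_int[OF VE Z] that by auto
  fix s t and \<eta> :: "'a \<Rightarrow> 'b" assume s: "0 \<le> s" "s \<le> t" "t \<le> T" and \<eta>: "\<eta> \<in> borel_measurable (F s)" "sq_int M \<eta>"
  show "(\<integral>w. \<eta> w \<bullet> (E t w - E s w) \<partial>M) = 0"
    using VE
  proof induction
    case (step V E a b \<xi> K)
    let ?P = "\<lambda>w. (Z (max s (min t b)) w - Z (max s (min t a)) w) *\<^sub>R \<xi> w"
    have sq: "sq_int M (E t)" "sq_int M (E s)"
      using simple_integral_sq_int[OF step.hyps(1) Z] s by auto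
    have P: "sq_int M ?P" "(\<integral>w. \<eta> w \<bullet> ?P w \<partial>M) = 0"
      using simple_piece_sq_int[OF Z s step.hyps(2-6)] \<eta> by auto
    have "(\<integral>w. \<eta> w \<bullet> (E t w + (Z (min t b) w - Z (min t a) w) *\<^sub>R \<xi> w
         - (E s w + (Z (min s b) w - Z (min s a) w) *\<^sub>R \<xi> w)) \<partial>M)
       = (\<integral>w. \<eta> w \<bullet> (E t w - E s w) + \<eta> w \<bullet> ?P w \<partial>M)"
    proof (intro Bochner_Integration.integral_cong refl)
      fix w
      have "?P w = (Z (min t b) w - Z (min t a) w) *\<^sub>R \<xi> w - (Z (min s b) w - Z (min s a) w) *\<^sub>R \<xi> w"
        unfolding clamp_increment[OF s(2) step.hyps(3), of "\<lambda>t. Z t w", symmetric] by (simp add: scaleR_diff_left)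
      then show "\<eta> w \<bullet> (E t w + (Z (min t b) w - Z (min t a) w) *\<^sub>R \<xi> w
         - (E s w + (Z (min s b) w - Z (min s a) w) *\<^sub>R \<xi> w)) = \<eta> w \<bullet> (E t w - E s w) + \<eta> w \<bullet> ?P w"
        by (simp add: inner_add_right inner_diff_right)
    qed
    also have "\<dots> = (\<integral>w. \<eta> w \<bullet> (E t w - E s w) \<partial>M) + (\<integral>w. \<eta> w \<bullet> ?P w \<partial>M)"
      using P(1) sq \<eta> by (intro Bochner_Integration.integral_add sq_int_inner sq_int_diff) auto
    also have "\<dots> = 0"
      using step.IH P(2) by linarith
    finally show ?case .
  qed simp
qed

lemma simple_integral_continuous:
  assumes "simple_integral Z V E" and Z: "continuous_on {0..T} (\<lambda>t. Z t w)"
  shows "continuous_on {0..T} (\<lambda>t. E t w)"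
  using assms(1)
proof induction
  case (step V E a b \<xi> K)
  have "continuous_on {0..T} (\<lambda>t. Z (min t c) w)" if "0 \<le> c" for c
    by (rule continuous_on_compose2[OF Z]) (use that in \<open>auto intro!: continuous_intros\<close>)
  with step show ?case by (intro continuous_intros) auto
qed simp

text \<open>The integrand of the integral up to \<open>t\<close>, as a function on the product space. Removing time \<open>0\<close> matches
  the half-open intervals of elementary processes.\<close>

definition up_to :: "real \<Rightarrow> ('a, 'b::real_vector) process \<Rightarrow> real \<times> 'a \<Rightarrow> 'b" where
  "up_to t V = (\<lambda>(r, w). indicator {0<..t} r *\<^sub>R V r w)"

lemma fst_PM [measurable]: "fst \<in> borel_measurable PM"
  using measurable_compose[OF measurable_fst measurable_leb[of "\<lambda>x. x"]] by simp

lemma sq_int_up_to: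
  assumes "sq_int PM (case_prod V)"
  shows "sq_int PM (up_to t V)"
proof (rule sq_int_bound[OF assms, of _ 1])
  have [measurable]: "case_prod V \<in> borel_measurable PM" using assms by (rule sq_int_measurable)
  have "(\<lambda>x. indicator {0<..t} (fst x) *\<^sub>R case_prod V x) \<in> borel_measurable PM" by measurable
  then show "up_to t V \<in> borel_measurable PM" by (simp add: up_to_def case_prod_beta')
  show "AE x in PM. norm (up_to t V x) \<le> 1 * norm (case_prod V x)"
    by (intro AE_I2) (auto simp: up_to_def indicator_def)
qed

lemma piece_sq_int:
  fixes \<xi> :: "'a \<Rightarrow> 'b::euclidean_space"
  assumes "\<xi> \<in> borel_measurable M" "\<And>w. w \<in> space M \<Longrightarrow> norm (\<xi> w) \<le> K"
  shows "sq_int PM (case_prod (\<lambda>t w. indicator {a<..b} t *\<^sub>R \<xi> w))"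
proof (rule PM.sq_int_bounded[of _ "\<bar>K\<bar>"])
  have [measurable]: "\<xi> \<in> borel_measurable M" by fact
  have "(\<lambda>x. indicator {a<..b} (fst x) *\<^sub>R \<xi> (snd x)) \<in> borel_measurable PM" by measurable
  then show "case_prod (\<lambda>t w. indicator {a<..b} t *\<^sub>R \<xi> w) \<in> borel_measurable PM" by (simp add: case_prod_beta')
  show "norm (case_prod (\<lambda>t w. indicator {a<..b} t *\<^sub>R \<xi> w) x) \<le> \<bar>K\<bar>" if "x \<in> space PM" for x
    using that assms(2)[of "snd x"] by (auto simp: indicator_def space_pair_measure intro: order_trans)
qed

lemma simple_integrand_sq_int:
  assumes "simple_integral Z V E"
  shows "sq_int PM (case_prod V)"
  using assms
proof induction
  case (step V E a b \<xi> K)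
  have "sq_int PM (\<lambda>x. case_prod V x + case_prod (\<lambda>t w. indicator {a<..b} t *\<^sub>R \<xi> w) x)"
    using step F_measurableD[OF step.hyps(5)] by (intro sq_int_add piece_sq_int[of _ K]) auto
  then show ?case by (simp add: case_prod_beta')
qed (simp add: case_prod_beta')

lemma up_to_add: "up_to t (\<lambda>r w. V r w + V' r w) = (\<lambda>x. up_to t V x + up_to t V' x)"
  by (auto simp: up_to_def scaleR_add_right)

lemma up_to_diff: "up_to t (\<lambda>r w. V r w - V' r w) = (\<lambda>x. up_to t V x - up_to t V' x)"
  by (auto simp: up_to_def scaleR_diff_right)

lemma piece_isometry:
  fixes \<xi> \<eta> :: "'a \<Rightarrow> 'b::euclidean_space"
  assumes Z: "integrator Z" "covariation 1 Z Z" and Z': "integrator Z'" "covariation 1 Z' Z'"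
    and cov: "covariation \<rho> Z Z'" and t: "0 \<le> t" "t \<le> T"
    and ab: "0 \<le> a" "a \<le> b" "b \<le> T" and cd: "0 \<le> c" "c \<le> d" "d \<le> T"
    and \<xi>: "\<xi> \<in> borel_measurable (F a)" "\<And>w. w \<in> space M \<Longrightarrow> norm (\<xi> w) \<le> K"
    and \<eta>: "\<eta> \<in> borel_measurable (F c)" "\<And>w. w \<in> space M \<Longrightarrow> norm (\<eta> w) \<le> L"
  shows "(\<integral>w. ((Z (min t b) w - Z (min t a) w) *\<^sub>R \<xi> w) \<bullet> ((Z' (min t d) w - Z' (min t c) w) *\<^sub>R \<eta> w) \<partial>M)
     = \<rho> * (\<integral>x. up_to t (\<lambda>r w. indicator {a<..b} r *\<^sub>R \<xi> w) x \<bullet> up_to t (\<lambda>r w. indicator {c<..d} r *\<^sub>R \<eta> w) x \<partial>PM)"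
proof -
  let ?S = "{0<..t} \<inter> ({a<..b} \<inter> {c<..d})"
  have i: "integrable M (\<lambda>w. \<xi> w \<bullet> \<eta> w)"
    using F_measurableD[OF \<xi>(1)] F_measurableD[OF \<eta>(1)] ab cd \<xi>(2) \<eta>(2)
    by (intro sq_int_inner sq_int_bounded[of \<xi> K] sq_int_bounded[of \<eta> L]) auto
  have j: "integrable (leb T) (indicator ?S :: real \<Rightarrow> real)"
    by (rule tm.integrable_const_bound[of _ 1]) (auto intro!: measurable_leb)
  have "(\<integral>x. up_to t (\<lambda>r w. indicator {a<..b} r *\<^sub>R \<xi> w) x \<bullet> up_to t (\<lambda>r w. indicator {c<..d} r *\<^sub>R \<eta> w) x \<partial>PM)
     = (\<integral>(r, w). indicator ?S r * (\<xi> w \<bullet> \<eta> w) \<partial>PM)"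
    by (intro Bochner_Integration.integral_cong) (auto simp: up_to_def indicator_def)
  also have "\<dots> = (\<integral>r. indicator ?S r \<partial>leb T) * (\<integral>w. \<xi> w \<bullet> \<eta> w \<partial>M)"
    by (rule TM.integral_product_pair(2)[OF j i])
  also have "(\<integral>r. indicator ?S r \<partial>leb T) = measure (leb T) (?S \<inter> {0..T})" by simp
  also have "\<dots> = measure lborel ?S"
    using t by (subst measure_restrict_space) (auto intro!: arg_cong[of _ _ "measure lborel"])
  also have "?S = {min t a<..min t b} \<inter> {min t c<..min t d}" using ab cd by auto
  finally have R: "(\<integral>x. up_to t (\<lambda>r w. indicator {a<..b} r *\<^sub>R \<xi> w) x \<bullet> up_to t (\<lambda>r w. indicator {c<..d} r *\<^sub>R \<eta> w) x \<partial>PM)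
     = measure lborel ({min t a<..min t b} \<inter> {min t c<..min t d}) * (\<integral>w. \<xi> w \<bullet> \<eta> w \<partial>M)" .
  show ?thesis
  proof (cases "a \<le> t \<and> c \<le> t")
    case True
    then have [simp]: "min t a = a" "min t c = c" by auto
    have "(\<integral>w. ((Z (min t b) w - Z a w) *\<^sub>R \<xi> w) \<bullet> ((Z' (min t d) w - Z' c w) *\<^sub>R \<eta> w) \<partial>M)
      = \<rho> * measure lborel ({a<..min t b} \<inter> {c<..min t d}) * (\<integral>w. \<xi> w \<bullet> \<eta> w \<partial>M)"
      by (rule increment_pair[OF Z Z' cov _ _ _ _ _ _ \<xi> \<eta>]) (use True ab cd t in auto)
    then show ?thesis using R by simp
  next
    case False
    then have "min t b = min t a \<or> min t d = min t c" using ab cd by auto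
    then show ?thesis unfolding R by auto
  qed
qed

text \<open>Both sides are bilinear in the integrands, so two inductions reduce the identity to a pair of
  single summands.\<close>

theorem simple_isometry:
  fixes V V' :: "('a, 'b::euclidean_space) process"
  assumes VE: "simple_integral Z V E" and VE': "simple_integral Z' V' E'"
    and Z: "integrator Z" "covariation 1 Z Z" and Z': "integrator Z'" "covariation 1 Z' Z'"
    and cov: "covariation \<rho> Z Z'" and t: "0 \<le> t" "t \<le> T"
  shows "(\<integral>w. E t w \<bullet> E' t w \<partial>M) = \<rho> * (\<integral>x. up_to t V x \<bullet> up_to t V' x \<partial>PM)"
proof -
  have one: "(\<integral>w. ((Z (min t b) w - Z (min t a) w) *\<^sub>R \<xi> w) \<bullet> E' t w \<partial>M)
     = \<rho> * (\<integral>x. up_to t (\<lambda>r w. indicator {a<..b} r *\<^sub>R \<xi> w) x \<bullet> up_to t V' x \<partial>PM)"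
    if ab: "0 \<le> a" "a \<le> b" "b \<le> T" and \<xi>: "\<xi> \<in> borel_measurable (F a)" "\<And>w. w \<in> space M \<Longrightarrow> norm (\<xi> w) \<le> K"
    for a b K and \<xi> :: "'a \<Rightarrow> 'b"
    using VE'
  proof induction
    case zero show ?case by (simp add: up_to_def case_prod_beta')
  next
    case (step V' E' c d \<eta> L)
    let ?P = "\<lambda>w. (Z (min t b) w - Z (min t a) w) *\<^sub>R \<xi> w" and ?Q = "\<lambda>w. (Z' (min t d) w - Z' (min t c) w) *\<^sub>R \<eta> w"
    let ?p = "\<lambda>r w. indicator {a<..b} r *\<^sub>R \<xi> w" and ?q = "\<lambda>r w. indicator {c<..d} r *\<^sub>R \<eta> w"
    have mx: "max 0 (min t u) = min t u" if "0 \<le> u" for u using that t by auto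
    have P: "sq_int M ?P" using simple_piece_sq_int(1)[OF Z order_refl t ab \<xi>] mx ab by auto
    have Q: "sq_int M ?Q"
      using simple_piece_sq_int(1)[OF Z' order_refl t step.hyps(2-6)] mx step.hyps by auto
    have E: "sq_int M (E' t)" by (rule simple_integral_sq_int[OF step.hyps(1) Z' t])
    have p: "sq_int PM (up_to t ?p)"
      using F_measurableD[OF \<xi>(1)] \<xi>(2) ab by (intro sq_int_up_to piece_sq_int[of _ K]) auto
    have q: "sq_int PM (up_to t ?q)"
      using F_measurableD[OF step.hyps(5)] step.hyps by (intro sq_int_up_to piece_sq_int[of _ L]) auto
    have v: "sq_int PM (up_to t V')"
      by (intro sq_int_up_to simple_integrand_sq_int[OF step.hyps(1)])
    have "(\<integral>w. ?P w \<bullet> (E' t w + ?Q w) \<partial>M) = (\<integral>w. ?P w \<bullet> E' t w \<partial>M) + (\<integral>w. ?P w \<bullet> ?Q w \<partial>M)"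
      unfolding inner_add_right
      by (rule Bochner_Integration.integral_add[OF sq_int_inner[OF P E] sq_int_inner[OF P Q]])
    also have "(\<integral>w. ?P w \<bullet> ?Q w \<partial>M) = \<rho> * (\<integral>x. up_to t ?p x \<bullet> up_to t ?q x \<partial>PM)"
      by (rule piece_isometry[OF Z Z' cov t ab step.hyps(2-4) \<xi> step.hyps(5,6)])
    also have "(\<integral>w. ?P w \<bullet> E' t w \<partial>M) = \<rho> * (\<integral>x. up_to t ?p x \<bullet> up_to t V' x \<partial>PM)" by (rule step.IH)
    finally show ?case
      unfolding up_to_add inner_add_right
      using Bochner_Integration.integral_add[OF sq_int_inner[OF p v] sq_int_inner[OF p q]]
      by (simp add: distrib_left)
  qed
  show ?thesis
    using VE
  proof induction
    case zero show ?case by (simp add: up_to_def case_prod_beta')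
  next
    case (step V E a b \<xi> K)
    let ?P = "\<lambda>w. (Z (min t b) w - Z (min t a) w) *\<^sub>R \<xi> w" and ?p = "\<lambda>r w. indicator {a<..b} r *\<^sub>R \<xi> w"
    have mx: "max 0 (min t u) = min t u" if "0 \<le> u" for u using that t by auto
    have P: "sq_int M ?P"
      using simple_piece_sq_int(1)[OF Z order_refl t step.hyps(2-6)] mx step.hyps by auto
    have E: "sq_int M (E t)" by (rule simple_integral_sq_int[OF step.hyps(1) Z t])
    have E': "sq_int M (E' t)" by (rule simple_integral_sq_int[OF VE' Z' t])
    have p: "sq_int PM (up_to t ?p)"
      using F_measurableD[OF step.hyps(5)] step.hyps by (intro sq_int_up_to piece_sq_int[of _ K]) auto
    have v: "sq_int PM (up_to t V)" "sq_int PM (up_to t V')"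
      by (intro sq_int_up_to simple_integrand_sq_int[OF step.hyps(1)]
          sq_int_up_to simple_integrand_sq_int[OF VE'])+
    have "(\<integral>w. (E t w + ?P w) \<bullet> E' t w \<partial>M) = (\<integral>w. E t w \<bullet> E' t w \<partial>M) + (\<integral>w. ?P w \<bullet> E' t w \<partial>M)"
      unfolding inner_add_left
      by (rule Bochner_Integration.integral_add[OF sq_int_inner[OF E E'] sq_int_inner[OF P E']])
    also have "(\<integral>w. ?P w \<bullet> E' t w \<partial>M) = \<rho> * (\<integral>x. up_to t ?p x \<bullet> up_to t V' x \<partial>PM)"
      by (rule one[OF step.hyps(2-6)])
    also have "(\<integral>w. E t w \<bullet> E' t w \<partial>M) = \<rho> * (\<integral>x. up_to t V x \<bullet> up_to t V' x \<partial>PM)" by (rule step.IH)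
    finally show ?case
      unfolding up_to_add inner_add_left
      using Bochner_Integration.integral_add[OF sq_int_inner[OF v(1,2)] sq_int_inner[OF p v(2)]]
      by (simp add: distrib_left)
  qed
qed

end

section \<open>Density of elementary processes\<close>

lemma sq_add3_le: "(x + y + z)\<^sup>2 \<le> 3 * (x\<^sup>2 + y\<^sup>2 + z\<^sup>2)" for x y z :: real
proof -
  have "0 \<le> (x - y)\<^sup>2 + (x - z)\<^sup>2 + (y - z)\<^sup>2" by simp
  then show ?thesis by (simp add: power2_eq_square algebra_simps)
qed

lemma norm_sq_add_le:
  fixes a b :: "'b::real_normed_vector"
  shows "(norm (a + b))\<^sup>2 \<le> 2 * (norm a)\<^sup>2 + 2 * (norm b)\<^sup>2"
proof -
  have "(norm (a + b))\<^sup>2 \<le> (norm a + norm b)\<^sup>2" by (intro power_mono norm_triangle_ineq) auto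
  also have "\<dots> \<le> 2 * (norm a)\<^sup>2 + 2 * (norm b)\<^sup>2"
    using sum_squares_bound[of "norm a" "norm b"] by (simp add: power2_sum)
  finally show ?thesis .
qed

lemma norm_sq_add3_le:
  fixes a b c :: "'b::real_normed_vector"
  shows "(norm (a + b + c))\<^sup>2 \<le> 4 * (norm a)\<^sup>2 + 4 * (norm b)\<^sup>2 + 4 * (norm c)\<^sup>2"
  using norm_sq_add_le[of "a + b" c] norm_sq_add_le[of a b] zero_le_power2[of "norm c"] by linarith

text \<open>Radial truncation: it is continuous, so an approximating continuous function can be forced to
  respect the bound on the approximated one.\<close>

definition clip :: "real \<Rightarrow> 'b::euclidean_space \<Rightarrow> 'b" where
  "clip K x = (K / max K (norm x)) *\<^sub>R x"

lemma norm_clip: "0 < K \<Longrightarrow> norm (clip K x) \<le> K"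
  by (auto simp: clip_def field_simps max_def)

lemma clip_id: "0 < K \<Longrightarrow> norm x \<le> K \<Longrightarrow> clip K x = x"
  by (simp add: clip_def max_def)

lemma continuous_clip: "0 < K \<Longrightarrow> continuous_on UNIV (clip K)"
  unfolding clip_def by (intro continuous_intros) (auto simp: max_def)

lemma continuous_approx_bounded:
  fixes f :: "real \<Rightarrow> 'b::euclidean_space"
  assumes f: "f \<in> borel_measurable borel" "\<And>t. norm (f t) \<le> K" and K: "0 < K" and e: "0 < e"
  obtains g where "continuous_on UNIV g" "\<And>t. norm (g t) \<le> K"
    "(\<integral>\<^sup>+t\<in>{a..b}. ennreal ((norm (g t - f t))\<^sup>2) \<partial>lborel) < ennreal e"
proof -
  have "f \<in> borel_measurable lebesgue" using f(1) by (intro measurable_completion) simp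
  then have "f measurable_on UNIV" by (rule lebesgue_measurable_imp_measurable_on) auto
  then obtain N g where N: "negligible N" and g: "\<And>n. continuous_on UNIV (g n)"
    and lim: "\<And>x. x \<notin> N \<Longrightarrow> (\<lambda>n. g n x) \<longlonglongrightarrow> f x"
    unfolding measurable_on_def by auto
  define c where "c n = (\<lambda>x. clip K (g n x))" for n :: nat
  have c: "continuous_on UNIV (c n)" for n
    unfolding c_def by (rule continuous_on_compose2[OF continuous_clip[OF K] g]) auto
  have cl: "(\<lambda>n. c n x) \<longlonglongrightarrow> f x" if "x \<notin> N" for x
  proof -
    have "(\<lambda>n. clip K (g n x)) \<longlonglongrightarrow> clip K (f x)"
      by (rule continuous_on_tendsto_compose[OF continuous_clip[OF K] lim[OF that]]) auto
    then show ?thesis using clip_id[OF K f(2)] by (simp add: c_def)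
  qed
  have [measurable]: "f \<in> borel_measurable borel" "\<And>n. c n \<in> borel_measurable borel"
    using f c by (auto intro: borel_measurable_continuous_onI)
  have ae: "AE x in lborel. x \<notin> N"
  proof -
    have "AE x in lebesgue. x \<notin> N" using N by (simp add: AE_not_in negligible_iff_null_sets)
    then show ?thesis using AE_completion_iff[of "\<lambda>x. x \<notin> N" lborel] by simp
  qed
  have bd: "(norm (c n t - f t))\<^sup>2 \<le> (2 * K)\<^sup>2" for n t
    using norm_triangle_ineq4[of "c n t" "f t"] norm_clip[OF K, of "g n t"] f(2)[of t]
    by (intro power_mono) (auto simp: c_def)
  have "(\<lambda>n. \<integral>\<^sup>+t. ennreal ((norm (c n t - f t))\<^sup>2) * indicator {a..b} t \<partial>lborel) \<longlonglongrightarrow> (\<integral>\<^sup>+t. 0 \<partial>(lborel :: real measure))"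
  proof (rule nn_integral_dominated_convergence[where w="\<lambda>t. ennreal ((2*K)\<^sup>2) * indicator {a..b} t"])
    show "(\<integral>\<^sup>+t. ennreal ((2*K)\<^sup>2) * indicator {a..b} t \<partial>lborel) < \<infinity>"
      by (subst nn_integral_cmult_indicator) (auto simp: ennreal_mult_less_top emeasure_lborel_Icc_eq)
    show "AE t in lborel. ennreal ((norm (c n t - f t))\<^sup>2) * indicator {a..b} t \<le> ennreal ((2*K)\<^sup>2) * indicator {a..b} t" for n
      using bd[of n] by (intro AE_I2 mult_right_mono ennreal_leI) auto
    show "AE t in lborel. (\<lambda>n. ennreal ((norm (c n t - f t))\<^sup>2) * indicator {a..b} t) \<longlonglongrightarrow> 0"
      using ae
    proof eventually_elim
      case (elim t)
      have "(\<lambda>n. ennreal ((norm (c n t - f t))\<^sup>2)) \<longlonglongrightarrow> ennreal ((norm (f t - f t))\<^sup>2)"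
        by (intro tendsto_intros cl[OF elim])
      then have "(\<lambda>n. ennreal ((norm (c n t - f t))\<^sup>2)) \<longlonglongrightarrow> 0" by simp
      then show ?case by (auto simp: indicator_def)
    qed
  qed measurable
  then have "(\<lambda>n. \<integral>\<^sup>+t\<in>{a..b}. ennreal ((norm (c n t - f t))\<^sup>2) \<partial>lborel) \<longlonglongrightarrow> 0" by simp
  then have "eventually (\<lambda>n. (\<integral>\<^sup>+t\<in>{a..b}. ennreal ((norm (c n t - f t))\<^sup>2) \<partial>lborel) < ennreal e) sequentially"
    using e by (intro order_tendstoD(2)) auto
  then obtain n where "(\<integral>\<^sup>+t\<in>{a..b}. ennreal ((norm (c n t - f t))\<^sup>2) \<partial>lborel) < ennreal e"
    by (auto simp: eventually_sequentially)
  moreover have "norm (c n t) \<le> K" for t using norm_clip[OF K] by (simp add: c_def)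
  ultimately show ?thesis using that c by blast
qed

lemma nn_integral_shift:
  fixes f :: "real \<Rightarrow> ennreal"
  assumes [measurable]: "f \<in> borel_measurable borel"
  shows "(\<integral>\<^sup>+t. f (t + c) \<partial>lborel) = (\<integral>\<^sup>+t. f t \<partial>lborel)"
  using nn_integral_real_affine[of f 1 c] by (simp add: add.commute)

text \<open>For continuous functions this is dominated convergence; a bounded function on \<open>[0, T]\<close> is
  approximated by these in mean square.\<close>

lemma l2_translation_continuous:
  fixes f :: "real \<Rightarrow> 'b::euclidean_space"
  assumes f: "f \<in> borel_measurable borel" "\<And>t. norm (f t) \<le> K" "\<And>t. t \<notin> {0..T} \<Longrightarrow> f t = 0"
    and r: "r \<longlonglongrightarrow> 0" "\<And>n. 0 < r n" "\<And>n. r n \<le> 1"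
  shows "(\<lambda>n. \<integral>\<^sup>+s. ennreal ((norm (f (s + r n) - f s))\<^sup>2) \<partial>lborel) \<longlonglongrightarrow> 0"
proof (rule order_tendstoI)
  fix e :: ennreal assume "0 < e"
  obtain \<epsilon> where \<epsilon>: "0 < \<epsilon>" "ennreal (12 * \<epsilon>) \<le> e"
  proof (cases e)
    case (real x)
    with \<open>0 < e\<close> show ?thesis by (intro that[of "x / 12"]) (auto simp: ennreal_less_zero_iff)
  qed (auto intro: that[of 1])
  have K: "norm (f t) \<le> \<bar>K\<bar> + 1" for t using f(2)[of t] by linarith
  have K0: "0 < \<bar>K\<bar> + 1" by linarith
  obtain g where g: "continuous_on UNIV g" "\<And>t. norm (g t) \<le> \<bar>K\<bar> + 1"
    "(\<integral>\<^sup>+t\<in>{-1..T+1}. ennreal ((norm (g t - f t))\<^sup>2) \<partial>lborel) < ennreal \<epsilon>"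
    by (rule continuous_approx_bounded[OF f(1) K K0 \<epsilon>(1), of "-1" "T+1"]) (rule that)
  have [measurable]: "f \<in> borel_measurable borel" "g \<in> borel_measurable borel"
    using f(1) g(1) by (auto intro: borel_measurable_continuous_onI)
  have "(\<lambda>n. \<integral>\<^sup>+s. ennreal ((norm (g (s + r n) - g s))\<^sup>2) * indicator {-1..T} s \<partial>lborel) \<longlonglongrightarrow> (\<integral>\<^sup>+s. 0 \<partial>(lborel :: real measure))"
  proof (rule nn_integral_dominated_convergence[where w="\<lambda>t. ennreal ((2*(\<bar>K\<bar> + 1))\<^sup>2) * indicator {-1..T} t"])
    show "(\<integral>\<^sup>+t. ennreal ((2*(\<bar>K\<bar> + 1))\<^sup>2) * indicator {-1..T} t \<partial>lborel) < \<infinity>"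
      by (subst nn_integral_cmult_indicator) (auto simp: ennreal_mult_less_top emeasure_lborel_Icc_eq)
    have bd: "(norm (g (s + r n) - g s))\<^sup>2 \<le> (2*(\<bar>K\<bar> + 1))\<^sup>2" for n s
      using norm_triangle_ineq4[of "g (s + r n)" "g s"] g(2)[of s] g(2)[of "s + r n"] by (intro power_mono) auto
    show "AE t in lborel. ennreal ((norm (g (t + r n) - g t))\<^sup>2) * indicator {-1..T} t \<le> ennreal ((2*(\<bar>K\<bar> + 1))\<^sup>2) * indicator {-1..T} t" for n
      using bd[of _ n] by (intro AE_I2 mult_right_mono ennreal_leI) auto
    show "AE t in lborel. (\<lambda>n. ennreal ((norm (g (t + r n) - g t))\<^sup>2) * indicator {-1..T} t) \<longlonglongrightarrow> 0"
    proof (rule AE_I2)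
      fix t
      have "(\<lambda>n. t + r n) \<longlonglongrightarrow> t + 0" by (intro tendsto_intros r)
      then have "(\<lambda>n. g (t + r n)) \<longlonglongrightarrow> g (t + 0)"
        using g(1) by (intro continuous_on_tendsto_compose[OF g(1)]) auto
      then have "(\<lambda>n. ennreal ((norm (g (t + r n) - g t))\<^sup>2)) \<longlonglongrightarrow> ennreal ((norm (g (t + 0) - g t))\<^sup>2)"
        by (intro tendsto_intros)
      then have "(\<lambda>n. ennreal ((norm (g (t + r n) - g t))\<^sup>2)) \<longlonglongrightarrow> 0" by simp
      then show "(\<lambda>n. ennreal ((norm (g (t + r n) - g t))\<^sup>2) * indicator {-1..T} t) \<longlonglongrightarrow> 0" by (auto simp: indicator_def)
    qed
  qed measurable
  then have "eventually (\<lambda>n. (\<integral>\<^sup>+s. ennreal ((norm (g (s + r n) - g s))\<^sup>2) * indicator {-1..T} s \<partial>lborel) < ennreal \<epsilon>) sequentially"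
    using \<epsilon> by (intro order_tendstoD(2)[of _ 0]) auto
  then show "eventually (\<lambda>n. (\<integral>\<^sup>+s. ennreal ((norm (f (s + r n) - f s))\<^sup>2) \<partial>lborel) < e) sequentially"
  proof eventually_elim
    case (elim n)
    let ?A = "\<lambda>t. ennreal ((norm (g t - f t))\<^sup>2) * indicator {-1..T+1} t"
    let ?B = "\<lambda>s. ennreal ((norm (g (s + r n) - g s))\<^sup>2) * indicator {-1..T} s"
    have A: "(\<integral>\<^sup>+t. ?A t \<partial>lborel) < ennreal \<epsilon>" using g(3) .
    have "(\<integral>\<^sup>+s. ennreal ((norm (f (s + r n) - f s))\<^sup>2) \<partial>lborel)
       \<le> (\<integral>\<^sup>+s. 4 * ?A (s + r n) + (4 * ?B s + 4 * ?A s) \<partial>lborel)"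
    proof (rule nn_integral_mono)
      fix s
      show "ennreal ((norm (f (s + r n) - f s))\<^sup>2) \<le> 4 * ?A (s + r n) + (4 * ?B s + 4 * ?A s)"
      proof (cases "s \<in> {-1..T}")
        case True
        then have i: "s + r n \<in> {-1..T+1}" "s \<in> {-1..T+1}" using r(2,3)[of n] by auto
        have "(norm (f (s + r n) - f s))\<^sup>2 \<le> 4 * (norm (g (s + r n) - f (s + r n)))\<^sup>2
            + (4 * (norm (g (s + r n) - g s))\<^sup>2 + 4 * (norm (g s - f s))\<^sup>2)"
          using norm_sq_add3_le[of "f (s + r n) - g (s + r n)" "g (s + r n) - g s" "g s - f s"]
          by (simp add: norm_minus_commute algebra_simps)
        then have "ennreal ((norm (f (s + r n) - f s))\<^sup>2) \<le> ennreal (4 * (norm (g (s + r n) - f (s + r n)))\<^sup>2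
            + (4 * (norm (g (s + r n) - g s))\<^sup>2 + 4 * (norm (g s - f s))\<^sup>2))" by (rule ennreal_leI)
        also have "\<dots> = 4 * ?A (s + r n) + (4 * ?B s + 4 * ?A s)"
          using True i by (simp add: ennreal_plus ennreal_mult)
        finally show ?thesis .
      next
        case False
        then have "s \<notin> {0..T}" "s + r n \<notin> {0..T}" using r(2,3)[of n] by auto
        then show ?thesis using f(3) by simp
      qed
    qed
    also have "\<dots> = 4 * (\<integral>\<^sup>+s. ?A (s + r n) \<partial>lborel) + (4 * (\<integral>\<^sup>+s. ?B s \<partial>lborel) + 4 * (\<integral>\<^sup>+s. ?A s \<partial>lborel))"
      by (simp add: nn_integral_add nn_integral_cmult)
    also have "(\<integral>\<^sup>+s. ?A (s + r n) \<partial>lborel) = (\<integral>\<^sup>+s. ?A s \<partial>lborel)" by (rule nn_integral_shift) measurable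
    also have "4 * (\<integral>\<^sup>+s. ?A s \<partial>lborel) + (4 * (\<integral>\<^sup>+s. ?B s \<partial>lborel) + 4 * (\<integral>\<^sup>+s. ?A s \<partial>lborel))
        < 4 * ennreal \<epsilon> + (4 * ennreal \<epsilon> + 4 * ennreal \<epsilon>)"
      using A elim by (intro add_strict_mono ennreal_mult_strict_left_mono) auto
    also have "\<dots> = ennreal (12 * \<epsilon>)" using \<epsilon>(1)
      by (simp add: ennreal_mult[symmetric] ennreal_plus[symmetric] flip: ennreal_numeral del: ennreal_plus ennreal_numeral)
    finally show ?case using \<epsilon>(2) by simp
  qed
qed simp

lemma mono_grid_cell:
  fixes \<tau> :: "nat \<Rightarrow> real"
  assumes "\<And>i. i < n \<Longrightarrow> \<tau> i \<le> \<tau> (Suc i)"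
  shows "t \<in> {\<tau> 0<..\<tau> n} \<Longrightarrow> \<exists>j<n. t \<in> {\<tau> j<..\<tau> (Suc j)} \<and> (\<forall>i<n. i \<noteq> j \<longrightarrow> t \<notin> {\<tau> i<..\<tau> (Suc i)})"
    and "t \<notin> {\<tau> 0<..\<tau> n} \<Longrightarrow> \<forall>i<n. t \<notin> {\<tau> i<..\<tau> (Suc i)}"
proof -
  have mono: "\<tau> i \<le> \<tau> j" if "i \<le> j" "j \<le> n" for i j
    using that
  proof (induction j)
    case (Suc j)
    then show ?case using assms[of j] by (cases "i = Suc j") auto
  qed simp
  show "\<forall>i<n. t \<notin> {\<tau> i<..\<tau> (Suc i)}" if "t \<notin> {\<tau> 0<..\<tau> n}"
  proof (intro allI impI)
    fix i assume "i < n"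
    then have "\<tau> 0 \<le> \<tau> i" "\<tau> (Suc i) \<le> \<tau> n" by (auto intro: mono)
    then show "t \<notin> {\<tau> i<..\<tau> (Suc i)}" using that unfolding greaterThanAtMost_iff by linarith
  qed
  assume t: "t \<in> {\<tau> 0<..\<tau> n}"
  define j where "j = (LEAST j. t \<le> \<tau> j)"
  have j: "t \<le> \<tau> j" unfolding j_def by (rule LeastI[of "\<lambda>j. t \<le> \<tau> j" n]) (use t in simp)
  have jn: "j \<le> n" unfolding j_def by (rule Least_le) (use t in simp)
  have below: "\<tau> i < t" if "i < j" for i using not_less_Least[of i "\<lambda>j. t \<le> \<tau> j"] that by (auto simp: j_def)
  have "j \<noteq> 0" using j t by (intro notI) simp
  then obtain k where k: "j = Suc k" by (cases j) auto
  show "\<exists>j<n. t \<in> {\<tau> j<..\<tau> (Suc j)} \<and> (\<forall>i<n. i \<noteq> j \<longrightarrow> t \<notin> {\<tau> i<..\<tau> (Suc i)})"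
  proof (intro exI[of _ k] conjI allI impI)
    show "k < n" using jn k by simp
    show "t \<in> {\<tau> k<..\<tau> (Suc k)}" using j below[of k] k by auto
    fix i assume i: "i < n" "i \<noteq> k"
    show "t \<notin> {\<tau> i<..\<tau> (Suc i)}"
    proof (cases "i < k")
      case True
      then have "\<tau> (Suc i) < t" using below[of "Suc i"] k by simp
      then show ?thesis by auto
    next
      case False
      then have "\<tau> j \<le> \<tau> i" using i k by (intro mono) auto
      then show ?thesis using j by auto
    qed
  qed
qed

lemma nn_integral_Ioc_shift:
  fixes f :: "real \<Rightarrow> ennreal"
  assumes [measurable]: "f \<in> borel_measurable borel"
  shows "(\<integral>\<^sup>+t. indicator {c<..c+h} t * f t \<partial>lborel) = (\<integral>\<^sup>+r. indicator {0<..h} r * f (r + c) \<partial>lborel)"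
proof -
  have "(\<integral>\<^sup>+r. indicator {0<..h} r * f (r + c) \<partial>lborel) = (\<integral>\<^sup>+r. indicator {c<..c+h} (r + c) * f (r + c) \<partial>lborel)"
    by (intro nn_integral_cong) (auto simp: indicator_def)
  also have "\<dots> = (\<integral>\<^sup>+t. indicator {c<..c+h} t * f t \<partial>lborel)"
    by (rule nn_integral_shift) measurable
  finally show ?thesis ..
qed

text \<open>Averaged over the offset \<open>s\<close> in \<open>(0, h]\<close>, the sum over the grid points is an integral of \<open>\<phi>\<close> over a
  whole interval of times, divided by \<open>h\<close>. The integral over \<open>r\<close> contributes a factor \<open>h\<close>, so the average
  is at most \<open>e\<close>, and some offset stays below \<open>2 e\<close>.\<close>

lemma random_grid:
  fixes \<phi> :: "real \<Rightarrow> real \<Rightarrow> ennreal"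
  assumes \<phi>[measurable]: "(\<lambda>(s, r). \<phi> s r) \<in> borel_measurable (borel \<Otimes>\<^sub>M borel)"
    and h: "0 < h" and bd: "\<And>r. 0 < r \<Longrightarrow> r \<le> h \<Longrightarrow> (\<integral>\<^sup>+s. \<phi> s r \<partial>lborel) \<le> ennreal e" and e: "0 < e"
  obtains s where "0 < s" "s \<le> h"
    "(\<Sum>i<n. \<integral>\<^sup>+r. indicator {0<..h} r * \<phi> (s + real i * h) r \<partial>lborel) \<le> ennreal (2 * e)"
proof (rule ccontr)
  assume "\<not> thesis"
  then have neg: "ennreal (2 * e) \<le> (\<Sum>i<n. \<integral>\<^sup>+r. indicator {0<..h} r * \<phi> (s + real i * h) r \<partial>lborel)"
    if "0 < s" "s \<le> h" for s using that \<open>\<And>s. 0 < s \<Longrightarrow> s \<le> h \<Longrightarrow> _ \<le> _ \<Longrightarrow> thesis\<close> by (meson linear)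
  have [measurable]: "(\<lambda>(s, r). \<phi> s r) \<in> borel_measurable (lborel \<Otimes>\<^sub>M lborel)"
    using \<phi> by (simp add: measurable_cong_sets[OF sets_pair_measure_cong[OF sets_lborel sets_lborel] refl])
  have m1 [measurable]: "(\<lambda>s. \<phi> (s + c) r) \<in> borel_measurable borel" for c r
    using measurable_compose[of "\<lambda>s. (s + c, r)" borel, OF _ \<phi>] by simp
  have m2 [measurable]: "(\<lambda>r. \<phi> s r) \<in> borel_measurable borel" for s
    using measurable_compose[of "\<lambda>r. (s, r)" borel, OF _ \<phi>] by simp
  have m3 [measurable]: "(\<lambda>(s, r). indicator {0<..h} s * (indicator {0<..h} r * \<phi> (s + c) r)) \<in> borel_measurable (lborel \<Otimes>\<^sub>M lborel)" for c
  proof -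
    have "(\<lambda>(s, r). \<phi> (s + c) r) \<in> borel_measurable (borel \<Otimes>\<^sub>M borel)"
      using measurable_compose[of "\<lambda>(s, r). (s + c, r)" "borel \<Otimes>\<^sub>M borel", OF _ \<phi>] by (simp add: case_prod_beta')
    then have [measurable]: "(\<lambda>x. \<phi> (fst x + c) (snd x)) \<in> borel_measurable (lborel \<Otimes>\<^sub>M lborel)"
      by (simp add: case_prod_beta' measurable_cong_sets[OF sets_pair_measure_cong[OF sets_lborel sets_lborel] refl])
    show ?thesis unfolding case_prod_beta' by measurable
  qed
  have "ennreal (2 * e) * ennreal h = (\<integral>\<^sup>+s. ennreal (2 * e) * indicator {0<..h} s \<partial>lborel)"
    using h by (simp add: nn_integral_cmult_indicator)
  also have "\<dots> \<le> (\<integral>\<^sup>+s. (\<Sum>i<n. \<integral>\<^sup>+r. indicator {0<..h} s * (indicator {0<..h} r * \<phi> (s + real i * h) r) \<partial>lborel) \<partial>lborel)"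
  proof (rule nn_integral_mono)
    fix s :: real
    show "ennreal (2 * e) * indicator {0<..h} s \<le> (\<Sum>i<n. \<integral>\<^sup>+r. indicator {0<..h} s * (indicator {0<..h} r * \<phi> (s + real i * h) r) \<partial>lborel)"
      using neg[of s] by (auto simp: indicator_def)
  qed
  also have "\<dots> = (\<Sum>i<n. \<integral>\<^sup>+s. \<integral>\<^sup>+r. indicator {0<..h} s * (indicator {0<..h} r * \<phi> (s + real i * h) r) \<partial>lborel \<partial>lborel)"
  proof (rule nn_integral_sum)
    fix i
    show "(\<lambda>s. \<integral>\<^sup>+r. indicator {0<..h} s * (indicator {0<..h} r * \<phi> (s + real i * h) r) \<partial>lborel) \<in> borel_measurable lborel"
      by (rule lborel.borel_measurable_nn_integral) (rule m3)
  qed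
  also have "\<dots> = (\<Sum>i<n. \<integral>\<^sup>+r. \<integral>\<^sup>+s. indicator {0<..h} s * (indicator {0<..h} r * \<phi> (s + real i * h) r) \<partial>lborel \<partial>lborel)"
    by (intro sum.cong refl lborel_pair.Fubini'[symmetric] m3)
  also have "\<dots> = (\<Sum>i<n. \<integral>\<^sup>+r. indicator {0<..h} r * (\<integral>\<^sup>+s. indicator {real i * h<..real i * h + h} s * \<phi> s r \<partial>lborel) \<partial>lborel)"
  proof (intro sum.cong refl nn_integral_cong)
    fix i r
    have "(\<integral>\<^sup>+s. indicator {0<..h} s * (indicator {0<..h} r * \<phi> (s + real i * h) r) \<partial>lborel)
       = (\<integral>\<^sup>+s. indicator {0<..h} r * (indicator {0<..h} s * \<phi> (s + real i * h) r) \<partial>lborel)"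
      by (intro nn_integral_cong) (simp add: mult_ac)
    also have "\<dots> = indicator {0<..h} r * (\<integral>\<^sup>+s. indicator {0<..h} s * \<phi> (s + real i * h) r \<partial>lborel)"
      by (intro nn_integral_cmult) measurable
    also have "(\<integral>\<^sup>+s. indicator {0<..h} s * \<phi> (s + real i * h) r \<partial>lborel)
       = (\<integral>\<^sup>+s. indicator {real i * h<..real i * h + h} s * \<phi> s r \<partial>lborel)"
      using m1[of 0 r] by (intro nn_integral_Ioc_shift[symmetric]) simp
    finally show "(\<integral>\<^sup>+s. indicator {0<..h} s * (indicator {0<..h} r * \<phi> (s + real i * h) r) \<partial>lborel)
      = indicator {0<..h} r * (\<integral>\<^sup>+s. indicator {real i * h<..real i * h + h} s * \<phi> s r \<partial>lborel)" .
  qed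
  also have "\<dots> = (\<integral>\<^sup>+r. indicator {0<..h} r * (\<integral>\<^sup>+s. (\<Sum>i<n. indicator {real i * h<..real i * h + h} s * \<phi> s r) \<partial>lborel) \<partial>lborel)"
  proof -
    have m4: "(\<lambda>(r, s). indicator {real i * h<..real i * h + h} s * \<phi> s r) \<in> borel_measurable (lborel \<Otimes>\<^sub>M lborel)" for i
    proof -
      have "(\<lambda>(r, s). \<phi> s r) \<in> borel_measurable (borel \<Otimes>\<^sub>M borel)"
        using measurable_compose[of "\<lambda>(r, s). (s, r)" "borel \<Otimes>\<^sub>M borel", OF _ \<phi>] by (simp add: case_prod_beta')
      then have [measurable]: "(\<lambda>x. \<phi> (snd x) (fst x)) \<in> borel_measurable (lborel \<Otimes>\<^sub>M lborel)"
        by (simp add: case_prod_beta' measurable_cong_sets[OF sets_pair_measure_cong[OF sets_lborel sets_lborel] refl])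
      show ?thesis unfolding case_prod_beta' by measurable
    qed
    have [measurable]: "(\<lambda>r. \<integral>\<^sup>+s. indicator {real i * h<..real i * h + h} s * \<phi> s r \<partial>lborel) \<in> borel_measurable borel" for i
      using lborel.borel_measurable_nn_integral[OF m4[of i]] by simp
    have [measurable]: "(\<lambda>s. \<phi> s r) \<in> borel_measurable borel" for r using m1[of 0 r] by simp
    have "(\<integral>\<^sup>+r. indicator {0<..h} r * (\<integral>\<^sup>+s. (\<Sum>i<n. indicator {real i * h<..real i * h + h} s * \<phi> s r) \<partial>lborel) \<partial>lborel)
      = (\<integral>\<^sup>+r. (\<Sum>i<n. indicator {0<..h} r * (\<integral>\<^sup>+s. indicator {real i * h<..real i * h + h} s * \<phi> s r \<partial>lborel)) \<partial>lborel)"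
      by (intro nn_integral_cong) (subst nn_integral_sum, measurable, simp only: sum_distrib_left)
    also have "\<dots> = (\<Sum>i<n. \<integral>\<^sup>+r. indicator {0<..h} r * (\<integral>\<^sup>+s. indicator {real i * h<..real i * h + h} s * \<phi> s r \<partial>lborel) \<partial>lborel)"
      by (rule nn_integral_sum) measurable
    finally show ?thesis ..
  qed
  also have "\<dots> \<le> (\<integral>\<^sup>+r. ennreal e * indicator {0<..h} r \<partial>lborel)"
  proof (rule nn_integral_mono)
    fix r :: real
    have "(\<Sum>i<n. indicator {real i * h<..real i * h + h} s * \<phi> s r) \<le> \<phi> s r" for s
    proof -
      have eq: "{real i * h<..real i * h + h} = {real i * h<..real (Suc i) * h}" for i by (simp add: algebra_simps)
      have mono: "real i * h \<le> real (Suc i) * h" for i using h by (simp add: algebra_simps)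
      show ?thesis
      proof (cases "s \<in> {real 0 * h<..real n * h}")
        case True
        from mono_grid_cell(1)[of n "\<lambda>i. real i * h", OF mono True] obtain j where j: "j < n"
          "s \<in> {real j * h<..real (Suc j) * h}" "\<And>i. i < n \<Longrightarrow> i \<noteq> j \<Longrightarrow> s \<notin> {real i * h<..real (Suc i) * h}" by blast
        have "(\<Sum>i<n. indicator {real i * h<..real i * h + h} s * \<phi> s r) = (\<Sum>i\<in>{j}. indicator {real i * h<..real i * h + h} s * \<phi> s r)"
          unfolding eq using j by (intro sum.mono_neutral_right) auto
        also have "\<dots> = indicator {real j * h<..real j * h + h} s * \<phi> s r"
          by (simp only: sum.insert finite.emptyI empty_iff not_False_eq_True sum.empty add_0_right)
        also have "\<dots> \<le> \<phi> s r" by (auto simp: indicator_def)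
        finally show ?thesis .
      next
        case False
        from mono_grid_cell(2)[of n "\<lambda>i. real i * h", OF mono False]
        have "(\<Sum>i<n. indicator {real i * h<..real i * h + h} s * \<phi> s r) = 0"
          unfolding eq by (intro sum.neutral) auto
        then show ?thesis by (simp only: zero_le)
      qed
    qed
    then have "(\<integral>\<^sup>+s. (\<Sum>i<n. indicator {real i * h<..real i * h + h} s * \<phi> s r) \<partial>lborel) \<le> (\<integral>\<^sup>+s. \<phi> s r \<partial>lborel)"
      by (intro nn_integral_mono)
    then show "indicator {0<..h} r * (\<integral>\<^sup>+s. (\<Sum>i<n. indicator {real i * h<..real i * h + h} s * \<phi> s r) \<partial>lborel)
        \<le> ennreal e * indicator {0<..h} r"
      using bd[of r] by (auto simp: indicator_def)
  qed
  also have "\<dots> = ennreal e * ennreal h" using h by (simp add: nn_integral_cmult_indicator)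
  finally have "ennreal (2 * e * h) \<le> ennreal (e * h)" using e h by (simp add: ennreal_mult)
  then show False using e h by (simp add: ennreal_le_iff)
qed


context filtered_space
begin

lemma nn_integral_PM:
  assumes [measurable]: "f \<in> borel_measurable PM"
  shows "(\<integral>\<^sup>+x. f x \<partial>PM) = (\<integral>\<^sup>+w. (\<integral>\<^sup>+t\<in>{0..T}. f (t, w) \<partial>lborel) \<partial>M)"
proof -
  have "(\<integral>\<^sup>+w. (\<integral>\<^sup>+t\<in>{0..T}. f (t, w) \<partial>lborel) \<partial>M) = (\<integral>\<^sup>+w. (\<integral>\<^sup>+t. f (t, w) \<partial>leb T) \<partial>M)"
    by (simp add: nn_integral_restrict_space)
  also have "\<dots> = (\<integral>\<^sup>+x. f x \<partial>PM)" by (rule TM.nn_integral_snd) measurable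
  finally show ?thesis ..
qed

lemma PM_extend_measurable:
  fixes H :: "('a, 'b::euclidean_space) process"
  assumes H: "case_prod H \<in> borel_measurable PM"
  shows "(\<lambda>(t, w). if t \<in> {0..T} then H t w else 0) \<in> borel_measurable (borel \<Otimes>\<^sub>M M)"
proof -
  have c: "(\<lambda>t::real. max 0 (min T t)) \<in> borel \<rightarrow>\<^sub>M leb T"
    by (rule measurable_restrict_space2) (use T_pos in auto)
  have "(\<lambda>x. (max 0 (min T (fst x)), snd x)) \<in> (borel \<Otimes>\<^sub>M M) \<rightarrow>\<^sub>M PM"
    by (rule measurable_Pair[OF measurable_compose[OF measurable_fst c] measurable_snd])
  from measurable_compose[OF this H]
  have [measurable]: "(\<lambda>x. H (max 0 (min T (fst x))) (snd x)) \<in> borel_measurable (borel \<Otimes>\<^sub>M M)" by simp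
  have "(\<lambda>x. indicator {0..T} (fst x) *\<^sub>R H (max 0 (min T (fst x))) (snd x)) \<in> borel_measurable (borel \<Otimes>\<^sub>M M)"
    by measurable
  also have "(\<lambda>x. indicator {0..T} (fst x) *\<^sub>R H (max 0 (min T (fst x))) (snd x)) = (\<lambda>(t, w). if t \<in> {0..T} then H t w else 0)"
    by (auto simp: fun_eq_iff indicator_def max_def min_def)
  finally show ?thesis .
qed

lemma elementary_val_measurable:
  assumes "elementary_process M T F m \<tau> \<xi>"
  shows "sq_int PM (case_prod (elementary_val m \<tau> \<xi>))"
  by (rule simple_integrand_sq_int[OF elementary_simple_integral[OF assms]])

text \<open>The approximation samples \<open>H\<close> at the points of a grid and keeps each value until the next point, so
  it is adapted because \<open>H\<close> is. As \<open>H\<close> is merely measurable in time, a given grid may be unsuitable;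
  but the error averaged over the offset of the grid is controlled by the translates of \<open>H\<close>,
  which converge in mean square. Averaging \<open>H\<close> over short time intervals instead would need
  progressive measurability to be adapted.\<close>

lemma elementary_dense_bounded:
  assumes ad: "adapted T F H" and Hm: "case_prod H \<in> borel_measurable PM"
    and K: "\<And>t w. t \<in> {0..T} \<Longrightarrow> w \<in> space M \<Longrightarrow> norm (H t w) \<le> K" and K0: "0 < K" and e: "0 < e"
  obtains m \<tau> \<xi> where "elementary_process M T F m \<tau> \<xi>"
    "(\<integral>\<^sup>+x. ennreal ((norm (case_prod (elementary_val m \<tau> \<xi>) x - case_prod H x))\<^sup>2) \<partial>PM) \<le> ennreal e"
proof -
  \<comment> \<open>extended by zero, so that all translates are defined\<close>
  define G where "G t w = (if t \<in> {0..T} then H t w else 0)" for t w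
  have Gm: "(\<lambda>x. G (fst x) (snd x)) \<in> borel_measurable (borel \<Otimes>\<^sub>M M)"
    using PM_extend_measurable[OF Hm] by (simp add: G_def case_prod_beta')
  have GK: "norm (G t w) \<le> K" if "w \<in> space M" for t w using K[OF _ that] K0 by (auto simp: G_def)
  have Gs [measurable]: "(\<lambda>t. G t w) \<in> borel_measurable borel" if "w \<in> space M" for w
    using measurable_compose[OF _ Gm, of "\<lambda>t. (t, w)" borel] that by simp
  have Gt [measurable]: "G t \<in> borel_measurable M" for t
    using measurable_compose[OF _ Gm, of "\<lambda>w. (t, w)" M] by simp
  define d where "d s r w = ennreal ((norm (G (s + r) w - G s w))\<^sup>2)" for s r w
  have dm: "(\<lambda>x. d (fst (fst x)) (snd (fst x)) (snd x)) \<in> borel_measurable ((borel \<Otimes>\<^sub>M borel) \<Otimes>\<^sub>M M)"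
  proof -
    have [measurable]: "(\<lambda>x. G (fst (fst x) + snd (fst x)) (snd x)) \<in> borel_measurable ((borel \<Otimes>\<^sub>M borel) \<Otimes>\<^sub>M M)"
      using measurable_compose[OF _ Gm, of "\<lambda>x. (fst (fst x) + snd (fst x), snd x)" "(borel \<Otimes>\<^sub>M borel) \<Otimes>\<^sub>M M"] by simp
    have [measurable]: "(\<lambda>x. G (fst (fst x)) (snd x)) \<in> borel_measurable ((borel \<Otimes>\<^sub>M (borel::real measure)) \<Otimes>\<^sub>M M)"
      using measurable_compose[OF _ Gm, of "\<lambda>x. (fst (fst x), snd x)" "(borel \<Otimes>\<^sub>M (borel::real measure)) \<Otimes>\<^sub>M M"] by simp
    show ?thesis unfolding d_def by measurable
  qed
  define \<phi> where "\<phi> s r = (\<integral>\<^sup>+w. d s r w \<partial>M)" for s r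
  have \<phi>m: "(\<lambda>(s, r). \<phi> s r) \<in> borel_measurable (borel \<Otimes>\<^sub>M borel)"
    unfolding \<phi>_def case_prod_beta'
    by (rule borel_measurable_nn_integral) (use dm in \<open>simp add: case_prod_beta'\<close>)
  have dsm: "(\<lambda>x. d (fst x) r (snd x)) \<in> borel_measurable (lborel \<Otimes>\<^sub>M M)" for r
  proof -
    have "(\<lambda>x. d (fst x) r (snd x)) \<in> borel_measurable (borel \<Otimes>\<^sub>M M)"
      using measurable_compose[OF _ dm, of "\<lambda>x. ((fst x, r), snd x)" "borel \<Otimes>\<^sub>M M"] by simp
    then show ?thesis by (simp add: measurable_cong_sets[OF sets_pair_measure_cong[OF sets_lborel refl] refl])
  qed
  have drm: "(\<lambda>x. d s (fst x) (snd x)) \<in> borel_measurable (lborel \<Otimes>\<^sub>M M)" for s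
  proof -
    have "(\<lambda>x. d s (fst x) (snd x)) \<in> borel_measurable (borel \<Otimes>\<^sub>M M)"
      using measurable_compose[OF _ dm, of "\<lambda>x. ((s, fst x), snd x)" "borel \<Otimes>\<^sub>M M"] by simp
    then show ?thesis by (simp add: measurable_cong_sets[OF sets_pair_measure_cong[OF sets_lborel refl] refl])
  qed
  interpret LM: pair_sigma_finite lborel M ..
  have int\<phi>: "(\<integral>\<^sup>+s. \<phi> s r \<partial>lborel) = (\<integral>\<^sup>+w. \<integral>\<^sup>+s. d s r w \<partial>lborel \<partial>M)" for r
    unfolding \<phi>_def
    by (rule LM.Fubini'[symmetric]) (use dsm in \<open>simp add: case_prod_beta'\<close>)
  have measw: "(\<lambda>w. \<integral>\<^sup>+s. d s r w \<partial>lborel) \<in> borel_measurable M" for r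
    using measurable_compose[OF _ dsm[of r], of "\<lambda>x. (snd x, fst x)" "M \<Otimes>\<^sub>M lborel"]
    by (intro lborel.borel_measurable_nn_integral) (simp add: case_prod_beta')
  have conv: "(\<lambda>n. \<integral>\<^sup>+s. \<phi> s (r n) \<partial>lborel) \<longlonglongrightarrow> 0"
    if r: "r \<longlonglongrightarrow> 0" "\<And>n. 0 < r n" "\<And>n. r n \<le> 1" for r :: "nat \<Rightarrow> real"
  proof -
    have "(\<lambda>n. \<integral>\<^sup>+w. \<integral>\<^sup>+s. d s (r n) w \<partial>lborel \<partial>M) \<longlonglongrightarrow> (\<integral>\<^sup>+w. 0 \<partial>M)"
    proof (rule nn_integral_dominated_convergence[where w="\<lambda>_. ennreal ((2 * K)\<^sup>2) * ennreal (T + 1)"])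
      show "(\<integral>\<^sup>+w. ennreal ((2 * K)\<^sup>2) * ennreal (T + 1) \<partial>M) < \<infinity>"
        by (simp add: emeasure_space_1 ennreal_mult_less_top)
      show "AE w in M. (\<lambda>n. \<integral>\<^sup>+s. d s (r n) w \<partial>lborel) \<longlonglongrightarrow> 0"
        unfolding d_def
        by (intro AE_I2 l2_translation_continuous[where K=K and T=T] r Gs) (auto simp: GK, auto simp: G_def)
      show "AE w in M. (\<integral>\<^sup>+s. d s (r n) w \<partial>lborel) \<le> ennreal ((2 * K)\<^sup>2) * ennreal (T + 1)" for n
      proof (rule AE_I2)
        fix w assume w: "w \<in> space M"
        have "(\<integral>\<^sup>+s. d s (r n) w \<partial>lborel) \<le> (\<integral>\<^sup>+s. ennreal ((2 * K)\<^sup>2) * indicator {-1..T} s \<partial>lborel)"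
        proof (rule nn_integral_mono)
          fix s
          show "d s (r n) w \<le> ennreal ((2 * K)\<^sup>2) * indicator {-1..T} s"
          proof (cases "s \<in> {-1..T}")
            case True
            have "norm (G (s + r n) w - G s w) \<le> 2 * K"
              using norm_triangle_ineq4[of "G (s + r n) w" "G s w"] GK[OF w, of s] GK[OF w, of "s + r n"] by linarith
            then have "(norm (G (s + r n) w - G s w))\<^sup>2 \<le> (2 * K)\<^sup>2" by (intro power_mono) auto
            then show ?thesis using True by (simp add: d_def ennreal_leI)
          next
            case False
            then have "s \<notin> {0..T}" "s + r n \<notin> {0..T}" using r(2,3)[of n] by auto
            then have "G s w = 0" "G (s + r n) w = 0" unfolding G_def by (simp_all only: if_False)
            then show ?thesis by (simp add: d_def)
          qed
        qed
        also have "\<dots> = ennreal ((2 * K)\<^sup>2) * ennreal (T + 1)"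
          using T_pos by (subst nn_integral_cmult_indicator) auto
        finally show "(\<integral>\<^sup>+s. d s (r n) w \<partial>lborel) \<le> ennreal ((2 * K)\<^sup>2) * ennreal (T + 1)" .
      qed
    qed (use measw in auto)
    then show ?thesis by (simp add: int\<phi>)
  qed
  have "\<exists>h0>0. \<forall>r. 0 < r \<longrightarrow> r \<le> h0 \<longrightarrow> (\<integral>\<^sup>+s. \<phi> s r \<partial>lborel) \<le> ennreal (e / 4)"
  proof (rule ccontr)
    assume "\<not> ?thesis"
    then have "\<exists>r. 0 < r \<and> r \<le> h \<and> \<not> (\<integral>\<^sup>+s. \<phi> s r \<partial>lborel) \<le> ennreal (e / 4)" if "0 < h" for h
      using that by blast
    then have "\<forall>n::nat. \<exists>r. 0 < r \<and> r \<le> 1 / real (Suc n) \<and> \<not> (\<integral>\<^sup>+s. \<phi> s r \<partial>lborel) \<le> ennreal (e / 4)" by simp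
    then obtain r where r: "\<And>n. 0 < r n" "\<And>n. r n \<le> 1 / real (Suc n)" "\<And>n. \<not> (\<integral>\<^sup>+s. \<phi> s (r n) \<partial>lborel) \<le> ennreal (e / 4)"
      by metis
    have "r \<longlonglongrightarrow> 0"
      by (rule tendsto_sandwich[OF _ _ tendsto_const LIMSEQ_Suc[OF lim_1_over_n]])
         (use r in \<open>auto intro!: always_eventually less_imp_le\<close>)
    moreover have "r n \<le> 1" for n using r(2)[of n] by (rule order_trans) simp
    ultimately have "(\<lambda>n. \<integral>\<^sup>+s. \<phi> s (r n) \<partial>lborel) \<longlonglongrightarrow> 0" using r(1) by (intro conv)
    then have "eventually (\<lambda>n. (\<integral>\<^sup>+s. \<phi> s (r n) \<partial>lborel) < ennreal (e / 4)) sequentially"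
      using e by (intro order_tendstoD(2)[of _ 0]) auto
    then show False using r(3) by (auto simp: eventually_sequentially dest: less_imp_le)
  qed
  then obtain h0 where h0: "0 < h0" "\<And>r. 0 < r \<Longrightarrow> r \<le> h0 \<Longrightarrow> (\<integral>\<^sup>+s. \<phi> s r \<partial>lborel) \<le> ennreal (e / 4)"
    by blast
  \<comment> \<open>the mesh is at most \<open>h0\<close>, and the initial piece before the first grid point costs at most \<open>e / 2\<close>\<close>
  obtain n :: nat where n: "T / h0 + 2 * K\<^sup>2 * T / e + 1 < real n" using reals_Archimedean2 by blast
  have pos: "0 \<le> T / h0" "0 \<le> 2 * K\<^sup>2 * T / e" using T_pos h0 e by auto
  have n0: "0 < real n" using n pos by linarith
  define h where "h = T / real n"
  have hT: "real n * h = T" using n0 by (simp add: h_def)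
  have h: "0 < h" using n0 T_pos by (simp add: h_def)
  have "T / h0 < real n" using n pos by linarith
  then have hh0: "h \<le> h0" using n0 h0 by (simp add: h_def field_simps)
  have "2 * K\<^sup>2 * T / e < real n" using n pos by linarith
  then have hK: "K\<^sup>2 * h \<le> e / 2" using n0 e by (simp add: h_def field_simps)
  obtain s where s: "0 < s" "s \<le> h"
    "(\<Sum>i<n. \<integral>\<^sup>+r. indicator {0<..h} r * \<phi> (s + real i * h) r \<partial>lborel) \<le> ennreal (2 * (e / 4))"
    by (rule random_grid[OF \<phi>m h, of "e / 4" n]) (use h0(2) hh0 e in \<open>auto intro: that\<close>)
  define \<tau> where "\<tau> i = min T (s + real i * h)" for i
  define \<xi> where "\<xi> i = H (\<tau> i)" for i :: nat
  have \<tau>i: "\<tau> i = s + real i * h" if "i < n" for i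
  proof -
    have "real (Suc i) \<le> real n" using that by simp
    then have "real (Suc i) * h \<le> real n * h" using h by (intro mult_right_mono) auto
    then show ?thesis using s hT by (simp add: \<tau>_def algebra_simps)
  qed
  have \<tau>n: "\<tau> n = T" using hT s by (simp add: \<tau>_def)
  have \<tau>0: "\<tau> 0 = s" using \<tau>i[of 0] n0 by simp
  have \<tau>r: "\<tau> i \<in> {0..T}" for i using T_pos s h by (auto simp: \<tau>_def)
  have \<tau>mono: "\<tau> i \<le> \<tau> (Suc i)" for i using h by (auto simp: \<tau>_def algebra_simps)
  have el: "elementary_process M T F n \<tau> \<xi>"
    unfolding elementary_process_def
  proof (intro conjI allI impI)
    show "\<xi> i \<in> borel_measurable (F (\<tau> i))" for i using ad \<tau>r by (simp add: \<xi>_def adapted_def)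
    show "\<exists>K. \<forall>w\<in>space M. norm (\<xi> i w) \<le> K" for i using K[OF \<tau>r] by (auto simp: \<xi>_def)
  qed (use \<tau>0 \<tau>n s \<tau>mono in auto)
  have pw: "ennreal ((norm (elementary_val n \<tau> \<xi> t w - H t w))\<^sup>2)
      \<le> ennreal (K\<^sup>2) * indicator {0..h} t + (\<Sum>i<n. indicator {s + real i * h<..s + real i * h + h} t * d (s + real i * h) (t - (s + real i * h)) w)"
    if t: "t \<in> {0..T}" and w: "w \<in> space M" for t w
  proof (cases "t \<in> {\<tau> 0<..\<tau> n}")
    case True
    from mono_grid_cell(1)[of n \<tau>, OF \<tau>mono True] obtain j where j: "j < n"
      "t \<in> {\<tau> j<..\<tau> (Suc j)}" "\<And>i. i < n \<Longrightarrow> i \<noteq> j \<Longrightarrow> t \<notin> {\<tau> i<..\<tau> (Suc i)}" by blast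
    have "elementary_val n \<tau> \<xi> t w = (\<Sum>i\<in>{j}. indicator {\<tau> i<..\<tau> (Suc i)} t *\<^sub>R \<xi> i w)"
      unfolding elementary_val_def using j by (intro sum.mono_neutral_right) auto
    also have "\<dots> = indicator {\<tau> j<..\<tau> (Suc j)} t *\<^sub>R \<xi> j w"
      by (simp only: sum.insert finite.emptyI empty_iff not_False_eq_True sum.empty add_0_right)
    finally have v: "elementary_val n \<tau> \<xi> t w = H (\<tau> j) w" using j(2) by (simp add: \<xi>_def)
    have tj: "t \<in> {s + real j * h<..s + real j * h + h}"
      using j(2) \<tau>i[OF j(1)] by (auto simp: \<tau>_def algebra_simps)
    have "ennreal ((norm (elementary_val n \<tau> \<xi> t w - H t w))\<^sup>2)
      = indicator {s + real j * h<..s + real j * h + h} t * d (s + real j * h) (t - (s + real j * h)) w"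
      unfolding v d_def using tj t \<tau>r[of j] \<tau>i[OF j(1)] by (simp add: G_def norm_minus_commute)
    also have "\<dots> \<le> (\<Sum>i<n. indicator {s + real i * h<..s + real i * h + h} t * d (s + real i * h) (t - (s + real i * h)) w)"
      using j(1) by (intro member_le_sum) auto
    also have "\<dots> \<le> ennreal (K\<^sup>2) * indicator {0..h} t + \<dots>" by (rule add_increasing) auto
    finally show ?thesis .
  next
    case False
    have "elementary_val n \<tau> \<xi> t w = 0"
      unfolding elementary_val_def using mono_grid_cell(2)[of n \<tau>, OF \<tau>mono False] by (intro sum.neutral) auto
    moreover have "t \<in> {0..h}" using False t \<tau>0 \<tau>n s by auto
    moreover have "(norm (H t w))\<^sup>2 \<le> K\<^sup>2" using K[OF t w] by (intro power_mono) auto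
    ultimately show ?thesis by (intro add_increasing2) (auto simp: ennreal_leI sum_nonneg)
  qed
  have evm: "case_prod (elementary_val n \<tau> \<xi>) \<in> borel_measurable PM"
    using elementary_val_measurable[OF el] by (rule sq_int_measurable)
  have dc: "d c (t - c) w = ennreal ((norm (G t w - G c w))\<^sup>2)" for c t w by (simp add: d_def)
  have "(\<integral>\<^sup>+x. ennreal ((norm (case_prod (elementary_val n \<tau> \<xi>) x - case_prod H x))\<^sup>2) \<partial>PM)
    = (\<integral>\<^sup>+w. (\<integral>\<^sup>+t\<in>{0..T}. ennreal ((norm (elementary_val n \<tau> \<xi> t w - H t w))\<^sup>2) \<partial>lborel) \<partial>M)"
    using evm Hm by (subst nn_integral_PM) auto
  also have "\<dots> \<le> (\<integral>\<^sup>+w. ennreal (K\<^sup>2 * h) + (\<Sum>i<n. \<integral>\<^sup>+r. indicator {0<..h} r * d (s + real i * h) r w \<partial>lborel) \<partial>M)"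
  proof (rule nn_integral_mono)
    fix w assume w: "w \<in> space M"
    note [measurable] = Gs[OF w]
    have "(\<integral>\<^sup>+t\<in>{0..T}. ennreal ((norm (elementary_val n \<tau> \<xi> t w - H t w))\<^sup>2) \<partial>lborel)
      \<le> (\<integral>\<^sup>+t. ennreal (K\<^sup>2) * indicator {0..h} t + (\<Sum>i<n. indicator {s + real i * h<..s + real i * h + h} t * d (s + real i * h) (t - (s + real i * h)) w) \<partial>lborel)"
      using pw[OF _ w] by (intro nn_integral_mono) (auto simp: indicator_def)
    also have "\<dots> = (\<integral>\<^sup>+t. ennreal (K\<^sup>2) * indicator {0..h} t \<partial>lborel) + (\<Sum>i<n. \<integral>\<^sup>+t. indicator {s + real i * h<..s + real i * h + h} t * d (s + real i * h) (t - (s + real i * h)) w \<partial>lborel)"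
      unfolding dc by (subst nn_integral_add; (measurable)?) (subst nn_integral_sum; (measurable)?; rule refl)
    also have "(\<integral>\<^sup>+t. ennreal (K\<^sup>2) * indicator {0..h} t \<partial>lborel) = ennreal (K\<^sup>2 * h)"
      using h by (simp add: nn_integral_cmult_indicator ennreal_mult)
    also have "(\<Sum>i<n. \<integral>\<^sup>+t. indicator {s + real i * h<..s + real i * h + h} t * d (s + real i * h) (t - (s + real i * h)) w \<partial>lborel)
      = (\<Sum>i<n. \<integral>\<^sup>+r. indicator {0<..h} r * d (s + real i * h) r w \<partial>lborel)"
    proof (intro sum.cong refl)
      fix i
      have dm': "(\<lambda>t. d (s + real i * h) (t - (s + real i * h)) w) \<in> borel_measurable borel"
        unfolding dc by measurable
      show "(\<integral>\<^sup>+t. indicator {s + real i * h<..s + real i * h + h} t * d (s + real i * h) (t - (s + real i * h)) w \<partial>lborel)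
        = (\<integral>\<^sup>+r. indicator {0<..h} r * d (s + real i * h) r w \<partial>lborel)"
        using nn_integral_Ioc_shift[OF dm', of "s + real i * h" h] by simp
    qed
    finally show "(\<integral>\<^sup>+t\<in>{0..T}. ennreal ((norm (elementary_val n \<tau> \<xi> t w - H t w))\<^sup>2) \<partial>lborel)
      \<le> ennreal (K\<^sup>2 * h) + (\<Sum>i<n. \<integral>\<^sup>+r. indicator {0<..h} r * d (s + real i * h) r w \<partial>lborel)" .
  qed
  also have "\<dots> = ennreal (K\<^sup>2 * h) + (\<Sum>i<n. \<integral>\<^sup>+w. \<integral>\<^sup>+r. indicator {0<..h} r * d (s + real i * h) r w \<partial>lborel \<partial>M)"
  proof -
    have m: "(\<lambda>x. indicator {0<..h} (fst x) * d c (fst x) (snd x)) \<in> borel_measurable (lborel \<Otimes>\<^sub>M M)" for c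
      using drm[of c] by measurable
    have [measurable]: "(\<lambda>w. \<integral>\<^sup>+r. indicator {0<..h} r * d c r w \<partial>lborel) \<in> borel_measurable M" for c
      using measurable_compose[OF _ m[of c], of "\<lambda>x. (snd x, fst x)" "M \<Otimes>\<^sub>M lborel"]
      by (intro lborel.borel_measurable_nn_integral) (simp add: case_prod_beta')
    show ?thesis by (simp add: nn_integral_add nn_integral_sum emeasure_space_1)
  qed
  also have "(\<Sum>i<n. \<integral>\<^sup>+w. \<integral>\<^sup>+r. indicator {0<..h} r * d (s + real i * h) r w \<partial>lborel \<partial>M)
      = (\<Sum>i<n. \<integral>\<^sup>+r. indicator {0<..h} r * \<phi> (s + real i * h) r \<partial>lborel)"
  proof (intro sum.cong refl)
    fix i
    let ?c = "s + real i * h"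
    have m: "(\<lambda>x. indicator {0<..h} (fst x) * d ?c (fst x) (snd x)) \<in> borel_measurable (lborel \<Otimes>\<^sub>M M)"
      using drm[of ?c] by measurable
    have [measurable]: "(\<lambda>w. d ?c r w) \<in> borel_measurable M" for r
      unfolding d_def by measurable
    have "(\<integral>\<^sup>+w. \<integral>\<^sup>+r. indicator {0<..h} r * d ?c r w \<partial>lborel \<partial>M) = (\<integral>\<^sup>+r. \<integral>\<^sup>+w. indicator {0<..h} r * d ?c r w \<partial>M \<partial>lborel)"
      by (rule LM.Fubini') (use m in \<open>simp add: case_prod_beta'\<close>)
    also have "\<dots> = (\<integral>\<^sup>+r. indicator {0<..h} r * \<phi> ?c r \<partial>lborel)"
      unfolding \<phi>_def by (intro nn_integral_cong nn_integral_cmult) measurable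
    finally show "(\<integral>\<^sup>+w. \<integral>\<^sup>+r. indicator {0<..h} r * d ?c r w \<partial>lborel \<partial>M) = (\<integral>\<^sup>+r. indicator {0<..h} r * \<phi> ?c r \<partial>lborel)" .
  qed
  also have "ennreal (K\<^sup>2 * h) + (\<Sum>i<n. \<integral>\<^sup>+r. indicator {0<..h} r * \<phi> (s + real i * h) r \<partial>lborel)
     \<le> ennreal (e / 2) + ennreal (2 * (e / 4))"
    using hK s(3) by (intro add_mono ennreal_leI)
  also have "\<dots> = ennreal e" using e by (simp flip: ennreal_plus)
  finally show ?thesis using that[OF el] by blast
qed

text \<open>Truncation reduces this to bounded processes.\<close>

theorem elementary_dense:
  assumes ad: "adapted T F H" and H: "sq_int PM (case_prod H)" and e: "0 < e"
  obtains m \<tau> \<xi> where "elementary_process M T F m \<tau> \<xi>"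
    "l2norm PM (\<lambda>x. case_prod (elementary_val m \<tau> \<xi>) x - case_prod H x) \<le> e"
proof -
  have [measurable]: "case_prod H \<in> borel_measurable PM" using H by (rule sq_int_measurable)
  define HN where "HN N t w = (if norm (H t w) \<le> real N then H t w else 0)" for N t w
  have HNm: "case_prod (HN N) \<in> borel_measurable PM" for N
  proof -
    have "(\<lambda>x. if norm (case_prod H x) \<le> real N then case_prod H x else 0) \<in> borel_measurable PM" by measurable
    then show ?thesis by (simp add: HN_def case_prod_beta')
  qed
  have HN: "sq_int PM (case_prod (HN N))" for N
    by (rule sq_int_bound[OF H HNm, where c=1]) (auto simp: HN_def)
  have "(\<lambda>N. \<integral>x. (norm (case_prod (HN N) x - case_prod H x))\<^sup>2 \<partial>PM) \<longlonglongrightarrow> (\<integral>x. 0 \<partial>PM)"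
  proof (rule integral_dominated_convergence[where w="\<lambda>x. (norm (case_prod H x))\<^sup>2"])
    show "AE x in PM. (\<lambda>N. (norm (case_prod (HN N) x - case_prod H x))\<^sup>2) \<longlonglongrightarrow> 0"
    proof (rule AE_I2)
      fix x
      obtain N0 :: nat where "norm (case_prod H x) \<le> real N0" using real_arch_simple by blast
      then have "(norm (case_prod (HN N) x - case_prod H x))\<^sup>2 = 0" if "N0 \<le> N" for N
        using that by (auto simp: HN_def case_prod_beta')
      then show "(\<lambda>N. (norm (case_prod (HN N) x - case_prod H x))\<^sup>2) \<longlonglongrightarrow> 0"
        by (intro tendsto_eventually) (auto simp: eventually_sequentially)
    qed
  qed (use HNm sq_intD[OF H] in \<open>auto simp: HN_def case_prod_beta'\<close>)
  then have "(\<lambda>N. l2norm PM (\<lambda>x. case_prod (HN N) x - case_prod H x)) \<longlonglongrightarrow> 0"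
    unfolding l2norm_def using tendsto_real_sqrt by fastforce
  then have "eventually (\<lambda>N. l2norm PM (\<lambda>x. case_prod (HN N) x - case_prod H x) < e / 2) sequentially"
    using e by (intro order_tendstoD(2)[of _ 0]) auto
  then obtain N where N: "l2norm PM (\<lambda>x. case_prod (HN N) x - case_prod H x) < e / 2"
    by (auto simp: eventually_sequentially)
  have adN: "adapted T F (HN N)"
    unfolding adapted_def
  proof
    fix t assume "t \<in> {0..T}"
    then have [measurable]: "H t \<in> borel_measurable (F t)" using ad by (simp add: adapted_def)
    show "HN N t \<in> borel_measurable (F t)" unfolding HN_def by measurable
  qed
  have bd: "norm (HN N t w) \<le> real N + 1" for t w by (auto simp: HN_def)
  have e4: "0 < (e / 2)\<^sup>2" using e by simp
  have N1: "0 < real N + 1" by simp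
  obtain m \<tau> \<xi> where el: "elementary_process M T F m \<tau> \<xi>"
    and le: "(\<integral>\<^sup>+x. ennreal ((norm (case_prod (elementary_val m \<tau> \<xi>) x - case_prod (HN N) x))\<^sup>2) \<partial>PM) \<le> ennreal ((e / 2)\<^sup>2)"
    by (rule elementary_dense_bounded[OF adN HNm bd N1 e4])
  have ev: "sq_int PM (case_prod (elementary_val m \<tau> \<xi>))" by (rule elementary_val_measurable[OF el])
  have "l2norm PM (\<lambda>x. case_prod (elementary_val m \<tau> \<xi>) x - case_prod (HN N) x) \<le> e / 2"
    using l2norm_le_if_nn_integral_le[OF le] e ev HNm by auto
  moreover have "l2norm PM (\<lambda>x. case_prod (elementary_val m \<tau> \<xi>) x - case_prod H x)
     \<le> l2norm PM (\<lambda>x. case_prod (elementary_val m \<tau> \<xi>) x - case_prod (HN N) x) + l2norm PM (\<lambda>x. case_prod (HN N) x - case_prod H x)"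
    by (rule l2norm_triangle3[OF ev HN H])
  ultimately have "l2norm PM (\<lambda>x. case_prod (elementary_val m \<tau> \<xi>) x - case_prod H x) \<le> e" using N by linarith
  with el show ?thesis by (rule that)
qed

end

section \<open>The stochastic integral\<close>

lemma ennreal_convergence_squeeze:
  fixes f :: "nat \<Rightarrow> ennreal"
  assumes "\<And>n. f n \<le> ennreal (g n)" "g \<longlonglongrightarrow> 0"
  shows "f \<longlonglongrightarrow> 0"
proof (rule tendsto_sandwich[OF always_eventually always_eventually])
  show "\<forall>n. 0 \<le> f n" "\<forall>n. f n \<le> ennreal (g n)" using assms by auto
  show "(\<lambda>n. ennreal (g n)) \<longlonglongrightarrow> 0" using tendsto_ennrealI[OF assms(2)] by simp
qed simp

context filtered_space
begin

text \<open>The random variable \<open>B\<close> is the sum of the squared maximal differences with weights \<open>4 ^ n\<close>.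
  It has finite mean, and where it is finite the paths converge uniformly at a geometric
  rate. Elsewhere the limit is set to zero; the filtration contains the null sets, so it remains
  adapted.\<close>

theorem continuous_limit_process:
  fixes Z :: "nat \<Rightarrow> ('a, 'b::euclidean_space) process"
  assumes ad: "\<And>n t. 0 \<le> t \<Longrightarrow> t \<le> T \<Longrightarrow> Z n t \<in> borel_measurable (F t)"
    and cont: "\<And>n. AE w in M. continuous_on {0..T} (\<lambda>t. Z n t w)"
    and bd: "\<And>n. (\<integral>\<^sup>+w. dyadic_sup T (\<lambda>t w. Z (Suc n) t w - Z n t w) w \<partial>M) \<le> ennreal (K * (1/8) ^ n)"
    and K: "0 \<le> K"
  obtains X B where "\<And>t. 0 \<le> t \<Longrightarrow> t \<le> T \<Longrightarrow> X t \<in> borel_measurable (F t)"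
    "\<And>w. continuous_on {0..T} (\<lambda>t. X t w)"
    "B \<in> borel_measurable M" "(\<integral>\<^sup>+w. B w \<partial>M) \<le> ennreal (2 * K)"
    "AE w in M. \<forall>n. \<forall>t\<in>{0..T}. ennreal ((norm (Z n t w - X t w))\<^sup>2) \<le> ennreal (4 * (1/4) ^ n) * B w"
proof -
  let ?D = "\<lambda>n t w. Z (Suc n) t w - Z n t w"
  define B where "B w = (\<Sum>n. ennreal (4 ^ n) * dyadic_sup T (?D n) w)" for w
  have ZM: "Z n t \<in> borel_measurable M" if "0 \<le> t" "t \<le> T" for n t
    using F_measurableD[OF ad[OF that]] that by simp
  have dm [measurable]: "dyadic_sup T (?D n) \<in> borel_measurable M" for n
    by (rule dyadic_sup_measurable) (intro borel_measurable_diff ZM)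
  have Bm [measurable]: "B \<in> borel_measurable M" unfolding B_def by measurable
  have B_le: "(\<integral>\<^sup>+w. B w \<partial>M) \<le> ennreal (2 * K)"
  proof -
    have "(\<integral>\<^sup>+w. B w \<partial>M) = (\<Sum>n. ennreal (4 ^ n) * (\<integral>\<^sup>+w. dyadic_sup T (?D n) w \<partial>M))"
      unfolding B_def by (subst nn_integral_suminf; (measurable)?) (subst nn_integral_cmult; (measurable)?; rule refl)
    also have "\<dots> \<le> (\<Sum>n. ennreal (K * (1/2) ^ n))"
    proof (intro suminf_le summableI)
      fix n
      have "ennreal (4 ^ n) * (\<integral>\<^sup>+w. dyadic_sup T (?D n) w \<partial>M) \<le> ennreal (4 ^ n) * ennreal (K * (1/8) ^ n)"
        by (intro mult_left_mono bd) auto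
      also have "\<dots> = ennreal (4 ^ n * (K * (1/8) ^ n))" using K by (simp add: ennreal_mult')
      also have "4 ^ n * (K * (1/8) ^ n) = K * (4 * (1/8)) ^ n" by (simp only: power_mult_distrib mult_ac)
      finally show "ennreal (4 ^ n) * (\<integral>\<^sup>+w. dyadic_sup T (?D n) w \<partial>M) \<le> ennreal (K * (1/2) ^ n)" by simp
    qed
    also have "\<dots> = ennreal (\<Sum>n. K * (1/2) ^ n)"
      using K by (intro suminf_ennreal2) (auto intro!: summable_mult summable_geometric)
    also have "(\<Sum>n. K * (1/2) ^ n) = 2 * K"
      using suminf_geometric[of "1/2::real"] by (subst suminf_mult) (auto intro!: summable_geometric)
    finally show ?thesis .
  qed
  have "AE w in M. B w \<noteq> \<infinity>"
    using B_le by (intro nn_integral_PInf_AE) (auto simp: top_unique)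
  moreover have "AE w in M. \<forall>n. continuous_on {0..T} (\<lambda>t. Z n t w)" using cont by (simp add: AE_all_countable)
  ultimately have "AE w in M. B w \<noteq> \<infinity> \<and> (\<forall>n. continuous_on {0..T} (\<lambda>t. Z n t w))" by eventually_elim auto
  then obtain N where N: "\<And>w. w \<in> space M - N \<Longrightarrow> B w \<noteq> \<infinity> \<and> (\<forall>n. continuous_on {0..T} (\<lambda>t. Z n t w))"
    and N0: "N \<in> null_sets M" by (rule AE_E3) blast
  define X where "X t w = (if w \<in> space M - N then Z 0 t w + (\<Sum>n. ?D n t w) else 0)" for t w
  have path: "continuous_on {0..T} (\<lambda>t. X t w) \<and>
      (\<forall>n. \<forall>t\<in>{0..T}. ennreal ((norm (Z n t w - X t w))\<^sup>2) \<le> ennreal (4 * (1/4) ^ n) * B w)"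
    if w: "w \<in> space M - N" for w
  proof -
    define b where "b = enn2real (B w)"
    have Bb: "B w = ennreal b" "0 \<le> b" using N[OF w] by (auto simp: b_def less_top)
    have Zc: "continuous_on {0..T} (\<lambda>t. Z n t w)" for n using N[OF w] by blast
    have step: "norm (?D n t w) \<le> sqrt b * (1/2) ^ n" if t: "t \<in> {0..T}" for n t
    proof -
      have "ennreal (4 ^ n) * ennreal ((norm (?D n t w))\<^sup>2) \<le> ennreal (4 ^ n) * dyadic_sup T (?D n) w"
        using t by (intro mult_left_mono norm_le_dyadic_sup[OF T_pos, where E="?D n"] continuous_on_diff Zc) auto
      also have "\<dots> \<le> B w"
        unfolding B_def using sum_le_suminf[of "\<lambda>n. ennreal (4 ^ n) * dyadic_sup T (?D n) w" "{n}"]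
        by (simp add: summableI)
      finally have "ennreal (4 ^ n * (norm (?D n t w))\<^sup>2) \<le> ennreal b" unfolding Bb by (simp add: ennreal_mult)
      then have "4 ^ n * (norm (?D n t w))\<^sup>2 \<le> b" using Bb(2) by (simp add: ennreal_le_iff)
      moreover have "((2::real) ^ n)\<^sup>2 = 4 ^ n" by (simp add: power2_eq_square flip: power_mult_distrib)
      ultimately have "(2 ^ n * norm (?D n t w))\<^sup>2 \<le> b" by (simp add: power_mult_distrib)
      then have "2 ^ n * norm (?D n t w) \<le> sqrt b" by (rule real_le_rsqrt)
      then show ?thesis by (simp add: field_simps)
    qed
    have sm: "summable (\<lambda>n. sqrt b * (1/2::real) ^ n)" by (intro summable_mult summable_geometric) auto
    have ul: "uniform_limit {0..T} (\<lambda>n t. \<Sum>i<n. ?D i t w) (\<lambda>t. \<Sum>n. ?D n t w) sequentially"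
      by (rule Weierstrass_m_test[OF step sm])
    have tele: "(\<Sum>i<n. ?D i t w) = Z n t w - Z 0 t w" for n t by (rule sum_lessThan_telescope)
    have "continuous_on {0..T} (\<lambda>t. \<Sum>n. ?D n t w)"
      by (rule uniform_limit_theorem[OF _ ul])
         (auto intro!: always_eventually continuous_on_sum continuous_on_diff Zc)
    then have 1: "continuous_on {0..T} (\<lambda>t. X t w)"
      using w Zc[of 0] by (simp add: X_def continuous_on_add)
    have lim: "(\<lambda>m. Z m t w) \<longlonglongrightarrow> X t w" if t: "t \<in> {0..T}" for t
    proof -
      have "(\<lambda>n. Z n t w - Z 0 t w) \<longlonglongrightarrow> (\<Sum>n. ?D n t w)"
        using tendsto_uniform_limitI[OF ul t] unfolding tele .
      from tendsto_add[OF this tendsto_const[of "Z 0 t w"]] show ?thesis using w by (simp add: X_def add.commute)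
    qed
    have far: "norm (Z n t w - X t w) \<le> 2 * sqrt b * (1/2) ^ n" if t: "t \<in> {0..T}" for n t
    proof -
      have "norm (Z n t w - Z (n + m) t w) \<le> 2 * sqrt b * ((1/2) ^ n - (1/2) ^ (n + m))" for m
      proof (induction m)
        case (Suc m)
        have "norm (Z n t w - Z (n + Suc m) t w) \<le> norm (Z n t w - Z (n + m) t w) + norm (Z (n + m) t w - Z (n + Suc m) t w)"
          using norm_triangle_ineq[of "Z n t w - Z (n + m) t w" "Z (n + m) t w - Z (n + Suc m) t w"] by simp
        also have "norm (Z (n + m) t w - Z (n + Suc m) t w) \<le> sqrt b * (1/2) ^ (n + m)"
          using step[OF t, of "n + m"] by (simp add: norm_minus_commute)
        finally show ?case using Suc by (simp add: algebra_simps)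
      qed simp
      then have "norm (Z n t w - Z (n + m) t w) \<le> 2 * sqrt b * (1/2) ^ n" for m
        by (rule order_trans) (use Bb(2) in \<open>simp add: algebra_simps\<close>)
      moreover have "(\<lambda>m. norm (Z n t w - Z (n + m) t w)) \<longlonglongrightarrow> norm (Z n t w - X t w)"
        using LIMSEQ_ignore_initial_segment[OF lim[OF t], of n]
        by (intro tendsto_intros) (simp add: add.commute)
      ultimately show ?thesis by (intro LIMSEQ_le_const2) auto
    qed
    have "ennreal ((norm (Z n t w - X t w))\<^sup>2) \<le> ennreal (4 * (1/4) ^ n) * B w" if t: "t \<in> {0..T}" for n t
    proof -
      have "(norm (Z n t w - X t w))\<^sup>2 \<le> (2 * sqrt b * (1/2) ^ n)\<^sup>2"
        using far[OF t] by (intro power_mono) auto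
      also have "\<dots> = 4 * (1/4) ^ n * b"
      proof -
        have "(((1::real)/2) ^ n)\<^sup>2 = (1/4) ^ n" by (simp add: power2_eq_square flip: power_mult_distrib)
        then show ?thesis using Bb(2) by (simp add: power_mult_distrib)
      qed
      finally show ?thesis unfolding Bb(1) using Bb(2) by (simp add: ennreal_leI flip: ennreal_mult)
    qed
    with 1 show ?thesis by blast
  qed
  show ?thesis
  proof (rule that)
    show "continuous_on {0..T} (\<lambda>t. X t w)" for w
      using path[of w] by (cases "w \<in> space M - N") (auto simp: X_def)
    show "X t \<in> borel_measurable (F t)" if t: "0 \<le> t" "t \<le> T" for t
    proof -
      have [measurable]: "Z n t \<in> borel_measurable (F t)" for n by (rule ad[OF t])
      have sp: "space M = space (F t)" using F_space[OF t(2)] by simp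
      have [measurable]: "N \<in> sets (F t)" using F_augmented[OF t(2)] N0 by (auto simp: augmented_def)
      show ?thesis unfolding X_def sp by measurable
    qed
    have "AE w in M. w \<in> space M - N" using AE_not_in[OF N0] AE_space by eventually_elim auto
    then show "AE w in M. \<forall>n. \<forall>t\<in>{0..T}. ennreal ((norm (Z n t w - X t w))\<^sup>2) \<le> ennreal (4 * (1/4) ^ n) * B w"
      by eventually_elim (use path in blast)
  qed (fact Bm B_le)+
qed

lemma limit_process_l2:
  assumes Z: "\<And>n. sq_int M (Z n)" and X: "X \<in> borel_measurable M"
    and B: "B \<in> borel_measurable M" "(\<integral>\<^sup>+w. B w \<partial>M) \<le> ennreal K" and K: "0 \<le> K"
    and le: "AE w in M. \<forall>n. ennreal ((norm (Z n w - X w))\<^sup>2) \<le> ennreal (4 * (1/4) ^ n) * B w"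
  shows "sq_int M X" "(\<lambda>n. l2norm M (\<lambda>w. Z n w - X w)) \<longlonglongrightarrow> 0"
proof -
  have nn: "(\<integral>\<^sup>+w. ennreal ((norm (Z n w - X w))\<^sup>2) \<partial>M) \<le> ennreal (4 * (1/4) ^ n * K)" for n
  proof -
    have "(\<integral>\<^sup>+w. ennreal ((norm (Z n w - X w))\<^sup>2) \<partial>M) \<le> (\<integral>\<^sup>+w. ennreal (4 * (1/4) ^ n) * B w \<partial>M)"
      using le by (intro nn_integral_mono_AE) (auto elim: eventually_mono)
    also have "\<dots> = ennreal (4 * (1/4) ^ n) * (\<integral>\<^sup>+w. B w \<partial>M)" by (rule nn_integral_cmult[OF B(1)])
    also have "\<dots> \<le> ennreal (4 * (1/4) ^ n) * ennreal K" by (intro mult_left_mono B(2)) auto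
    finally show ?thesis using K by (simp flip: ennreal_mult)
  qed
  have Zm: "Z n \<in> borel_measurable M" for n using Z by (rule sq_int_measurable)
  have d: "sq_int M (\<lambda>w. Z n w - X w)" for n
    by (subst sq_int_iff_nn_integral)
       (auto intro: borel_measurable_diff Zm X order_le_less_trans[OF nn])
  show sq: "sq_int M X" using sq_int_diff[OF Z[of 0] d[of 0]] by simp
  have "(\<lambda>n. 4 * (1/4) ^ n * K) \<longlonglongrightarrow> 4 * 0 * K"
    by (intro tendsto_intros LIMSEQ_realpow_zero) auto
  then have "(\<lambda>n. \<integral>\<^sup>+w. ennreal ((norm (Z n w - X w))\<^sup>2) \<partial>M) \<longlonglongrightarrow> 0"
    using nn by (intro ennreal_convergence_squeeze[of _ "\<lambda>n. 4 * (1/4) ^ n * K"]) auto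
  then show "(\<lambda>n. l2norm M (\<lambda>w. Z n w - X w)) \<longlonglongrightarrow> 0"
    using l2_tendsto_iff_nn_integral[of M Z X, OF Z sq] by simp
qed

definition ito_approx :: "('a, real) process \<Rightarrow> ('a, 'b::euclidean_space) process \<Rightarrow> ('a, 'b) process \<Rightarrow>
    (nat \<Rightarrow> ('a, 'b) process) \<Rightarrow> (nat \<Rightarrow> ('a, 'b) process) \<Rightarrow> bool" where
  "ito_approx Z H I V E \<longleftrightarrow> (\<forall>j. simple_integral Z (V j) (E j)) \<and>
     (\<lambda>j. l2norm PM (\<lambda>x. case_prod (V j) x - case_prod H x)) \<longlonglongrightarrow> 0 \<and>
     (\<forall>t\<in>{0..T}. (\<lambda>j. l2norm M (\<lambda>w. E j t w - I t w)) \<longlonglongrightarrow> 0)"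

lemma ito_approxD:
  assumes "ito_approx Z H I V E"
  shows "\<And>j. simple_integral Z (V j) (E j)"
    "(\<lambda>j. l2norm PM (\<lambda>x. case_prod (V j) x - case_prod H x)) \<longlonglongrightarrow> 0"
    "\<And>t. 0 \<le> t \<Longrightarrow> t \<le> T \<Longrightarrow> (\<lambda>j. l2norm M (\<lambda>w. E j t w - I t w)) \<longlonglongrightarrow> 0"
  using assms unfolding ito_approx_def by auto

text \<open>The approximants need not be elementary processes in the sense of \<open>has_stoch_integral\<close>, so that the relation
  is visibly closed under differences.\<close>

definition ito :: "('a, real) process \<Rightarrow> ('a, 'b::euclidean_space) process \<Rightarrow> ('a, 'b) process \<Rightarrow> bool" where
  "ito Z H I \<longleftrightarrow> sq_int PM (case_prod H) \<and>
     (\<forall>t\<in>{0..T}. I t \<in> borel_measurable (F t) \<and> sq_int M (I t)) \<and>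
     (AE w in M. continuous_on {0..T} (\<lambda>t. I t w)) \<and> (\<exists>V E. ito_approx Z H I V E)"

lemma itoD:
  assumes "ito Z H I"
  shows "sq_int PM (case_prod H)"
    and "\<And>t. 0 \<le> t \<Longrightarrow> t \<le> T \<Longrightarrow> I t \<in> borel_measurable (F t)"
    and "\<And>t. 0 \<le> t \<Longrightarrow> t \<le> T \<Longrightarrow> sq_int M (I t)"
    and "AE w in M. continuous_on {0..T} (\<lambda>t. I t w)"
  using assms unfolding ito_def by auto

lemma itoI:
  assumes "sq_int PM (case_prod H)"
    and "\<And>t. 0 \<le> t \<Longrightarrow> t \<le> T \<Longrightarrow> I t \<in> borel_measurable (F t)"
    and "\<And>t. 0 \<le> t \<Longrightarrow> t \<le> T \<Longrightarrow> sq_int M (I t)"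
    and "AE w in M. continuous_on {0..T} (\<lambda>t. I t w)"
    and "\<And>j. simple_integral Z (V j) (E j)"
    and "(\<lambda>j::nat. l2norm PM (\<lambda>x. case_prod (V j) x - case_prod H x)) \<longlonglongrightarrow> 0"
    and "\<And>t. 0 \<le> t \<Longrightarrow> t \<le> T \<Longrightarrow> (\<lambda>j. l2norm M (\<lambda>w. E j t w - I t w)) \<longlonglongrightarrow> 0"
  shows "ito Z H I"
proof -
  have "ito_approx Z H I V E" unfolding ito_approx_def using assms(5-7) by simp
  then show ?thesis unfolding ito_def using assms(1-4) by auto
qed

lemma l2_tendsto_diff:
  assumes "\<And>n. sq_int N (f n)" "sq_int N f'" "\<And>n. sq_int N (g n)" "sq_int N g'"
    "(\<lambda>n. l2norm N (\<lambda>x. f n x - f' x)) \<longlonglongrightarrow> 0" "(\<lambda>n. l2norm N (\<lambda>x. g n x - g' x)) \<longlonglongrightarrow> 0"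
  shows "(\<lambda>n. l2norm N (\<lambda>x. (f n x - g n x) - (f' x - g' x))) \<longlonglongrightarrow> 0"
proof (rule Lim_null_comparison[OF always_eventually], rule allI)
  fix n
  have "l2norm N (\<lambda>x. (f n x - f' x) - (g n x - g' x)) \<le> l2norm N (\<lambda>x. f n x - f' x) + l2norm N (\<lambda>x. g n x - g' x)"
    by (intro l2norm_triangle_diff sq_int_diff assms)
  moreover have "(\<lambda>x. (f n x - f' x) - (g n x - g' x)) = (\<lambda>x. (f n x - g n x) - (f' x - g' x))"
    by (simp add: algebra_simps)
  ultimately show "norm (l2norm N (\<lambda>x. (f n x - g n x) - (f' x - g' x))) \<le> l2norm N (\<lambda>x. f n x - f' x) + l2norm N (\<lambda>x. g n x - g' x)"
    by simp
  show "(\<lambda>n. l2norm N (\<lambda>x. f n x - f' x) + l2norm N (\<lambda>x. g n x - g' x)) \<longlonglongrightarrow> 0"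
    using tendsto_add[OF assms(5,6)] by simp
qed

lemma ito_diff:
  assumes Z: "integrator Z" "covariation 1 Z Z" and H: "ito Z H I" and H': "ito Z H' I'"
  shows "ito Z (\<lambda>t w. H t w - H' t w) (\<lambda>t w. I t w - I' t w)"
proof -
  obtain V E where aV: "ito_approx Z H I V E" using H unfolding ito_def by blast
  note V = ito_approxD[OF aV]
  obtain V' E' where aV': "ito_approx Z H' I' V' E'" using H' unfolding ito_def by blast
  note V' = ito_approxD[OF aV']
  have sq: "case_prod (\<lambda>t w. f t w - g t w) = (\<lambda>x. case_prod f x - case_prod g x)" for f g :: "('a, 'b) process"
    by auto
  show ?thesis
  proof (rule itoI[where V="\<lambda>j t w. V j t w - V' j t w" and E="\<lambda>j t w. E j t w - E' j t w"])
    show "sq_int PM (case_prod (\<lambda>t w. H t w - H' t w))"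
      unfolding sq by (intro sq_int_diff itoD(1)[OF H] itoD(1)[OF H'])
    show "simple_integral Z (\<lambda>t w. V j t w - V' j t w) (\<lambda>t w. E j t w - E' j t w)" for j
      by (rule simple_integral_diff[OF V'(1) V(1)])
    show "(\<lambda>j. l2norm PM (\<lambda>x. case_prod (\<lambda>t w. V j t w - V' j t w) x - case_prod (\<lambda>t w. H t w - H' t w) x)) \<longlonglongrightarrow> 0"
      unfolding sq
      by (intro l2_tendsto_diff simple_integrand_sq_int[OF V(1)] simple_integrand_sq_int[OF V'(1)]
          itoD(1)[OF H] itoD(1)[OF H'] V(2) V'(2))
  next
    fix t assume t: "0 \<le> t" "t \<le> T"
    show "(\<lambda>w. I t w - I' t w) \<in> borel_measurable (F t)"
      by (intro borel_measurable_diff itoD(2)[OF H t] itoD(2)[OF H' t])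
    show "sq_int M (\<lambda>w. I t w - I' t w)"
      by (intro sq_int_diff itoD(3)[OF H t] itoD(3)[OF H' t])
    show "(\<lambda>j. l2norm M (\<lambda>w. (E j t w - E' j t w) - (I t w - I' t w))) \<longlonglongrightarrow> 0"
      by (intro l2_tendsto_diff simple_integral_sq_int[OF V(1) Z t] simple_integral_sq_int[OF V'(1) Z t]
          itoD(3)[OF H t] itoD(3)[OF H' t] V(3)[OF t] V'(3)[OF t])
  next
    show "AE w in M. continuous_on {0..T} (\<lambda>t. I t w - I' t w)"
      using itoD(4)[OF H] itoD(4)[OF H'] by eventually_elim (rule continuous_on_diff)
  qed
qed

lemma ito_martingale:
  assumes Z: "integrator Z" "covariation 1 Z Z" and H: "ito Z H I"
  shows "l2_martingale I"
proof -
  obtain V E where aV: "ito_approx Z H I V E" using H unfolding ito_def by blast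
  note V = ito_approxD[OF aV]
  show ?thesis
    unfolding l2_martingale_def
  proof (intro conjI ballI allI impI)
    show "I t \<in> borel_measurable (F t)" "sq_int M (I t)" if "t \<in> {0..T}" for t
      using itoD(2,3)[OF H] that by auto
    fix s t and \<eta> :: "'a \<Rightarrow> 'b" assume s: "0 \<le> s" "s \<le> t" "t \<le> T" and \<eta>: "\<eta> \<in> borel_measurable (F s)" "sq_int M \<eta>"
    have t: "0 \<le> t" "s \<le> T" using s by auto
    have E: "sq_int M (E j t)" "sq_int M (E j s)" for j
      using simple_integral_sq_int[OF V(1) Z] s t by auto
    have I: "sq_int M (I t)" "sq_int M (I s)" using itoD(3)[OF H] s t by auto
    have "(\<lambda>j. \<integral>w. \<eta> w \<bullet> (E j t w - E j s w) \<partial>M) \<longlonglongrightarrow> (\<integral>w. \<eta> w \<bullet> (I t w - I s w) \<partial>M)"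
      by (intro l2_inner_converges l2_tendsto_diff sq_int_diff \<eta> E I V(3) s t) (simp add: l2norm_def)
    moreover have "(\<integral>w. \<eta> w \<bullet> (E j t w - E j s w) \<partial>M) = 0" for j
      by (rule l2_martingaleD(3)[OF simple_integral_martingale[OF V(1) Z] s \<eta>])
    ultimately show "(\<integral>w. \<eta> w \<bullet> (I t w - I s w) \<partial>M) = 0"
      by (simp add: LIMSEQ_const_iff)
  qed
qed

lemma up_to_l2_le:
  assumes "sq_int PM (case_prod V)"
  shows "l2norm PM (up_to t V) \<le> l2norm PM (case_prod V)"
proof -
  have "AE x in PM. norm (up_to t V x) \<le> 1 * norm (case_prod V x)"
    by (intro AE_I2) (auto simp: up_to_def indicator_def)
  from l2norm_mono[OF assms sq_int_measurable[OF sq_int_up_to[OF assms]] this] show ?thesis by simp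
qed

lemma up_to_tendsto:
  assumes "\<And>n. sq_int PM (case_prod (V n))" "sq_int PM (case_prod H)"
    and l: "(\<lambda>n. l2norm PM (\<lambda>x. case_prod (V n) x - case_prod H x)) \<longlonglongrightarrow> 0"
  shows "(\<lambda>n. l2norm PM (\<lambda>x. up_to t (V n) x - up_to t H x)) \<longlonglongrightarrow> 0"
proof (rule Lim_null_comparison[OF always_eventually l], rule allI)
  fix n
  have "sq_int PM (case_prod (\<lambda>r w. V n r w - H r w))"
    using sq_int_diff[OF assms(1)[of n] assms(2)] by (simp add: case_prod_beta')
  from up_to_l2_le[OF this, of t]
  show "norm (l2norm PM (\<lambda>x. up_to t (V n) x - up_to t H x)) \<le> l2norm PM (\<lambda>x. case_prod (V n) x - case_prod H x)"
    by (simp add: up_to_diff case_prod_beta')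
qed

text \<open>Passage to the limit in \<open>simple_isometry\<close>.\<close>

theorem ito_isometry:
  assumes Z: "integrator Z" "covariation 1 Z Z" and Z': "integrator Z'" "covariation 1 Z' Z'"
    and cov: "covariation \<rho> Z Z'" and t: "0 \<le> t" "t \<le> T"
    and H: "ito Z H I" and H': "ito Z' H' I'"
  shows "(\<integral>w. I t w \<bullet> I' t w \<partial>M) = \<rho> * (\<integral>x. up_to t H x \<bullet> up_to t H' x \<partial>PM)"
proof -
  obtain V E where aV: "ito_approx Z H I V E" using H unfolding ito_def by blast
  note V = ito_approxD[OF aV]
  obtain V' E' where aV': "ito_approx Z' H' I' V' E'" using H' unfolding ito_def by blast
  note V' = ito_approxD[OF aV']
  note sq = simple_integral_sq_int[OF V(1) Z t] simple_integral_sq_int[OF V'(1) Z' t]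
    simple_integrand_sq_int[OF V(1)] simple_integrand_sq_int[OF V'(1)]
    itoD(3)[OF H t] itoD(3)[OF H' t] itoD(1)[OF H] itoD(1)[OF H']
  have "(\<lambda>j. \<integral>w. E j t w \<bullet> E' j t w \<partial>M) \<longlonglongrightarrow> (\<integral>w. I t w \<bullet> I' t w \<partial>M)"
    by (intro l2_inner_converges sq V(3) V'(3) t)
  moreover have "(\<lambda>j. \<rho> * (\<integral>x. up_to t (V j) x \<bullet> up_to t (V' j) x \<partial>PM)) \<longlonglongrightarrow> \<rho> * (\<integral>x. up_to t H x \<bullet> up_to t H' x \<partial>PM)"
    by (intro tendsto_mult tendsto_const l2_inner_converges sq_int_up_to up_to_tendsto sq V(2) V'(2))
  moreover have "(\<integral>w. E j t w \<bullet> E' j t w \<partial>M) = \<rho> * (\<integral>x. up_to t (V j) x \<bullet> up_to t (V' j) x \<partial>PM)" for j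
    by (rule simple_isometry[OF V(1) V'(1) Z Z' cov t])
  ultimately show ?thesis by (simp add: LIMSEQ_unique)
qed

corollary ito_l2norm:
  assumes Z: "integrator Z" "covariation 1 Z Z" and t: "0 \<le> t" "t \<le> T" and H: "ito Z H I"
  shows "l2norm M (I t) = l2norm PM (up_to t H)"
  using ito_isometry[OF Z Z Z(2) t H H] unfolding l2norm_def by (simp add: power2_norm_eq_inner)

corollary ito_maximal:
  assumes Z: "integrator Z" "covariation 1 Z Z" and H: "ito Z H I"
  shows "(\<integral>\<^sup>+w. dyadic_sup T I w \<partial>M) \<le> ennreal (4 * (l2norm PM (case_prod H))\<^sup>2)"
proof -
  have "l2norm M (I T) \<le> l2norm PM (case_prod H)"
    using ito_l2norm[OF Z _ _ H, of T] T_pos up_to_l2_le[OF itoD(1)[OF H], of T] by simp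
  then have "ennreal (4 * (l2norm M (I T))\<^sup>2) \<le> ennreal (4 * (l2norm PM (case_prod H))\<^sup>2)"
    by (intro ennreal_leI mult_left_mono power_mono) auto
  with doob_l2[OF ito_martingale[OF Z H]] show ?thesis by (rule order_trans)
qed

lemma simple_ito:
  assumes Z: "integrator Z" "covariation 1 Z Z" and VE: "simple_integral Z V E"
  shows "ito Z V E"
proof (rule itoI[where V="\<lambda>_. V" and E="\<lambda>_. E"])
  show "sq_int PM (case_prod V)" by (rule simple_integrand_sq_int[OF VE])
  show "AE w in M. continuous_on {0..T} (\<lambda>t. E t w)"
    using integratorD(2)[OF Z(1)] by eventually_elim (rule simple_integral_continuous[OF VE])
  show "E t \<in> borel_measurable (F t)" "sq_int M (E t)" if "0 \<le> t" "t \<le> T" for t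
    using simple_integral_measurable[OF VE Z(1)] simple_integral_sq_int[OF VE Z] that by auto
qed (simp_all add: l2norm_def VE)

lemma nn_integral_M2_eq:
  assumes "sq_int PM (case_prod V)" "sq_int PM (case_prod H)"
  shows "(\<integral>\<^sup>+w. (\<integral>\<^sup>+t\<in>{0..T}. ennreal ((norm (V t w - H t w))\<^sup>2) \<partial>lborel) \<partial>M)
    = ennreal ((l2norm PM (\<lambda>x. case_prod V x - case_prod H x))\<^sup>2)"
proof -
  have sq: "sq_int PM (\<lambda>x. case_prod V x - case_prod H x)" using assms by (rule sq_int_diff)
  have [measurable]: "(\<lambda>x. case_prod V x - case_prod H x) \<in> borel_measurable PM"
    using sq by (rule sq_int_measurable)
  have "(\<lambda>x. ennreal ((norm (case_prod V x - case_prod H x))\<^sup>2)) \<in> borel_measurable PM" by measurable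
  from nn_integral_PM[OF this] show ?thesis using nn_integral_sq[OF sq] by simp
qed

lemma has_stoch_integral_ito:
  assumes Z: "integrator Z" "covariation 1 Z Z" and H: "has_stoch_integral M T F Z H I"
  shows "ito Z H I"
proof -
  obtain m \<tau> \<xi> where el: "\<And>j. elementary_process M T F (m j) (\<tau> j) (\<xi> j)"
    and l1: "(\<lambda>j::nat. \<integral>\<^sup>+w. (\<integral>\<^sup>+t\<in>{0..T}. ennreal ((norm (elementary_val (m j) (\<tau> j) (\<xi> j) t w - H t w))\<^sup>2) \<partial>lborel) \<partial>M) \<longlonglongrightarrow> 0"
    and l2: "\<And>t. t\<in>{0..T} \<Longrightarrow> (\<lambda>j. \<integral>\<^sup>+w. ennreal ((norm (elementary_integral Z (m j) (\<tau> j) (\<xi> j) t w - I t w))\<^sup>2) \<partial>M) \<longlonglongrightarrow> 0"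
    and HI: "H \<in> M2_space M T F" "adapted T F I" "AE w in M. continuous_on {0..T} (\<lambda>t. I t w)"
    using H unfolding has_stoch_integral_def by blast
  note si = elementary_simple_integral[OF el, of Z]
  have Hsq: "sq_int PM (case_prod H)" using HI(1) by (simp add: M2_space_iff)
  have Isq: "sq_int M (I t)" if "t \<in> {0..T}" for t
  proof -
    have t: "0 \<le> t" "t \<le> T" using that by auto
    have "eventually (\<lambda>j. (\<integral>\<^sup>+w. ennreal ((norm (elementary_integral Z (m j) (\<tau> j) (\<xi> j) t w - I t w))\<^sup>2) \<partial>M) < 1) sequentially"
      by (rule order_tendstoD(2)[OF l2[OF that]]) simp
    then obtain j where j: "(\<integral>\<^sup>+w. ennreal ((norm (elementary_integral Z (m j) (\<tau> j) (\<xi> j) t w - I t w))\<^sup>2) \<partial>M) < 1"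
      by (auto simp: eventually_sequentially)
    have E: "sq_int M (elementary_integral Z (m j) (\<tau> j) (\<xi> j) t)"
      by (rule simple_integral_sq_int[OF si Z t])
    have "I t \<in> borel_measurable (F t)" using HI(2) that unfolding adapted_def by blast
    then have "I t \<in> borel_measurable M" using F_measurableD t by blast
    then have "(\<lambda>w. elementary_integral Z (m j) (\<tau> j) (\<xi> j) t w - I t w) \<in> borel_measurable M"
      by (intro borel_measurable_diff sq_int_measurable[OF E])
    then have "sq_int M (\<lambda>w. elementary_integral Z (m j) (\<tau> j) (\<xi> j) t w - I t w)"
      using j by (subst sq_int_iff_nn_integral) (auto intro: order_less_trans)
    from sq_int_diff[OF E this] show ?thesis by simp
  qed
  have c1: "(\<lambda>j. l2norm PM (\<lambda>x. case_prod (elementary_val (m j) (\<tau> j) (\<xi> j)) x - case_prod H x)) \<longlonglongrightarrow> 0"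
  proof -
    have "(\<lambda>j. ennreal ((l2norm PM (\<lambda>x. case_prod (elementary_val (m j) (\<tau> j) (\<xi> j)) x - case_prod H x))\<^sup>2)) \<longlonglongrightarrow> 0"
      using l1 unfolding nn_integral_M2_eq[OF simple_integrand_sq_int[OF si] Hsq] .
    then show ?thesis
      using l2_tendsto_iff_nn_integral[of PM "\<lambda>j. case_prod (elementary_val (m j) (\<tau> j) (\<xi> j))" "case_prod H",
        OF simple_integrand_sq_int[OF si] Hsq]
        nn_integral_sq[OF sq_int_diff[OF simple_integrand_sq_int[OF si] Hsq]] by simp
  qed
  have c2: "(\<lambda>j. l2norm M (\<lambda>w. elementary_integral Z (m j) (\<tau> j) (\<xi> j) t w - I t w)) \<longlonglongrightarrow> 0" if "t \<in> {0..T}" for t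
    using l2[OF that] that
      l2_tendsto_iff_nn_integral[of M "\<lambda>j. elementary_integral Z (m j) (\<tau> j) (\<xi> j) t" "I t",
        OF simple_integral_sq_int[OF si Z] Isq[OF that]] by simp
  show ?thesis
    by (rule itoI[OF Hsq _ Isq HI(3) si c1 c2]) (use HI(2) in \<open>auto simp: adapted_def\<close>)
qed

text \<open>The geometric rate makes the maximal differences of the integrals summable.\<close>

lemma M2_approximation:
  assumes H: "H \<in> M2_space M T F"
  shows "\<exists>m \<tau> \<xi>. \<forall>j::nat. elementary_process M T F (m j) (\<tau> j) (\<xi> j) \<and>
    l2norm PM (\<lambda>x. case_prod (elementary_val (m j) (\<tau> j) (\<xi> j)) x - case_prod H x) \<le> (1/4) ^ j"
proof -
  have H': "adapted T F H" "sq_int PM (case_prod H)" using H by (auto simp: M2_space_iff)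
  have "\<exists>p. elementary_process M T F (fst p) (fst (snd p)) (snd (snd p)) \<and>
      l2norm PM (\<lambda>x. case_prod (elementary_val (fst p) (fst (snd p)) (snd (snd p))) x - case_prod H x) \<le> (1/4) ^ j" for j :: nat
  proof -
    obtain m \<tau> \<xi> where "elementary_process M T F m \<tau> \<xi>"
      "l2norm PM (\<lambda>x. case_prod (elementary_val m \<tau> \<xi>) x - case_prod H x) \<le> (1/4) ^ j"
      by (rule elementary_dense[OF H', of "(1/4) ^ j"]) auto
    then show ?thesis by (intro exI[of _ "(m, \<tau>, \<xi>)"]) simp
  qed
  then have "\<forall>j::nat. \<exists>p. elementary_process M T F (fst p) (fst (snd p)) (snd (snd p)) \<and>
      l2norm PM (\<lambda>x. case_prod (elementary_val (fst p) (fst (snd p)) (snd (snd p))) x - case_prod H x) \<le> (1/4) ^ j" ..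
  from choice[OF this] obtain p where p: "\<forall>j::nat. elementary_process M T F (fst (p j)) (fst (snd (p j))) (snd (snd (p j))) \<and>
      l2norm PM (\<lambda>x. case_prod (elementary_val (fst (p j)) (fst (snd (p j))) (snd (snd (p j)))) x - case_prod H x) \<le> (1/4) ^ j" ..
  then show ?thesis
    by (intro exI[of _ "\<lambda>j. fst (p j)"] exI[of _ "\<lambda>j. fst (snd (p j))"] exI[of _ "\<lambda>j. snd (snd (p j))"])
qed

text \<open>By isometry and Doob's inequality the integrals of the approximants satisfy the hypothesis of
  \<open>continuous_limit_process\<close>. The elementary approximants are returned, since they also serve for
  integrators with drift.\<close>

theorem stoch_integral_exists:
  assumes Z: "integrator Z" "covariation 1 Z Z" and H: "H \<in> M2_space M T F"
  obtains I m \<tau> \<xi> where "ito Z H I" "\<And>w. continuous_on {0..T} (\<lambda>t. I t w)"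
    "\<And>j::nat. elementary_process M T F (m j) (\<tau> j) (\<xi> j)"
    "(\<lambda>j. l2norm PM (\<lambda>x. case_prod (elementary_val (m j) (\<tau> j) (\<xi> j)) x - case_prod H x)) \<longlonglongrightarrow> 0"
    "\<And>t. 0 \<le> t \<Longrightarrow> t \<le> T \<Longrightarrow> (\<lambda>j. l2norm M (\<lambda>w. elementary_integral Z (m j) (\<tau> j) (\<xi> j) t w - I t w)) \<longlonglongrightarrow> 0"
proof -
  obtain m \<tau> \<xi> where el: "\<And>j::nat. elementary_process M T F (m j) (\<tau> j) (\<xi> j)"
    and le: "\<And>j. l2norm PM (\<lambda>x. case_prod (elementary_val (m j) (\<tau> j) (\<xi> j)) x - case_prod H x) \<le> (1/4) ^ j"
    using M2_approximation[OF H] by blast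
  define V E where "V j = elementary_val (m j) (\<tau> j) (\<xi> j)" and "E j = elementary_integral Z (m j) (\<tau> j) (\<xi> j)" for j
  have Hsq: "sq_int PM (case_prod H)" using H by (simp add: M2_space_iff)
  have si: "simple_integral Z (V j) (E j)" for j unfolding V_def E_def by (rule elementary_simple_integral[OF el])
  note ie = simple_ito[OF Z si]
  note Vsq = simple_integrand_sq_int[OF si]
  have step: "(\<integral>\<^sup>+w. dyadic_sup T (\<lambda>t w. E (Suc n) t w - E n t w) w \<partial>M) \<le> ennreal (16 * (1/8) ^ n)" for n
  proof -
    have "l2norm PM (\<lambda>x. case_prod (V (Suc n)) x - case_prod (V n) x)
      \<le> l2norm PM (\<lambda>x. case_prod (V (Suc n)) x - case_prod H x) + l2norm PM (\<lambda>x. case_prod H x - case_prod (V n) x)"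
      by (rule l2norm_triangle3[OF Vsq Hsq Vsq])
    also have "\<dots> \<le> (1/4) ^ Suc n + (1/4) ^ n"
      using le[of "Suc n"] le[of n] l2norm_commute[of PM "case_prod H" "case_prod (V n)"] by (simp add: V_def)
    also have "\<dots> \<le> 2 * (1/4) ^ n" by simp
    finally have "(l2norm PM (\<lambda>x. case_prod (V (Suc n)) x - case_prod (V n) x))\<^sup>2 \<le> (2 * (1/4) ^ n)\<^sup>2"
      by (intro power_mono) auto
    also have "\<dots> = 4 * ((1/4)\<^sup>2) ^ n" by (simp add: power_mult_distrib flip: power_mult) (simp add: mult.commute)
    also have "\<dots> \<le> 4 * (1/8) ^ n" by (intro mult_left_mono power_mono) (auto simp: power2_eq_square)
    finally have b: "4 * (l2norm PM (\<lambda>x. case_prod (V (Suc n)) x - case_prod (V n) x))\<^sup>2 \<le> 16 * (1/8) ^ n" by simp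
    have "(\<integral>\<^sup>+w. dyadic_sup T (\<lambda>t w. E (Suc n) t w - E n t w) w \<partial>M)
      \<le> ennreal (4 * (l2norm PM (case_prod (\<lambda>t w. V (Suc n) t w - V n t w)))\<^sup>2)"
      by (rule ito_maximal[OF Z ito_diff[OF Z ie ie]])
    also have "\<dots> \<le> ennreal (16 * (1/8) ^ n)" using b by (intro ennreal_leI) (simp add: case_prod_beta')
    finally show ?thesis .
  qed
  obtain I B where I: "\<And>t. 0 \<le> t \<Longrightarrow> t \<le> T \<Longrightarrow> I t \<in> borel_measurable (F t)"
    "\<And>w. continuous_on {0..T} (\<lambda>t. I t w)"
    "B \<in> borel_measurable M" "(\<integral>\<^sup>+w. B w \<partial>M) \<le> ennreal (2 * 16)"
    "AE w in M. \<forall>n. \<forall>t\<in>{0..T}. ennreal ((norm (E n t w - I t w))\<^sup>2) \<le> ennreal (4 * (1/4) ^ n) * B w"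
    by (rule continuous_limit_process[OF itoD(2)[OF ie] itoD(4)[OF ie] step]) auto
  have L: "sq_int M (I t)" "(\<lambda>n. l2norm M (\<lambda>w. E n t w - I t w)) \<longlonglongrightarrow> 0" if t: "0 \<le> t" "t \<le> T" for t
  proof -
    have "AE w in M. \<forall>n. ennreal ((norm (E n t w - I t w))\<^sup>2) \<le> ennreal (4 * (1/4) ^ n) * B w"
      using I(5) by eventually_elim (use t in auto)
    from limit_process_l2[OF itoD(3)[OF ie t] F_measurableD[OF I(1)[OF t] t(2)] I(3,4) _ this]
    show "sq_int M (I t)" "(\<lambda>n. l2norm M (\<lambda>w. E n t w - I t w)) \<longlonglongrightarrow> 0" by auto
  qed
  have Vl: "(\<lambda>j. l2norm PM (\<lambda>x. case_prod (V j) x - case_prod H x)) \<longlonglongrightarrow> 0"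
    by (rule Lim_null_comparison[OF always_eventually LIMSEQ_realpow_zero[of "1/4"]]) (use le in \<open>auto simp: V_def\<close>)
  have Ic: "AE w in M. continuous_on {0..T} (\<lambda>t. I t w)" by (intro AE_I2 I(2))
  have "ito Z H I"
    by (rule itoI[OF Hsq I(1) L(1) Ic si Vl L(2)])
  then show ?thesis
    by (rule that[OF _ I(2) el]) (use Vl L(2) in \<open>simp_all add: V_def E_def\<close>)
qed

end

section \<open>Time integrals and integrators with drift\<close>

lemma set_integral_leb:
  fixes f :: "real \<Rightarrow> 'b::euclidean_space"
  assumes "A \<subseteq> {0..T}"
  shows "(LBINT s:A. f s) = (\<integral>s. indicator A s *\<^sub>R f s \<partial>leb T)"
    and "set_integrable lborel A f \<longleftrightarrow> integrable (leb T) (\<lambda>s. indicator A s *\<^sub>R f s)"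
proof -
  have eq: "(\<lambda>s. indicator {0..T} s *\<^sub>R (indicator A s *\<^sub>R f s)) = (\<lambda>s. indicator A s *\<^sub>R f s)"
    using assms by (auto simp: indicator_def fun_eq_iff)
  show "(LBINT s:A. f s) = (\<integral>s. indicator A s *\<^sub>R f s \<partial>leb T)"
    by (subst integral_restrict_space) (simp, simp only: eq set_lebesgue_integral_def)
  show "set_integrable lborel A f \<longleftrightarrow> integrable (leb T) (\<lambda>s. indicator A s *\<^sub>R f s)"
    by (subst integrable_restrict_space) (simp, simp only: eq set_integrable_def)
qed

lemma sq_int_indicator:
  assumes "sq_int (leb T) f" "A \<in> sets borel"
  shows "sq_int (leb T) (\<lambda>s. indicator A s *\<^sub>R f s)"
proof (rule sq_int_bound[OF assms(1), where c=1])
  have "(indicator A :: real \<Rightarrow> real) \<in> borel_measurable (leb T)"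
    using assms(2) by (intro measurable_leb) simp
  then show "(\<lambda>s. indicator A s *\<^sub>R f s) \<in> borel_measurable (leb T)"
    by (rule borel_measurable_scaleR[OF _ sq_int_measurable[OF assms(1)]])
qed (auto simp: indicator_def)

lemma sq_int_set_integrable:
  assumes "sq_int (leb T) f" "A \<subseteq> {0..T}" "A \<in> sets borel"
  shows "set_integrable lborel A f"
proof -
  interpret finite_measure "leb T" by (rule finite_leb)
  show ?thesis unfolding set_integral_leb(2)[OF assms(2)]
    by (rule sq_int_integrable[OF sq_int_indicator[OF assms(1,3)]])
qed

lemma norm_time_integral_le:
  assumes f: "sq_int (leb T) f" and s: "0 \<le> s" "s \<le> t" "t \<le> T"
  shows "norm (LBINT r:{s..t}. f r) \<le> sqrt (t - s) * l2norm (leb T) (\<lambda>r. indicator {s..t} r *\<^sub>R f r)"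
proof -
  interpret finite_measure "leb T" by (rule finite_leb)
  have sub: "{s..t} \<subseteq> {0..T}" using s by auto
  have one: "sq_int (leb T) (\<lambda>r. indicator {s..t} r *\<^sub>R (1::real))"
    by (intro sq_int_indicator) auto
  have f': "sq_int (leb T) (\<lambda>r. indicator {s..t} r *\<^sub>R f r)"
    by (intro sq_int_indicator f) auto
  have "norm (LBINT r:{s..t}. f r) \<le> (\<integral>r. norm (indicator {s..t} r *\<^sub>R f r) \<partial>leb T)"
    unfolding set_integral_leb(1)[OF sub] by (rule integral_norm_bound)
  also have "\<dots> = (\<integral>r. norm (indicator {s..t} r *\<^sub>R (1::real)) * norm (indicator {s..t} r *\<^sub>R f r) \<partial>leb T)"
    by (intro Bochner_Integration.integral_cong) (auto simp: indicator_def)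
  also have "\<dots> \<le> l2norm (leb T) (\<lambda>r. indicator {s..t} r *\<^sub>R (1::real)) * l2norm (leb T) (\<lambda>r. indicator {s..t} r *\<^sub>R f r)"
    by (rule integral_norm_mult_le[OF one f'])
  also have "l2norm (leb T) (\<lambda>r. indicator {s..t} r *\<^sub>R (1::real)) = sqrt (t - s)"
  proof -
    have "(\<integral>r. (norm (indicator {s..t} r *\<^sub>R (1::real)))\<^sup>2 \<partial>leb T) = (LBINT r:{s..t}. 1)"
      unfolding set_integral_leb(1)[OF sub] by (intro Bochner_Integration.integral_cong) (auto simp: indicator_def)
    also have "\<dots> = t - s" using s by (simp add: set_lebesgue_integral_def)
    finally show ?thesis by (simp add: l2norm_def)
  qed
  finally show ?thesis .
qed

lemma time_integral_continuous:
  fixes f :: "real \<Rightarrow> 'b::euclidean_space"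
  assumes "set_integrable lborel {0..T} f"
  shows "continuous_on {0..T} (\<lambda>t. LBINT s:{0..t}. f s)"
proof -
  have eq: "integral {0..t} f = (LBINT s:{0..t}. f s)" if "t \<in> {0..T}" for t
    using that by (intro set_borel_integral_eq_integral(2)[symmetric] set_integrable_subset[OF assms]) auto
  have "continuous_on {0..T} (\<lambda>t. integral {0..t} f)"
    by (intro indefinite_integral_continuous_1 set_borel_integral_eq_integral[OF assms])
  then show ?thesis by (rule continuous_on_eq) (rule eq)
qed

context filtered_space
begin

definition restr :: "real set \<Rightarrow> ('a, 'b::real_vector) process \<Rightarrow> real \<times> 'a \<Rightarrow> 'b" where
  "restr A V = (\<lambda>(r, w). indicator A r *\<^sub>R V r w)"

lemma sq_int_restr:
  assumes "sq_int PM (case_prod V)" and A: "A \<in> sets borel"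
  shows "sq_int PM (restr A V)" "l2norm PM (restr A V) \<le> l2norm PM (case_prod V)"
proof -
  have [measurable]: "case_prod V \<in> borel_measurable PM" using assms(1) by (rule sq_int_measurable)
  have [measurable]: "A \<in> sets borel" by fact
  have "(\<lambda>x. indicator A (fst x) *\<^sub>R case_prod V x) \<in> borel_measurable PM" by measurable
  then have m: "restr A V \<in> borel_measurable PM" by (simp add: restr_def case_prod_beta')
  have le: "AE x in PM. norm (restr A V x) \<le> 1 * norm (case_prod V x)"
    by (intro AE_I2) (auto simp: restr_def indicator_def)
  show "sq_int PM (restr A V)" by (rule sq_int_bound[OF assms(1) m le])
  show "l2norm PM (restr A V) \<le> l2norm PM (case_prod V)" using l2norm_mono[OF assms(1) m le] by simp
qed

text \<open>Fubini along paths; the next lemma does the same for fixed times.\<close>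

lemma path_sq_int:
  assumes H: "sq_int PM (case_prod H)"
  shows "AE w in M. sq_int (leb T) (\<lambda>s. H s w)"
    "integrable M (\<lambda>w. (l2norm (leb T) (\<lambda>s. H s w))\<^sup>2)"
    "(\<integral>w. (l2norm (leb T) (\<lambda>s. H s w))\<^sup>2 \<partial>M) = (l2norm PM (case_prod H))\<^sup>2"
proof -
  have [measurable]: "case_prod H \<in> borel_measurable PM" using H by (rule sq_int_measurable)
  have i: "integrable PM (\<lambda>(s, w). (norm (H s w))\<^sup>2)" using sq_intD[OF H] by (simp add: case_prod_beta')
  show "AE w in M. sq_int (leb T) (\<lambda>s. H s w)"
    using TM.AE_integrable_snd[OF i] AE_space
  proof eventually_elim
    case (elim w)
    then have "(\<lambda>s. case_prod H (s, w)) \<in> borel_measurable (leb T)" by measurable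
    with elim show ?case by (simp add: sq_int_def)
  qed
  show "integrable M (\<lambda>w. (l2norm (leb T) (\<lambda>s. H s w))\<^sup>2)"
    using TM.integrable_snd[OF i] by (simp add: l2norm_sq)
  show "(\<integral>w. (l2norm (leb T) (\<lambda>s. H s w))\<^sup>2 \<partial>M) = (l2norm PM (case_prod H))\<^sup>2"
    using TM.integral_snd[OF i] by (simp add: l2norm_sq case_prod_beta')
qed

lemma section_sq_int:
  assumes H: "sq_int PM (case_prod H)"
  shows "AE t in leb T. sq_int M (H t)"
    "integrable (leb T) (\<lambda>t. (l2norm M (H t))\<^sup>2)"
    "(\<integral>t. (l2norm M (H t))\<^sup>2 \<partial>leb T) = (l2norm PM (case_prod H))\<^sup>2"
proof -
  have [measurable]: "case_prod H \<in> borel_measurable PM" using H by (rule sq_int_measurable)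
  have i: "integrable PM (\<lambda>(s, w). (norm (H s w))\<^sup>2)" using sq_intD[OF H] by (simp add: case_prod_beta')
  show "AE t in leb T. sq_int M (H t)"
    using TM.AE_integrable_fst[OF i] AE_space
  proof eventually_elim
    case (elim t)
    then have "(\<lambda>w. case_prod H (t, w)) \<in> borel_measurable M" by measurable
    with elim show ?case by (simp add: sq_int_def)
  qed
  show "integrable (leb T) (\<lambda>t. (l2norm M (H t))\<^sup>2)"
    using TM.integrable_fst[OF i] by (simp add: l2norm_sq)
  show "(\<integral>t. (l2norm M (H t))\<^sup>2 \<partial>leb T) = (l2norm PM (case_prod H))\<^sup>2"
    using TM.integral_fst[OF i] by (simp add: l2norm_sq case_prod_beta')
qed

lemma time_integral_measurable:
  assumes H: "sq_int PM (case_prod H)" and A: "A \<subseteq> {0..T}" "A \<in> sets borel"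
  shows "(\<lambda>w. LBINT r:A. H r w) \<in> borel_measurable M"
proof -
  have [measurable]: "restr A H \<in> borel_measurable PM"
    using sq_int_restr(1)[OF H A(2)] by (rule sq_int_measurable)
  have "(\<lambda>x. restr A H (snd x, fst x)) \<in> borel_measurable (M \<Otimes>\<^sub>M leb T)" by measurable
  then have "(\<lambda>(w, r). indicator A r *\<^sub>R H r w) \<in> borel_measurable (M \<Otimes>\<^sub>M leb T)"
    by (simp add: restr_def case_prod_beta')
  then show ?thesis unfolding set_integral_leb(1)[OF A(1)]
    by (rule tm.borel_measurable_lebesgue_integral)
qed

lemma time_integral_l2:
  assumes H: "sq_int PM (case_prod H)" and s: "0 \<le> s" "s \<le> t" "t \<le> T"
  shows "sq_int M (\<lambda>w. LBINT r:{s..t}. H r w)"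
    "l2norm M (\<lambda>w. LBINT r:{s..t}. H r w) \<le> sqrt (t - s) * l2norm PM (restr {s..t} H)"
proof -
  have sub: "{s..t} \<subseteq> {0..T}" using s by auto
  have m: "(\<lambda>w. LBINT r:{s..t}. H r w) \<in> borel_measurable M"
    by (rule time_integral_measurable[OF H sub]) auto
  have R: "sq_int PM (case_prod (\<lambda>r w. indicator {s..t} r *\<^sub>R H r w))"
    using sq_int_restr(1)[OF H, of "{s..t}"] by (simp add: restr_def)
  have le: "AE w in M. (norm (LBINT r:{s..t}. H r w))\<^sup>2
      \<le> (t - s) * (l2norm (leb T) (\<lambda>r. indicator {s..t} r *\<^sub>R H r w))\<^sup>2"
    using path_sq_int(1)[OF H]
  proof eventually_elim
    case (elim w)
    have "(norm (LBINT r:{s..t}. H r w))\<^sup>2 \<le> (sqrt (t - s) * l2norm (leb T) (\<lambda>r. indicator {s..t} r *\<^sub>R H r w))\<^sup>2"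
      by (intro power_mono norm_time_integral_le[OF elim s]) auto
    then show ?case using s by (simp add: power_mult_distrib)
  qed
  have int: "integrable M (\<lambda>w. (t - s) * (l2norm (leb T) (\<lambda>r. indicator {s..t} r *\<^sub>R H r w))\<^sup>2)"
    by (intro integrable_mult_right path_sq_int(2)[OF R])
  have i: "integrable M (\<lambda>w. (norm (LBINT r:{s..t}. H r w))\<^sup>2)"
    by (rule Bochner_Integration.integrable_bound[OF int]) (use m le s in auto)
  show sq: "sq_int M (\<lambda>w. LBINT r:{s..t}. H r w)" using m i by (simp add: sq_int_def)
  have "(l2norm M (\<lambda>w. LBINT r:{s..t}. H r w))\<^sup>2 \<le> (\<integral>w. (t - s) * (l2norm (leb T) (\<lambda>r. indicator {s..t} r *\<^sub>R H r w))\<^sup>2 \<partial>M)"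
    unfolding l2norm_sq[of M] by (rule integral_mono_AE[OF i int le])
  also have "\<dots> = (t - s) * (l2norm PM (restr {s..t} H))\<^sup>2"
    using path_sq_int(3)[OF R] by (simp add: restr_def)
  also have "\<dots> = (sqrt (t - s) * l2norm PM (restr {s..t} H))\<^sup>2" using s by (simp add: power_mult_distrib)
  finally show "l2norm M (\<lambda>w. LBINT r:{s..t}. H r w) \<le> sqrt (t - s) * l2norm PM (restr {s..t} H)"
    using s by (simp add: power2_le_iff_abs_le)
qed

lemma time_integral_diff:
  assumes H: "sq_int PM (case_prod H)" and G: "sq_int PM (case_prod G)" and A: "A \<in> sets borel" "A \<subseteq> {0..T}"
  shows "AE w in M. (LBINT r:A. H r w - G r w) = (LBINT r:A. H r w) - (LBINT r:A. G r w)"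
  using path_sq_int(1)[OF H] path_sq_int(1)[OF G]
  by eventually_elim (intro set_integral_diff(2) sq_int_set_integrable[OF _ A(2,1)])

lemma time_integral_expectation:
  assumes H: "sq_int PM (case_prod H)" and A: "A \<in> sets borel" "A \<subseteq> {0..T}"
  shows "(\<integral>w. (LBINT r:A. H r w) \<partial>M) = (LBINT r:A. mean M H r)"
proof -
  have i: "integrable PM (\<lambda>(r, w). indicator A r *\<^sub>R H r w)"
    using PM.sq_int_integrable[OF sq_int_restr(1)[OF H A(1)]] by (simp add: restr_def)
  show ?thesis
    unfolding set_integral_leb(1)[OF A(2)] using TM.Fubini_integral[OF i] by simp
qed

lemma time_integral_path_continuous:
  assumes H: "sq_int PM (case_prod H)"
  shows "AE w in M. continuous_on {0..T} (\<lambda>t. LBINT s:{0..t}. H s w)"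
  using path_sq_int(1)[OF H]
  by eventually_elim (intro time_integral_continuous sq_int_set_integrable; auto)

lemma l2_tendsto_add:
  assumes "\<And>n. sq_int N (f n)" "sq_int N f'" "\<And>n. sq_int N (g n)" "sq_int N g'"
    "(\<lambda>n. l2norm N (\<lambda>x. f n x - f' x)) \<longlonglongrightarrow> 0" "(\<lambda>n. l2norm N (\<lambda>x. g n x - g' x)) \<longlonglongrightarrow> 0"
  shows "(\<lambda>n. l2norm N (\<lambda>x. (f n x + g n x) - (f' x + g' x))) \<longlonglongrightarrow> 0"
proof -
  have "l2norm N (\<lambda>x. - g n x - - g' x) = l2norm N (\<lambda>x. g n x - g' x)" for n
    unfolding l2norm_def by (simp add: norm_minus_commute)
  then have "(\<lambda>n. l2norm N (\<lambda>x. - g n x - - g' x)) \<longlonglongrightarrow> 0" using assms(6) by simp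
  from l2_tendsto_diff[OF assms(1,2) sq_int_minus[OF assms(3)] sq_int_minus[OF assms(4)] assms(5) this]
  show ?thesis by simp
qed

lemma simple_integral_drift:
  assumes VE: "simple_integral (\<lambda>t w. LBINT s:{0..t}. h s) V E" and h: "bdd_meas T h" and t: "0 \<le> t" "t \<le> T"
  shows "set_integrable lborel {0..t} (\<lambda>s. h s *\<^sub>R V s w) \<and> E t w = (LBINT s:{0..t}. h s *\<^sub>R V s w)"
  using VE
proof induction
  case zero show ?case by (simp add: set_integrable_def)
next
  case (step V E a b \<xi> K)
  obtain C where C: "\<And>s. s \<in> {0..T} \<Longrightarrow> \<bar>h s\<bar> \<le> C" using h by (force simp: bdd_meas_def bounded_iff)
  have "sq_int (leb T) h"
    by (rule tm.sq_int_bounded[OF bdd_meas_measurable[OF h], of C]) (use C in auto)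
  then have hi: "set_integrable lborel A h" if "A \<subseteq> {0..T}" "A \<in> sets borel" for A
    by (rule sq_int_set_integrable[OF _ that])
  have sp: "(LBINT s:{0..u}. h s) - (LBINT s:{0..v}. h s) = (LBINT s:{v<..u}. h s)" if "0 \<le> v" "v \<le> u" "u \<le> T" for u v
  proof -
    have "{0..u} = {0..v} \<union> {v<..u}" using that by auto
    then show ?thesis using that
      by (simp add: set_integral_Un[OF _ hi hi, of "{0..v}" "{v<..u}"] disjoint_iff subset_eq)
  qed
  have S: "{min t a<..min t b} \<inter> {0..t} = {a<..b} \<inter> {0..t}" "{min t a<..min t b} \<subseteq> {0..t}" using step t by auto
  have eq: "(\<lambda>s. indicator {0..t} s *\<^sub>R (h s *\<^sub>R (indicator {a<..b} s *\<^sub>R \<xi> w)))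
     = (\<lambda>s. (indicator {min t a<..min t b} s *\<^sub>R h s) *\<^sub>R \<xi> w)"
    using step t by (auto simp: indicator_def fun_eq_iff)
  have sub: "{min t a<..min t b} \<subseteq> {0..T}" using step t by auto
  have i: "integrable lborel (\<lambda>s. indicator {min t a<..min t b} s *\<^sub>R h s)"
    using hi[OF sub] by (simp add: set_integrable_def)
  have 1: "set_integrable lborel {0..t} (\<lambda>s. h s *\<^sub>R (indicator {a<..b} s *\<^sub>R \<xi> w))"
    unfolding set_integrable_def eq by (rule integrable_scaleR_left) (rule i)
  have 2: "(LBINT s:{0..t}. h s *\<^sub>R (indicator {a<..b} s *\<^sub>R \<xi> w)) = (LBINT s:{min t a<..min t b}. h s) *\<^sub>R \<xi> w"
    unfolding set_lebesgue_integral_def eq by (rule integral_scaleR_left) (rule i)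
  have 3: "(LBINT s:{0..min t b}. h s) - (LBINT s:{0..min t a}. h s) = (LBINT s:{min t a<..min t b}. h s)"
    using step t by (intro sp) auto
  show ?case
    unfolding scaleR_add_right 3 using step.IH 1 2 set_integral_add[of lborel "{0..t}"] by simp
qed

lemma elementary_integral_diff:
  "elementary_integral (\<lambda>t w. Z t w - Z' t w) m \<tau> \<xi> t w = elementary_integral Z m \<tau> \<xi> t w - elementary_integral Z' m \<tau> \<xi> t w"
  unfolding elementary_integral_def sum_subtractf[symmetric]
  by (intro sum.cong refl) (simp add: algebra_simps)

lemma elementary_integral_drift:
  fixes \<xi> :: "nat \<Rightarrow> 'a \<Rightarrow> 'b::euclidean_space"
  assumes el: "elementary_process M T F m \<tau> \<xi>" and h: "bdd_meas T h" and t: "0 \<le> t" "t \<le> T"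
  shows "elementary_integral (\<lambda>t w. LBINT s:{0..t}. h s) m \<tau> \<xi> t w = (LBINT s:{0..t}. h s *\<^sub>R elementary_val m \<tau> \<xi> s w)"
  using simple_integral_drift[OF elementary_simple_integral[OF el] h t] by blast

lemma drift_scale_sq_int:
  fixes H :: "('a, 'b::euclidean_space) process"
  assumes H: "sq_int PM (case_prod H)" and h: "bdd_meas T h"
  obtains C where "0 \<le> C" "\<And>G :: ('a, 'b) process. sq_int PM (case_prod G) \<Longrightarrow>
    sq_int PM (case_prod (\<lambda>s w. h s *\<^sub>R G s w)) \<and>
    l2norm PM (case_prod (\<lambda>s w. h s *\<^sub>R G s w)) \<le> C * l2norm PM (case_prod G)"
proof -
  obtain C0 where C0: "\<And>s. s \<in> {0..T} \<Longrightarrow> \<bar>h s\<bar> \<le> C0" using h by (force simp: bdd_meas_def bounded_iff)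
  define C where "C = max 0 C0"
  have C: "0 \<le> C" "\<And>s. s \<in> {0..T} \<Longrightarrow> \<bar>h s\<bar> \<le> C" using C0 by (auto simp: C_def le_max_iff_disj)
  show ?thesis
  proof (rule that[OF C(1)])
    fix G :: "('a, 'b) process" assume G: "sq_int PM (case_prod G)"
    have [measurable]: "case_prod G \<in> borel_measurable PM" using G by (rule sq_int_measurable)
    have [measurable]: "h \<in> borel_measurable (leb T)" by (rule bdd_meas_measurable[OF h])
    have "(\<lambda>x. h (fst x) *\<^sub>R case_prod G x) \<in> borel_measurable PM" by measurable
    then have m: "case_prod (\<lambda>s w. h s *\<^sub>R G s w) \<in> borel_measurable PM" by (simp add: case_prod_beta')
    have le: "AE x in PM. norm (case_prod (\<lambda>s w. h s *\<^sub>R G s w) x) \<le> C * norm (case_prod G x)"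
      using C(2) by (intro AE_I2) (auto simp: space_pair_measure intro!: mult_right_mono)
    show "sq_int PM (case_prod (\<lambda>s w. h s *\<^sub>R G s w)) \<and>
      l2norm PM (case_prod (\<lambda>s w. h s *\<^sub>R G s w)) \<le> C * l2norm PM (case_prod G)"
      using sq_int_bound[OF G m le] l2norm_mono[OF G m le C(1)] by blast
  qed
qed

lemma drift_l2_tendsto:
  fixes V :: "nat \<Rightarrow> ('a, 'b::euclidean_space) process"
  assumes V: "\<And>j. sq_int PM (case_prod (V j))" and H: "sq_int PM (case_prod H)" and h: "bdd_meas T h"
    and l: "(\<lambda>j. l2norm PM (\<lambda>x. case_prod (V j) x - case_prod H x)) \<longlonglongrightarrow> 0" and t: "0 \<le> t" "t \<le> T"
  shows "\<And>j. sq_int M (\<lambda>w. LBINT s:{0..t}. h s *\<^sub>R V j s w)" "sq_int M (\<lambda>w. LBINT s:{0..t}. h s *\<^sub>R H s w)"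
    "(\<lambda>j. l2norm M (\<lambda>w. (LBINT s:{0..t}. h s *\<^sub>R V j s w) - (LBINT s:{0..t}. h s *\<^sub>R H s w))) \<longlonglongrightarrow> 0"
proof -
  obtain C where C: "0 \<le> C" "\<And>G :: ('a, 'b) process. sq_int PM (case_prod G) \<Longrightarrow>
    sq_int PM (case_prod (\<lambda>s w. h s *\<^sub>R G s w)) \<and>
    l2norm PM (case_prod (\<lambda>s w. h s *\<^sub>R G s w)) \<le> C * l2norm PM (case_prod G)"
    using drift_scale_sq_int[OF H h] by blast
  show sV: "sq_int M (\<lambda>w. LBINT s:{0..t}. h s *\<^sub>R V j s w)" for j
    using C(2)[OF V] by (intro time_integral_l2 t) auto
  show sH: "sq_int M (\<lambda>w. LBINT s:{0..t}. h s *\<^sub>R H s w)"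
    using C(2)[OF H] by (intro time_integral_l2 t) auto
  show "(\<lambda>j. l2norm M (\<lambda>w. (LBINT s:{0..t}. h s *\<^sub>R V j s w) - (LBINT s:{0..t}. h s *\<^sub>R H s w))) \<longlonglongrightarrow> 0"
  proof (rule Lim_null_comparison[OF always_eventually], rule allI)
    fix j
    let ?D = "\<lambda>s w. V j s w - H s w"
    have D: "sq_int PM (case_prod ?D)" using sq_int_diff[OF V[of j] H] by (simp add: case_prod_beta')
    have A: "{0..t} \<in> sets borel" "{0..t} \<subseteq> {0..T}" using t by auto
    have ae: "AE w in M. (LBINT s:{0..t}. h s *\<^sub>R ?D s w) = (LBINT s:{0..t}. h s *\<^sub>R V j s w) - (LBINT s:{0..t}. h s *\<^sub>R H s w)"
      using time_integral_diff[of "\<lambda>s w. h s *\<^sub>R V j s w" "\<lambda>s w. h s *\<^sub>R H s w", OF _ _ A] C(2)[OF V] C(2)[OF H]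
      by (simp add: scaleR_diff_right)
    have "l2norm M (\<lambda>w. (LBINT s:{0..t}. h s *\<^sub>R V j s w) - (LBINT s:{0..t}. h s *\<^sub>R H s w)) = l2norm M (\<lambda>w. LBINT s:{0..t}. h s *\<^sub>R ?D s w)"
    proof (rule l2norm_cong_AE)
      show "(\<lambda>w. (LBINT s:{0..t}. h s *\<^sub>R V j s w) - (LBINT s:{0..t}. h s *\<^sub>R H s w)) \<in> borel_measurable M"
        by (intro borel_measurable_diff sq_int_measurable sV sH)
      show "(\<lambda>w. LBINT s:{0..t}. h s *\<^sub>R ?D s w) \<in> borel_measurable M"
        using C(2)[OF D] A by (intro time_integral_measurable) auto
    qed (use ae in eventually_elim, simp)
    also have "\<dots> \<le> sqrt (t - 0) * l2norm PM (restr {0..t} (\<lambda>s w. h s *\<^sub>R ?D s w))"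
      using C(2)[OF D] t by (intro time_integral_l2) auto
    also have "\<dots> \<le> sqrt (t - 0) * (C * l2norm PM (case_prod ?D))"
      using C(2)[OF D] sq_int_restr(2)[of "\<lambda>s w. h s *\<^sub>R ?D s w" "{0..t}"] t
      by (intro mult_left_mono) (auto intro: order_trans)
    finally show "norm (l2norm M (\<lambda>w. (LBINT s:{0..t}. h s *\<^sub>R V j s w) - (LBINT s:{0..t}. h s *\<^sub>R H s w)))
      \<le> sqrt t * (C * l2norm PM (\<lambda>x. case_prod (V j) x - case_prod H x))" by (simp add: case_prod_beta')
    show "(\<lambda>j. sqrt t * (C * l2norm PM (\<lambda>x. case_prod (V j) x - case_prod H x))) \<longlonglongrightarrow> 0"
      using tendsto_mult_right_zero[OF tendsto_mult_right_zero[OF l, of C], of "sqrt t"] .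
  qed
qed

text \<open>The process \<open>H\<close> is adapted and jointly measurable, but not assumed progressively measurable. For an elementary process
  the time integral is its elementary integral against the deterministic integrator \<open>\<integral> h\<close>, hence
  adapted, and adaptedness passes to mean-square limits.\<close>

theorem time_integral_adapted:
  fixes H :: "('a, 'b::euclidean_space) process"
  assumes H: "H \<in> M2_space M T F" and h: "bdd_meas T h" and t: "0 \<le> t" "t \<le> T"
  shows "(\<lambda>w. LBINT s:{0..t}. h s *\<^sub>R H s w) \<in> borel_measurable (F t)"
proof -
  obtain m \<tau> \<xi> where el: "\<And>j::nat. elementary_process M T F (m j) (\<tau> j) (\<xi> j)"
    and le: "\<And>j. l2norm PM (\<lambda>x. case_prod (elementary_val (m j) (\<tau> j) (\<xi> j)) x - case_prod H x) \<le> (1/4) ^ j"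
    using M2_approximation[OF H] by blast
  have Hsq: "sq_int PM (case_prod H)" using H by (simp add: M2_space_iff)
  have l: "(\<lambda>j. l2norm PM (\<lambda>x. case_prod (elementary_val (m j) (\<tau> j) (\<xi> j)) x - case_prod H x)) \<longlonglongrightarrow> 0"
    by (rule Lim_null_comparison[OF always_eventually LIMSEQ_realpow_zero[of "1/4"]]) (use le in auto)
  note d = drift_l2_tendsto[OF elementary_val_measurable[OF el] Hsq h l t]
  have m: "(\<lambda>w. LBINT s:{0..t}. h s *\<^sub>R elementary_val (m j) (\<tau> j) (\<xi> j) s w) \<in> borel_measurable (F t)" for j
  proof -
    have "elementary_integral (\<lambda>t w. LBINT s:{0..t}. h s) (m j) (\<tau> j) (\<xi> j) t \<in> borel_measurable (F t)"
    proof -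
      have "E t \<in> borel_measurable (F t)" if "simple_integral (\<lambda>t w. LBINT s:{0..t}. h s) V E" for V E :: "('a, 'b) process"
        using that
      proof induction
        case (step V E a b \<xi> K)
        show ?case
        proof (cases "a \<le> t")
          case True
          show ?thesis
            by (intro borel_measurable_add step.IH borel_measurable_scaleR borel_measurable_const F_measurable_mono[OF step.hyps(5) True t(2)])
        next
          case False
          then have "min t b = min t a" using step.hyps by auto
          then show ?thesis using step.IH by simp
        qed
      qed simp
      from this[OF elementary_simple_integral[OF el]] show ?thesis .
    qed
    then show ?thesis unfolding elementary_integral_drift[OF el h t, abs_def] .
  qed
  show ?thesis
    by (rule augmented_l2_limit[OF finite_measure_axioms F_augmented[OF t(2)] m d])
qed

text \<open>Elementary integrals against \<open>Z - \<integral> h\<close> split into one against \<open>Z\<close> and a time integral, and each part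
  converges in mean square for the same approximants.\<close>

lemma has_stoch_integral_exists:
  assumes Z: "integrator Z" "covariation 1 Z Z" and H: "H \<in> M2_space M T F"
  obtains I where "ito Z H I" "\<And>h. bdd_meas T h \<Longrightarrow>
    has_stoch_integral M T F (\<lambda>t w. Z t w - (LBINT s:{0..t}. h s)) H (\<lambda>t w. I t w - (LBINT s:{0..t}. h s *\<^sub>R H s w))"
proof -
  obtain I m \<tau> \<xi> where I: "ito Z H I" "\<And>w. continuous_on {0..T} (\<lambda>t. I t w)"
    and el: "\<And>j::nat. elementary_process M T F (m j) (\<tau> j) (\<xi> j)"
    and l: "(\<lambda>j. l2norm PM (\<lambda>x. case_prod (elementary_val (m j) (\<tau> j) (\<xi> j)) x - case_prod H x)) \<longlonglongrightarrow> 0"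
    and E: "\<And>t. 0 \<le> t \<Longrightarrow> t \<le> T \<Longrightarrow> (\<lambda>j. l2norm M (\<lambda>w. elementary_integral Z (m j) (\<tau> j) (\<xi> j) t w - I t w)) \<longlonglongrightarrow> 0"
    using stoch_integral_exists[OF Z H] by blast
  have Hsq: "sq_int PM (case_prod H)" using H by (simp add: M2_space_iff)
  note Vsq = elementary_val_measurable[OF el]
  show ?thesis
  proof (rule that[OF I(1)])
    fix h :: "real \<Rightarrow> real" assume h: "bdd_meas T h"
    let ?J = "\<lambda>t w. I t w - (LBINT s:{0..t}. h s *\<^sub>R H s w)"
    let ?Z = "\<lambda>t w. Z t w - (LBINT s:{0..t}. h s)"
    have hH: "sq_int PM (case_prod (\<lambda>s w. h s *\<^sub>R H s w))"
      using drift_scale_sq_int[OF Hsq h] Hsq by blast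
    show "has_stoch_integral M T F ?Z H ?J"
      unfolding has_stoch_integral_def
    proof (intro conjI exI allI ballI)
      show "H \<in> M2_space M T F" by fact
      show "adapted T F ?J"
        unfolding adapted_def
        by (intro ballI borel_measurable_diff itoD(2)[OF I(1)] time_integral_adapted[OF H h]) auto
      show "AE w in M. continuous_on {0..T} (\<lambda>t. ?J t w)"
        using time_integral_path_continuous[OF hH] by eventually_elim (intro continuous_on_diff I(2))
      show "elementary_process M T F (m j) (\<tau> j) (\<xi> j)" for j by (rule el)
      have "(\<lambda>j. ennreal ((l2norm PM (\<lambda>x. case_prod (elementary_val (m j) (\<tau> j) (\<xi> j)) x - case_prod H x))\<^sup>2)) \<longlonglongrightarrow> 0"
        using tendsto_ennrealI[OF tendsto_power[OF l, of 2]] by simp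
      then show "(\<lambda>j. \<integral>\<^sup>+w. (\<integral>\<^sup>+t\<in>{0..T}. ennreal ((norm (elementary_val (m j) (\<tau> j) (\<xi> j) t w - H t w))\<^sup>2) \<partial>lborel) \<partial>M) \<longlonglongrightarrow> 0"
        unfolding nn_integral_M2_eq[OF Vsq Hsq] .
    next
      fix t assume "t \<in> {0..T}"
      then have t: "0 \<le> t" "t \<le> T" by auto
      note d = drift_l2_tendsto[OF Vsq Hsq h l t]
      note e = simple_integral_sq_int[OF elementary_simple_integral[OF el] Z t]
      have "(\<lambda>j. l2norm M (\<lambda>w. (elementary_integral Z (m j) (\<tau> j) (\<xi> j) t w - (LBINT s:{0..t}. h s *\<^sub>R elementary_val (m j) (\<tau> j) (\<xi> j) s w)) - ?J t w)) \<longlonglongrightarrow> 0"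
        by (rule l2_tendsto_diff[OF e itoD(3)[OF I(1) t] d(1,2) E[OF t] d(3)])
      then show "(\<lambda>j. \<integral>\<^sup>+w. ennreal ((norm (elementary_integral ?Z (m j) (\<tau> j) (\<xi> j) t w - ?J t w))\<^sup>2) \<partial>M) \<longlonglongrightarrow> 0"
        unfolding elementary_integral_diff elementary_integral_drift[OF el h t]
        using l2_tendsto_iff_nn_integral[of M "\<lambda>j w. elementary_integral Z (m j) (\<tau> j) (\<xi> j) t w - (LBINT s:{0..t}. h s *\<^sub>R elementary_val (m j) (\<tau> j) (\<xi> j) s w)" "?J t",
          OF sq_int_diff[OF e d(1)] sq_int_diff[OF itoD(3)[OF I(1) t] d(2)]] by blast
    qed
  qed
qed

lemma has_stoch_integral_drift_ito:
  assumes Z: "integrator Z" "covariation 1 Z Z" and h: "bdd_meas T h"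
    and J: "has_stoch_integral M T F (\<lambda>t w. Z t w - (LBINT s:{0..t}. h s)) H J"
  shows "ito Z H (\<lambda>t w. J t w + (LBINT s:{0..t}. h s *\<^sub>R H s w))"
proof -
  let ?Z = "\<lambda>t w. Z t w - (LBINT s:{0..t}. h s)"
  obtain m \<tau> \<xi> where el: "\<And>j. elementary_process M T F (m j) (\<tau> j) (\<xi> j)"
    and l1: "(\<lambda>j::nat. \<integral>\<^sup>+w. (\<integral>\<^sup>+t\<in>{0..T}. ennreal ((norm (elementary_val (m j) (\<tau> j) (\<xi> j) t w - H t w))\<^sup>2) \<partial>lborel) \<partial>M) \<longlonglongrightarrow> 0"
    and l2: "\<And>t. t\<in>{0..T} \<Longrightarrow> (\<lambda>j. \<integral>\<^sup>+w. ennreal ((norm (elementary_integral ?Z (m j) (\<tau> j) (\<xi> j) t w - J t w))\<^sup>2) \<partial>M) \<longlonglongrightarrow> 0"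
    and HI: "H \<in> M2_space M T F" "adapted T F J" "AE w in M. continuous_on {0..T} (\<lambda>t. J t w)"
    using J unfolding has_stoch_integral_def by blast
  note si = elementary_simple_integral[OF el, of Z]
  note Vsq = elementary_val_measurable[OF el]
  have Hsq: "sq_int PM (case_prod H)" using HI(1) by (simp add: M2_space_iff)
  have hH: "sq_int PM (case_prod (\<lambda>s w. h s *\<^sub>R H s w))"
    using drift_scale_sq_int[OF Hsq h] Hsq by blast
  have c1: "(\<lambda>j. l2norm PM (\<lambda>x. case_prod (elementary_val (m j) (\<tau> j) (\<xi> j)) x - case_prod H x)) \<longlonglongrightarrow> 0"
  proof -
    have "(\<lambda>j. ennreal ((l2norm PM (\<lambda>x. case_prod (elementary_val (m j) (\<tau> j) (\<xi> j)) x - case_prod H x))\<^sup>2)) \<longlonglongrightarrow> 0"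
      using l1 unfolding nn_integral_M2_eq[OF Vsq Hsq] .
    then show ?thesis
      using l2_tendsto_iff_nn_integral[of PM "\<lambda>j. case_prod (elementary_val (m j) (\<tau> j) (\<xi> j))" "case_prod H", OF Vsq Hsq]
        nn_integral_sq[OF sq_int_diff[OF Vsq Hsq]] by simp
  qed
  have Jm: "J t \<in> borel_measurable (F t)" if "0 \<le> t" "t \<le> T" for t using HI(2) that unfolding adapted_def by auto
  have L: "sq_int M (\<lambda>w. J t w + (LBINT s:{0..t}. h s *\<^sub>R H s w)) \<and>
    (\<lambda>j. l2norm M (\<lambda>w. elementary_integral Z (m j) (\<tau> j) (\<xi> j) t w - (J t w + (LBINT s:{0..t}. h s *\<^sub>R H s w)))) \<longlonglongrightarrow> 0"
    if t: "0 \<le> t" "t \<le> T" for t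
  proof -
    have tt: "t \<in> {0..T}" using t by simp
    note d = drift_l2_tendsto[OF Vsq Hsq h c1 t]
    note e = simple_integral_sq_int[OF si Z t]
    let ?E = "\<lambda>j w. elementary_integral Z (m j) (\<tau> j) (\<xi> j) t w - (LBINT s:{0..t}. h s *\<^sub>R elementary_val (m j) (\<tau> j) (\<xi> j) s w)"
    have E: "sq_int M (?E j)" for j by (rule sq_int_diff[OF e d(1)])
    have l2': "(\<lambda>j. \<integral>\<^sup>+w. ennreal ((norm (?E j w - J t w))\<^sup>2) \<partial>M) \<longlonglongrightarrow> 0"
      using l2[OF tt] unfolding elementary_integral_diff elementary_integral_drift[OF el h t] .
    have "eventually (\<lambda>j. (\<integral>\<^sup>+w. ennreal ((norm (?E j w - J t w))\<^sup>2) \<partial>M) < 1) sequentially"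
      by (rule order_tendstoD(2)[OF l2']) simp
    then obtain j where j: "(\<integral>\<^sup>+w. ennreal ((norm (?E j w - J t w))\<^sup>2) \<partial>M) < 1"
      by (auto simp: eventually_sequentially)
    have "J t \<in> borel_measurable M" using F_measurableD[OF Jm[OF t] t(2)] .
    then have "(\<lambda>w. ?E j w - J t w) \<in> borel_measurable M"
      by (intro borel_measurable_diff sq_int_measurable[OF E])
    then have "sq_int M (\<lambda>w. ?E j w - J t w)"
      using j by (subst sq_int_iff_nn_integral) (auto intro: order_less_trans)
    from sq_int_diff[OF E[of j] this] have Jsq: "sq_int M (J t)" by simp
    have "(\<lambda>j. l2norm M (\<lambda>w. ?E j w - J t w)) \<longlonglongrightarrow> 0"
      using l2' l2_tendsto_iff_nn_integral[of M ?E "J t", OF E Jsq] by blast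
    from l2_tendsto_add[OF E Jsq d(1,2) this d(3)]
    have "(\<lambda>j. l2norm M (\<lambda>w. elementary_integral Z (m j) (\<tau> j) (\<xi> j) t w - (J t w + (LBINT s:{0..t}. h s *\<^sub>R H s w)))) \<longlonglongrightarrow> 0"
      by simp
    with sq_int_add[OF Jsq d(2)] show ?thesis by blast
  qed
  have cont: "AE w in M. continuous_on {0..T} (\<lambda>t. J t w + (LBINT s:{0..t}. h s *\<^sub>R H s w))"
    using HI(3) time_integral_path_continuous[OF hH] by eventually_elim (rule continuous_on_add)
  show ?thesis
    by (rule itoI[OF Hsq borel_measurable_add[OF Jm time_integral_adapted[OF HI(1) h]] _ cont si c1]) (use L in auto)
qed

end

section \<open>Stochastic differential equations of mean-field type\<close>

lemma dyadic_sup_le: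
  assumes "0 \<le> T" "\<And>t. 0 \<le> t \<Longrightarrow> t \<le> T \<Longrightarrow> ennreal ((norm (E t w))\<^sup>2) \<le> c"
  shows "dyadic_sup T E w \<le> c"
  unfolding dyadic_sup_def using dyadic_time_bounds[OF assms(1)] by (intro SUP_least assms(2)) auto

lemma dyadic_sup_ge:
  assumes "k \<le> 2 ^ n"
  shows "ennreal ((norm (E (real k * T / 2 ^ n) w))\<^sup>2) \<le> dyadic_sup T E w"
  unfolding dyadic_sup_def using assms by (intro SUP_upper2[of n] SUP_upper) auto

lemma dyadic_sup_add:
  assumes T: "0 \<le> T"
  shows "dyadic_sup T (\<lambda>t w. E t w + E' t w) w \<le> 2 * dyadic_sup T E w + 2 * dyadic_sup T E' w"
  unfolding dyadic_sup_def[of T "\<lambda>t w. E t w + E' t w"]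
proof (intro SUP_least)
  fix n and k :: nat assume k: "k \<in> {..2 ^ n}"
  let ?t = "real k * T / 2 ^ n"
  have "ennreal ((norm (E ?t w + E' ?t w))\<^sup>2) \<le> ennreal (2 * (norm (E ?t w))\<^sup>2 + 2 * (norm (E' ?t w))\<^sup>2)"
    by (intro ennreal_leI norm_sq_add_le)
  also have "\<dots> = 2 * ennreal ((norm (E ?t w))\<^sup>2) + 2 * ennreal ((norm (E' ?t w))\<^sup>2)"
    by (simp add: ennreal_plus ennreal_mult)
  also have "\<dots> \<le> 2 * dyadic_sup T E w + 2 * dyadic_sup T E' w"
    using k by (intro add_mono mult_left_mono dyadic_sup_ge) auto
  finally show "ennreal ((norm (E ?t w + E' ?t w))\<^sup>2) \<le> 2 * dyadic_sup T E w + 2 * dyadic_sup T E' w" .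
qed

lemma dyadic_sup_cong:
  assumes T: "0 \<le> T" and eq: "\<And>t. t \<in> {0..T} \<Longrightarrow> E t w = E' t w"
  shows "dyadic_sup T E w = dyadic_sup T E' w"
  unfolding dyadic_sup_def using dyadic_time_bounds[OF T] eq by (intro SUP_cong refl) auto

lemma continuous_cadlag:
  assumes c: "continuous_on {0..T} f"
  shows "cadlag_on T f"
  unfolding cadlag_on_def
proof (intro conjI ballI exI)
  fix t assume t: "t \<in> {0..<T}"
  have "continuous_on {t..T} f" by (rule continuous_on_subset[OF c]) (use t in auto)
  then show "(f \<longlongrightarrow> f t) (at_right t)" by (rule continuous_on_Icc_at_rightD) (use t in auto)
next
  fix t assume t: "t \<in> {0<..T}"
  have "continuous_on {0..t} f" by (rule continuous_on_subset[OF c]) (use t in auto)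
  then show "(f \<longlongrightarrow> f t) (at_left t)" by (rule continuous_on_Icc_at_leftD) (use t in auto)
qed

lemma exp_integral_bound:
  fixes l t :: real
  assumes "0 < l" "0 \<le> t"
  shows "set_integrable lborel {0..t} (\<lambda>s. exp (l * s))" "(LBINT s:{0..t}. exp (l * s)) \<le> exp (l * t) / l"
proof -
  show i: "set_integrable lborel {0..t} (\<lambda>s. exp (l * s))"
    by (rule borel_integrable_atLeastAtMost') (intro continuous_intros)
  have "((\<lambda>s. exp (l * s)) has_integral (exp (l * t) / l - exp (l * 0) / l)) {0..t}"
  proof (rule fundamental_theorem_of_calculus[OF assms(2)])
    fix x
    have "((\<lambda>s. exp (l * s) / l) has_real_derivative exp (l * x)) (at x within {0..t})"
      by (rule derivative_eq_intros refl | use assms(1) in simp)+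
    then show "((\<lambda>s. exp (l * s) / l) has_vector_derivative exp (l * x)) (at x within {0..t})"
      by (simp add: has_real_derivative_iff_has_vector_derivative)
  qed
  then have "(LBINT s:{0..t}. exp (l * s)) = exp (l * t) / l - 1 / l"
    unfolding set_borel_integral_eq_integral(2)[OF i] by (simp add: integral_unique)
  then show "(LBINT s:{0..t}. exp (l * s)) \<le> exp (l * t) / l" using assms(1) by simp
qed

context filtered_space
begin

lemma S2_spaceD:
  assumes "X \<in> S2_space M T F"
  shows "\<And>t. 0 \<le> t \<Longrightarrow> t \<le> T \<Longrightarrow> X t \<in> borel_measurable (F t)"
    and "\<And>w. w \<in> space M \<Longrightarrow> cadlag_on T (\<lambda>t. X t w)"
    and "(\<integral>\<^sup>+w. (SUP t\<in>{0..T}. ennreal ((norm (X t w))\<^sup>2)) \<partial>M) < \<infinity>"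
  using assms by (auto simp: S2_space_def adapted_def)

lemma S2_l2_bound:
  assumes X: "X \<in> S2_space M T F"
  obtains K where "0 \<le> K" "\<And>t. 0 \<le> t \<Longrightarrow> t \<le> T \<Longrightarrow> sq_int M (X t) \<and> l2norm M (X t) \<le> K"
proof -
  let ?S = "\<integral>\<^sup>+w. (SUP t\<in>{0..T}. ennreal ((norm (X t w))\<^sup>2)) \<partial>M"
  define K where "K = sqrt (enn2real ?S)"
  have K: "?S = ennreal (K\<^sup>2)" using S2_spaceD(3)[OF X] by (simp add: K_def)
  show ?thesis
  proof (rule that)
    show "0 \<le> K" by (simp add: K_def)
    fix t assume t: "0 \<le> t" "t \<le> T"
    have "(\<integral>\<^sup>+w. ennreal ((norm (X t w))\<^sup>2) \<partial>M) \<le> ?S"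
      using t by (intro nn_integral_mono SUP_upper) auto
    then show "sq_int M (X t) \<and> l2norm M (X t) \<le> K"
      using F_measurableD[OF S2_spaceD(1)[OF X t] t(2)] unfolding K
      by (intro l2norm_le_if_nn_integral_le) (auto simp: K_def)
  qed
qed

text \<open>By right continuity the process is the limit of its values at the next dyadic time.\<close>

lemma cadlag_jointly_measurable:
  assumes Xm: "\<And>t. 0 \<le> t \<Longrightarrow> t \<le> T \<Longrightarrow> X t \<in> borel_measurable M"
    and c: "\<And>w. w \<in> space M \<Longrightarrow> cadlag_on T (\<lambda>t. X t w)"
  shows "case_prod X \<in> borel_measurable PM"
proof (rule borel_measurable_LIMSEQ_metric)
  define g where "g n k = min T ((real k + 1) / 2 ^ n)" for n k :: nat
  define k where "k n t = nat \<lfloor>t * 2 ^ n\<rfloor>" for n :: nat and t :: real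
  have g0: "0 \<le> g n k" "g n k \<le> T" for n k using T_pos by (auto simp: g_def)
  show "(\<lambda>x. X (g n (k n (fst x))) (snd x)) \<in> borel_measurable PM" for n
  proof (rule measurable_compose_countable[where f="\<lambda>j x. X (g n j) (snd x)"])
    show "(\<lambda>x. X (g n j) (snd x)) \<in> borel_measurable PM" for j
      by (rule measurable_compose[OF measurable_snd Xm[OF g0]])
    show "(\<lambda>x. k n (fst x)) \<in> PM \<rightarrow>\<^sub>M count_space UNIV" unfolding k_def by measurable
  qed
  fix x assume "x \<in> space PM"
  then obtain t w where x: "x = (t, w)" "t \<in> {0..T}" "w \<in> space M" by (auto simp: space_pair_measure)
  have "(\<lambda>n. X (g n (k n t)) w) \<longlonglongrightarrow> X t w"
  proof (cases "t = T")
    case True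
    have "g n (k n t) = T" for n
    proof -
      have "t * 2 ^ n \<le> real (k n t) + 1" unfolding k_def using x(2) by linarith
      then have "T \<le> (real (k n t) + 1) / 2 ^ n" using True by (simp add: field_simps)
      then show ?thesis by (simp add: g_def)
    qed
    then show ?thesis using True by simp
  next
    case False
    then have t: "t \<in> {0..<T}" using x(2) by auto
    have "t < (real (k n t) + 1) / 2 ^ n" for n
    proof -
      have "t * 2 ^ n < real (k n t) + 1" unfolding k_def using t by (simp; linarith)
      then show ?thesis by (simp add: field_simps)
    qed
    then have gt: "t < g n (k n t)" for n using t by (simp add: g_def)
    have "g n (k n t) \<le> t + (1/2) ^ n" for n
    proof -
      have "real (k n t) \<le> t * 2 ^ n" unfolding k_def using t by simp
      then have "(real (k n t) + 1) / 2 ^ n \<le> t + 1 / 2 ^ n" by (simp add: field_simps)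
      then show ?thesis by (simp add: g_def power_divide)
    qed
    then have le: "eventually (\<lambda>n. g n (k n t) \<le> t + (1/2) ^ n) sequentially" by (intro always_eventually) blast
    have ge: "eventually (\<lambda>n. t \<le> g n (k n t)) sequentially" using gt by (intro always_eventually) (blast intro: less_imp_le)
    have "(\<lambda>n. t + (1/2) ^ n) \<longlonglongrightarrow> t + 0" by (intro tendsto_intros LIMSEQ_realpow_zero) auto
    then have "(\<lambda>n. t + (1/2) ^ n) \<longlonglongrightarrow> t" by simp
    from tendsto_sandwich[OF ge le tendsto_const this]
    have lim: "(\<lambda>n. g n (k n t)) \<longlonglongrightarrow> t" .
    have fl: "filterlim (\<lambda>n. g n (k n t)) (at_right t) sequentially"
      unfolding filterlim_at
    proof (rule conjI[OF _ lim], rule always_eventually, rule allI)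
      fix n show "g n (k n t) \<in> {t<..} \<and> g n (k n t) \<noteq> t" using gt[of n] by simp
    qed
    have "((\<lambda>t. X t w) \<longlongrightarrow> X t w) (at_right t)"
      using c[OF x(3)] t unfolding cadlag_on_def by blast
    from filterlim_compose[OF this fl] show ?thesis .
  qed
  then show "(\<lambda>n. X (g n (k n (fst x))) (snd x)) \<longlonglongrightarrow> case_prod X x" using x by simp
qed

lemma S2_M2:
  assumes X: "X \<in> S2_space M T F"
  shows "X \<in> M2_space M T F"
proof -
  obtain K where K: "0 \<le> K" "\<And>t. 0 \<le> t \<Longrightarrow> t \<le> T \<Longrightarrow> sq_int M (X t) \<and> l2norm M (X t) \<le> K"
    using S2_l2_bound[OF X] by blast
  have [measurable]: "case_prod X \<in> borel_measurable PM"
    using K S2_spaceD(2)[OF X] by (intro cadlag_jointly_measurable sq_int_measurable) auto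
  have "(\<integral>\<^sup>+x. ennreal ((norm (case_prod X x))\<^sup>2) \<partial>PM) = (\<integral>\<^sup>+t. \<integral>\<^sup>+w. ennreal ((norm (case_prod X (t, w)))\<^sup>2) \<partial>M \<partial>leb T)"
    by (rule nn_integral_fst[symmetric]) measurable
  also have "\<dots> \<le> (\<integral>\<^sup>+t. ennreal (K\<^sup>2) \<partial>leb T)"
  proof (rule nn_integral_mono)
    fix t assume "t \<in> space (leb T)"
    then have t: "0 \<le> t" "t \<le> T" by auto
    show "(\<integral>\<^sup>+w. ennreal ((norm (case_prod X (t, w)))\<^sup>2) \<partial>M) \<le> ennreal (K\<^sup>2)"
      using K(2)[OF t] by (simp add: nn_integral_sq ennreal_leI power_mono)
  qed
  also have "\<dots> < \<infinity>" by (simp add: ennreal_mult_less_top emeasure_restrict_space emeasure_lborel_Icc_eq)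
  finally show ?thesis
    using S2_spaceD(1)[OF X] by (simp add: M2_space_iff sq_int_iff_nn_integral adapted_def)
qed

lemma continuous_S2:
  assumes ad: "\<And>t. 0 \<le> t \<Longrightarrow> t \<le> T \<Longrightarrow> X t \<in> borel_measurable (F t)"
    and c: "\<And>w. continuous_on {0..T} (\<lambda>t. X t w)" and b: "(\<integral>\<^sup>+w. dyadic_sup T X w \<partial>M) < \<infinity>"
  shows "X \<in> S2_space M T F"
proof -
  have "(\<integral>\<^sup>+w. (SUP t\<in>{0..T}. ennreal ((norm (X t w))\<^sup>2)) \<partial>M) \<le> (\<integral>\<^sup>+w. dyadic_sup T X w \<partial>M)"
    by (intro nn_integral_mono SUP_least norm_le_dyadic_sup[OF T_pos c]) auto
  then show ?thesis using ad c b continuous_cadlag by (auto simp: S2_space_def adapted_def intro: order_le_less_trans)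
qed

text \<open>The path is replaced by zero on the exceptional null set.\<close>

lemma continuous_version:
  fixes Z :: "('a, 'b::euclidean_space) process"
  assumes ad: "\<And>t. 0 \<le> t \<Longrightarrow> t \<le> T \<Longrightarrow> Z t \<in> borel_measurable (F t)"
    and c: "AE w in M. continuous_on {0..T} (\<lambda>t. Z t w)"
  obtains X where "\<And>t. 0 \<le> t \<Longrightarrow> t \<le> T \<Longrightarrow> X t \<in> borel_measurable (F t)"
    "\<And>w. continuous_on {0..T} (\<lambda>t. X t w)" "AE w in M. \<forall>t\<in>{0..T}. X t w = Z t w"
proof -
  obtain N where N: "\<And>w. w \<in> space M - N \<Longrightarrow> continuous_on {0..T} (\<lambda>t. Z t w)" and N0: "N \<in> null_sets M"
    using c by (rule AE_E3) blast
  define X where "X t w = (if w \<in> space M - N then Z t w else 0)" for t w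
  show ?thesis
  proof (rule that[of X])
    show "continuous_on {0..T} (\<lambda>t. X t w)" for w
      using N[of w] by (cases "w \<in> space M - N") (auto simp: X_def)
    show "X t \<in> borel_measurable (F t)" if t: "0 \<le> t" "t \<le> T" for t
    proof -
      have [measurable]: "Z t \<in> borel_measurable (F t)" by (rule ad[OF t])
      have sp: "space M = space (F t)" using F_space[OF t(2)] by simp
      have [measurable]: "N \<in> sets (F t)" using F_augmented[OF t(2)] N0 by (auto simp: augmented_def)
      show ?thesis unfolding X_def sp by measurable
    qed
    show "AE w in M. \<forall>t\<in>{0..T}. X t w = Z t w"
      using AE_not_in[OF N0] AE_space by eventually_elim (auto simp: X_def)
  qed
qed

lemma dyadic_sup_time_integral:
  assumes H: "sq_int PM (case_prod H)"
  shows "(\<integral>\<^sup>+w. dyadic_sup T (\<lambda>t w. LBINT s:{0..t}. H s w) w \<partial>M) \<le> ennreal (T * (l2norm PM (case_prod H))\<^sup>2)"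
proof -
  have "(\<integral>\<^sup>+w. dyadic_sup T (\<lambda>t w. LBINT s:{0..t}. H s w) w \<partial>M)
     \<le> (\<integral>\<^sup>+w. ennreal (T * (l2norm (leb T) (\<lambda>s. H s w))\<^sup>2) \<partial>M)"
  proof (rule nn_integral_mono_AE)
    show "AE w in M. dyadic_sup T (\<lambda>t w. LBINT s:{0..t}. H s w) w \<le> ennreal (T * (l2norm (leb T) (\<lambda>s. H s w))\<^sup>2)"
      using path_sq_int(1)[OF H]
    proof eventually_elim
      case (elim w)
      show ?case
      proof (rule dyadic_sup_le)
        fix t assume t: "0 \<le> t" "t \<le> T"
        have "l2norm (leb T) (\<lambda>r. indicator {0..t} r *\<^sub>R H r w) \<le> 1 * l2norm (leb T) (\<lambda>s. H s w)"
          by (rule l2norm_mono[OF elim sq_int_measurable[OF sq_int_indicator[OF elim]]])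
             (auto simp: indicator_def)
        then have "norm (LBINT s:{0..t}. H s w) \<le> sqrt T * l2norm (leb T) (\<lambda>s. H s w)"
          using t by (intro order_trans[OF norm_time_integral_le[OF elim order_refl t]] mult_mono) auto
        then have "(norm (LBINT s:{0..t}. H s w))\<^sup>2 \<le> (sqrt T * l2norm (leb T) (\<lambda>s. H s w))\<^sup>2"
          by (intro power_mono) auto
        then show "ennreal ((norm (LBINT s:{0..t}. H s w))\<^sup>2) \<le> ennreal (T * (l2norm (leb T) (\<lambda>s. H s w))\<^sup>2)"
          using T_pos by (intro ennreal_leI) (simp add: power_mult_distrib)
      qed (use T_pos in simp)
    qed
  qed
  also have "\<dots> = ennreal (\<integral>w. T * (l2norm (leb T) (\<lambda>s. H s w))\<^sup>2 \<partial>M)"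
    using T_pos by (intro nn_integral_eq_integral integrable_mult_right path_sq_int(2)[OF H]) auto
  also have "\<dots> = ennreal (T * (l2norm PM (case_prod H))\<^sup>2)" using path_sq_int(3)[OF H] by simp
  finally show ?thesis .
qed

lemma restr_l2_sections:
  assumes H: "sq_int PM (case_prod H)" and A: "A \<in> sets borel" "A \<subseteq> {0..T}"
  shows "(l2norm PM (restr A H))\<^sup>2 = (LBINT t:A. (l2norm M (H t))\<^sup>2)"
    and "set_integrable lborel A (\<lambda>t. (l2norm M (H t))\<^sup>2)"
proof -
  have R: "sq_int PM (case_prod (\<lambda>r w. indicator A r *\<^sub>R H r w))"
    using sq_int_restr(1)[OF H A(1)] by (simp add: restr_def)
  have eq: "(l2norm M (\<lambda>w. indicator A t *\<^sub>R H t w))\<^sup>2 = indicator A t *\<^sub>R (l2norm M (H t))\<^sup>2" for t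
    by (simp add: l2norm_sq indicator_def)
  show "(l2norm PM (restr A H))\<^sup>2 = (LBINT t:A. (l2norm M (H t))\<^sup>2)"
    using section_sq_int(3)[OF R] unfolding set_integral_leb(1)[OF A(2)] eq by (simp add: restr_def)
  show "set_integrable lborel A (\<lambda>t. (l2norm M (H t))\<^sup>2)"
    using section_sq_int(2)[OF R] unfolding set_integral_leb(2)[OF A(2)] eq .
qed

lemma up_to_le_restr:
  assumes H: "sq_int PM (case_prod H)"
  shows "l2norm PM (up_to t H) \<le> l2norm PM (restr {0..t} H)"
proof -
  have R: "sq_int PM (restr {0..t} H)" by (rule sq_int_restr(1)[OF H]) simp
  have "AE x in PM. norm (up_to t H x) \<le> 1 * norm (restr {0..t} H x)"
    by (intro AE_I2) (auto simp: up_to_def restr_def indicator_def)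
  from l2norm_mono[OF R sq_int_measurable[OF sq_int_up_to[OF H]] this] show ?thesis by simp
qed

text \<open>Cauchy-Schwarz for the time integral, isometry for the values and Doob's inequality for the
  suprema of the stochastic integrals.\<close>

lemma ito_process_estimates:
  assumes Z1: "integrator Z1" "covariation 1 Z1 Z1" and Z2: "integrator Z2" "covariation 1 Z2 Z2"
    and b: "sq_int PM (case_prod \<beta>)" and I: "ito Z1 \<sigma>1 I" and J: "ito Z2 \<sigma>2 J"
    and eq: "AE w in M. \<forall>t\<in>{0..T}. D t w = (LBINT s:{0..t}. \<beta> s w) + I t w + J t w"
  shows "\<And>t c. 0 \<le> t \<Longrightarrow> t \<le> T \<Longrightarrow> D t \<in> borel_measurable M \<Longrightarrow>
      (l2norm PM (restr {0..t} \<beta>))\<^sup>2 \<le> c \<Longrightarrow> (l2norm PM (restr {0..t} \<sigma>1))\<^sup>2 \<le> c \<Longrightarrow> (l2norm PM (restr {0..t} \<sigma>2))\<^sup>2 \<le> c \<Longrightarrow>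
      sq_int M (D t) \<and> (l2norm M (D t))\<^sup>2 \<le> 3 * (T + 2) * c"
    and "\<And>c. (l2norm PM (case_prod \<beta>))\<^sup>2 \<le> c \<Longrightarrow> (l2norm PM (case_prod \<sigma>1))\<^sup>2 \<le> c \<Longrightarrow> (l2norm PM (case_prod \<sigma>2))\<^sup>2 \<le> c \<Longrightarrow>
      (\<integral>\<^sup>+w. dyadic_sup T D w \<partial>M) \<le> ennreal ((4 * T + 24) * c)"
proof -
  let ?A = "\<lambda>t w. LBINT s:{0..t}. \<beta> s w"
  note s = itoD(1)[OF I] itoD(1)[OF J]
  {
    fix t c assume t: "0 \<le> t" "t \<le> T" and D: "D t \<in> borel_measurable M"
      and c: "(l2norm PM (restr {0..t} \<beta>))\<^sup>2 \<le> c" "(l2norm PM (restr {0..t} \<sigma>1))\<^sup>2 \<le> c" "(l2norm PM (restr {0..t} \<sigma>2))\<^sup>2 \<le> c"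
    note a = time_integral_l2[OF b order_refl t]
    note i = itoD(3)[OF I t] itoD(3)[OF J t]
    have sq: "sq_int M (\<lambda>w. ?A t w + I t w + J t w)" by (intro sq_int_add a i)
    have ae: "AE w in M. ?A t w + I t w + J t w = D t w" using eq by eventually_elim (use t in simp)
    have 1: "sq_int M (D t)" by (rule sq_int_cong_AE[OF sq D ae])
    have e1: "l2norm M (D t) = l2norm M (\<lambda>w. ?A t w + I t w + J t w)"
      by (rule l2norm_cong_AE[OF sq_int_measurable[OF sq] D ae, symmetric])
    have e2: "l2norm M (\<lambda>w. ?A t w + I t w + J t w) \<le> l2norm M (\<lambda>w. ?A t w + I t w) + l2norm M (J t)"
      by (intro l2norm_triangle sq_int_add a i)
    have e3: "l2norm M (\<lambda>w. ?A t w + I t w) \<le> l2norm M (?A t) + l2norm M (I t)"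
      by (intro l2norm_triangle a i)
    have "l2norm M (D t) \<le> l2norm M (?A t) + l2norm M (I t) + l2norm M (J t)" using e1 e2 e3 by linarith
    then have "(l2norm M (D t))\<^sup>2 \<le> (l2norm M (?A t) + l2norm M (I t) + l2norm M (J t))\<^sup>2"
      by (intro power_mono) auto
    also have "\<dots> \<le> 3 * ((l2norm M (?A t))\<^sup>2 + (l2norm M (I t))\<^sup>2 + (l2norm M (J t))\<^sup>2)" by (rule sq_add3_le)
    also have "\<dots> \<le> 3 * (T * c + c + c)"
    proof (intro mult_left_mono add_mono)
      have "(l2norm M (?A t))\<^sup>2 \<le> (sqrt (t - 0) * l2norm PM (restr {0..t} \<beta>))\<^sup>2" by (intro power_mono a(2)) auto
      also have "\<dots> \<le> T * c" using t c(1) by (simp add: power_mult_distrib mult_mono)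
      finally show "(l2norm M (?A t))\<^sup>2 \<le> T * c" .
      have "(l2norm PM (up_to t \<sigma>1))\<^sup>2 \<le> (l2norm PM (restr {0..t} \<sigma>1))\<^sup>2" by (intro power_mono up_to_le_restr s) auto
      from order_trans[OF this c(2)] show "(l2norm M (I t))\<^sup>2 \<le> c" unfolding ito_l2norm[OF Z1 t I] .
      have "(l2norm PM (up_to t \<sigma>2))\<^sup>2 \<le> (l2norm PM (restr {0..t} \<sigma>2))\<^sup>2" by (intro power_mono up_to_le_restr s) auto
      from order_trans[OF this c(3)] show "(l2norm M (J t))\<^sup>2 \<le> c" unfolding ito_l2norm[OF Z2 t J] .
    qed simp
    also have "\<dots> = 3 * (T + 2) * c" by (simp add: algebra_simps)
    finally show "sq_int M (D t) \<and> (l2norm M (D t))\<^sup>2 \<le> 3 * (T + 2) * c" using 1 by blast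
  next
    fix c assume c: "(l2norm PM (case_prod \<beta>))\<^sup>2 \<le> c" "(l2norm PM (case_prod \<sigma>1))\<^sup>2 \<le> c" "(l2norm PM (case_prod \<sigma>2))\<^sup>2 \<le> c"
    have c0: "0 \<le> c" using c(1) by (rule order_trans[rotated]) simp
    have T0: "0 \<le> T" using T_pos by simp
    have [measurable]: "dyadic_sup T ?A \<in> borel_measurable M"
      by (intro dyadic_sup_measurable time_integral_measurable[OF b]) auto
    have [measurable]: "dyadic_sup T I \<in> borel_measurable M" "dyadic_sup T J \<in> borel_measurable M"
      by (intro dyadic_sup_measurable sq_int_measurable itoD(3)[OF I] itoD(3)[OF J]; assumption)+
    have "(\<integral>\<^sup>+w. dyadic_sup T D w \<partial>M) \<le> (\<integral>\<^sup>+w. 4 * dyadic_sup T ?A w + 4 * dyadic_sup T I w + 2 * dyadic_sup T J w \<partial>M)"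
    proof (rule nn_integral_mono_AE)
      show "AE w in M. dyadic_sup T D w \<le> 4 * dyadic_sup T ?A w + 4 * dyadic_sup T I w + 2 * dyadic_sup T J w"
        using eq
      proof eventually_elim
        case (elim w)
        have "dyadic_sup T D w = dyadic_sup T (\<lambda>t w. ?A t w + I t w + J t w) w"
          by (rule dyadic_sup_cong[OF T0]) (use elim in auto)
        also have "\<dots> \<le> 2 * dyadic_sup T (\<lambda>t w. ?A t w + I t w) w + 2 * dyadic_sup T J w" by (rule dyadic_sup_add[OF T0])
        also have "\<dots> \<le> 2 * (2 * dyadic_sup T ?A w + 2 * dyadic_sup T I w) + 2 * dyadic_sup T J w"
          by (intro add_right_mono mult_left_mono dyadic_sup_add[OF T0]) simp
        finally show ?case by (simp add: distrib_left flip: mult.assoc)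
      qed
    qed
    also have "\<dots> = 4 * (\<integral>\<^sup>+w. dyadic_sup T ?A w \<partial>M) + 4 * (\<integral>\<^sup>+w. dyadic_sup T I w \<partial>M) + 2 * (\<integral>\<^sup>+w. dyadic_sup T J w \<partial>M)"
      by (simp add: nn_integral_add nn_integral_cmult)
    also have "\<dots> \<le> 4 * ennreal (T * c) + 4 * ennreal (4 * c) + 2 * ennreal (4 * c)"
    proof (intro add_mono mult_left_mono)
      show "(\<integral>\<^sup>+w. dyadic_sup T ?A w \<partial>M) \<le> ennreal (T * c)"
        using T0 c(1) by (intro order_trans[OF dyadic_sup_time_integral[OF b]] ennreal_leI mult_left_mono)
      show "(\<integral>\<^sup>+w. dyadic_sup T I w \<partial>M) \<le> ennreal (4 * c)"
        using c(2) by (intro order_trans[OF ito_maximal[OF Z1 I]] ennreal_leI) auto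
      show "(\<integral>\<^sup>+w. dyadic_sup T J w \<partial>M) \<le> ennreal (4 * c)"
        using c(3) by (intro order_trans[OF ito_maximal[OF Z2 J]] ennreal_leI) auto
    qed auto
    also have "\<dots> = ennreal ((4 * T + 24) * c)"
    proof -
      have "4 * ennreal (T * c) = ennreal (4 * (T * c))" "4 * ennreal (4 * c) = ennreal (16 * c)" "2 * ennreal (4 * c) = ennreal (8 * c)"
        using c0 T0 by (simp_all add: ennreal_mult)
      then show ?thesis using c0 T0 by (simp add: algebra_simps flip: ennreal_plus)
    qed
    finally show "(\<integral>\<^sup>+w. dyadic_sup T D w \<partial>M) \<le> ennreal ((4 * T + 24) * c)" .
  }
qed

end

context filtered_space
begin

lemma indistinguishable:
  fixes X X' :: "('a, 'b::euclidean_space) process"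
  assumes c: "\<And>w. continuous_on {0..T} (\<lambda>t. X t w)" "\<And>w. continuous_on {0..T} (\<lambda>t. X' t w)"
    and eq: "\<And>t. 0 \<le> t \<Longrightarrow> t \<le> T \<Longrightarrow> AE w in M. X t w = X' t w"
  shows "AE w in M. \<forall>t\<in>{0..T}. X t w = X' t w"
proof -
  have "AE w in M. \<forall>n k. k \<le> 2 ^ n \<longrightarrow> X (real k * T / 2 ^ n) w = X' (real k * T / 2 ^ n) w"
    unfolding AE_all_countable
  proof (intro allI)
    fix n k :: nat
    show "AE w in M. k \<le> 2 ^ n \<longrightarrow> X (real k * T / 2 ^ n) w = X' (real k * T / 2 ^ n) w"
      using eq[of "real k * T / 2 ^ n"] dyadic_time_bounds[of T k n] T_pos by (cases "k \<le> 2 ^ n") auto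
  qed
  then show ?thesis
  proof eventually_elim
    case (elim w)
    have "dyadic_sup T (\<lambda>t w. X t w - X' t w) w \<le> 0"
      unfolding dyadic_sup_def using elim by (intro SUP_least) auto
    then have "ennreal ((norm (X t w - X' t w))\<^sup>2) \<le> 0" if "t \<in> {0..T}" for t
      using that by (intro order_trans[OF norm_le_dyadic_sup[OF T_pos, of "\<lambda>t w. X t w - X' t w"]] continuous_on_diff c) auto
    then show ?case by (auto simp: ennreal_eq_0_iff)
  qed
qed

lemma S2_dyadic_sup:
  assumes "X \<in> S2_space M T F" shows "(\<integral>\<^sup>+w. dyadic_sup T X w \<partial>M) < \<infinity>"
proof -
  have "(\<integral>\<^sup>+w. dyadic_sup T X w \<partial>M) \<le> (\<integral>\<^sup>+w. (SUP t\<in>{0..T}. ennreal ((norm (X t w))\<^sup>2)) \<partial>M)"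
    using T_pos by (intro nn_integral_mono dyadic_sup_le SUP_upper) auto
  then show ?thesis using S2_spaceD(3)[OF assms] by (rule order_le_less_trans)
qed

lemma S2_diff_sq_int:
  assumes "X \<in> S2_space M T F" "X' \<in> S2_space M T F"
  shows "sq_int PM (case_prod (\<lambda>t w. X t w - X' t w))"
proof -
  have "sq_int PM (\<lambda>x. case_prod X x - case_prod X' x)"
    using S2_M2[OF assms(1)] S2_M2[OF assms(2)] by (intro sq_int_diff) (auto simp: M2_space_iff)
  then show ?thesis by (simp add: case_prod_beta')
qed

lemma M2_diff_sq_int:
  assumes "X \<in> M2_space M T F" "X' \<in> M2_space M T F"
  shows "sq_int PM (case_prod (\<lambda>t w. X t w - X' t w))"
proof -
  have "sq_int PM (\<lambda>x. case_prod X x - case_prod X' x)"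
    using assms by (intro sq_int_diff) (auto simp: M2_space_iff)
  then show ?thesis by (simp add: case_prod_beta')
qed

lemma restr_full:
  assumes H: "sq_int PM (case_prod H)"
  shows "l2norm PM (restr {0..T} H) = l2norm PM (case_prod H)"
proof (rule l2norm_cong_AE)
  show "restr {0..T} H \<in> borel_measurable PM"
    by (rule sq_int_measurable[OF sq_int_restr(1)[OF H]]) simp
  show "AE x in PM. restr {0..T} H x = case_prod H x"
    by (intro AE_I2) (auto simp: restr_def space_pair_measure)
qed (rule sq_int_measurable[OF H])

text \<open>The stochastic integrals are recorded for integrators with every bounded deterministic drift,
  because the noise of the state equation is \<open>Y\<close> with a drift removed.\<close>

definition ito_process ::
  "('a, real) process \<Rightarrow> ('a, real) process \<Rightarrow> 'b::euclidean_space \<Rightarrow> ('a, 'b) process \<Rightarrow> ('a, 'b) process \<Rightarrow>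
   ('a, 'b) process \<Rightarrow> ('a, 'b) process \<Rightarrow> ('a, 'b) process \<Rightarrow> ('a, 'b) process \<Rightarrow> bool" where
  "ito_process Z1 Z2 x0 \<beta> \<sigma>1 \<sigma>2 X I J \<longleftrightarrow>
     X \<in> S2_space M T F \<and> (\<forall>w. continuous_on {0..T} (\<lambda>t. X t w)) \<and> ito Z1 \<sigma>1 I \<and> ito Z2 \<sigma>2 J \<and>
     (\<forall>h. bdd_meas T h \<longrightarrow> has_stoch_integral M T F (\<lambda>t w. Z1 t w - (LBINT s:{0..t}. h s)) \<sigma>1 (\<lambda>t w. I t w - (LBINT s:{0..t}. h s *\<^sub>R \<sigma>1 s w))) \<and>
     (\<forall>h. bdd_meas T h \<longrightarrow> has_stoch_integral M T F (\<lambda>t w. Z2 t w - (LBINT s:{0..t}. h s)) \<sigma>2 (\<lambda>t w. J t w - (LBINT s:{0..t}. h s *\<^sub>R \<sigma>2 s w))) \<and>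
     (AE w in M. \<forall>t\<in>{0..T}. X t w = x0 + (LBINT s:{0..t}. \<beta> s w) + I t w + J t w)"

lemma ito_processD:
  assumes "ito_process Z1 Z2 x0 \<beta> \<sigma>1 \<sigma>2 X I J"
  shows "X \<in> S2_space M T F" "\<And>w. continuous_on {0..T} (\<lambda>t. X t w)" "ito Z1 \<sigma>1 I" "ito Z2 \<sigma>2 J"
    "AE w in M. \<forall>t\<in>{0..T}. X t w = x0 + (LBINT s:{0..t}. \<beta> s w) + I t w + J t w"
  using assms unfolding ito_process_def by blast+

lemma ito_process_exists:
  fixes \<beta> \<sigma>1 \<sigma>2 :: "('a, 'b::euclidean_space) process"
  assumes Z1: "integrator Z1" "covariation 1 Z1 Z1" and Z2: "integrator Z2" "covariation 1 Z2 Z2"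
    and b: "\<beta> \<in> M2_space M T F" and s: "\<sigma>1 \<in> M2_space M T F" "\<sigma>2 \<in> M2_space M T F"
  shows "\<exists>X I J. ito_process Z1 Z2 x0 \<beta> \<sigma>1 \<sigma>2 X I J"
proof -
  obtain I where I: "ito Z1 \<sigma>1 I" "\<And>h. bdd_meas T h \<Longrightarrow>
    has_stoch_integral M T F (\<lambda>t w. Z1 t w - (LBINT s:{0..t}. h s)) \<sigma>1 (\<lambda>t w. I t w - (LBINT s:{0..t}. h s *\<^sub>R \<sigma>1 s w))"
    using has_stoch_integral_exists[OF Z1 s(1)] by blast
  obtain J where J: "ito Z2 \<sigma>2 J" "\<And>h. bdd_meas T h \<Longrightarrow>
    has_stoch_integral M T F (\<lambda>t w. Z2 t w - (LBINT s:{0..t}. h s)) \<sigma>2 (\<lambda>t w. J t w - (LBINT s:{0..t}. h s *\<^sub>R \<sigma>2 s w))"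
    using has_stoch_integral_exists[OF Z2 s(2)] by blast
  have bsq: "sq_int PM (case_prod \<beta>)" using b by (simp add: M2_space_iff)
  have one: "bdd_meas T (\<lambda>_. 1::real)" by (simp add: bdd_meas_def image_constant_conv)
  let ?Z = "\<lambda>t w. x0 + (LBINT s:{0..t}. \<beta> s w) + I t w + J t w"
  have Zm: "?Z t \<in> borel_measurable (F t)" if t: "0 \<le> t" "t \<le> T" for t
    using time_integral_adapted[OF b one t]
    by (intro borel_measurable_add borel_measurable_const itoD(2)[OF I(1) t] itoD(2)[OF J(1) t]) simp
  have Zc: "AE w in M. continuous_on {0..T} (\<lambda>t. ?Z t w)"
    using time_integral_path_continuous[OF bsq] itoD(4)[OF I(1)] itoD(4)[OF J(1)]
    by eventually_elim (intro continuous_intros)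
  obtain X where X: "\<And>t. 0 \<le> t \<Longrightarrow> t \<le> T \<Longrightarrow> X t \<in> borel_measurable (F t)"
    "\<And>w. continuous_on {0..T} (\<lambda>t. X t w)" "AE w in M. \<forall>t\<in>{0..T}. X t w = ?Z t w"
    using continuous_version[OF Zm Zc] by blast
  let ?D = "\<lambda>t w. X t w - x0"
  have De: "AE w in M. \<forall>t\<in>{0..T}. ?D t w = (LBINT s:{0..t}. \<beta> s w) + I t w + J t w"
    using X(3) by eventually_elim simp
  define c where "c = (l2norm PM (case_prod \<beta>))\<^sup>2 + (l2norm PM (case_prod \<sigma>1))\<^sup>2 + (l2norm PM (case_prod \<sigma>2))\<^sup>2"
  have D: "(\<integral>\<^sup>+w. dyadic_sup T ?D w \<partial>M) \<le> ennreal ((4 * T + 24) * c)"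
    by (rule ito_process_estimates(2)[OF Z1 Z2 bsq I(1) J(1) De]) (simp_all add: c_def)
  have [measurable]: "dyadic_sup T ?D \<in> borel_measurable M"
    by (intro dyadic_sup_measurable borel_measurable_diff borel_measurable_const F_measurableD[OF X(1)])
  have "(\<integral>\<^sup>+w. dyadic_sup T X w \<partial>M) \<le> (\<integral>\<^sup>+w. 2 * ennreal ((norm x0)\<^sup>2) + 2 * dyadic_sup T ?D w \<partial>M)"
  proof (rule nn_integral_mono)
    fix w
    have "dyadic_sup T (\<lambda>t w. x0 + ?D t w) w \<le> 2 * dyadic_sup T (\<lambda>t w. x0) w + 2 * dyadic_sup T ?D w"
      using T_pos by (intro dyadic_sup_add) simp
    also have "\<dots> \<le> 2 * ennreal ((norm x0)\<^sup>2) + 2 * dyadic_sup T ?D w"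
      using T_pos by (intro add_right_mono mult_left_mono dyadic_sup_le) auto
    finally show "dyadic_sup T X w \<le> 2 * ennreal ((norm x0)\<^sup>2) + 2 * dyadic_sup T ?D w" by simp
  qed
  also have "\<dots> = 2 * ennreal ((norm x0)\<^sup>2) + 2 * (\<integral>\<^sup>+w. dyadic_sup T ?D w \<partial>M)"
    by (simp add: nn_integral_add nn_integral_cmult emeasure_space_1)
  also have "\<dots> < \<infinity>"
    using order_le_less_trans[OF D ennreal_less_top] by (simp add: ennreal_mult_less_top)
  finally have "X \<in> S2_space M T F" by (intro continuous_S2 X)
  then show ?thesis
    unfolding ito_process_def using X(2,3) I J by blast
qed

lemma ito_process_diff_estimates:
  fixes X X' :: "('a, 'b::euclidean_space) process"
  assumes Z1: "integrator Z1" "covariation 1 Z1 Z1" and Z2: "integrator Z2" "covariation 1 Z2 Z2"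
    and M2: "\<beta> \<in> M2_space M T F" "\<beta>' \<in> M2_space M T F"
    and X: "ito_process Z1 Z2 x0 \<beta> \<sigma>1 \<sigma>2 X I J" and X': "ito_process Z1 Z2 x0 \<beta>' \<sigma>1' \<sigma>2' X' I' J'"
    and C: "0 \<le> C" and G: "sq_int PM (case_prod G)"
    and lip: "\<And>t. 0 \<le> t \<Longrightarrow> t \<le> T \<Longrightarrow> l2norm M (\<lambda>w. \<beta> t w - \<beta>' t w) \<le> C * l2norm M (G t)"
      "\<And>t. 0 \<le> t \<Longrightarrow> t \<le> T \<Longrightarrow> l2norm M (\<lambda>w. \<sigma>1 t w - \<sigma>1' t w) \<le> C * l2norm M (G t)"
      "\<And>t. 0 \<le> t \<Longrightarrow> t \<le> T \<Longrightarrow> l2norm M (\<lambda>w. \<sigma>2 t w - \<sigma>2' t w) \<le> C * l2norm M (G t)"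
  shows "\<And>t. 0 \<le> t \<Longrightarrow> t \<le> T \<Longrightarrow>
      (l2norm M (\<lambda>w. X t w - X' t w))\<^sup>2 \<le> 3 * (T + 2) * C\<^sup>2 * (LBINT s:{0..t}. (l2norm M (G s))\<^sup>2)"
    and "(\<integral>\<^sup>+w. dyadic_sup T (\<lambda>t w. X t w - X' t w) w \<partial>M) \<le> ennreal ((4 * T + 24) * (C\<^sup>2 * (LBINT s:{0..T}. (l2norm M (G s))\<^sup>2)))"
proof -
  note x = ito_processD[OF X] and x' = ito_processD[OF X']
  let ?b = "\<lambda>t w. \<beta> t w - \<beta>' t w" and ?s1 = "\<lambda>t w. \<sigma>1 t w - \<sigma>1' t w" and ?s2 = "\<lambda>t w. \<sigma>2 t w - \<sigma>2' t w"
  have b: "sq_int PM (case_prod ?b)" by (rule M2_diff_sq_int[OF M2])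
  note I = ito_diff[OF Z1 x(3) x'(3)] and J = ito_diff[OF Z2 x(4) x'(4)]
  have bsq: "sq_int PM (case_prod \<beta>)" "sq_int PM (case_prod \<beta>')" using M2 by (auto simp: M2_space_iff)
  have eq: "AE w in M. \<forall>t\<in>{0..T}. X t w - X' t w = (LBINT s:{0..t}. ?b s w) + (I t w - I' t w) + (J t w - J' t w)"
    using x(5) x'(5) path_sq_int(1)[OF bsq(1)] path_sq_int(1)[OF bsq(2)]
  proof eventually_elim
    case (elim w)
    show ?case
    proof
      fix t assume t: "t \<in> {0..T}"
      have "(LBINT s:{0..t}. ?b s w) = (LBINT s:{0..t}. \<beta> s w) - (LBINT s:{0..t}. \<beta>' s w)"
        using t by (intro set_integral_diff(2) sq_int_set_integrable[OF elim(3)] sq_int_set_integrable[OF elim(4)]) auto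
      with elim(1,2) t show "X t w - X' t w = (LBINT s:{0..t}. ?b s w) + (I t w - I' t w) + (J t w - J' t w)"
        by simp
    qed
  qed
  have bd: "(l2norm PM (restr {0..t} H))\<^sup>2 \<le> C\<^sup>2 * (LBINT s:{0..t}. (l2norm M (G s))\<^sup>2)"
    if H: "sq_int PM (case_prod H)" and le: "\<And>t. 0 \<le> t \<Longrightarrow> t \<le> T \<Longrightarrow> l2norm M (H t) \<le> C * l2norm M (G t)" and t: "0 \<le> t" "t \<le> T"
    for t and H :: "('a, 'b) process"
  proof -
    have A: "{0..t} \<in> sets borel" "{0..t} \<subseteq> {0..T}" using t by auto
    have i: "set_integrable lborel {0..t} (\<lambda>s. C\<^sup>2 * (l2norm M (G s))\<^sup>2)"
      by (intro set_integrable_mult_right restr_l2_sections(2)[OF G A])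
    have "(l2norm PM (restr {0..t} H))\<^sup>2 \<le> (LBINT s:{0..t}. C\<^sup>2 * (l2norm M (G s))\<^sup>2)"
      unfolding restr_l2_sections(1)[OF H A]
    proof (rule set_integral_mono[OF restr_l2_sections(2)[OF H A] i])
      fix s assume "s \<in> {0..t}"
      then have "(l2norm M (H s))\<^sup>2 \<le> (C * l2norm M (G s))\<^sup>2" using t by (intro power_mono le) auto
      then show "(l2norm M (H s))\<^sup>2 \<le> C\<^sup>2 * (l2norm M (G s))\<^sup>2" by (simp add: power_mult_distrib)
    qed
    then show ?thesis by simp
  qed
  show "(l2norm M (\<lambda>w. X t w - X' t w))\<^sup>2 \<le> 3 * (T + 2) * C\<^sup>2 * (LBINT s:{0..t}. (l2norm M (G s))\<^sup>2)"
    if t: "0 \<le> t" "t \<le> T" for t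
  proof -
    have m: "(\<lambda>w. X t w - X' t w) \<in> borel_measurable M"
      using F_measurableD[OF S2_spaceD(1)[OF x(1) t] t(2)] F_measurableD[OF S2_spaceD(1)[OF x'(1) t] t(2)]
      by (rule borel_measurable_diff)
    show ?thesis
      using ito_process_estimates(1)[OF Z1 Z2 b I J eq t m bd[OF b lip(1) t] bd[OF itoD(1)[OF I] lip(2) t] bd[OF itoD(1)[OF J] lip(3) t]]
      by (simp add: mult.assoc)
  qed
  have T: "0 \<le> T" "T \<le> T" using T_pos by auto
  show "(\<integral>\<^sup>+w. dyadic_sup T (\<lambda>t w. X t w - X' t w) w \<partial>M) \<le> ennreal ((4 * T + 24) * (C\<^sup>2 * (LBINT s:{0..T}. (l2norm M (G s))\<^sup>2)))"
    using bd[OF b lip(1) T] bd[OF itoD(1)[OF I] lip(2) T] bd[OF itoD(1)[OF J] lip(3) T]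
    unfolding restr_full[OF b] restr_full[OF itoD(1)[OF I]] restr_full[OF itoD(1)[OF J]]
    by (rule ito_process_estimates(2)[OF Z1 Z2 b I J eq])
qed

text \<open>Picard iteration. The coefficients are maps on processes, since they involve the law of the
  solution. With squared mean-square distances at time \<open>t\<close> weighted by \<open>exp (- l t)\<close>, each step is a contraction by the
  factor \<open>1/8\<close> on all of \<open>[0, T]\<close>. The iterates converge uniformly by \<open>continuous_limit_process\<close>,
  and applying one more step to the limit \<open>X\<close> gives a process \<open>X'\<close> indistinguishable from it.\<close>

theorem mean_field_sde_exists:
  fixes x0 :: "'b::euclidean_space" and b \<sigma>1 \<sigma>2 :: "('a, 'b) process \<Rightarrow> ('a, 'b) process"
  assumes Z1: "integrator Z1" "covariation 1 Z1 Z1" and Z2: "integrator Z2" "covariation 1 Z2 Z2"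
    and M2: "\<And>X. X \<in> S2_space M T F \<Longrightarrow> b X \<in> M2_space M T F"
      "\<And>X. X \<in> S2_space M T F \<Longrightarrow> \<sigma>1 X \<in> M2_space M T F" "\<And>X. X \<in> S2_space M T F \<Longrightarrow> \<sigma>2 X \<in> M2_space M T F"
    and C: "0 \<le> C"
    and lip: "\<And>X X' t. X \<in> S2_space M T F \<Longrightarrow> X' \<in> S2_space M T F \<Longrightarrow> 0 \<le> t \<Longrightarrow> t \<le> T \<Longrightarrow>
         l2norm M (\<lambda>w. b X t w - b X' t w) \<le> C * l2norm M (\<lambda>w. X t w - X' t w)"
      "\<And>X X' t. X \<in> S2_space M T F \<Longrightarrow> X' \<in> S2_space M T F \<Longrightarrow> 0 \<le> t \<Longrightarrow> t \<le> T \<Longrightarrow>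
         l2norm M (\<lambda>w. \<sigma>1 X t w - \<sigma>1 X' t w) \<le> C * l2norm M (\<lambda>w. X t w - X' t w)"
      "\<And>X X' t. X \<in> S2_space M T F \<Longrightarrow> X' \<in> S2_space M T F \<Longrightarrow> 0 \<le> t \<Longrightarrow> t \<le> T \<Longrightarrow>
         l2norm M (\<lambda>w. \<sigma>2 X t w - \<sigma>2 X' t w) \<le> C * l2norm M (\<lambda>w. X t w - X' t w)"
  shows "\<exists>X I J. ito_process Z1 Z2 x0 (b X) (\<sigma>1 X) (\<sigma>2 X) X I J"
proof -
  let ?S = "S2_space M T F"
  let ?step = "\<lambda>X X'. \<exists>I J. ito_process Z1 Z2 x0 (b X) (\<sigma>1 X) (\<sigma>2 X) X' I J"
  define Xs where "Xs = rec_nat (\<lambda>t w. x0) (\<lambda>_ X. SOME X'. ?step X X')"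
  have Xs_Suc: "Xs (Suc n) = (SOME X'. ?step (Xs n) X')" for n by (simp add: Xs_def)
  have stepS: "X' \<in> ?S" if "?step X X'" for X X' using that ito_processD(1) by blast
  have ex: "\<exists>X'. ?step X X'" if "X \<in> ?S" for X
    using ito_process_exists[OF Z1 Z2 M2(1)[OF that] M2(2)[OF that] M2(3)[OF that], of x0] by blast
  have XS: "Xs n \<in> ?S \<and> ?step (Xs n) (Xs (Suc n))" for n
  proof (induction n)
    case 0
    have "(\<integral>\<^sup>+w. dyadic_sup T (\<lambda>t w. x0) w \<partial>M) \<le> (\<integral>\<^sup>+w. ennreal ((norm x0)\<^sup>2) \<partial>M)"
      using T_pos by (intro nn_integral_mono dyadic_sup_le) auto
    also have "\<dots> < \<infinity>" by (simp add: emeasure_space_1)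
    finally have "Xs 0 \<in> ?S" unfolding Xs_def by (intro continuous_S2) auto
    with someI_ex[OF ex] show ?case unfolding Xs_Suc by blast
  next
    case (Suc n)
    then have "Xs (Suc n) \<in> ?S" using stepS by blast
    with someI_ex[OF ex] show ?case unfolding Xs_Suc[of "Suc n"] by blast
  qed
  define G where "G n = (\<lambda>t w. Xs (Suc n) t w - Xs n t w)" for n
  have Gsq: "sq_int PM (case_prod (G n))" for n unfolding G_def by (rule S2_diff_sq_int) (use XS in blast)+
  have est: "(l2norm M (\<lambda>w. Y t w - Y' t w))\<^sup>2 \<le> 3 * (T + 2) * C\<^sup>2 * (LBINT s:{0..t}. (l2norm M (\<lambda>w. X s w - X' s w))\<^sup>2)"
      "(\<integral>\<^sup>+w. dyadic_sup T (\<lambda>t w. Y t w - Y' t w) w \<partial>M)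
       \<le> ennreal ((4 * T + 24) * (C\<^sup>2 * (LBINT s:{0..T}. (l2norm M (\<lambda>w. X s w - X' s w))\<^sup>2)))"
    if X: "X \<in> ?S" "X' \<in> ?S" "?step X Y" "?step X' Y'" and t: "0 \<le> t" "t \<le> T" for X X' Y Y' t
  proof -
    obtain I J I' J' where s: "ito_process Z1 Z2 x0 (b X) (\<sigma>1 X) (\<sigma>2 X) Y I J" "ito_process Z1 Z2 x0 (b X') (\<sigma>1 X') (\<sigma>2 X') Y' I' J'"
      using X by blast
    note e = ito_process_diff_estimates[OF Z1 Z2 M2(1)[OF X(1)] M2(1)[OF X(2)] s C S2_diff_sq_int[OF X(1,2)]
        lip(1)[OF X(1,2)] lip(2)[OF X(1,2)] lip(3)[OF X(1,2)]]
    show "(l2norm M (\<lambda>w. Y t w - Y' t w))\<^sup>2 \<le> 3 * (T + 2) * C\<^sup>2 * (LBINT s:{0..t}. (l2norm M (\<lambda>w. X s w - X' s w))\<^sup>2)"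
      by (rule e(1)) (use t in auto)
    show "(\<integral>\<^sup>+w. dyadic_sup T (\<lambda>t w. Y t w - Y' t w) w \<partial>M)
       \<le> ennreal ((4 * T + 24) * (C\<^sup>2 * (LBINT s:{0..T}. (l2norm M (\<lambda>w. X s w - X' s w))\<^sup>2)))"
      by (rule e(2)) auto
  qed
  define \<kappa> where "\<kappa> = 3 * (T + 2) * C\<^sup>2 + 1"
  have \<kappa>: "0 < \<kappa>" "3 * (T + 2) * C\<^sup>2 \<le> \<kappa>" unfolding \<kappa>_def using T_pos by (auto intro!: add_nonneg_pos mult_nonneg_nonneg)
  \<comment> \<open>integrating \<open>\<kappa> * exp (l * s)\<close> over \<open>[0, t]\<close> yields at most \<open>exp (l * t) / 8\<close>\<close>
  define l where "l = 8 * \<kappa>"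
  have l: "0 < l" using \<kappa> by (simp add: l_def)
  obtain K1 where K1: "0 \<le> K1" "\<And>t. 0 \<le> t \<Longrightarrow> t \<le> T \<Longrightarrow> sq_int M (Xs (Suc 0) t) \<and> l2norm M (Xs (Suc 0) t) \<le> K1"
    using S2_l2_bound[of "Xs (Suc 0)"] XS by blast
  obtain K2 where K2: "0 \<le> K2" "\<And>t. 0 \<le> t \<Longrightarrow> t \<le> T \<Longrightarrow> sq_int M (Xs 0 t) \<and> l2norm M (Xs 0 t) \<le> K2"
    using S2_l2_bound[of "Xs 0"] XS by blast
  define K where "K = (K1 + K2)\<^sup>2"
  have K0: "0 \<le> K" by (simp add: K_def)
  have Gi: "set_integrable lborel {0..t} (\<lambda>s. (l2norm M (G n s))\<^sup>2)" if "t \<le> T" for n t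
    using that by (intro restr_l2_sections(2)[OF Gsq]) auto
  have Gint: "(LBINT s:{0..t}. (l2norm M (G n s))\<^sup>2) \<le> K * (1/8) ^ n * (exp (l * t) / l)"
    if t: "0 \<le> t" "t \<le> T" and le: "\<And>s. 0 \<le> s \<Longrightarrow> s \<le> T \<Longrightarrow> (l2norm M (G n s))\<^sup>2 \<le> K * exp (l * s) * (1/8) ^ n" for n t
  proof -
    have "(LBINT s:{0..t}. (l2norm M (G n s))\<^sup>2) \<le> (LBINT s:{0..t}. K * (1/8) ^ n * exp (l * s))"
      using le t by (intro set_integral_mono Gi set_integrable_mult_right exp_integral_bound l) (auto simp: mult_ac)
    also have "\<dots> = K * (1/8) ^ n * (LBINT s:{0..t}. exp (l * s))" by simp
    also have "\<dots> \<le> K * (1/8) ^ n * (exp (l * t) / l)"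
      using K0 by (intro mult_left_mono exp_integral_bound(2) l t) auto
    finally show ?thesis .
  qed
  have Gb: "(l2norm M (G n t))\<^sup>2 \<le> K * exp (l * t) * (1/8) ^ n" if "0 \<le> t" "t \<le> T" for n t
    using that
  proof (induction n arbitrary: t)
    case 0
    have "l2norm M (G 0 t) \<le> l2norm M (Xs (Suc 0) t) + l2norm M (Xs 0 t)"
      unfolding G_def using K1(2)[OF 0] K2(2)[OF 0] by (intro l2norm_triangle_diff) auto
    also have "\<dots> \<le> K1 + K2" using K1(2)[OF 0] K2(2)[OF 0] by (intro add_mono) auto
    finally have "(l2norm M (G 0 t))\<^sup>2 \<le> K" unfolding K_def by (intro power_mono) auto
    also have "\<dots> \<le> K * exp (l * t)" using K0 l 0 by (simp add: mult_le_cancel_left1)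
    finally show ?case by simp
  next
    case (Suc n)
    have "(l2norm M (G (Suc n) t))\<^sup>2 \<le> 3 * (T + 2) * C\<^sup>2 * (LBINT s:{0..t}. (l2norm M (G n s))\<^sup>2)"
      unfolding G_def by (rule est(1)) (use XS Suc.prems in blast)+
    also have "\<dots> \<le> \<kappa> * (K * (1/8) ^ n * (exp (l * t) / l))"
      using \<kappa> T_pos by (intro mult_mono Gint Suc) (auto simp: set_lebesgue_integral_def intro!: integral_nonneg_AE AE_I2)
    also have "\<dots> = K * exp (l * t) * (1/8) ^ Suc n" using \<kappa>(1) by (simp add: l_def)
    finally show ?case .
  qed
  define B where "B = (4 * T + 24) * (C\<^sup>2 * (K * (exp (l * T) / l)))"
  have B0: "0 \<le> B" using T_pos K0 l by (simp add: B_def)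
  have sup: "(\<integral>\<^sup>+w. dyadic_sup T (\<lambda>t w. Xs (Suc (Suc n)) t w - Xs (Suc n) t w) w \<partial>M) \<le> ennreal (B * (1/8) ^ n)" for n
  proof -
    have "(\<integral>\<^sup>+w. dyadic_sup T (\<lambda>t w. Xs (Suc (Suc n)) t w - Xs (Suc n) t w) w \<partial>M)
       \<le> ennreal ((4 * T + 24) * (C\<^sup>2 * (LBINT s:{0..T}. (l2norm M (G n s))\<^sup>2)))"
      unfolding G_def by (rule est(2)[of _ _ _ _ T]) (use XS T_pos in \<open>blast intro: less_imp_le\<close>)+
    also have "\<dots> \<le> ennreal ((4 * T + 24) * (C\<^sup>2 * (K * (1/8) ^ n * (exp (l * T) / l))))"
      using T_pos by (intro ennreal_leI mult_left_mono Gint Gb) auto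
    also have "(4 * T + 24) * (C\<^sup>2 * (K * (1/8) ^ n * (exp (l * T) / l))) = B * (1/8) ^ n" by (simp add: B_def)
    finally show ?thesis .
  qed
  have XSc: "continuous_on {0..T} (\<lambda>t. Xs (Suc n) t w)" for n w using XS[of n] ito_processD(2) by blast
  have XSm: "Xs n t \<in> borel_measurable (F t)" if "0 \<le> t" "t \<le> T" for n t using XS[of n] S2_spaceD(1) that by blast
  obtain X E where X: "\<And>t. 0 \<le> t \<Longrightarrow> t \<le> T \<Longrightarrow> X t \<in> borel_measurable (F t)"
    "\<And>w. continuous_on {0..T} (\<lambda>t. X t w)"
    "E \<in> borel_measurable M" "(\<integral>\<^sup>+w. E w \<partial>M) \<le> ennreal (2 * B)"
    "AE w in M. \<forall>n. \<forall>t\<in>{0..T}. ennreal ((norm (Xs (Suc n) t w - X t w))\<^sup>2) \<le> ennreal (4 * (1/4) ^ n) * E w"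
    using continuous_limit_process[of "\<lambda>n. Xs (Suc n)", OF XSm AE_I2[OF XSc] sup B0] by blast
  have dist: "sq_int M (\<lambda>w. X t w - Xs (Suc n) t w) \<and> (l2norm M (\<lambda>w. X t w - Xs (Suc n) t w))\<^sup>2 \<le> 4 * (1/4) ^ n * (2 * B)"
    if t: "0 \<le> t" "t \<le> T" for n t
  proof -
    have "(\<integral>\<^sup>+w. ennreal ((norm (X t w - Xs (Suc n) t w))\<^sup>2) \<partial>M) \<le> (\<integral>\<^sup>+w. ennreal (4 * (1/4) ^ n) * E w \<partial>M)"
    proof (rule nn_integral_mono_AE)
      show "AE w in M. ennreal ((norm (X t w - Xs (Suc n) t w))\<^sup>2) \<le> ennreal (4 * (1/4) ^ n) * E w"
        using X(5) by eventually_elim (use t in \<open>simp add: norm_minus_commute\<close>)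
    qed
    also have "\<dots> \<le> ennreal (4 * (1/4) ^ n) * ennreal (2 * B)"
      unfolding nn_integral_cmult[OF X(3)] by (intro mult_left_mono X(4)) auto
    also have "\<dots> = ennreal ((sqrt (4 * (1/4) ^ n * (2 * B)))\<^sup>2)" using B0 by (simp flip: ennreal_mult)
    finally have nn: "(\<integral>\<^sup>+w. ennreal ((norm (X t w - Xs (Suc n) t w))\<^sup>2) \<partial>M) \<le> ennreal ((sqrt (4 * (1/4) ^ n * (2 * B)))\<^sup>2)" .
    have m: "(\<lambda>w. X t w - Xs (Suc n) t w) \<in> borel_measurable M"
      by (intro borel_measurable_diff F_measurableD[OF X(1)[OF t] t(2)] F_measurableD[OF XSm[OF t] t(2)])
    have "sq_int M (\<lambda>w. X t w - Xs (Suc n) t w) \<and> l2norm M (\<lambda>w. X t w - Xs (Suc n) t w) \<le> sqrt (4 * (1/4) ^ n * (2 * B))"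
      by (rule l2norm_le_if_nn_integral_le[OF nn _ m]) (use B0 in simp)
    moreover from this have "(l2norm M (\<lambda>w. X t w - Xs (Suc n) t w))\<^sup>2 \<le> (sqrt (4 * (1/4) ^ n * (2 * B)))\<^sup>2"
      by (intro power_mono) auto
    ultimately show ?thesis using B0 by simp
  qed
  have XinS: "X \<in> ?S"
  proof (rule continuous_S2[OF X(1,2)])
    let ?Y = "Xs (Suc 0)"
    have [measurable]: "E \<in> borel_measurable M" "dyadic_sup T ?Y \<in> borel_measurable M"
      by (fact X(3)) (intro dyadic_sup_measurable F_measurableD[OF XSm])
    have "(\<integral>\<^sup>+w. dyadic_sup T X w \<partial>M) \<le> (\<integral>\<^sup>+w. 2 * dyadic_sup T ?Y w + 8 * E w \<partial>M)"
    proof (rule nn_integral_mono_AE)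
      show "AE w in M. dyadic_sup T X w \<le> 2 * dyadic_sup T ?Y w + 8 * E w"
        using X(5)
      proof eventually_elim
        case (elim w)
        have "dyadic_sup T (\<lambda>t w. X t w - ?Y t w) w \<le> 4 * E w"
          using T_pos elim[rule_format, of _ 0] by (intro dyadic_sup_le) (auto simp: norm_minus_commute)
        then have 1: "2 * dyadic_sup T (\<lambda>t w. X t w - ?Y t w) w \<le> 2 * (4 * E w)" by (rule mult_left_mono) simp
        have 2: "dyadic_sup T (\<lambda>t w. ?Y t w + (X t w - ?Y t w)) w \<le> 2 * dyadic_sup T ?Y w + 2 * dyadic_sup T (\<lambda>t w. X t w - ?Y t w) w"
          using T_pos by (intro dyadic_sup_add) simp
        from order_trans[OF 2 add_left_mono[OF 1]]
        have "dyadic_sup T X w \<le> 2 * dyadic_sup T ?Y w + 2 * (4 * E w)" by simp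
        then show ?case by (simp flip: mult.assoc)
      qed
    qed
    also have "\<dots> = 2 * (\<integral>\<^sup>+w. dyadic_sup T ?Y w \<partial>M) + 8 * (\<integral>\<^sup>+w. E w \<partial>M)"
      by (simp add: nn_integral_add nn_integral_cmult)
    also have "\<dots> < \<infinity>"
      using S2_dyadic_sup[of ?Y] XS[of "Suc 0"] order_le_less_trans[OF X(4) ennreal_less_top]
      by (simp add: ennreal_mult_less_top)
    finally show "(\<integral>\<^sup>+w. dyadic_sup T X w \<partial>M) < \<infinity>" .
  qed
  \<comment> \<open>\<open>X\<close> is a fixed point: one more step is mean-square close to the iterates as well\<close>
  obtain X' where X': "?step X X'" using ex[OF XinS] by blast
  then obtain I J where IJ: "ito_process Z1 Z2 x0 (b X) (\<sigma>1 X) (\<sigma>2 X) X' I J" by blast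
  have X'S: "X' \<in> ?S" by (rule ito_processD(1)[OF IJ])
  have eq: "AE w in M. X t w = X' t w" if t: "0 \<le> t" "t \<le> T" for t
  proof -
    let ?e = "\<lambda>n::nat. 4 * (1/4) ^ n * (2 * B)"
    have sX: "sq_int M (X t)" "sq_int M (X' t)"
      using S2_l2_bound[OF XinS] S2_l2_bound[OF X'S] t by metis+
    have sXs: "sq_int M (Xs (Suc n) t)" for n using S2_l2_bound[of "Xs (Suc n)"] XS[of "Suc n"] t by metis
    have "(l2norm M (\<lambda>w. X' t w - Xs (Suc (Suc n)) t w))\<^sup>2 \<le> \<kappa> * (T * ?e n)" for n
    proof -
      have "(l2norm M (\<lambda>w. X' t w - Xs (Suc (Suc n)) t w))\<^sup>2
          \<le> 3 * (T + 2) * C\<^sup>2 * (LBINT s:{0..t}. (l2norm M (\<lambda>w. X s w - Xs (Suc n) s w))\<^sup>2)"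
        by (rule est(1)[OF XinS _ X' _ t]) (use XS in blast)+
      also have "\<dots> \<le> \<kappa> * (LBINT s:{0..t}. (l2norm M (\<lambda>w. X s w - Xs (Suc n) s w))\<^sup>2)"
        using \<kappa> by (intro mult_right_mono) (auto simp: set_lebesgue_integral_def intro!: integral_nonneg_AE AE_I2)
      also have "(LBINT s:{0..t}. (l2norm M (\<lambda>w. X s w - Xs (Suc n) s w))\<^sup>2) \<le> (LBINT s:{0..t}. ?e n)"
      proof (rule set_integral_mono)
        show "set_integrable lborel {0..t} (\<lambda>s. (l2norm M (\<lambda>w. X s w - Xs (Suc n) s w))\<^sup>2)"
          using t by (intro restr_l2_sections(2)[OF S2_diff_sq_int[OF XinS]]) (use XS in auto)
        show "set_integrable lborel {0..t} (\<lambda>s. ?e n)" by (rule borel_integrable_atLeastAtMost') (intro continuous_intros)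
        show "(l2norm M (\<lambda>w. X s w - Xs (Suc n) s w))\<^sup>2 \<le> ?e n" if "s \<in> {0..t}" for s using dist[of s n] that t by auto
      qed
      also have "(LBINT s:{0..t}. ?e n) \<le> T * ?e n"
        using t B0 by (simp add: set_lebesgue_integral_def mult_right_mono)
      finally show ?thesis using \<kappa>(1) by (simp add: mult_left_mono)
    qed
    then have b1: "l2norm M (\<lambda>w. X' t w - Xs (Suc (Suc n)) t w) \<le> sqrt (\<kappa> * (T * ?e n))" for n by (rule real_le_rsqrt)
    have b2: "l2norm M (\<lambda>w. X t w - Xs (Suc (Suc n)) t w) \<le> sqrt (?e (Suc n))" for n
      using dist[OF t, of "Suc n"] by (intro real_le_rsqrt) blast
    have "l2norm M (\<lambda>w. X t w - X' t w) \<le> sqrt (?e (Suc n)) + sqrt (\<kappa> * (T * ?e n))" for n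
      using l2norm_triangle3[OF sX(1) sXs[of "Suc n"] sX(2)] b1[of n] b2[of n]
        l2norm_commute[of M "X' t" "Xs (Suc (Suc n)) t"] by simp
    moreover have "(\<lambda>n. sqrt (?e (Suc n)) + sqrt (\<kappa> * (T * ?e n))) \<longlonglongrightarrow> sqrt (4 * 0 * (2 * B)) + sqrt (\<kappa> * (T * (4 * 0 * (2 * B))))"
      by (intro tendsto_intros LIMSEQ_Suc LIMSEQ_realpow_zero) auto
    ultimately have "l2norm M (\<lambda>w. X t w - X' t w) \<le> sqrt (4 * 0 * (2 * B)) + sqrt (\<kappa> * (T * (4 * 0 * (2 * B))))"
      by (intro LIMSEQ_le_const) auto
    then have "l2norm M (\<lambda>w. X t w - X' t w) = 0" using l2norm_nonneg[of M "\<lambda>w. X t w - X' t w"] by simp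
    from l2norm_zeroD[OF sq_int_diff[OF sX] this] show ?thesis by simp
  qed
  have "AE w in M. \<forall>t\<in>{0..T}. X t w = X' t w"
    by (rule indistinguishable[OF X(2) ito_processD(2)[OF IJ] eq])
  with ito_processD(5)[OF IJ]
  have "AE w in M. \<forall>t\<in>{0..T}. X t w = x0 + (LBINT s:{0..t}. b X s w) + I t w + J t w"
    by eventually_elim simp
  with IJ X(2) XinS have "ito_process Z1 Z2 x0 (b X) (\<sigma>1 X) (\<sigma>2 X) X I J"
    unfolding ito_process_def by blast
  then show ?thesis by blast
qed

end

section \<open>Bounded matrix coefficients\<close>

lemma bounded_bilinear_matrix_vector_mult:
  "bounded_bilinear ((*v) :: real^'m::finite^'n::finite \<Rightarrow> real^'m \<Rightarrow> real^'n)"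
  unfolding bilinear_conv_bounded_bilinear[symmetric] bilinear_def
  by (auto intro!: linearI simp: matrix_vector_mult_add_rdistrib matrix_vector_right_distrib
      matrix_vector_mult_scaleR scaleR_matrix_vector_assoc)

lemma borel_measurable_matrix_vector_mult [measurable (raw)]:
  fixes A :: "'a \<Rightarrow> real^'m::finite^'n::finite"
  assumes "A \<in> borel_measurable N" "v \<in> borel_measurable N"
  shows "(\<lambda>x. A x *v v x) \<in> borel_measurable N"
  by (rule borel_measurable_continuous_Pair[OF assms])
     (intro bounded_bilinear.continuous_on[OF bounded_bilinear_matrix_vector_mult] continuous_on_fst continuous_on_snd continuous_on_id)

lemma bdd_meas_operator_bound:
  fixes A :: "real \<Rightarrow> real^'m::finite^'n::finite"
  assumes "bdd_meas T A"
  obtains C where "0 \<le> C" "\<And>t v. t \<in> {0..T} \<Longrightarrow> norm (A t *v v) \<le> C * norm v"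
proof -
  obtain K where K: "0 < K" "\<And>(B :: real^'m^'n) v. norm (B *v v) \<le> norm B * norm v * K"
    using bounded_bilinear.pos_bounded[OF bounded_bilinear_matrix_vector_mult] by blast
  obtain a where a: "\<And>t. t \<in> {0..T} \<Longrightarrow> norm (A t) \<le> a" using assms by (force simp: bdd_meas_def bounded_iff)
  show ?thesis
  proof (rule that[of "max 0 a * K"])
    show "0 \<le> max 0 a * K" using K by simp
    fix t v assume t: "t \<in> {0..T}"
    have "norm (A t *v v) \<le> norm (A t) * norm v * K" by (rule K(2))
    also have "\<dots> \<le> max 0 a * norm v * K"
      using a[OF t] K(1) by (intro mult_right_mono) auto
    finally show "norm (A t *v v) \<le> max 0 a * K * norm v" by (simp add: mult_ac)
  qed
qed

text \<open>A continuous function is bounded on the compact closure of the range of the pair.\<close>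

lemma bdd_meas_combine:
  fixes f :: "'c::euclidean_space \<Rightarrow> 'd::euclidean_space \<Rightarrow> 'e::euclidean_space"
  assumes f: "continuous_on UNIV (\<lambda>(x, y). f x y)" and A: "bdd_meas T A" and B: "bdd_meas T B"
  shows "bdd_meas T (\<lambda>t. f (A t) (B t))"
proof -
  have c: "compact (closure ((\<lambda>t. (A t, B t)) ` {0..T}))"
  proof -
    have "bounded ((A ` {0..T}) \<times> (B ` {0..T}))" using A B by (intro bounded_Times) (auto simp: bdd_meas_def)
    then have "bounded ((\<lambda>t. (A t, B t)) ` {0..T})" by (rule bounded_subset) auto
    then show ?thesis by (simp add: compact_closure)
  qed
  have b: "bounded ((\<lambda>(x, y). f x y) ` closure ((\<lambda>t. (A t, B t)) ` {0..T}))"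
    by (intro compact_imp_bounded compact_continuous_image[OF _ c] continuous_on_subset[OF f]) simp
  have eq: "(\<lambda>t. f (A t) (B t)) ` {0..T} = (\<lambda>(x, y). f x y) ` (\<lambda>t. (A t, B t)) ` {0..T}"
    by (simp add: image_image)
  have "bounded ((\<lambda>t. f (A t) (B t)) ` {0..T})"
    unfolding eq by (rule bounded_subset[OF b image_mono[OF closure_subset]])
  moreover have "(\<lambda>t. f (A t) (B t)) \<in> borel_measurable (restrict_space borel {0..T})"
  proof (rule borel_measurable_continuous_Pair[of A _ B f])
    show "A \<in> borel_measurable (restrict_space borel {0..T})" "B \<in> borel_measurable (restrict_space borel {0..T})"
      using A B by (simp_all add: bdd_meas_def)
    show "continuous_on UNIV (\<lambda>x. f (fst x) (snd x))" using f by (simp add: case_prod_beta')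
  qed
  ultimately show ?thesis by (simp add: bdd_meas_def)
qed

lemma bdd_meas_add: "bdd_meas T A \<Longrightarrow> bdd_meas T B \<Longrightarrow> bdd_meas T (\<lambda>t. A t + B t)"
  by (rule bdd_meas_combine[where f="(+)"]) (auto simp: case_prod_beta' intro!: continuous_intros)

lemma bdd_meas_diff: "bdd_meas T A \<Longrightarrow> bdd_meas T B \<Longrightarrow> bdd_meas T (\<lambda>t. A t - B t)"
  by (rule bdd_meas_combine[where f="(-)"]) (auto simp: case_prod_beta' intro!: continuous_intros)

lemma bdd_meas_scaleR: "bdd_meas T A \<Longrightarrow> bdd_meas T B \<Longrightarrow> bdd_meas T (\<lambda>t. A t *\<^sub>R B t)"
  by (rule bdd_meas_combine[where f="(*\<^sub>R)"]) (auto simp: case_prod_beta' intro!: continuous_intros)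

lemma bdd_meas_transpose:
  fixes A :: "real \<Rightarrow> real^'m::finite^'n::finite"
  assumes "bdd_meas T A" shows "bdd_meas T (\<lambda>t. transpose (A t))"
proof -
  have "continuous_on UNIV (\<lambda>(x :: real^'m^'n, y :: real^'m^'n). transpose x)"
    unfolding transpose_def case_prod_beta' by (intro continuous_intros)
  from bdd_meas_combine[OF this assms assms] show ?thesis .
qed

context filtered_space
begin

lemma M2_spaceI: "adapted T F H \<Longrightarrow> sq_int PM (case_prod H) \<Longrightarrow> H \<in> M2_space M T F"
  by (simp add: M2_space_iff)

lemma M2_sq: "H \<in> M2_space M T F \<Longrightarrow> sq_int PM (case_prod H)"
  by (simp add: M2_space_iff)

lemma M2_measurable: "H \<in> M2_space M T F \<Longrightarrow> 0 \<le> t \<Longrightarrow> t \<le> T \<Longrightarrow> H t \<in> borel_measurable (F t)"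
  by (simp add: M2_space_iff adapted_def)

lemma M2_measurable_M: "H \<in> M2_space M T F \<Longrightarrow> 0 \<le> t \<Longrightarrow> t \<le> T \<Longrightarrow> H t \<in> borel_measurable M"
  using F_measurableD[OF M2_measurable] .

lemma M2_add:
  assumes H: "H \<in> M2_space M T F" and G: "G \<in> M2_space M T F"
  shows "(\<lambda>t w. H t w + G t w) \<in> M2_space M T F"
proof (rule M2_spaceI)
  show "adapted T F (\<lambda>t w. H t w + G t w)"
    unfolding adapted_def using M2_measurable[OF H] M2_measurable[OF G] by (intro ballI borel_measurable_add) auto
  show "sq_int PM (case_prod (\<lambda>t w. H t w + G t w))"
    using sq_int_add[OF M2_sq[OF H] M2_sq[OF G]] by (simp add: case_prod_beta')
qed

lemma M2_bounded_op:
  fixes H :: "('a, 'b::euclidean_space) process" and f :: "real \<Rightarrow> 'b \<Rightarrow> 'c::euclidean_space"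
  assumes H: "H \<in> M2_space M T F" and f: "(\<lambda>(t, v). f t v) \<in> borel_measurable (leb T \<Otimes>\<^sub>M borel)"
    and C: "0 \<le> C" "\<And>t v. t \<in> {0..T} \<Longrightarrow> norm (f t v) \<le> C * norm v"
  shows "(\<lambda>t w. f t (H t w)) \<in> M2_space M T F"
proof (rule M2_spaceI)
  show "adapted T F (\<lambda>t w. f t (H t w))"
    unfolding adapted_def
  proof
    fix t assume t: "t \<in> {0..T}"
    have "(\<lambda>v. f t v) \<in> borel_measurable borel"
      using measurable_compose[OF _ f, of "\<lambda>v. (t, v)" borel] t by simp
    from measurable_compose[OF M2_measurable[OF H] this] t
    show "(\<lambda>w. f t (H t w)) \<in> borel_measurable (F t)" by simp
  qed
  have [measurable]: "case_prod H \<in> borel_measurable PM" using M2_sq[OF H] by (rule sq_int_measurable)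
  have "(\<lambda>x. (fst x, case_prod H x)) \<in> PM \<rightarrow>\<^sub>M leb T \<Otimes>\<^sub>M borel" by measurable
  from measurable_compose[OF this f] have m: "case_prod (\<lambda>t w. f t (H t w)) \<in> borel_measurable PM"
    by (simp add: case_prod_beta')
  show "sq_int PM (case_prod (\<lambda>t w. f t (H t w)))"
    by (rule sq_int_bound[OF M2_sq[OF H] m, where c=C]) (use C in \<open>auto simp: space_pair_measure\<close>)
qed

lemma M2_matrix:
  fixes H :: "('a, real^'m::finite) process" and A :: "real \<Rightarrow> real^'m^'n::finite"
  assumes H: "H \<in> M2_space M T F" and A: "bdd_meas T A"
  shows "(\<lambda>t w. A t *v H t w) \<in> M2_space M T F"
proof -
  obtain C where C: "0 \<le> C" "\<And>t v. t \<in> {0..T} \<Longrightarrow> norm (A t *v v) \<le> C * norm v"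
    using bdd_meas_operator_bound[OF A] by blast
  have [measurable]: "A \<in> borel_measurable (leb T)" by (rule bdd_meas_measurable[OF A])
  show ?thesis by (rule M2_bounded_op[OF H _ C(1)]) (measurable, use C(2) in auto)
qed

lemma M2_scaleR:
  fixes H :: "('a, 'b::euclidean_space) process"
  assumes H: "H \<in> M2_space M T F" and h: "bdd_meas T h"
  shows "(\<lambda>t w. h t *\<^sub>R H t w) \<in> M2_space M T F"
proof -
  obtain C where C: "\<And>t. t \<in> {0..T} \<Longrightarrow> \<bar>h t\<bar> \<le> C" using h by (force simp: bdd_meas_def bounded_iff)
  have [measurable]: "h \<in> borel_measurable (restrict_space borel {0..T})" using h by (simp add: bdd_meas_def)
  show ?thesis
  proof (rule M2_bounded_op[OF H, where C="max 0 C"])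
    show "(\<lambda>(t, v :: 'b). h t *\<^sub>R v) \<in> borel_measurable (leb T \<Otimes>\<^sub>M borel)" by measurable
    show "norm (h t *\<^sub>R v) \<le> max 0 C * norm v" if "t \<in> {0..T}" for t and v :: 'b
      using C[OF that] by (auto intro!: mult_right_mono simp: le_max_iff_disj)
  qed simp
qed

lemma M2_diff:
  assumes H: "H \<in> M2_space M T F" and G: "G \<in> M2_space M T F"
  shows "(\<lambda>t w. H t w - G t w) \<in> M2_space M T F"
  using M2_add[OF H M2_scaleR[OF G, of "\<lambda>_. - 1"]] by (simp add: bdd_meas_def image_constant_conv)

lemma M2_deterministic:
  assumes g: "sq_int (leb T) g"
  shows "(\<lambda>t w. g t) \<in> M2_space M T F"
proof (rule M2_spaceI)
  have [measurable]: "g \<in> borel_measurable (leb T)" using g by (rule sq_int_measurable)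
  have m: "case_prod (\<lambda>t w. g t) \<in> borel_measurable PM" by measurable
  have "(\<integral>\<^sup>+x. ennreal ((norm (case_prod (\<lambda>t w. g t) x))\<^sup>2) \<partial>PM) = (\<integral>\<^sup>+t. \<integral>\<^sup>+w. ennreal ((norm (case_prod (\<lambda>t w. g t) (t, w)))\<^sup>2) \<partial>M \<partial>leb T)"
    by (rule nn_integral_fst[symmetric]) measurable
  also have "\<dots> = ennreal ((l2norm (leb T) g)\<^sup>2)" by (simp add: emeasure_space_1 nn_integral_sq[OF g])
  finally show "sq_int PM (case_prod (\<lambda>t w. g t))" using m by (simp add: sq_int_iff_nn_integral)
qed (simp add: adapted_def)

lemma mean_sq_int:
  assumes H: "sq_int PM (case_prod H)"
  shows "sq_int (leb T) (mean M H)"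
proof -
  have "case_prod H \<in> borel_measurable PM" using H by (rule sq_int_measurable)
  then have m: "mean M H \<in> borel_measurable (leb T)" by (rule borel_measurable_lebesgue_integral)
  have "integrable (leb T) (\<lambda>t. (norm (mean M H t))\<^sup>2)"
  proof (rule Bochner_Integration.integrable_bound[OF section_sq_int(2)[OF H]])
    show "AE t in leb T. norm ((norm (mean M H t))\<^sup>2) \<le> norm ((l2norm M (H t))\<^sup>2)"
      using section_sq_int(1)[OF H]
      by eventually_elim (simp add: power_mono norm_expectation_le_l2norm)
  qed (use m in measurable)
  with m show ?thesis by (simp add: sq_int_def)
qed

lemma M2_mean:
  assumes "H \<in> M2_space M T F"
  shows "(\<lambda>t w. mean M H t) \<in> M2_space M T F"
  by (rule M2_deterministic[OF mean_sq_int[OF M2_sq[OF assms]]])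

lemma expectation_matrix:
  fixes B :: "real^'m::finite^'n::finite"
  assumes "integrable M f"
  shows "integrable M (\<lambda>w. B *v f w)" "(\<integral>w. B *v f w \<partial>M) = B *v (\<integral>w. f w \<partial>M)"
proof -
  have l: "bounded_linear ((*v) B)" by (rule matrix_vector_mul_bounded_linear)
  show "integrable M (\<lambda>w. B *v f w)" by (rule integrable_bounded_linear[OF l assms])
  show "(\<integral>w. B *v f w \<partial>M) = B *v (\<integral>w. f w \<partial>M)" by (rule integral_bounded_linear[OF l assms])
qed

text \<open>Drift and diffusion coefficients of the state equation all have this form.\<close>

definition mf_coeff ::
  "(real \<Rightarrow> real^'n^'c) \<Rightarrow> (real \<Rightarrow> real^'n^'c) \<Rightarrow> (real \<Rightarrow> real^'k1^'c) \<Rightarrow> (real \<Rightarrow> real^'k1^'c) \<Rightarrow>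
   (real \<Rightarrow> real^'k2^'c) \<Rightarrow> (real \<Rightarrow> real^'k2^'c) \<Rightarrow>
   ('a, real^'n::finite) process \<Rightarrow> ('a, real^'k1::finite) process \<Rightarrow> ('a, real^'k2::finite) process \<Rightarrow>
   ('a, real^'c::finite) process" where
  "mf_coeff P P' R R' S S' X u v t w = P t *v X t w + P' t *v mean M X t + R t *v u t w + R' t *v mean M u t
     + S t *v v t w + S' t *v mean M v t"

lemma mf_coeff_M2:
  assumes "bdd_meas T P" "bdd_meas T P'" "bdd_meas T R" "bdd_meas T R'" "bdd_meas T S" "bdd_meas T S'"
    "X \<in> M2_space M T F" "u \<in> M2_space M T F" "v \<in> M2_space M T F"
  shows "mf_coeff P P' R R' S S' X u v \<in> M2_space M T F"
  unfolding mf_coeff_def[abs_def] by (intro M2_add M2_matrix[OF M2_mean] M2_matrix assms)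

lemma mf_coeff_lipschitz:
  fixes P P' :: "real \<Rightarrow> real^'n::finite^'c::finite" and R R' :: "real \<Rightarrow> real^'k1::finite^'c" and S S' :: "real \<Rightarrow> real^'k2::finite^'c"
    and u :: "('a, real^'k1) process" and v :: "('a, real^'k2) process"
  assumes P: "bdd_meas T P" "bdd_meas T P'"
  obtains C where "0 \<le> C" "\<And>(X :: ('a, real^'n) process) X' t. X \<in> S2_space M T F \<Longrightarrow> X' \<in> S2_space M T F \<Longrightarrow> 0 \<le> t \<Longrightarrow> t \<le> T \<Longrightarrow>
    sq_int M (\<lambda>w. mf_coeff P P' R R' S S' X u v t w - mf_coeff P P' R R' S S' X' u v t w) \<and>
    l2norm M (\<lambda>w. mf_coeff P P' R R' S S' X u v t w - mf_coeff P P' R R' S S' X' u v t w)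
       \<le> C * l2norm M (\<lambda>w. X t w - X' t w)"
proof -
  obtain C where C: "0 \<le> C" "\<And>t v. t \<in> {0..T} \<Longrightarrow> norm (P t *v v) \<le> C * norm v"
    using bdd_meas_operator_bound[OF P(1)] by blast
  obtain C' where C': "0 \<le> C'" "\<And>t v. t \<in> {0..T} \<Longrightarrow> norm (P' t *v v) \<le> C' * norm v"
    using bdd_meas_operator_bound[OF P(2)] by blast
  show ?thesis
  proof (rule that[of "C + C'"])
    show "0 \<le> C + C'" using C C' by simp
    fix X X' :: "('a, real^'n) process" and t
    assume X: "X \<in> S2_space M T F" "X' \<in> S2_space M T F" and t: "0 \<le> t" "t \<le> T"
    have sq: "sq_int M (X t)" "sq_int M (X' t)"
      using S2_l2_bound[OF X(1)] S2_l2_bound[OF X(2)] t by metis+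
    have d: "sq_int M (\<lambda>w. X t w - X' t w)" using sq by auto
    let ?D = "\<lambda>w. X t w - X' t w"
    have [measurable]: "?D \<in> borel_measurable M" using d by (rule sq_int_measurable)
    have eq: "mf_coeff P P' R R' S S' X u v t w - mf_coeff P P' R R' S S' X' u v t w = P t *v ?D w + P' t *v (\<integral>w. ?D w \<partial>M)" for w
      using sq by (simp add: mf_coeff_def matrix_vector_mult_diff_distrib sq_int_integrable)
    have tt: "t \<in> {0..T}" using t by simp
    have m: "(\<lambda>w. P t *v ?D w) \<in> borel_measurable M" by measurable
    have le: "AE w in M. norm (P t *v ?D w) \<le> C * norm (?D w)" using C(2)[OF tt] by simp
    have a: "sq_int M (\<lambda>w. P t *v ?D w)" by (rule sq_int_bound[OF d m le])
    have b: "l2norm M (\<lambda>w. P t *v ?D w) \<le> C * l2norm M ?D" by (rule l2norm_mono[OF d m le C(1)])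
    have "norm (P' t *v (\<integral>w. ?D w \<partial>M)) \<le> C' * l2norm M ?D"
      using order_trans[OF C'(2)[OF tt] mult_left_mono[OF norm_expectation_le_l2norm[OF d] C'(1)]] .
    then show "sq_int M (\<lambda>w. mf_coeff P P' R R' S S' X u v t w - mf_coeff P P' R R' S S' X' u v t w) \<and>
      l2norm M (\<lambda>w. mf_coeff P P' R R' S S' X u v t w - mf_coeff P P' R R' S S' X' u v t w) \<le> (C + C') * l2norm M ?D"
      unfolding eq using a b l2norm_triangle[OF a sq_int_const[of "P' t *v (\<integral>w. ?D w \<partial>M)"]]
      by (auto simp: distrib_right)
  qed
qed

lemma mf_coeff_mean:
  assumes X: "X \<in> M2_space M T F" "u \<in> M2_space M T F" "v \<in> M2_space M T F"
  shows "AE t in leb T. mean M (mf_coeff P P' R R' S S' X u v) t =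
    (P t + P' t) *v mean M X t + (R t + R' t) *v mean M u t + (S t + S' t) *v mean M v t"
  using section_sq_int(1)[OF M2_sq[OF X(1)]] section_sq_int(1)[OF M2_sq[OF X(2)]] section_sq_int(1)[OF M2_sq[OF X(3)]]
proof eventually_elim
  case (elim t)
  note i = elim[THEN sq_int_integrable]
  note e = expectation_matrix[OF i(1)] expectation_matrix[OF i(2)] expectation_matrix[OF i(3)]
  show ?case unfolding mf_coeff_def by (simp add: e prob_space matrix_vector_mult_add_rdistrib)
qed

lemma ito_mean_zero:
  assumes Z: "integrator Z" "covariation 1 Z Z" and I: "ito Z H I" and t: "0 \<le> t" "t \<le> T"
  shows "(\<integral>w. I t w \<partial>M) = 0"
proof -
  have z: "0 \<le> (0::real)" "0 \<le> T" using T_pos by auto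
  have "up_to 0 H = (\<lambda>x. 0)" by (auto simp: up_to_def fun_eq_iff)
  then have "l2norm M (I 0) = 0" using ito_l2norm[OF Z z I] by (simp add: l2norm_def)
  then have I0: "AE w in M. I 0 w = 0" by (rule l2norm_zeroD[OF itoD(3)[OF I z]])
  have "(\<integral>w. I t w \<partial>M) \<bullet> e = 0" for e
  proof -
    have "(\<integral>w. e \<bullet> (I t w - I 0 w) \<partial>M) = 0"
      by (rule l2_martingaleD(3)[OF ito_martingale[OF Z I] z(1) t]) auto
    moreover have "(\<integral>w. e \<bullet> (I t w - I 0 w) \<partial>M) = (\<integral>w. e \<bullet> I t w \<partial>M)"
      using I0 sq_int_measurable[OF itoD(3)[OF I t]] sq_int_measurable[OF itoD(3)[OF I z]]
      by (intro integral_cong_AE) auto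
    ultimately show ?thesis
      using integral_inner_right[of e M "I t"] sq_int_integrable[OF itoD(3)[OF I t]] by (simp add: inner_commute)
  qed
  then show ?thesis using inner_eq_zero_iff by blast
qed

end

context filtered_space
begin

section \<open>Linear backward equations without source\<close>

lemma LBINT_Icc_split:
  fixes f :: "real \<Rightarrow> 'b::euclidean_space"
  assumes f: "set_integrable lborel {0..T} f" and s: "0 \<le> s" "s \<le> t" "t \<le> T"
  shows "(LBINT r:{0..t}. f r) = (LBINT r:{0..s}. f r) + (LBINT r:{s..t}. f r)"
proof -
  have i: "set_integrable lborel {a..b} f" if "0 \<le> a" "b \<le> T" for a b
    using that by (intro set_integrable_subset[OF f]) auto
  have e: "(LBINT r:{a..b}. f r) = integral {a..b} f" "f integrable_on {a..b}" if "0 \<le> a" "b \<le> T" for a b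
    using set_borel_integral_eq_integral[OF i[OF that]] by auto
  have "integral {0..s} f + integral {s..t} f = integral {0..t} f"
    using s e(2)[of 0 t] by (intro Henstock_Kurzweil_Integration.integral_combine) auto
  then show ?thesis using s e(1)[of 0 t] e(1)[of 0 s] e(1)[of s t] by simp
qed

lemma up_to_l2_sections:
  assumes H: "sq_int PM (case_prod H)" and t: "0 \<le> t" "t \<le> T"
  shows "(l2norm PM (up_to t H))\<^sup>2 = (LBINT r:{0..t}. (l2norm M (H r))\<^sup>2)"
proof -
  have A: "{0<..t} \<in> sets borel" "{0<..t} \<subseteq> {0..T}" using t by auto
  have "(l2norm PM (up_to t H))\<^sup>2 = (l2norm PM (restr {0<..t} H))\<^sup>2" by (simp add: up_to_def restr_def)
  also have "\<dots> = (LBINT r:{0<..t}. (l2norm M (H r))\<^sup>2)" by (rule restr_l2_sections(1)[OF H A])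
  also have "\<dots> = (LBINT r:{0..t}. (l2norm M (H r))\<^sup>2)"
  proof (rule set_integral_cong_set)
    have "AE r in lborel. r \<noteq> (0::real)" by (rule AE_lborel_singleton)
    then show "AE x in lborel. (x \<in> {0..t}) = (x \<in> {0<..t})" by eventually_elim auto
    have "set_integrable lborel {0<..t} (\<lambda>r. (l2norm M (H r))\<^sup>2)" by (rule restr_l2_sections(2)[OF H A])
    then show "set_borel_measurable lborel {0<..t} (\<lambda>r. (l2norm M (H r))\<^sup>2)"
      by (simp add: set_borel_measurable_def set_integrable_def)
    have "set_integrable lborel {0..t} (\<lambda>r. (l2norm M (H r))\<^sup>2)" using t by (intro restr_l2_sections(2)[OF H]) auto
    then show "set_borel_measurable lborel {0..t} (\<lambda>r. (l2norm M (H r))\<^sup>2)"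
      by (simp add: set_borel_measurable_def set_integrable_def)
  qed
  finally show ?thesis .
qed

text \<open>The two integrals are orthogonal, so the square of the sum has no cross term.\<close>

lemma ito_increment_l2:
  fixes H1 H2 :: "('a, 'b::euclidean_space) process"
  assumes Z1: "integrator Z1" "covariation 1 Z1 Z1" and Z2: "integrator Z2" "covariation 1 Z2 Z2" and cov: "covariation 0 Z1 Z2"
    and I: "ito Z1 H1 I" and J: "ito Z2 H2 J" and s: "0 \<le> s" "s \<le> t" "t \<le> T"
  shows "(l2norm M (\<lambda>w. (I t w - I s w) + (J t w - J s w)))\<^sup>2
    = (LBINT r:{s..t}. (l2norm M (H1 r))\<^sup>2) + (LBINT r:{s..t}. (l2norm M (H2 r))\<^sup>2)"
proof -
  have st: "0 \<le> t" "s \<le> T" using s by auto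
  have one: "(l2norm M (\<lambda>w. I t w - I s w))\<^sup>2 = (LBINT r:{s..t}. (l2norm M (H r))\<^sup>2)"
    if Z: "integrator Z" "covariation 1 Z Z" and I: "ito Z H I" for Z and H I :: "('a, 'b) process"
  proof -
    note sq = itoD(3)[OF I st(1) s(3)] itoD(3)[OF I s(1) st(2)]
    note Hsq = itoD(1)[OF I]
    have "(l2norm M (\<lambda>w. I s w + (I t w - I s w)))\<^sup>2 = (l2norm M (I s))\<^sup>2 + 2 * (\<integral>w. I s w \<bullet> (I t w - I s w) \<partial>M) + (l2norm M (\<lambda>w. I t w - I s w))\<^sup>2"
      by (intro l2norm_sq_add sq sq_int_diff)
    moreover have "(\<integral>w. I s w \<bullet> (I t w - I s w) \<partial>M) = 0"
      by (rule l2_martingaleD(3)[OF ito_martingale[OF Z I] s itoD(2)[OF I s(1) st(2)] sq(2)])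
    ultimately have "(l2norm M (I t))\<^sup>2 = (l2norm M (I s))\<^sup>2 + (l2norm M (\<lambda>w. I t w - I s w))\<^sup>2" by simp
    moreover have "(LBINT r:{0..t}. (l2norm M (H r))\<^sup>2) = (LBINT r:{0..s}. (l2norm M (H r))\<^sup>2) + (LBINT r:{s..t}. (l2norm M (H r))\<^sup>2)"
      by (intro LBINT_Icc_split restr_l2_sections(2)[OF Hsq] s) auto
    ultimately show ?thesis
      unfolding ito_l2norm[OF Z st(1) s(3) I] ito_l2norm[OF Z s(1) st(2) I]
        up_to_l2_sections[OF Hsq st(1) s(3)] up_to_l2_sections[OF Hsq s(1) st(2)] by simp
  qed
  note i = itoD(3)[OF I st(1) s(3)] itoD(3)[OF I s(1) st(2)] and j = itoD(3)[OF J st(1) s(3)] itoD(3)[OF J s(1) st(2)]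
  have c: "(\<integral>w. I r w \<bullet> J r w \<partial>M) = 0" if "0 \<le> r" "r \<le> T" for r
    using ito_isometry[OF Z1 Z2 cov that I J] by simp
  have c1: "(\<integral>w. J s w \<bullet> (I t w - I s w) \<partial>M) = 0"
    by (rule l2_martingaleD(3)[OF ito_martingale[OF Z1 I] s itoD(2)[OF J s(1) st(2)] j(2)])
  have c2: "(\<integral>w. I s w \<bullet> (J t w - J s w) \<partial>M) = 0"
    by (rule l2_martingaleD(3)[OF ito_martingale[OF Z2 J] s itoD(2)[OF I s(1) st(2)] i(2)])
  have "(\<integral>w. (I t w - I s w) \<bullet> (J t w - J s w) \<partial>M) = (\<integral>w. I t w \<bullet> J t w - I s w \<bullet> J s w - J s w \<bullet> (I t w - I s w) - I s w \<bullet> (J t w - J s w) \<partial>M)"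
    by (intro Bochner_Integration.integral_cong refl) (simp add: inner_diff_left inner_diff_right inner_commute)
  also have "\<dots> = 0"
    using i j c[of t] c[of s] c1 c2 st s by (simp add: sq_int_inner sq_int_diff)
  finally have cross: "(\<integral>w. (I t w - I s w) \<bullet> (J t w - J s w) \<partial>M) = 0" .
  have "(l2norm M (\<lambda>w. (I t w - I s w) + (J t w - J s w)))\<^sup>2
    = (l2norm M (\<lambda>w. I t w - I s w))\<^sup>2 + 2 * (\<integral>w. (I t w - I s w) \<bullet> (J t w - J s w) \<partial>M) + (l2norm M (\<lambda>w. J t w - J s w))\<^sup>2"
    by (intro l2norm_sq_add sq_int_diff i j)
  then show ?thesis unfolding cross one[OF Z1 I] one[OF Z2 J] by simp
qed

text \<open>As \<open>d s\<close> is known at time \<open>s\<close>, it is orthogonal to the increments of both integrals after \<open>s\<close>. The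
  second moment of the right-hand side is therefore the sum of those of \<open>d s\<close> and of the increments.\<close>

lemma backward_energy:
  fixes d \<gamma> q qt :: "('a, 'b::euclidean_space) process"
  assumes Z1: "integrator Z1" "covariation 1 Z1 Z1" and Z2: "integrator Z2" "covariation 1 Z2 Z2" and cov: "covariation 0 Z1 Z2"
    and I: "ito Z1 q I" and J: "ito Z2 qt J" and g: "sq_int PM (case_prod \<gamma>)" and s: "0 \<le> s" "s \<le> t" "t \<le> T"
    and d: "d s \<in> borel_measurable (F s)" "sq_int M (d s)"
    and eq: "AE w in M. d s w + ((I t w - I s w) + (J t w - J s w)) = (LBINT r:{s..t}. \<gamma> r w)"
  shows "(l2norm M (d s))\<^sup>2 + (LBINT r:{s..t}. (l2norm M (q r))\<^sup>2) + (LBINT r:{s..t}. (l2norm M (qt r))\<^sup>2)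
    \<le> (t - s) * (LBINT r:{s..t}. (l2norm M (\<gamma> r))\<^sup>2)"
proof -
  have st: "0 \<le> t" "s \<le> T" using s by auto
  note i = itoD(3)[OF I st(1) s(3)] itoD(3)[OF I s(1) st(2)] and j = itoD(3)[OF J st(1) s(3)] itoD(3)[OF J s(1) st(2)]
  let ?N = "\<lambda>w. (I t w - I s w) + (J t w - J s w)"
  have N: "sq_int M ?N" by (intro sq_int_add sq_int_diff i j)
  have "(\<integral>w. d s w \<bullet> ?N w \<partial>M) = (\<integral>w. d s w \<bullet> (I t w - I s w) \<partial>M) + (\<integral>w. d s w \<bullet> (J t w - J s w) \<partial>M)"
    unfolding inner_add_right by (intro Bochner_Integration.integral_add sq_int_inner sq_int_diff i j d)
  also have "\<dots> = 0"
    using l2_martingaleD(3)[OF ito_martingale[OF Z1 I] s d] l2_martingaleD(3)[OF ito_martingale[OF Z2 J] s d] by simp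
  finally have o: "(\<integral>w. d s w \<bullet> ?N w \<partial>M) = 0" .
  note tl = time_integral_l2[OF g s]
  have A: "{s..t} \<in> sets borel" "{s..t} \<subseteq> {0..T}" using s by auto
  have "(l2norm M (d s))\<^sup>2 + (l2norm M ?N)\<^sup>2 = (l2norm M (\<lambda>w. d s w + ?N w))\<^sup>2"
    using l2norm_sq_add[OF d(2) N] o by simp
  also have "l2norm M (\<lambda>w. d s w + ?N w) = l2norm M (\<lambda>w. LBINT r:{s..t}. \<gamma> r w)"
    by (intro l2norm_cong_AE eq sq_int_measurable sq_int_add[OF d(2) N] tl(1))
  also have "(l2norm M (\<lambda>w. LBINT r:{s..t}. \<gamma> r w))\<^sup>2 \<le> (sqrt (t - s) * l2norm PM (restr {s..t} \<gamma>))\<^sup>2"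
    by (intro power_mono tl(2)) auto
  also have "\<dots> = (t - s) * (LBINT r:{s..t}. (l2norm M (\<gamma> r))\<^sup>2)"
    using s by (simp add: power_mult_distrib restr_l2_sections(1)[OF g A])
  finally show ?thesis unfolding ito_increment_l2[OF Z1 Z2 cov I J s] by simp
qed

text \<open>On a time interval of length \<open>\<epsilon>\<close> at whose right end \<open>d\<close> vanishes, \<open>backward_energy\<close> bounds the
  total energy of \<open>d\<close>, \<open>q\<close> and \<open>qt\<close> by a multiple of itself that is smaller than \<open>1\<close> for small
  \<open>\<epsilon>\<close>. So all three vanish on the interval, and finitely many intervals lead from \<open>T\<close> back to \<open>0\<close>.\<close>

theorem backward_equation_trivial:
  fixes d \<gamma> q qt :: "('a, 'b::euclidean_space) process"
  assumes Z1: "integrator Z1" "covariation 1 Z1 Z1" and Z2: "integrator Z2" "covariation 1 Z2 Z2" and cov: "covariation 0 Z1 Z2"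
    and I: "ito Z1 q I" and J: "ito Z2 qt J" and g: "sq_int PM (case_prod \<gamma>)"
    and d: "\<And>t. 0 \<le> t \<Longrightarrow> t \<le> T \<Longrightarrow> d t \<in> borel_measurable (F t)" "\<And>t. 0 \<le> t \<Longrightarrow> t \<le> T \<Longrightarrow> sq_int M (d t)"
      "sq_int PM (case_prod d)"
    and eq: "AE w in M. \<forall>t\<in>{0..T}. d t w = (LBINT r:{t..T}. \<gamma> r w) - (I T w - I t w) - (J T w - J t w)"
    and C: "0 \<le> C" "AE t in lborel. t \<in> {0..T} \<longrightarrow> l2norm M (\<gamma> t) \<le> C * (l2norm M (d t) + l2norm M (q t) + l2norm M (qt t))"
  shows "\<And>t. 0 \<le> t \<Longrightarrow> t \<le> T \<Longrightarrow> AE w in M. d t w = 0" "l2norm PM (case_prod q) = 0" "l2norm PM (case_prod qt) = 0"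
proof -
  note qs = itoD(1)[OF I] itoD(1)[OF J]
  define \<kappa> where "\<kappa> = 3 * C\<^sup>2"
  have \<kappa>: "0 \<le> \<kappa>" by (simp add: \<kappa>_def)
  let ?D = "\<lambda>t. (l2norm M (d t))\<^sup>2" and ?q = "\<lambda>t. (l2norm M (q t))\<^sup>2" and ?r = "\<lambda>t. (l2norm M (qt t))\<^sup>2"
  have int: "set_integrable lborel {s..t} ?D" "set_integrable lborel {s..t} ?q" "set_integrable lborel {s..t} ?r"
    "set_integrable lborel {s..t} (\<lambda>t. (l2norm M (\<gamma> t))\<^sup>2)" if "0 \<le> s" "t \<le> T" for s t
    by (intro restr_l2_sections(2) d(3) qs g; use that in auto)+
  have nn: "0 \<le> (LBINT r:{s..t}. (f r :: real)\<^sup>2)" for s t f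
    unfolding set_lebesgue_integral_def by (intro integral_nonneg_AE AE_I2) simp
  let ?S = "\<lambda>s t. (LBINT r:{s..t}. ?D r) + (LBINT r:{s..t}. ?q r) + (LBINT r:{s..t}. ?r r)"
  have gS: "(LBINT r:{s..t}. (l2norm M (\<gamma> r))\<^sup>2) \<le> \<kappa> * ?S s t" if s: "0 \<le> s" "t \<le> T" for s t
  proof -
    have i: "set_integrable lborel {s..t} (\<lambda>r. \<kappa> * (?D r + ?q r + ?r r))"
      by (intro set_integrable_mult_right set_integral_add int s)
    have "(LBINT r:{s..t}. (l2norm M (\<gamma> r))\<^sup>2) \<le> (LBINT r:{s..t}. \<kappa> * (?D r + ?q r + ?r r))"
    proof (rule set_integral_mono_AE[OF int(4)[OF s] i])
      show "AE r\<in>{s..t} in lborel. (l2norm M (\<gamma> r))\<^sup>2 \<le> \<kappa> * (?D r + ?q r + ?r r)"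
        using C(2)
      proof eventually_elim
        case (elim r)
        show ?case
        proof
          assume "r \<in> {s..t}"
          then have "(l2norm M (\<gamma> r))\<^sup>2 \<le> (C * (l2norm M (d r) + l2norm M (q r) + l2norm M (qt r)))\<^sup>2"
            using elim s by (intro power_mono) auto
          also have "\<dots> \<le> C\<^sup>2 * (3 * (?D r + ?q r + ?r r))"
            unfolding power_mult_distrib by (intro mult_left_mono sq_add3_le) simp
          finally show "(l2norm M (\<gamma> r))\<^sup>2 \<le> \<kappa> * (?D r + ?q r + ?r r)" by (simp add: \<kappa>_def algebra_simps)
        qed
      qed
    qed
    also have "\<dots> = \<kappa> * ?S s t"
      using int[OF s] by (simp add: set_integral_add)
    finally show ?thesis .
  qed
  have energy: "?D s + (LBINT r:{s..t}. ?q r) + (LBINT r:{s..t}. ?r r) \<le> (t - s) * (\<kappa> * ?S s t)"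
    if dt: "AE w in M. d t w = 0" and s: "0 \<le> s" "s \<le> t" "t \<le> T" for s t
  proof -
    have st: "s \<le> T" using s by simp
    have "AE w in M. d s w + ((I t w - I s w) + (J t w - J s w)) = (LBINT r:{s..t}. \<gamma> r w)"
      using eq dt path_sq_int(1)[OF g]
    proof eventually_elim
      case (elim w)
      have gi: "set_integrable lborel {0..T} (\<lambda>r. \<gamma> r w)" by (rule sq_int_set_integrable[OF elim(3)]) auto
      have "(LBINT r:{s..T}. \<gamma> r w) = (LBINT r:{s..t}. \<gamma> r w) + (LBINT r:{t..T}. \<gamma> r w)"
        using LBINT_Icc_split[OF gi, of s T] LBINT_Icc_split[OF gi, of t T] LBINT_Icc_split[OF gi, of s t] s by simp
      moreover have "(LBINT r:{t..T}. \<gamma> r w) = (I T w - I t w) + (J T w - J t w)"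
        using bspec[OF elim(1), of t] elim(2) s by (simp add: algebra_simps)
      moreover have "d s w = (LBINT r:{s..T}. \<gamma> r w) - (I T w - I s w) - (J T w - J s w)"
        using bspec[OF elim(1), of s] s by simp
      ultimately have "d s w = ((LBINT r:{s..t}. \<gamma> r w) + ((I T w - I t w) + (J T w - J t w))) - (I T w - I s w) - (J T w - J s w)"
        by (simp only:)
      then show ?case by simp
    qed
    from backward_energy[where d=d, OF Z1 Z2 cov I J g s d(1)[OF s(1) st] d(2)[OF s(1) st] this]
    have "?D s + (LBINT r:{s..t}. ?q r) + (LBINT r:{s..t}. ?r r) \<le> (t - s) * (LBINT r:{s..t}. (l2norm M (\<gamma> r))\<^sup>2)" .
    also have "\<dots> \<le> (t - s) * (\<kappa> * ?S s t)" using s by (intro mult_left_mono gS) auto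
    finally show ?thesis .
  qed
  \<comment> \<open>enough steps for \<open>\<epsilon> * (1 + \<epsilon>) * \<kappa> < 1\<close>, the constant of the contraction\<close>
  obtain n :: nat where n: "T * (1 + T) * \<kappa> + 1 < real n" using reals_Archimedean2 by blast
  have n0: "1 < real n" using n T_pos \<kappa> by (intro order_le_less_trans[OF _ n]) auto
  define \<epsilon> where "\<epsilon> = T / real n"
  have \<epsilon>: "0 < \<epsilon>" "\<epsilon> \<le> T" "real n * \<epsilon> = T" using n0 T_pos by (auto simp: \<epsilon>_def field_simps)
  have small: "\<epsilon> * (1 + \<epsilon>) * \<kappa> < 1"
  proof -
    have "\<epsilon> * (1 + \<epsilon>) * \<kappa> \<le> \<epsilon> * (1 + T) * \<kappa>" using \<epsilon> \<kappa> by (intro mult_right_mono mult_left_mono) auto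
    also have "\<dots> = (T * (1 + T) * \<kappa>) / real n" by (simp add: \<epsilon>_def)
    also have "\<dots> < 1" using n n0 by (simp add: field_simps)
    finally show ?thesis .
  qed
  have step: "(\<forall>s\<in>{t-\<epsilon>..t}. 0 \<le> s \<longrightarrow> ?D s = 0) \<and> ?S (max 0 (t - \<epsilon>)) t = 0"
    if t: "0 \<le> t" "t \<le> T" and dt: "?D t = 0" for t
  proof -
    define a where "a = max 0 (t - \<epsilon>)"
    have a: "0 \<le> a" "a \<le> t" "t - a \<le> \<epsilon>" using t \<epsilon> by (auto simp: a_def)
    have z: "AE w in M. d t w = 0" by (rule l2norm_zeroD[OF d(2)[OF t]]) (use dt in simp)
    have mono: "(LBINT r:{s..t}. f r) \<le> (LBINT r:{a..t}. f r)"
      if f: "\<And>s t. 0 \<le> s \<Longrightarrow> t \<le> T \<Longrightarrow> set_integrable lborel {s..t} f" "\<And>r. 0 \<le> f r" and s: "a \<le> s" "s \<le> t" for f :: "real \<Rightarrow> real" and s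
    proof -
      have fi: "set_integrable lborel {0..T} f" by (rule f(1)) auto
      have "(LBINT r:{a..t}. f r) = (LBINT r:{a..s}. f r) + (LBINT r:{s..t}. f r)"
        using LBINT_Icc_split[OF fi, of a t] LBINT_Icc_split[OF fi, of s t] LBINT_Icc_split[OF fi, of a s] s a t by simp
      moreover have "0 \<le> (LBINT r:{a..s}. f r)"
        unfolding set_lebesgue_integral_def using f(2) by (intro integral_nonneg_AE AE_I2) simp
      ultimately show ?thesis by simp
    qed
    have Sm: "?S s t \<le> ?S a t" if "a \<le> s" "s \<le> t" for s
      using that by (intro add_mono mono int) auto
    have S0: "0 \<le> ?S s t" for s using nn[of s t] by (intro add_nonneg_nonneg) auto
    have Db: "?D s \<le> \<epsilon> * (\<kappa> * ?S a t)" if s: "a \<le> s" "s \<le> t" for s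
    proof -
      have "?D s \<le> ?D s + (LBINT r:{s..t}. ?q r) + (LBINT r:{s..t}. ?r r)"
        using nn[of s t "\<lambda>r. l2norm M (q r)"] nn[of s t "\<lambda>r. l2norm M (qt r)"] by linarith
      also have "\<dots> \<le> (t - s) * (\<kappa> * ?S s t)" using s a t by (intro energy[OF z]) auto
      also have "\<dots> \<le> \<epsilon> * (\<kappa> * ?S a t)"
        using s a \<epsilon>(1) \<kappa> by (intro mult_mono Sm mult_nonneg_nonneg S0) auto
      finally show ?thesis .
    qed
    have "(LBINT r:{a..t}. ?D r) \<le> (LBINT r:{a..t}. \<epsilon> * (\<kappa> * ?S a t))"
    proof (rule set_integral_mono)
      show "set_integrable lborel {a..t} ?D" using a t by (intro int) auto
      show "set_integrable lborel {a..t} (\<lambda>r. \<epsilon> * (\<kappa> * ?S a t))" by (rule borel_integrable_atLeastAtMost') (intro continuous_intros)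
      show "?D r \<le> \<epsilon> * (\<kappa> * ?S a t)" if "r \<in> {a..t}" for r using that by (intro Db) auto
    qed
    also have "\<dots> = (t - a) * (\<epsilon> * (\<kappa> * ?S a t))" using a by (simp add: set_lebesgue_integral_def)
    also have "\<dots> \<le> \<epsilon> * (\<epsilon> * (\<kappa> * ?S a t))" using a \<epsilon>(1) \<kappa> S0 by (intro mult_right_mono mult_nonneg_nonneg) auto
    finally have 1: "(LBINT r:{a..t}. ?D r) \<le> \<epsilon> * (\<epsilon> * (\<kappa> * ?S a t))" .
    have "(LBINT r:{a..t}. ?q r) + (LBINT r:{a..t}. ?r r) \<le> ?D a + (LBINT r:{a..t}. ?q r) + (LBINT r:{a..t}. ?r r)" by simp
    also have "\<dots> \<le> (t - a) * (\<kappa> * ?S a t)" using a t by (intro energy[OF z]) auto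
    also have "\<dots> \<le> \<epsilon> * (\<kappa> * ?S a t)" using a \<kappa> S0 by (intro mult_right_mono mult_nonneg_nonneg) auto
    finally have 2: "(LBINT r:{a..t}. ?q r) + (LBINT r:{a..t}. ?r r) \<le> \<epsilon> * (\<kappa> * ?S a t)" .
    have "?S a t \<le> (\<epsilon> * (1 + \<epsilon>) * \<kappa>) * ?S a t" using 1 2 by (simp add: algebra_simps)
    then have "(1 - \<epsilon> * (1 + \<epsilon>) * \<kappa>) * ?S a t \<le> 0" by (simp add: algebra_simps)
    then have Sz: "?S a t = 0" using small S0[of a] by (simp add: mult_le_0_iff)
    have "?D s = 0" if "s \<in> {t-\<epsilon>..t}" "0 \<le> s" for s
      using Db[of s] that Sz zero_le_power2[of "l2norm M (d s)"] by (auto simp: a_def)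
    then show ?thesis using Sz unfolding a_def by blast
  qed
  have T0: "0 \<le> T" "T \<le> T" using T_pos by auto
  have DT: "?D T = 0"
  proof -
    have "AE w in M. d T w = 0"
      using eq
    proof eventually_elim
      case (elim w)
      have "AE r in lborel. r \<noteq> T" by (rule AE_lborel_singleton)
      then have "(LBINT r:{T..T}. \<gamma> r w) = 0"
        unfolding set_lebesgue_integral_def by (intro integral_eq_zero_AE) (auto elim!: eventually_mono)
      with elim[rule_format, of T] T0 show ?case by simp
    qed
    then have "l2norm M (d T) = l2norm M (\<lambda>w. 0 :: 'b)"
      using d(2)[OF T0] by (intro l2norm_cong_AE sq_int_measurable) auto
    then show ?thesis by simp
  qed
  have ind: "k \<le> n \<Longrightarrow> (\<forall>s\<in>{T - real k * \<epsilon>..T}. 0 \<le> s \<longrightarrow> ?D s = 0) \<and> ?S (max 0 (T - real k * \<epsilon>)) T = 0" for k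
  proof (induction k)
    case 0
    have "?S T T = 0"
    proof -
      have "(LBINT r:{T..T}. (f r)\<^sup>2) = 0" for f :: "real \<Rightarrow> real"
        unfolding set_lebesgue_integral_def
        by (rule integral_eq_zero_AE, rule eventually_mono[OF AE_lborel_singleton[of T]]) auto
      then show ?thesis by simp
    qed
    then show ?case using DT T0 by simp
  next
    case (Suc k)
    let ?t = "T - real k * \<epsilon>"
    have "real (Suc k) * \<epsilon> \<le> real n * \<epsilon>" using Suc.prems \<epsilon>(1) by (intro mult_right_mono) auto
    then have t: "0 \<le> ?t - \<epsilon>" "0 \<le> ?t" "?t \<le> T" "T - real (Suc k) * \<epsilon> = ?t - \<epsilon>" using \<epsilon> by (auto simp: algebra_simps)
    have IH: "\<forall>s\<in>{?t..T}. 0 \<le> s \<longrightarrow> ?D s = 0" "?S ?t T = 0" using Suc t by auto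
    from step[OF t(2,3)] IH(1) t have st: "\<forall>s\<in>{?t-\<epsilon>..?t}. 0 \<le> s \<longrightarrow> ?D s = 0" "?S (?t - \<epsilon>) ?t = 0" by auto
    have "(LBINT r:{?t - \<epsilon>..T}. f r) = (LBINT r:{?t - \<epsilon>..?t}. f r) + (LBINT r:{?t..T}. f r)"
      if "set_integrable lborel {0..T} f" for f :: "real \<Rightarrow> real"
      using LBINT_Icc_split[OF that, of "?t - \<epsilon>" T] LBINT_Icc_split[OF that, of "?t - \<epsilon>" ?t] LBINT_Icc_split[OF that, of ?t T] t \<epsilon>(1) by simp
    from this[OF int(1)[OF order_refl order_refl]] this[OF int(2)[OF order_refl order_refl]] this[OF int(3)[OF order_refl order_refl]]
    have "?S (?t - \<epsilon>) T = 0" using st(2) IH(2) by simp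
    moreover have "\<forall>s\<in>{?t-\<epsilon>..T}. 0 \<le> s \<longrightarrow> ?D s = 0"
    proof (intro ballI impI)
      fix s assume "s \<in> {?t-\<epsilon>..T}" "0 \<le> s"
      then show "?D s = 0" using st(1) IH(1) by (cases "s \<le> ?t") auto
    qed
    ultimately show ?case unfolding t(4) using t(1) by simp
  qed
  have all: "\<forall>s\<in>{0..T}. 0 \<le> s \<longrightarrow> ?D s = 0" "?S 0 T = 0" using ind[of n] \<epsilon>(3) by auto
  show "AE w in M. d t w = 0" if "0 \<le> t" "t \<le> T" for t
    by (rule l2norm_zeroD[OF d(2)[OF that]]) (use all(1) that in auto)
  have "(LBINT r:{0..T}. ?q r) = 0" "(LBINT r:{0..T}. ?r r) = 0"
    using all(2) nn[of 0 T "\<lambda>r. l2norm M (d r)"] nn[of 0 T "\<lambda>r. l2norm M (q r)"] nn[of 0 T "\<lambda>r. l2norm M (qt r)"] by linarith+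
  then show "l2norm PM (case_prod q) = 0" "l2norm PM (case_prod qt) = 0"
    using restr_l2_sections(1)[OF qs(1), of "{0..T}"] restr_l2_sections(1)[OF qs(2), of "{0..T}"] restr_full[OF qs(1)] restr_full[OF qs(2)] by auto
qed

end

section \<open>State and adjoint of the game\<close>

locale lq_game =
  fixes M :: "'a measure" and T :: real and W Y :: "('a, real) process"
    and \<Gamma> :: "('n::finite, 'k1::finite, 'k2::finite) lq_data"
  assumes T: "0 < T" and prob: "prob_space M" and bm: "brownian_motion M T W" "brownian_motion M T Y"
    and ind: "independent_processes M T W Y" and L1: "L1 T \<Gamma>"

sublocale lq_game \<subseteq> filtered_space M T "joint_filtration M W Y"
  by (rule joint_filtration_filtered_space[OF prob T bm])

context lq_game
begin

lemma coefficients_bounded: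
  "bdd_meas T (A1 \<Gamma>)" "bdd_meas T (A2 \<Gamma>)" "bdd_meas T (C1 \<Gamma>)" "bdd_meas T (C2 \<Gamma>)" "bdd_meas T (F1 \<Gamma>)" "bdd_meas T (F2 \<Gamma>)"
  "bdd_meas T (B11 \<Gamma>)" "bdd_meas T (B12 \<Gamma>)" "bdd_meas T (D11 \<Gamma>)" "bdd_meas T (D12 \<Gamma>)" "bdd_meas T (G11 \<Gamma>)" "bdd_meas T (G12 \<Gamma>)"
  "bdd_meas T (B21 \<Gamma>)" "bdd_meas T (B22 \<Gamma>)" "bdd_meas T (D21 \<Gamma>)" "bdd_meas T (D22 \<Gamma>)" "bdd_meas T (G21 \<Gamma>)" "bdd_meas T (G22 \<Gamma>)"
  "bdd_meas T (N11 \<Gamma>)" "bdd_meas T (N12 \<Gamma>)" "bdd_meas T (N21 \<Gamma>)" "bdd_meas T (N22 \<Gamma>)" "bdd_meas T (Q_run \<Gamma>)" "bdd_meas T (h_obs \<Gamma>)"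
  using L1 unfolding L1_def by blast+

lemma W_integrator: "integrator W" "covariation 1 W W"
  by (rule brownian_integrator[OF prob T bm ind refl filtered_space_axioms])+

lemma Y_integrator: "integrator Y" "covariation 1 Y Y"
proof -
  note ind' = independent_processes_commute[OF ind]
  show "integrator Y" "covariation 1 Y Y"
    by (rule brownian_integrator[OF prob T bm(2,1) ind' joint_filtration_commute filtered_space_axioms])+
qed

lemma WY_covariation: "covariation 0 W Y"
  by (rule independent_brownian_covariation[OF prob T bm ind])

lemma controls_M2:
  assumes "u \<in> controls M T Y" shows "u \<in> M2_space M T (joint_filtration M W Y)"
proof -
  have "f \<in> borel_measurable (joint_filtration M W Y t)" if "f \<in> borel_measurable (natural_filtration M Y t)" for f :: "'a \<Rightarrow> real^'b" and t
    by (rule measurable_sub_sets[OF that]) (auto simp: sets_joint_filtration intro: sigma_sets.Basic)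
  with assms show ?thesis unfolding controls_def M2_space_def adapted_def by blast
qed

text \<open>The drift of the state once the observation noise is written as \<open>Y - \<integral> h\<close>, with \<open>Y\<close> a Brownian
  motion.\<close>

definition total_drift :: "('a, real^'n) process \<Rightarrow> ('a, real^'k1) process \<Rightarrow> ('a, real^'k2) process \<Rightarrow> ('a, real^'n) process" where
  "total_drift X u1 u2 t w = drift_coeff M \<Gamma> X u1 u2 t w - h_obs \<Gamma> t *\<^sub>R obs_coeff M \<Gamma> X u1 u2 t w"

lemma coeff_eq:
  "drift_coeff M \<Gamma> X u1 u2 = mf_coeff (A1 \<Gamma>) (A2 \<Gamma>) (B11 \<Gamma>) (B12 \<Gamma>) (B21 \<Gamma>) (B22 \<Gamma>) X u1 u2"
  "W_coeff M \<Gamma> X u1 u2 = mf_coeff (C1 \<Gamma>) (C2 \<Gamma>) (D11 \<Gamma>) (D12 \<Gamma>) (D21 \<Gamma>) (D22 \<Gamma>) X u1 u2"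
  "obs_coeff M \<Gamma> X u1 u2 = mf_coeff (F1 \<Gamma>) (F2 \<Gamma>) (G11 \<Gamma>) (G12 \<Gamma>) (G21 \<Gamma>) (G22 \<Gamma>) X u1 u2"
  by (intro ext, simp only: drift_coeff_def W_coeff_def obs_coeff_def mf_coeff_def)+

abbreviation "F \<equiv> joint_filtration M W Y"

lemma coeff_M2:
  assumes "X \<in> M2_space M T F" "u1 \<in> M2_space M T F" "u2 \<in> M2_space M T F"
  shows "drift_coeff M \<Gamma> X u1 u2 \<in> M2_space M T F" "W_coeff M \<Gamma> X u1 u2 \<in> M2_space M T F"
    "obs_coeff M \<Gamma> X u1 u2 \<in> M2_space M T F" "total_drift X u1 u2 \<in> M2_space M T F"
proof -
  show 1: "drift_coeff M \<Gamma> X u1 u2 \<in> M2_space M T F" "W_coeff M \<Gamma> X u1 u2 \<in> M2_space M T F"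
    "obs_coeff M \<Gamma> X u1 u2 \<in> M2_space M T F"
    unfolding coeff_eq by (intro mf_coeff_M2 coefficients_bounded assms)+
  show "total_drift X u1 u2 \<in> M2_space M T F"
    unfolding total_drift_def[abs_def] by (intro M2_diff M2_scaleR 1 coefficients_bounded)
qed

lemma drift_split:
  assumes X: "X \<in> M2_space M T F" and u: "u1 \<in> M2_space M T F" "u2 \<in> M2_space M T F"
  shows "AE w in M. \<forall>t\<in>{0..T}. (LBINT s:{0..t}. total_drift X u1 u2 s w)
    = (LBINT s:{0..t}. drift_coeff M \<Gamma> X u1 u2 s w) - (LBINT s:{0..t}. h_obs \<Gamma> s *\<^sub>R obs_coeff M \<Gamma> X u1 u2 s w)"
proof -
  note c = coeff_M2[OF X u]
  show ?thesis
    using path_sq_int(1)[OF M2_sq[OF c(1)]] path_sq_int(1)[OF M2_sq[OF M2_scaleR[OF c(3) coefficients_bounded(24)]]]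
  proof eventually_elim
    case (elim w)
    show ?case
    proof
      fix t assume "t \<in> {0..T}"
      then have A: "{0..t} \<subseteq> {0..T}" "{0..t} \<in> sets borel" by auto
      show "(LBINT s:{0..t}. total_drift X u1 u2 s w)
        = (LBINT s:{0..t}. drift_coeff M \<Gamma> X u1 u2 s w) - (LBINT s:{0..t}. h_obs \<Gamma> s *\<^sub>R obs_coeff M \<Gamma> X u1 u2 s w)"
        unfolding total_drift_def
        by (rule set_integral_diff(2)[OF sq_int_set_integrable[OF elim(1) A] sq_int_set_integrable[OF elim(2) A]])
    qed
  qed
qed

lemma obs_noise_eq: "obs_noise \<Gamma> Y = (\<lambda>t w. Y t w - (LBINT s:{0..t}. h_obs \<Gamma> s))"
  by (intro ext) (rule obs_noise_def)

text \<open>The equation is solved with the integrators \<open>W\<close> and \<open>Y\<close>; then the drift \<open>h\<close> is moved back from the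
  time integral into the second stochastic integral.\<close>

theorem state_exists:
  assumes u: "u1 \<in> controls M T Y" "u2 \<in> controls M T Y"
  shows "\<exists>X. is_state M T W Y \<Gamma> x0 u1 u2 X"
proof -
  note u' = controls_M2[OF u(1)] controls_M2[OF u(2)]
  let ?b = "\<lambda>X. drift_coeff M \<Gamma> X u1 u2" and ?s = "\<lambda>X. W_coeff M \<Gamma> X u1 u2" and ?o = "\<lambda>X. obs_coeff M \<Gamma> X u1 u2"
  obtain Cb where Cb: "0 \<le> Cb" "\<And>(X :: ('a, real^'n) process) X' t. X \<in> S2_space M T F \<Longrightarrow> X' \<in> S2_space M T F \<Longrightarrow> 0 \<le> t \<Longrightarrow> t \<le> T \<Longrightarrow>
    sq_int M (\<lambda>w. ?b X t w - ?b X' t w) \<and> l2norm M (\<lambda>w. ?b X t w - ?b X' t w) \<le> Cb * l2norm M (\<lambda>w. X t w - X' t w)"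
    
    by (rule mf_coeff_lipschitz[OF coefficients_bounded(1,2), where R="B11 \<Gamma>" and R'="B12 \<Gamma>" and S="B21 \<Gamma>" and S'="B22 \<Gamma>" and u=u1 and v=u2, folded coeff_eq]) (rule that)
  obtain Cs where Cs: "0 \<le> Cs" "\<And>(X :: ('a, real^'n) process) X' t. X \<in> S2_space M T F \<Longrightarrow> X' \<in> S2_space M T F \<Longrightarrow> 0 \<le> t \<Longrightarrow> t \<le> T \<Longrightarrow>
    sq_int M (\<lambda>w. ?s X t w - ?s X' t w) \<and> l2norm M (\<lambda>w. ?s X t w - ?s X' t w) \<le> Cs * l2norm M (\<lambda>w. X t w - X' t w)"
    
    by (rule mf_coeff_lipschitz[OF coefficients_bounded(3,4), where R="D11 \<Gamma>" and R'="D12 \<Gamma>" and S="D21 \<Gamma>" and S'="D22 \<Gamma>" and u=u1 and v=u2, folded coeff_eq]) (rule that)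
  obtain Co where Co: "0 \<le> Co" "\<And>(X :: ('a, real^'n) process) X' t. X \<in> S2_space M T F \<Longrightarrow> X' \<in> S2_space M T F \<Longrightarrow> 0 \<le> t \<Longrightarrow> t \<le> T \<Longrightarrow>
    sq_int M (\<lambda>w. ?o X t w - ?o X' t w) \<and> l2norm M (\<lambda>w. ?o X t w - ?o X' t w) \<le> Co * l2norm M (\<lambda>w. X t w - X' t w)"
    
    by (rule mf_coeff_lipschitz[OF coefficients_bounded(5,6), where R="G11 \<Gamma>" and R'="G12 \<Gamma>" and S="G21 \<Gamma>" and S'="G22 \<Gamma>" and u=u1 and v=u2, folded coeff_eq]) (rule that)
  obtain H where H: "0 \<le> H" "\<And>t. t \<in> {0..T} \<Longrightarrow> \<bar>h_obs \<Gamma> t\<bar> \<le> H"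
  proof -
    obtain a where "\<And>t. t \<in> {0..T} \<Longrightarrow> \<bar>h_obs \<Gamma> t\<bar> \<le> a"
      using coefficients_bounded(24) by (force simp: bdd_meas_def bounded_iff)
    with that[of "max 0 a"] show ?thesis by force
  qed
  define C where "C = Cb + H * Co + Cs + Co"
  have C: "0 \<le> C" "Cb + H * Co \<le> C" "Cs \<le> C" "Co \<le> C" using Cb(1) Cs(1) Co(1) H(1) by (auto simp: C_def)
  have "\<exists>X I J. ito_process W Y x0 (total_drift X u1 u2) (?s X) (?o X) X I J"
  proof (rule mean_field_sde_exists[OF W_integrator Y_integrator coeff_M2(4)[OF S2_M2 u'] coeff_M2(2)[OF S2_M2 u'] coeff_M2(3)[OF S2_M2 u'] C(1)])
    fix X X' :: "('a, real^'n) process" and t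
    assume X: "X \<in> S2_space M T F" "X' \<in> S2_space M T F" and t: "0 \<le> t" "t \<le> T"
    note b = Cb(2)[OF X t] Cs(2)[OF X t] Co(2)[OF X t]
    let ?D = "l2norm M (\<lambda>w. X t w - X' t w)"
    have up: "x \<le> C * ?D" if "x \<le> c * ?D" "c \<le> C" for x c
      using order_trans[OF that(1) mult_right_mono[OF that(2) l2norm_nonneg]] .
    show "l2norm M (\<lambda>w. ?s X t w - ?s X' t w) \<le> C * ?D" using up[OF conjunct2[OF b(2)] C(3)] .
    show "l2norm M (\<lambda>w. ?o X t w - ?o X' t w) \<le> C * ?D" using up[OF conjunct2[OF b(3)] C(4)] .
    let ?o' = "\<lambda>w. ?o X t w - ?o X' t w"
    have "l2norm M (\<lambda>w. h_obs \<Gamma> t *\<^sub>R ?o' w) \<le> H * l2norm M ?o'"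
    proof (rule l2norm_mono[OF conjunct1[OF b(3)] _ _ H(1)])
      show "(\<lambda>w. h_obs \<Gamma> t *\<^sub>R ?o' w) \<in> borel_measurable M"
        by (intro sq_int_measurable sq_int_scaleR conjunct1[OF b(3)])
      show "AE w in M. norm (h_obs \<Gamma> t *\<^sub>R ?o' w) \<le> H * norm (?o' w)"
        using H(2)[of t] t by (intro AE_I2) (simp add: mult_right_mono)
    qed
    also have "\<dots> \<le> H * (Co * ?D)" using b(3) H(1) by (intro mult_left_mono) auto
    finally have ho: "l2norm M (\<lambda>w. h_obs \<Gamma> t *\<^sub>R ?o' w) \<le> H * (Co * ?D)" .
    have eq: "total_drift X u1 u2 t w - total_drift X' u1 u2 t w = (?b X t w - ?b X' t w) - h_obs \<Gamma> t *\<^sub>R ?o' w" for w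
      by (simp add: total_drift_def algebra_simps)
    have "l2norm M (\<lambda>w. total_drift X u1 u2 t w - total_drift X' u1 u2 t w)
      \<le> l2norm M (\<lambda>w. ?b X t w - ?b X' t w) + l2norm M (\<lambda>w. h_obs \<Gamma> t *\<^sub>R ?o' w)"
      unfolding eq by (intro l2norm_triangle_diff sq_int_scaleR conjunct1[OF b(1)] conjunct1[OF b(3)])
    also have "\<dots> \<le> Cb * ?D + H * (Co * ?D)" using b(1) ho by (intro add_mono) auto
    also have "\<dots> = (Cb + H * Co) * ?D" by (simp add: algebra_simps)
    finally show "l2norm M (\<lambda>w. total_drift X u1 u2 t w - total_drift X' u1 u2 t w) \<le> C * ?D"
      by (rule up[OF _ C(2)])
  qed
  then obtain X I J where S: "ito_process W Y x0 (total_drift X u1 u2) (?s X) (?o X) X I J" by blast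
  note XS = ito_processD[OF S]
  \<comment> \<open>\<open>W\<close> itself is the integrator without drift\<close>
  have zero: "bdd_meas T (\<lambda>_. 0::real)" by (simp add: bdd_meas_def image_constant_conv)
  from S have sI: "has_stoch_integral M T F (\<lambda>t w. W t w - (LBINT s:{0..t}. (0::real))) (?s X) (\<lambda>t w. I t w - (LBINT s:{0..t}. (0::real) *\<^sub>R ?s X s w))"
    and sJ: "has_stoch_integral M T F (\<lambda>t w. Y t w - (LBINT s:{0..t}. h_obs \<Gamma> s)) (?o X) (\<lambda>t w. J t w - (LBINT s:{0..t}. h_obs \<Gamma> s *\<^sub>R ?o X s w))"
    unfolding ito_process_def using zero coefficients_bounded(24) by blast+
  have "(LBINT s:{0..t}. (0::'c::euclidean_space)) = 0" for t :: real by (simp add: set_lebesgue_integral_def)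
  with sI have sI': "has_stoch_integral M T F W (?s X) I" by simp
  have "AE w in M. \<forall>t\<in>{0..T}. X t w = x0 + (LBINT s:{0..t}. ?b X s w) + I t w + (J t w - (LBINT s:{0..t}. h_obs \<Gamma> s *\<^sub>R ?o X s w))"
    using XS(5) drift_split[OF S2_M2[OF XS(1)] u'] by eventually_elim simp
  with XS(1) sI' sJ show ?thesis unfolding is_state_def obs_noise_eq by blast
qed

definition mean_A :: "real \<Rightarrow> real^'n^'n" where
  "mean_A t = (A1 \<Gamma> t + A2 \<Gamma> t) - h_obs \<Gamma> t *\<^sub>R (F1 \<Gamma> t + F2 \<Gamma> t)"

definition mean_B1 :: "real \<Rightarrow> real^'k1^'n" where
  "mean_B1 t = (B11 \<Gamma> t + B12 \<Gamma> t) - h_obs \<Gamma> t *\<^sub>R (G11 \<Gamma> t + G12 \<Gamma> t)"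

definition mean_B2 :: "real \<Rightarrow> real^'k2^'n" where
  "mean_B2 t = (B21 \<Gamma> t + B22 \<Gamma> t) - h_obs \<Gamma> t *\<^sub>R (G21 \<Gamma> t + G22 \<Gamma> t)"

lemma mean_coeff_bounded: "bdd_meas T mean_A" "bdd_meas T mean_B1" "bdd_meas T mean_B2"
  unfolding mean_A_def[abs_def] mean_B1_def[abs_def] mean_B2_def[abs_def]
  by (intro bdd_meas_diff bdd_meas_add bdd_meas_scaleR coefficients_bounded)+

text \<open>Stochastic integrals have mean zero, and expectation commutes with the time integral and with the
  deterministic matrices.\<close>

lemma state_mean:
  assumes u: "u1 \<in> controls M T Y" "u2 \<in> controls M T Y" and X: "is_state M T W Y \<Gamma> x0 u1 u2 X" and t: "0 \<le> t" "t \<le> T"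
  shows "mean M X t = x0 + (LBINT s:{0..t}. mean_A s *v mean M X s + mean_B1 s *v mean M u1 s + mean_B2 s *v mean M u2 s)"
proof -
  note u' = controls_M2[OF u(1)] controls_M2[OF u(2)]
  have XS: "X \<in> S2_space M T F" using X unfolding is_state_def by blast
  note X2 = S2_M2[OF XS]
  note c = coeff_M2[OF X2 u']
  obtain I J where sI: "has_stoch_integral M T F W (W_coeff M \<Gamma> X u1 u2) I"
    and sJ: "has_stoch_integral M T F (\<lambda>t w. Y t w - (LBINT s:{0..t}. h_obs \<Gamma> s)) (obs_coeff M \<Gamma> X u1 u2) J"
    and eq: "AE w in M. \<forall>t\<in>{0..T}. X t w = x0 + (LBINT s:{0..t}. drift_coeff M \<Gamma> X u1 u2 s w) + I t w + J t w"
    using X unfolding is_state_def obs_noise_eq by blast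
  define K where "K = (\<lambda>t w. J t w + (LBINT s:{0..t}. h_obs \<Gamma> s *\<^sub>R obs_coeff M \<Gamma> X u1 u2 s w))"
  let ?b = "total_drift X u1 u2"
  have iI: "ito W (W_coeff M \<Gamma> X u1 u2) I" by (rule has_stoch_integral_ito[OF W_integrator sI])
  have iJ: "ito Y (obs_coeff M \<Gamma> X u1 u2) K"
    unfolding K_def by (rule has_stoch_integral_drift_ito[OF Y_integrator coefficients_bounded(24) sJ])
  have "AE w in M. X t w = x0 + (LBINT s:{0..t}. ?b s w) + I t w + K t w"
    using eq drift_split[OF X2 u'] by eventually_elim (use t in \<open>simp add: K_def\<close>)
  moreover have A: "{0..t} \<in> sets borel" "{0..t} \<subseteq> {0..T}" using t by auto
  have bi: "integrable M (\<lambda>w. LBINT s:{0..t}. ?b s w)"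
    by (rule sq_int_integrable[OF time_integral_l2(1)[OF M2_sq[OF c(4)] order_refl t]])
  note Ii = sq_int_integrable[OF itoD(3)[OF iI t]] and Ji = sq_int_integrable[OF itoD(3)[OF iJ t]]
  ultimately have "mean M X t = (\<integral>w. x0 + (LBINT s:{0..t}. ?b s w) + I t w + K t w \<partial>M)"
    using M2_measurable_M[OF X2 t] by (intro integral_cong_AE borel_measurable_add borel_measurable_const borel_measurable_integrable[OF bi] borel_measurable_integrable[OF Ii] borel_measurable_integrable[OF Ji])
  also have "\<dots> = x0 + (\<integral>w. (LBINT s:{0..t}. ?b s w) \<partial>M) + (\<integral>w. I t w \<partial>M) + (\<integral>w. K t w \<partial>M)"
    using bi Ii Ji by (simp only: Bochner_Integration.integral_add Bochner_Integration.integrable_add integrable_const) (simp add: prob_space)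
  also have "\<dots> = x0 + (LBINT s:{0..t}. mean M ?b s)"
    using ito_mean_zero[OF W_integrator iI t] ito_mean_zero[OF Y_integrator iJ t]
      time_integral_expectation[OF M2_sq[OF c(4)] A] by simp
  also have "(LBINT s:{0..t}. mean M ?b s) = (LBINT s:{0..t}. mean_A s *v mean M X s + mean_B1 s *v mean M u1 s + mean_B2 s *v mean M u2 s)"
    unfolding set_integral_leb(1)[OF A(2)]
  proof (rule integral_cong_AE)
    let ?r = "\<lambda>s. mean_A s *v mean M X s + mean_B1 s *v mean M u1 s + mean_B2 s *v mean M u2 s"
    have i[measurable]: "indicator {0..t} \<in> borel_measurable (leb T)" by (intro measurable_leb) simp
    have [measurable]: "mean M ?b \<in> borel_measurable (leb T)" "mean M X \<in> borel_measurable (leb T)"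
      "mean M u1 \<in> borel_measurable (leb T)" "mean M u2 \<in> borel_measurable (leb T)"
      by (intro sq_int_measurable mean_sq_int M2_sq c X2 u')+
    have [measurable]: "mean_A \<in> borel_measurable (leb T)" "mean_B1 \<in> borel_measurable (leb T)" "mean_B2 \<in> borel_measurable (leb T)"
      by (intro bdd_meas_measurable mean_coeff_bounded)+
    show "(\<lambda>s. indicator {0..t} s *\<^sub>R mean M ?b s) \<in> borel_measurable (leb T)"
      "(\<lambda>s. indicator {0..t} s *\<^sub>R ?r s) \<in> borel_measurable (leb T)" by measurable
    have "AE s in leb T. mean M ?b s = ?r s"
      using section_sq_int(1)[OF M2_sq[OF c(1)]] section_sq_int(1)[OF M2_sq[OF c(3)]]
        mf_coeff_mean[OF X2 u', of "A1 \<Gamma>" "A2 \<Gamma>" "B11 \<Gamma>" "B12 \<Gamma>" "B21 \<Gamma>" "B22 \<Gamma>"]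
        mf_coeff_mean[OF X2 u', of "F1 \<Gamma>" "F2 \<Gamma>" "G11 \<Gamma>" "G12 \<Gamma>" "G21 \<Gamma>" "G22 \<Gamma>"]
    proof eventually_elim
      case (elim s)
      have "mean M ?b s = mean M (drift_coeff M \<Gamma> X u1 u2) s - h_obs \<Gamma> s *\<^sub>R mean M (obs_coeff M \<Gamma> X u1 u2) s"
        unfolding total_drift_def using elim(1,2)[THEN sq_int_integrable] by simp
      also have "\<dots> = ?r s"
        unfolding coeff_eq elim(3,4) mean_A_def mean_B1_def mean_B2_def
        by (simp add: matrix_vector_mult_diff_rdistrib scaleR_matrix_vector_assoc[symmetric], simp add: scaleR_add_right)
      finally show ?case .
    qed
    then show "AE s in leb T. indicator {0..t} s *\<^sub>R mean M ?b s = indicator {0..t} s *\<^sub>R ?r s"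
      by eventually_elim simp
  qed
  finally show ?thesis .
qed

end

declare transpose_matrix_vector [simp del]

context filtered_space
begin

lemma l2norm_centred:
  assumes f: "sq_int M f"
  shows "sq_int M (\<lambda>w. f w - (\<integral>w. f w \<partial>M))" "l2norm M (\<lambda>w. f w - (\<integral>w. f w \<partial>M)) \<le> 2 * l2norm M f"
proof -
  show "sq_int M (\<lambda>w. f w - (\<integral>w. f w \<partial>M))" by (intro sq_int_diff f sq_int_const)
  show "l2norm M (\<lambda>w. f w - (\<integral>w. f w \<partial>M)) \<le> 2 * l2norm M f"
    using l2norm_triangle_diff[OF f sq_int_const[of "\<integral>w. f w \<partial>M"]] norm_expectation_le_l2norm[OF f] by simp
qed

lemma matrix_l2:
  fixes f :: "'a \<Rightarrow> real^'m::finite" and A :: "real^'m^'n::finite"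
  assumes f: "sq_int M f" and C: "0 \<le> C" "\<And>v. norm (A *v v) \<le> C * norm v"
  shows "sq_int M (\<lambda>w. A *v f w)" "l2norm M (\<lambda>w. A *v f w) \<le> C * l2norm M f"
proof -
  have [measurable]: "f \<in> borel_measurable M" by (rule sq_int_measurable[OF f])
  have m: "(\<lambda>w. A *v f w) \<in> borel_measurable M" by measurable
  have le: "AE w in M. norm (A *v f w) \<le> C * norm (f w)" using C(2) by simp
  show "sq_int M (\<lambda>w. A *v f w)" by (rule sq_int_bound[OF f m le])
  show "l2norm M (\<lambda>w. A *v f w) \<le> C * l2norm M f" by (rule l2norm_mono[OF f m le C(1)])
qed

lemma l2_zero_sections:
  assumes H: "sq_int PM (case_prod H)" "l2norm PM (case_prod H) = 0"
  shows "AE t in leb T. AE w in M. H t w = 0"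
  using TM.AE_pair[OF l2norm_zeroD[OF H]] by simp

lemma vec_cond_exp_const:
  fixes f :: "'a \<Rightarrow> real^'n::finite"
  assumes G: "subalgebra M G" and f: "f \<in> borel_measurable M" and c: "AE w in M. f w = c"
  shows "AE w in M. vec_cond_exp M G f w = c"
proof -
  interpret G: finite_measure_subalgebra M G by unfold_locales (rule G)
  have "AE w in M. real_cond_exp M G (\<lambda>x. f x $ i) w = c $ i" for i
  proof -
    have "AE w in M. real_cond_exp M G (\<lambda>x. f x $ i) w = real_cond_exp M G (\<lambda>x. c $ i) w"
    proof (rule G.real_cond_exp_cong)
      show "(\<lambda>x. f x $ i) \<in> borel_measurable M"
        by (rule measurable_compose[OF f]) (intro borel_measurable_continuous_onI continuous_intros)
      show "AE x in M. f x $ i = c $ i" using c by eventually_elim simp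
    qed simp
    moreover have "AE w in M. real_cond_exp M G (\<lambda>x. c $ i) w = c $ i"
      by (rule G.real_cond_exp_F_meas) auto
    ultimately show ?thesis by eventually_elim simp
  qed
  then have "AE w in M. \<forall>i\<in>UNIV. real_cond_exp M G (\<lambda>x. f x $ i) w = c $ i"
    by (intro AE_finite_allI) auto
  then show ?thesis by eventually_elim (simp add: vec_cond_exp_def vec_eq_iff)
qed

end

context lq_game
begin

lemma Q_sq: "sq_int (leb T) (Q_run \<Gamma>)"
proof -
  obtain K where K: "\<forall>x\<in>Q_run \<Gamma> ` {0..T}. norm x \<le> K" using coefficients_bounded(23) unfolding bdd_meas_def bounded_iff by blast
  show ?thesis
  proof (rule tm.sq_int_bounded)
    show "Q_run \<Gamma> \<in> borel_measurable (leb T)" by (rule bdd_meas_measurable[OF coefficients_bounded(23)])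
    show "norm (Q_run \<Gamma> t) \<le> K" if "t \<in> space (leb T)" for t using K that by simp
  qed
qed

text \<open>The adjoint equation minus its expectation is an equation for \<open>p - E p\<close> with the same \<open>q\<close> and
  \<open>qt\<close>. Source and terminal value cancel, and its drift is at each time bounded in mean square by the
  three unknowns, so \<open>backward_equation_trivial\<close> applies.\<close>

theorem adjoint_deterministic:
  assumes adj: "adjoint_solution M T W Y \<Gamma> p q qt"
  shows "\<And>t. 0 \<le> t \<Longrightarrow> t \<le> T \<Longrightarrow> AE w in M. p t w = mean M p t"
    and "AE t in leb T. AE w in M. q t w = 0"
    and "\<And>t. 0 \<le> t \<Longrightarrow> t \<le> T \<Longrightarrow> mean M p t = M_term \<Gamma> + (LBINT s:{t..T}. transpose (mean_A s) *v mean M p s + Q_run \<Gamma> s)"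
proof -
  let ?a = "adjoint_drift M \<Gamma> p q qt"
  have pS: "p \<in> S2_space M T F" and q2: "q \<in> M2_space M T F" and qt2: "qt \<in> M2_space M T F"
    using adj unfolding adjoint_solution_def by blast+
  note p2 = S2_M2[OF pS]
  obtain I J where sI: "has_stoch_integral M T F W q I" and sJ: "has_stoch_integral M T F Y qt J"
    and eq: "AE w in M. \<forall>t\<in>{0..T}. p t w = M_term \<Gamma> + (LBINT s:{t..T}. ?a s w) - (I T w - I t w) - (J T w - J t w)"
    using adj unfolding adjoint_solution_def by blast
  note I = has_stoch_integral_ito[OF W_integrator sI] and J = has_stoch_integral_ito[OF Y_integrator sJ]
  have T0: "0 \<le> T" "T \<le> T" using T by auto
  let ?P1 = "\<lambda>t. transpose (A1 \<Gamma> t) - h_obs \<Gamma> t *\<^sub>R transpose (F1 \<Gamma> t)" and ?P2 = "\<lambda>t. transpose (A2 \<Gamma> t) - h_obs \<Gamma> t *\<^sub>R transpose (F2 \<Gamma> t)"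
  note b = coefficients_bounded
  have P1: "bdd_meas T ?P1" by (intro bdd_meas_diff bdd_meas_scaleR bdd_meas_transpose b)
  have P2: "bdd_meas T ?P2" by (intro bdd_meas_diff bdd_meas_scaleR bdd_meas_transpose b)
  have a2: "?a \<in> M2_space M T F"
    unfolding adjoint_drift_def[abs_def]
    by (intro M2_add M2_matrix M2_matrix[OF M2_mean] M2_deterministic[OF Q_sq] P1 P2 bdd_meas_transpose b p2 q2 qt2)
  have asq: "sq_int PM (case_prod ?a)" by (rule M2_sq[OF a2])
  note secs = section_sq_int(1)[OF M2_sq[OF p2]] section_sq_int(1)[OF M2_sq[OF q2]] section_sq_int(1)[OF M2_sq[OF qt2]]
  have amean: "AE t in leb T. mean M ?a t = (?P1 t + ?P2 t) *v mean M p t + (transpose (C1 \<Gamma> t) + transpose (C2 \<Gamma> t)) *v mean M q t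
      + (transpose (F1 \<Gamma> t) + transpose (F2 \<Gamma> t)) *v mean M qt t + Q_run \<Gamma> t"
    using secs
  proof eventually_elim
    case (elim t)
    note i = elim[THEN sq_int_integrable]
    note e = expectation_matrix[OF i(1)] expectation_matrix[OF i(2)] expectation_matrix[OF i(3)]
    show ?case unfolding adjoint_drift_def by (simp add: e prob_space matrix_vector_mult_add_rdistrib)
  qed
  let ?d = "\<lambda>t w. p t w - mean M p t" and ?g = "\<lambda>t w. ?a t w - mean M ?a t"
  have d2: "?d \<in> M2_space M T F" and g2: "?g \<in> M2_space M T F" by (intro M2_diff M2_mean p2 a2)+
  have pmean: "mean M p t = M_term \<Gamma> + (LBINT s:{t..T}. mean M ?a s)" if t: "0 \<le> t" "t \<le> T" for t
  proof -
    have A: "{t..T} \<in> sets borel" "{t..T} \<subseteq> {0..T}" using t by auto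
    have bi: "integrable M (\<lambda>w. LBINT s:{t..T}. ?a s w)"
      by (rule sq_int_integrable[OF time_integral_l2(1)[OF asq t order_refl]])
    note Ii = sq_int_integrable[OF itoD(3)[OF I t]] sq_int_integrable[OF itoD(3)[OF I T0]]
    note Ji = sq_int_integrable[OF itoD(3)[OF J t]] sq_int_integrable[OF itoD(3)[OF J T0]]
    let ?r = "\<lambda>w. M_term \<Gamma> + (LBINT s:{t..T}. ?a s w) - (I T w - I t w) - (J T w - J t w)"
    have ri: "integrable M ?r" by (intro Bochner_Integration.integrable_add Bochner_Integration.integrable_diff integrable_const bi Ii Ji)
    have "AE w in M. p t w = ?r w" using eq by eventually_elim (use t in simp)
    then have "mean M p t = (\<integral>w. ?r w \<partial>M)"
      by (intro integral_cong_AE M2_measurable_M[OF p2 t] borel_measurable_integrable[OF ri])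
    also have "\<dots> = M_term \<Gamma> + (\<integral>w. (LBINT s:{t..T}. ?a s w) \<partial>M) - ((\<integral>w. I T w \<partial>M) - (\<integral>w. I t w \<partial>M)) - ((\<integral>w. J T w \<partial>M) - (\<integral>w. J t w \<partial>M))"
      using bi Ii Ji by (simp add: prob_space)
    also have "\<dots> = M_term \<Gamma> + (LBINT s:{t..T}. mean M ?a s)"
      using ito_mean_zero[OF W_integrator I t] ito_mean_zero[OF W_integrator I T0] ito_mean_zero[OF Y_integrator J t]
        ito_mean_zero[OF Y_integrator J T0] time_integral_expectation[OF asq A] by simp
    finally show ?thesis .
  qed
  \<comment> \<open>the equation of \<open>p - E p\<close>\<close>
  have deq: "AE w in M. \<forall>t\<in>{0..T}. ?d t w = (LBINT r:{t..T}. ?g r w) - (I T w - I t w) - (J T w - J t w)"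
    using eq path_sq_int(1)[OF asq]
  proof eventually_elim
    case (elim w)
    show ?case
    proof
      fix t assume t: "t \<in> {0..T}"
      then have A: "{t..T} \<subseteq> {0..T}" "{t..T} \<in> sets borel" by auto
      have "(LBINT r:{t..T}. ?g r w) = (LBINT r:{t..T}. ?a r w) - (LBINT r:{t..T}. mean M ?a r)"
        by (rule set_integral_diff(2)[OF sq_int_set_integrable[OF elim(2) A] sq_int_set_integrable[OF mean_sq_int[OF asq] A]])
      then show "?d t w = (LBINT r:{t..T}. ?g r w) - (I T w - I t w) - (J T w - J t w)"
        using bspec[OF elim(1) t] pmean[of t] t by simp
    qed
  qed
  obtain C where C: "0 \<le> C" "\<And>t v. t \<in> {0..T} \<Longrightarrow> norm (?P1 t *v v) \<le> C * norm v" using bdd_meas_operator_bound[OF P1] by blast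
  obtain C' where C': "0 \<le> C'" "\<And>t v. t \<in> {0..T} \<Longrightarrow> norm (transpose (C1 \<Gamma> t) *v v) \<le> C' * norm v"
    using bdd_meas_operator_bound[OF bdd_meas_transpose[OF b(3)]] by blast
  obtain C'' where C'': "0 \<le> C''" "\<And>t v. t \<in> {0..T} \<Longrightarrow> norm (transpose (F1 \<Gamma> t) *v v) \<le> C'' * norm v"
    using bdd_meas_operator_bound[OF bdd_meas_transpose[OF b(5)]] by blast
  define K where "K = C + 2 * C' + 2 * C''"
  have K: "0 \<le> K" "C \<le> K" "2 * C' \<le> K" "2 * C'' \<le> K" using C(1) C'(1) C''(1) by (auto simp: K_def)
  have "AE t in leb T. l2norm M (?g t) \<le> K * (l2norm M (?d t) + l2norm M (q t) + l2norm M (qt t))"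
    using secs amean AE_space
  proof eventually_elim
    case (elim t)
    then have tt: "t \<in> {0..T}" by simp
    let ?q = "\<lambda>w. q t w - mean M q t" and ?qt = "\<lambda>w. qt t w - mean M qt t"
    have g: "?g t w = ?P1 t *v ?d t w + transpose (C1 \<Gamma> t) *v ?q w + transpose (F1 \<Gamma> t) *v ?qt w" for w
      unfolding elim(4) by (simp add: adjoint_drift_def matrix_vector_mult_add_rdistrib matrix_vector_mult_diff_distrib)
    have ds: "sq_int M (?d t)" by (rule l2norm_centred(1)[OF elim(1)])
    note m = matrix_l2[OF ds C(1) C(2)[OF tt]] matrix_l2[OF l2norm_centred(1)[OF elim(2)] C'(1) C'(2)[OF tt]]
      matrix_l2[OF l2norm_centred(1)[OF elim(3)] C''(1) C''(2)[OF tt]]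
    have "l2norm M (?g t) \<le> C * l2norm M (?d t) + C' * l2norm M ?q + C'' * l2norm M ?qt"
      unfolding g using l2norm_triangle[OF sq_int_add[OF m(1) m(3)] m(5)] l2norm_triangle[OF m(1) m(3)] m(2,4,6) by linarith
    also have "\<dots> \<le> C * l2norm M (?d t) + C' * (2 * l2norm M (q t)) + C'' * (2 * l2norm M (qt t))"
      by (intro add_mono mult_left_mono l2norm_centred(2) elim order_refl C(1) C'(1) C''(1))
    also have "\<dots> = C * l2norm M (?d t) + (2 * C') * l2norm M (q t) + (2 * C'') * l2norm M (qt t)" by simp
    also have "\<dots> \<le> K * l2norm M (?d t) + K * l2norm M (q t) + K * l2norm M (qt t)"
      by (intro add_mono mult_right_mono K l2norm_nonneg)
    finally show ?case by (simp add: algebra_simps)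
  qed
  then have lip: "AE t in lborel. t \<in> {0..T} \<longrightarrow> l2norm M (?g t) \<le> K * (l2norm M (?d t) + l2norm M (q t) + l2norm M (qt t))"
    by (subst (asm) AE_restrict_space_iff) auto
  have dsq: "sq_int M (?d t)" if "0 \<le> t" "t \<le> T" for t
    using S2_l2_bound[OF pS] that l2norm_centred(1) by metis
  note triv = backward_equation_trivial[OF W_integrator Y_integrator WY_covariation I J M2_sq[OF g2] M2_measurable[OF d2] dsq M2_sq[OF d2] deq K(1) lip]
  show "AE w in M. p t w = mean M p t" if "0 \<le> t" "t \<le> T" for t
  proof -
    have "AE w in M. p t w - mean M p t = 0" by (rule triv(1)[OF _ _ _ _ that])
    then show ?thesis by simp
  qed
  have triv2: "l2norm PM (case_prod q) = 0" by (rule triv(2))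
  have triv3: "l2norm PM (case_prod qt) = 0" by (rule triv(3))
  have q0: "AE t in leb T. AE w in M. q t w = 0" by (rule l2_zero_sections[OF itoD(1)[OF I] triv2])
  then show "AE t in leb T. AE w in M. q t w = 0" .
  have qt0: "AE t in leb T. AE w in M. qt t w = 0" by (rule l2_zero_sections[OF itoD(1)[OF J] triv3])
  show "mean M p t = M_term \<Gamma> + (LBINT s:{t..T}. transpose (mean_A s) *v mean M p s + Q_run \<Gamma> s)" if t: "0 \<le> t" "t \<le> T" for t
  proof -
    have A: "{t..T} \<subseteq> {0..T}" using t by auto
    have i[measurable]: "indicator {t..T} \<in> borel_measurable (leb T)" by (intro measurable_leb) simp
    have [measurable]: "mean M ?a \<in> borel_measurable (leb T)" "mean M p \<in> borel_measurable (leb T)"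
      by (intro sq_int_measurable mean_sq_int M2_sq a2 p2)+
    have [measurable]: "Q_run \<Gamma> \<in> borel_measurable (leb T)" "(\<lambda>s. transpose (mean_A s)) \<in> borel_measurable (leb T)"
      by (intro bdd_meas_measurable bdd_meas_transpose mean_coeff_bounded b)+
    have "(LBINT s:{t..T}. mean M ?a s) = (LBINT s:{t..T}. transpose (mean_A s) *v mean M p s + Q_run \<Gamma> s)"
      unfolding set_integral_leb(1)[OF A]
    proof (rule integral_cong_AE)
      show "(\<lambda>s. indicator {t..T} s *\<^sub>R mean M ?a s) \<in> borel_measurable (leb T)"
        "(\<lambda>s. indicator {t..T} s *\<^sub>R (transpose (mean_A s) *v mean M p s + Q_run \<Gamma> s)) \<in> borel_measurable (leb T)" by measurable
      show "AE s in leb T. indicator {t..T} s *\<^sub>R mean M ?a s = indicator {t..T} s *\<^sub>R (transpose (mean_A s) *v mean M p s + Q_run \<Gamma> s)"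
        using amean q0 qt0 secs(2,3)
      proof eventually_elim
        case (elim s)
        have "mean M q s = (\<integral>w. 0 \<partial>M)" "mean M qt s = (\<integral>w. 0 \<partial>M)"
          by (intro integral_cong_AE elim sq_int_measurable; simp)+
        then have z: "mean M q s = 0" "mean M qt s = 0" by simp_all
        have "?P1 s + ?P2 s = transpose (mean_A s)"
          by (simp add: mean_A_def transpose_def vec_eq_iff algebra_simps)
        then show ?case using elim(1) by (simp add: z)
      qed
    qed
    then show ?thesis using pmean[OF t] by simp
  qed
qed

end

section \<open>Duality and quadratic functionals\<close>

text \<open>After inserting the integral equations, both time integrals contain the double integral of
  \<open>g s \<bullet> f t\<close> over \<open>t \<le> s\<close>, in the two orders of integration.\<close>

lemma integration_by_parts:
  fixes f g :: "real \<Rightarrow> 'b::euclidean_space"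
  assumes f: "sq_int (leb T) f" and g: "sq_int (leb T) g"
    and m: "\<And>t. 0 \<le> t \<Longrightarrow> t \<le> T \<Longrightarrow> m t = x + (LBINT s:{0..t}. f s)"
    and P: "\<And>t. 0 \<le> t \<Longrightarrow> t \<le> T \<Longrightarrow> P t = y + (LBINT s:{t..T}. g s)" and T: "0 < T"
  shows "y \<bullet> m T - P 0 \<bullet> x = (\<integral>t. P t \<bullet> f t \<partial>leb T) - (\<integral>t. g t \<bullet> m t \<partial>leb T)"
proof -
  interpret tm: finite_measure "leb T" by (rule finite_leb)
  interpret TT: pair_sigma_finite "leb T" "leb T" ..
  have fi: "integrable (leb T) f" and gi: "integrable (leb T) g"
    by (intro tm.sq_int_integrable f g)+
  have [measurable]: "f \<in> borel_measurable (leb T)" "g \<in> borel_measurable (leb T)"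
    by (intro sq_int_measurable f g)+
  let ?k = "\<lambda>t s. (if t \<le> s then g s \<bullet> f t else 0)"
  have id: "(\<lambda>t. t) \<in> borel_measurable (leb T)" by (rule measurable_leb) simp
  have [measurable]: "fst \<in> borel_measurable (leb T \<Otimes>\<^sub>M leb T)" "snd \<in> borel_measurable (leb T \<Otimes>\<^sub>M leb T)"
    by (rule measurable_compose[OF measurable_fst id], rule measurable_compose[OF measurable_snd id])
  have km: "(\<lambda>x. ?k (fst x) (snd x)) \<in> borel_measurable (leb T \<Otimes>\<^sub>M leb T)" by measurable
  have ki: "integrable (leb T \<Otimes>\<^sub>M leb T) (\<lambda>(t, s). ?k t s)"
  proof (rule Bochner_Integration.integrable_bound[OF TT.integral_product_pair(1)[OF integrable_norm[OF fi] integrable_norm[OF gi]]])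
    show "(\<lambda>(t, s). ?k t s) \<in> borel_measurable (leb T \<Otimes>\<^sub>M leb T)" using km by (simp add: case_prod_beta')
    have "norm (g s \<bullet> f t) \<le> norm (f t) * norm (g s)" for t s using Cauchy_Schwarz_ineq2[of "g s" "f t"] by (simp add: mult.commute)
    then show "AE x in leb T \<Otimes>\<^sub>M leb T. norm (case x of (t, s) \<Rightarrow> ?k t s) \<le> norm (case x of (t, s) \<Rightarrow> norm (f t) * norm (g s))"
      by (intro AE_I2) (auto simp: abs_mult)
  qed
  have Pf: "P t \<bullet> f t = y \<bullet> f t + (\<integral>s. ?k t s \<partial>leb T)" if t: "t \<in> {0..T}" for t
  proof -
    have "set_integrable lborel {t..T} g" by (rule sq_int_set_integrable[OF g]) (use t in auto)
    then have i: "integrable (leb T) (\<lambda>s. indicator {t..T} s *\<^sub>R g s)"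
      by (subst (asm) set_integral_leb(2)[of _ T]) (use t in auto)
    have "(LBINT s:{t..T}. g s) \<bullet> f t = (\<integral>s. (indicator {t..T} s *\<^sub>R g s) \<bullet> f t \<partial>leb T)"
      using t by (subst set_integral_leb(1)[of _ T]) (auto intro!: integral_inner_left[symmetric] i simp del: inner_scaleR_left)
    also have "\<dots> = (\<integral>s. ?k t s \<partial>leb T)"
      by (rule Bochner_Integration.integral_cong) auto
    finally show ?thesis using P[of t] t by (simp add: inner_add_left)
  qed
  have mg: "g s \<bullet> m s = g s \<bullet> x + (\<integral>t. ?k t s \<partial>leb T)" if s: "s \<in> {0..T}" for s
  proof -
    have "set_integrable lborel {0..s} f" by (rule sq_int_set_integrable[OF f]) (use s in auto)
    then have i: "integrable (leb T) (\<lambda>t. indicator {0..s} t *\<^sub>R f t)"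
      by (subst (asm) set_integral_leb(2)[of _ T]) (use s in auto)
    have "g s \<bullet> (LBINT t:{0..s}. f t) = (\<integral>t. g s \<bullet> (indicator {0..s} t *\<^sub>R f t) \<partial>leb T)"
      using s by (subst set_integral_leb(1)[of _ T]) (auto intro!: integral_inner_right[symmetric] i simp del: inner_scaleR_right)
    also have "\<dots> = (\<integral>t. ?k t s \<partial>leb T)"
      by (rule Bochner_Integration.integral_cong) auto
    finally show ?thesis using m[of s] s by (simp add: inner_add_right)
  qed
  have k1: "integrable (leb T) (\<lambda>t. \<integral>s. ?k t s \<partial>leb T)" using TT.integrable_fst[OF ki] by simp
  have k2: "integrable (leb T) (\<lambda>s. \<integral>t. ?k t s \<partial>leb T)" using TT.integrable_snd[OF ki] by simp
  have yf: "integrable (leb T) (\<lambda>t. y \<bullet> f t)" and gx: "integrable (leb T) (\<lambda>t. g t \<bullet> x)" using fi gi by auto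
  have 1: "(\<integral>t. P t \<bullet> f t \<partial>leb T) = y \<bullet> (\<integral>t. f t \<partial>leb T) + (\<integral>t. \<integral>s. ?k t s \<partial>leb T \<partial>leb T)"
  proof -
    have "(\<integral>t. P t \<bullet> f t \<partial>leb T) = (\<integral>t. y \<bullet> f t + (\<integral>s. ?k t s \<partial>leb T) \<partial>leb T)"
      by (rule Bochner_Integration.integral_cong[OF refl]) (rule Pf, simp)
    then show ?thesis using fi by (simp only: Bochner_Integration.integral_add[OF yf k1] integral_inner_right)
  qed
  have 2: "(\<integral>t. g t \<bullet> m t \<partial>leb T) = (\<integral>t. g t \<partial>leb T) \<bullet> x + (\<integral>s. \<integral>t. ?k t s \<partial>leb T \<partial>leb T)"
  proof -
    have "(\<integral>t. g t \<bullet> m t \<partial>leb T) = (\<integral>s. g s \<bullet> x + (\<integral>t. ?k t s \<partial>leb T) \<partial>leb T)"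
      by (rule Bochner_Integration.integral_cong[OF refl]) (rule mg, simp)
    then show ?thesis using gi by (simp only: Bochner_Integration.integral_add[OF gx k2] integral_inner_left)
  qed
  have 3: "(\<integral>s. \<integral>t. ?k t s \<partial>leb T \<partial>leb T) = (\<integral>t. \<integral>s. ?k t s \<partial>leb T \<partial>leb T)"
    by (rule TT.Fubini_integral[OF ki])
  have full: "(LBINT s:{0..T}. h s) = (\<integral>s. h s \<partial>leb T)" for h :: "real \<Rightarrow> 'b"
    unfolding set_integral_leb(1)[OF order_refl] by (rule Bochner_Integration.integral_cong) auto
  have "m T = x + (\<integral>t. f t \<partial>leb T)" "P 0 = y + (\<integral>t. g t \<partial>leb T)"
    using m[of T] P[of 0] T full by auto
  then show "y \<bullet> m T - P 0 \<bullet> x = (\<integral>t. P t \<bullet> f t \<partial>leb T) - (\<integral>t. g t \<bullet> m t \<partial>leb T)"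
    unfolding 1 2 3 by (simp add: inner_add_left inner_add_right)
qed

context filtered_space
begin

lemma PM_integral_sections:
  fixes \<phi> :: "('a, real) process"
  assumes i: "integrable PM (case_prod \<phi>)"
  shows "integrable M (\<lambda>w. LBINT s:{0..T}. \<phi> s w)" "(\<integral>w. (LBINT s:{0..T}. \<phi> s w) \<partial>M) = (\<integral>x. case_prod \<phi> x \<partial>PM)"
    "(\<integral>x. case_prod \<phi> x \<partial>PM) = (\<integral>t. mean M \<phi> t \<partial>leb T)"
proof -
  have eq: "(LBINT s:{0..T}. \<phi> s w) = (\<integral>s. \<phi> s w \<partial>leb T)" for w
    unfolding set_integral_leb(1)[OF order_refl] by (rule Bochner_Integration.integral_cong) auto
  show "integrable M (\<lambda>w. LBINT s:{0..T}. \<phi> s w)" unfolding eq using TM.integrable_snd[OF i] .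
  show "(\<integral>w. (LBINT s:{0..T}. \<phi> s w) \<partial>M) = (\<integral>x. case_prod \<phi> x \<partial>PM)" unfolding eq using TM.integral_snd[OF i] .
  show "(\<integral>x. case_prod \<phi> x \<partial>PM) = (\<integral>t. mean M \<phi> t \<partial>leb T)" using TM.integral_fst[OF i] by simp
qed

text \<open>The inner product of square integrable processes.\<close>

definition bilin :: "('a, 'b::euclidean_space) process \<Rightarrow> ('a, 'b) process \<Rightarrow> real" where
  "bilin u v = (\<integral>(t, w). u t w \<bullet> v t w \<partial>PM)"

lemma M2_inner:
  assumes "u \<in> M2_space M T F" "v \<in> M2_space M T F"
  shows "integrable PM (\<lambda>(t, w). u t w \<bullet> v t w)"
  using sq_int_inner[OF M2_sq[OF assms(1)] M2_sq[OF assms(2)]] by (simp add: case_prod_beta')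

lemma bilin_add:
  assumes "u \<in> M2_space M T F" "u' \<in> M2_space M T F" "v \<in> M2_space M T F"
  shows "bilin (\<lambda>t w. u t w + u' t w) v = bilin u v + bilin u' v" "bilin v (\<lambda>t w. u t w + u' t w) = bilin v u + bilin v u'"
  using M2_inner[OF assms(1,3)] M2_inner[OF assms(2,3)] M2_inner[OF assms(3,1)] M2_inner[OF assms(3,2)]
  unfolding bilin_def by (simp_all add: case_prod_beta' inner_add_left inner_add_right)

lemma bilin_scaleR: "bilin (\<lambda>t w. c *\<^sub>R u t w) v = c * bilin u v" "bilin v (\<lambda>t w. c *\<^sub>R u t w) = c * bilin v u"
  unfolding bilin_def by (simp_all add: case_prod_beta')

lemma bilin_sections:
  assumes "u \<in> M2_space M T F" "v \<in> M2_space M T F"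
  shows "bilin u v = (\<integral>t. (\<integral>w. u t w \<bullet> v t w \<partial>M) \<partial>leb T)"
    "(\<lambda>t. \<integral>w. u t w \<bullet> v t w \<partial>M) \<in> borel_measurable (leb T)"
  unfolding bilin_def using PM_integral_sections(3)[OF M2_inner[OF assms]] TM.integrable_fst[OF M2_inner[OF assms]] by simp_all

lemma bilin_cong:
  assumes "u \<in> M2_space M T F" "u' \<in> M2_space M T F" "v \<in> M2_space M T F" "v' \<in> M2_space M T F"
    and "AE t in leb T. (\<integral>w. u t w \<bullet> v t w \<partial>M) = (\<integral>w. u' t w \<bullet> v' t w \<partial>M)"
  shows "bilin u v = bilin u' v'"
  unfolding bilin_sections(1)[OF assms(1,3)] bilin_sections(1)[OF assms(2,4)]
  by (rule integral_cong_AE[OF bilin_sections(2)[OF assms(1,3)] bilin_sections(2)[OF assms(2,4)] assms(5)])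

lemma bilin_deterministic:
  assumes b: "sq_int (leb T) b" and v: "v \<in> M2_space M T F"
  shows "bilin (\<lambda>t w. b t) v = (\<integral>t. b t \<bullet> mean M v t \<partial>leb T)"
  unfolding bilin_sections(1)[OF M2_deterministic[OF b] v]
proof (rule integral_cong_AE)
  show "(\<lambda>t. b t \<bullet> mean M v t) \<in> borel_measurable (leb T)"
    by (intro borel_measurable_inner sq_int_measurable[OF b] sq_int_measurable[OF mean_sq_int[OF M2_sq[OF v]]])
  show "AE t in leb T. (\<integral>w. b t \<bullet> v t w \<partial>M) = b t \<bullet> mean M v t"
    using section_sq_int(1)[OF M2_sq[OF v]] by eventually_elim (simp add: sq_int_integrable)
qed (rule bilin_sections(2)[OF M2_deterministic[OF b] v])

lemma bilin_mean:
  assumes b: "sq_int (leb T) b" and v: "v \<in> M2_space M T F"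
  shows "bilin (\<lambda>t w. b t) (\<lambda>t w. mean M v t) = bilin (\<lambda>t w. b t) v"
  unfolding bilin_deterministic[OF b v] bilin_deterministic[OF b M2_mean[OF v]] by (simp add: prob_space)

lemma bilin_self: "bilin u u = (l2norm PM (case_prod u))\<^sup>2"
  unfolding bilin_def l2norm_sq by (simp add: power2_norm_eq_inner case_prod_beta')

lemma sq_int_matrix:
  fixes f :: "real \<Rightarrow> real^'m::finite" and A :: "real \<Rightarrow> real^'m^'n::finite"
  assumes f: "sq_int (leb T) f" and A: "bdd_meas T A"
  shows "sq_int (leb T) (\<lambda>t. A t *v f t)"
proof -
  obtain C where C: "0 \<le> C" "\<And>t v. t \<in> {0..T} \<Longrightarrow> norm (A t *v v) \<le> C * norm v"
    using bdd_meas_operator_bound[OF A] by blast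
  have [measurable]: "A \<in> borel_measurable (leb T)" "f \<in> borel_measurable (leb T)"
    by (intro bdd_meas_measurable A sq_int_measurable f)+
  have m: "(\<lambda>t. A t *v f t) \<in> borel_measurable (leb T)" by measurable
  show ?thesis by (rule sq_int_bound[OF f m, where c=C]) (use C(2) in \<open>intro AE_I2, simp\<close>)
qed

text \<open>The self-adjoint operator of the quadratic form \<open>E \<integral> \<langle>N u, u\<rangle> + \<langle>N' E u, E u\<rangle> dt\<close>.\<close>

definition mf_op :: "(real \<Rightarrow> real^'k^'k) \<Rightarrow> (real \<Rightarrow> real^'k^'k) \<Rightarrow> ('a, real^'k::finite) process \<Rightarrow> ('a, real^'k) process" where
  "mf_op N N' u t w = N t *v u t w + N' t *v mean M u t"

lemma mf_op_M2:
  assumes "bdd_meas T N" "bdd_meas T N'" "u \<in> M2_space M T F"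
  shows "mf_op N N' u \<in> M2_space M T F"
  unfolding mf_op_def[abs_def] by (intro M2_add M2_matrix M2_mean assms)

lemma mf_op_bilin:
  assumes N: "bdd_meas T N" "bdd_meas T N'" and u: "u \<in> M2_space M T F" "v \<in> M2_space M T F"
  shows "bilin (mf_op N N' u) v = bilin (\<lambda>t w. N t *v u t w) v + bilin (\<lambda>t w. N' t *v mean M u t) (\<lambda>t w. mean M v t)"
proof -
  have b: "sq_int (leb T) (\<lambda>t. N' t *v mean M u t)"
    by (rule sq_int_matrix[OF mean_sq_int[OF M2_sq[OF u(1)]] N(2)])
  show ?thesis unfolding mf_op_def[abs_def] bilin_mean[OF b u(2)]
    by (rule bilin_add(1)[OF M2_matrix[OF u(1) N(1)] M2_deterministic[OF b] u(2)])
qed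

lemma mf_op_symmetric:
  assumes N: "bdd_meas T N" "bdd_meas T N'" "sym_valued T N" "sym_valued T N'" and u: "u \<in> M2_space M T F" "v \<in> M2_space M T F"
  shows "bilin (mf_op N N' u) v = bilin (mf_op N N' v) u"
proof -
  have s: "(A *v x) \<bullet> y = (A *v y) \<bullet> x" if "transpose A = A" for A :: "real^'c^'c" and x y
    using dot_lmul_matrix[of x A y] that by (metis inner_commute transpose_matrix_vector)
  have sym: "bilin (\<lambda>t w. B t *v r t w) z = bilin (\<lambda>t w. B t *v z t w) r" if "sym_valued T B" for B :: "real \<Rightarrow> real^'c^'c" and r z
    unfolding bilin_def
  proof (rule Bochner_Integration.integral_cong[OF refl])
    fix x assume "x \<in> space PM"
    then have "fst x \<in> {0..T}" by (auto simp: space_pair_measure)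
    then have "transpose (B (fst x)) = B (fst x)" using that by (simp add: sym_valued_def)
    from s[OF this] show "(case x of (t, w) \<Rightarrow> (B t *v r t w) \<bullet> z t w) = (case x of (t, w) \<Rightarrow> (B t *v z t w) \<bullet> r t w)"
      by (simp add: case_prod_beta')
  qed
  show ?thesis unfolding mf_op_bilin[OF N(1,2) u] mf_op_bilin[OF N(1,2) u(2,1)]
    using sym[OF N(3), of u v] sym[OF N(4), of "\<lambda>t w. mean M u t" "\<lambda>t w. mean M v t"] by simp
qed

lemma mf_op_add:
  assumes N: "bdd_meas T N" "bdd_meas T N'" and u: "u \<in> M2_space M T F" "v \<in> M2_space M T F" "r \<in> M2_space M T F"
  shows "bilin (mf_op N N' (\<lambda>t w. u t w + c *\<^sub>R v t w)) r = bilin (mf_op N N' u) r + c * bilin (mf_op N N' v) r"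
proof -
  have cb: "bdd_meas T (\<lambda>_. c)" by (simp add: bdd_meas_def image_constant_conv)
  note cv = M2_scaleR[OF u(2) cb]
  note uv = M2_add[OF u(1) cv]
  note op = mf_op_M2[OF N u(1)] mf_op_M2[OF N u(2)]
  have "bilin (mf_op N N' (\<lambda>t w. u t w + c *\<^sub>R v t w)) r = bilin (\<lambda>t w. mf_op N N' u t w + c *\<^sub>R mf_op N N' v t w) r"
  proof (rule bilin_cong[OF mf_op_M2[OF N uv] M2_add[OF op(1) M2_scaleR[OF op(2) cb]] u(3) u(3)])
    show "AE t in leb T. (\<integral>w. mf_op N N' (\<lambda>t w. u t w + c *\<^sub>R v t w) t w \<bullet> r t w \<partial>M) =
        (\<integral>w. (mf_op N N' u t w + c *\<^sub>R mf_op N N' v t w) \<bullet> r t w \<partial>M)"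
      using section_sq_int(1)[OF M2_sq[OF u(1)]] section_sq_int(1)[OF M2_sq[OF u(2)]]
    proof eventually_elim
      case (elim t)
      have "mean M (\<lambda>t w. u t w + c *\<^sub>R v t w) t = mean M u t + c *\<^sub>R mean M v t"
        using elim by (simp add: sq_int_integrable)
      then have "mf_op N N' (\<lambda>t w. u t w + c *\<^sub>R v t w) t w = mf_op N N' u t w + c *\<^sub>R mf_op N N' v t w" for w
        by (simp add: mf_op_def matrix_vector_right_distrib matrix_vector_mult_scaleR scaleR_add_right)
      then show ?case by simp
    qed
  qed
  then show ?thesis by (simp add: bilin_add(1)[OF op(1) M2_scaleR[OF op(2) cb] u(3)] bilin_scaleR)
qed

text \<open>With \<open>v = E v + (v - E v)\<close> the mixed terms vanish: the mean sees \<open>N + N'\<close>, the centred part sees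
  \<open>N\<close>.\<close>

lemma mf_op_nonneg:
  assumes N: "bdd_meas T N" "bdd_meas T N'"
    and pos: "AE t in leb T. (\<forall>v. 0 \<le> (N t *v v) \<bullet> v) \<and> (\<forall>v. 0 \<le> ((N t + N' t) *v v) \<bullet> v)"
    and v: "v \<in> M2_space M T F"
  shows "0 \<le> bilin (mf_op N N' v) v"
  unfolding bilin_sections(1)[OF mf_op_M2[OF N v] v]
proof (rule integral_nonneg_AE)
  show "AE t in leb T. 0 \<le> (\<integral>w. mf_op N N' v t w \<bullet> v t w \<partial>M)"
    using pos section_sq_int(1)[OF M2_sq[OF v]]
  proof eventually_elim
    case (elim t)
    let ?m = "mean M v t"
    have i: "integrable M (v t)" by (rule sq_int_integrable[OF elim(2)])
    have l: "bounded_linear ((*v) (N t))" by (rule matrix_vector_mul_bounded_linear)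
    obtain C where C: "\<And>x. norm (N t *v x) \<le> C * norm x" using bounded_linear.bounded[OF l] by (auto simp: mult.commute)
    have Nv: "sq_int M (\<lambda>w. N t *v v t w)"
      by (rule sq_int_bound[OF elim(2), where c=C])
         (use C borel_measurable_integrable[OF expectation_matrix(1)[OF i, of "N t"]] in auto)
    note e = expectation_matrix[OF i, of "N t"]
    have iN: "integrable M (\<lambda>w. (N t *v v t w) \<bullet> v t w)" by (rule sq_int_inner[OF Nv elim(2)])
    have "0 \<le> (\<integral>w. (N t *v (v t w - ?m)) \<bullet> (v t w - ?m) \<partial>M)" using elim(1) by simp
    also have "\<dots> = (\<integral>w. (N t *v v t w) \<bullet> v t w - (N t *v v t w) \<bullet> ?m - (N t *v ?m) \<bullet> v t w + (N t *v ?m) \<bullet> ?m \<partial>M)"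
      by (simp add: matrix_vector_mult_diff_distrib inner_diff_left inner_diff_right algebra_simps)
    also have "\<dots> = (\<integral>w. (N t *v v t w) \<bullet> v t w \<partial>M) - (N t *v ?m) \<bullet> ?m"
      using iN e i by (simp add: prob_space)
    finally have 1: "(N t *v ?m) \<bullet> ?m \<le> (\<integral>w. (N t *v v t w) \<bullet> v t w \<partial>M)" by simp
    have "(\<integral>w. mf_op N N' v t w \<bullet> v t w \<partial>M) = (\<integral>w. (N t *v v t w) \<bullet> v t w \<partial>M) + (N' t *v ?m) \<bullet> ?m"
      unfolding mf_op_def inner_add_left using iN i by simp
    moreover have "0 \<le> (N t *v ?m) \<bullet> ?m + (N' t *v ?m) \<bullet> ?m"
      using elim(1) by (simp add: matrix_vector_mult_add_rdistrib inner_add_left)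
    ultimately show ?case using 1 by linarith
  qed
qed

text \<open>Expanding the functional around \<open>u\<close> in a direction \<open>v\<close> gives a linear term, the inner product of \<open>v\<close> with the
  gradient \<open>G\<close>, and a nonnegative quadratic term. A zero of \<open>G\<close> is thus a minimum. Conversely,
  \<open>G\<close> is adapted, hence an admissible direction, and moving along \<open>- G\<close> decreases the
  functional to first order unless \<open>G\<close> vanishes.\<close>

theorem mean_field_quadratic_minimum:
  fixes u :: "('a, real^'k::finite) process"
  assumes N: "bdd_meas T N" "bdd_meas T N'" "sym_valued T N" "sym_valued T N'"
    and pos: "AE t in leb T. (\<forall>v. 0 \<le> (N t *v v) \<bullet> v) \<and> (\<forall>v. 0 \<le> ((N t + N' t) *v v) \<bullet> v)"
    and b: "sq_int (leb T) b" and u: "u \<in> M2_space M T F"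
  shows "(\<forall>v\<in>M2_space M T F. bilin (mf_op N N' u) u + bilin (\<lambda>t w. b t) u \<le> bilin (mf_op N N' v) v + bilin (\<lambda>t w. b t) v)
    \<longleftrightarrow> (AE t in leb T. AE w in M. 2 *\<^sub>R (N t *v u t w) + 2 *\<^sub>R (N' t *v mean M u t) + b t = 0)"
proof -
  let ?U = "M2_space M T F :: ('a, real^'k) process set"
  define K where "K v = bilin (mf_op N N' v) v + bilin (\<lambda>t w. b t) v" for v
  define G where "G = (\<lambda>t w. (2::real) *\<^sub>R mf_op N N' u t w + b t)"
  have cb: "bdd_meas T (\<lambda>_. c)" for c :: real by (simp add: bdd_meas_def image_constant_conv)
  note b2 = M2_deterministic[OF b]
  note opu = mf_op_M2[OF N(1,2) u]
  have G2: "G \<in> ?U" unfolding G_def by (rule M2_add[OF M2_scaleR[OF opu cb] b2])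
  have expand: "K (\<lambda>t w. u t w + c *\<^sub>R v t w) = K u + c * bilin G v + c\<^sup>2 * bilin (mf_op N N' v) v" if v: "v \<in> ?U" for v c
  proof -
    note cv = M2_scaleR[OF v cb[of c]]
    note uv = M2_add[OF u cv]
    have "bilin (mf_op N N' (\<lambda>t w. u t w + c *\<^sub>R v t w)) (\<lambda>t w. u t w + c *\<^sub>R v t w)
      = bilin (mf_op N N' u) u + c * bilin (mf_op N N' u) v + c * (bilin (mf_op N N' v) u + c * bilin (mf_op N N' v) v)"
      unfolding mf_op_add[OF N(1,2) u v uv] bilin_add(2)[OF u cv opu] bilin_add(2)[OF u cv mf_op_M2[OF N(1,2) v]] bilin_scaleR ..
    moreover have "bilin (\<lambda>t w. b t) (\<lambda>t w. u t w + c *\<^sub>R v t w) = bilin (\<lambda>t w. b t) u + c * bilin (\<lambda>t w. b t) v"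
      unfolding bilin_add(2)[OF u cv b2] bilin_scaleR ..
    moreover have "bilin G v = 2 * bilin (mf_op N N' u) v + bilin (\<lambda>t w. b t) v"
      unfolding G_def bilin_add(1)[OF M2_scaleR[OF opu cb] b2 v] bilin_scaleR ..
    ultimately show ?thesis unfolding K_def mf_op_symmetric[OF N v u]
      by (simp add: algebra_simps power2_eq_square)
  qed
  have Geq: "G t w = 2 *\<^sub>R (N t *v u t w) + 2 *\<^sub>R (N' t *v mean M u t) + b t" for t w
    by (simp add: G_def mf_op_def scaleR_add_right)
  show ?thesis unfolding Geq[symmetric] K_def[symmetric]
  proof
    assume min: "\<forall>v\<in>?U. K u \<le> K v"
    define g where "g = bilin G G"
    define q where "q = bilin (mf_op N N' G) G"
    have q0: "0 \<le> q" unfolding q_def by (rule mf_op_nonneg[OF N(1,2) pos G2])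
    have le: "g \<le> e * q" if e: "0 < e" for e
    proof -
      have "K u \<le> K (\<lambda>t w. u t w + (- e) *\<^sub>R G t w)" by (rule bspec[OF min M2_add[OF u M2_scaleR[OF G2 cb]]])
      also have "\<dots> = K u - e * g + e\<^sup>2 * q" unfolding expand[OF G2] g_def q_def by simp
      finally have "e * g \<le> e * (e * q)" by (simp add: power2_eq_square mult.assoc)
      then show ?thesis using e by simp
    qed
    have "g \<le> 0"
    proof (cases "q = 0")
      case True then show ?thesis using le[of 1] by simp
    next
      case False
      show ?thesis
      proof (rule ccontr)
        assume "\<not> g \<le> 0"
        \<comment> \<open>for this step size the right-hand side is \<open>g / 2\<close>\<close>
        then have "g \<le> g / (2 * q) * q" using False q0 by (intro le) auto
        with \<open>\<not> g \<le> 0\<close> False show False by simp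
      qed
    qed
    then have "l2norm PM (case_prod G) = 0" unfolding g_def bilin_self by simp
    then show "AE t in leb T. AE w in M. G t w = 0" by (rule l2_zero_sections[OF M2_sq[OF G2]])
  next
    assume G0: "AE t in leb T. AE w in M. G t w = 0"
    show "\<forall>v\<in>?U. K u \<le> K v"
    proof
      fix v assume v: "v \<in> ?U"
      note d = M2_diff[OF v u]
      have "bilin G (\<lambda>t w. v t w - u t w) = bilin (\<lambda>t w. 0) (\<lambda>t w. v t w - u t w)"
      proof (rule bilin_cong[OF G2 M2_deterministic[OF sq_int_zero] d d])
        show "AE t in leb T. (\<integral>w. G t w \<bullet> (v t w - u t w) \<partial>M) = (\<integral>w. 0 \<bullet> (v t w - u t w) \<partial>M)"
          using G0
        proof eventually_elim
          case (elim t)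
          have "(\<integral>w. G t w \<bullet> (v t w - u t w) \<partial>M) = 0"
            by (rule integral_eq_zero_AE) (use elim in \<open>eventually_elim, simp\<close>)
          then show ?case by simp
        qed
      qed
      also have "\<dots> = 0" by (simp add: bilin_def case_prod_beta')
      finally have z: "bilin G (\<lambda>t w. v t w - u t w) = 0" .
      have "(\<lambda>t w. u t w + 1 *\<^sub>R (v t w - u t w)) = v" by (intro ext) simp
      then have "K v = K u + bilin (mf_op N N' (\<lambda>t w. v t w - u t w)) (\<lambda>t w. v t w - u t w)"
        using expand[OF d, of 1] z by simp
      then show "K u \<le> K v" using mf_op_nonneg[OF N(1,2) pos d] by simp
    qed
  qed
qed

end

section \<open>Saddle points\<close>

lemma inner_transpose: "(transpose A *v x) \<bullet> y = x \<bullet> (A *v y)" for A :: "real^'m::finite^'n::finite"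
  by (simp add: transpose_matrix_vector dot_lmul_matrix)

context lq_game
begin

lemma running_cost:
  fixes N N' :: "real \<Rightarrow> real^'k^'k::finite"
  assumes N: "bdd_meas T N" "bdd_meas T N'" and u: "u \<in> M2_space M T F"
  defines "\<phi> \<equiv> \<lambda>t w. (N t *v u t w) \<bullet> u t w + (N' t *v mean M u t) \<bullet> mean M u t"
  shows "integrable M (\<lambda>w. LBINT s:{0..T}. \<phi> s w)" "(\<integral>w. (LBINT s:{0..T}. \<phi> s w) \<partial>M) = bilin (mf_op N N' u) u"
proof -
  note i = M2_inner[OF M2_matrix[OF u N(1)] u] M2_inner[OF M2_matrix[OF M2_mean[OF u] N(2)] M2_mean[OF u]]
  have "integrable PM (case_prod \<phi>)" "(\<integral>x. case_prod \<phi> x \<partial>PM) = bilin (mf_op N N' u) u"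
    using i unfolding \<phi>_def mf_op_bilin[OF N u u] unfolding bilin_def by (simp_all add: case_prod_beta')
  then show "integrable M (\<lambda>w. LBINT s:{0..T}. \<phi> s w)" "(\<integral>w. (LBINT s:{0..T}. \<phi> s w) \<partial>M) = bilin (mf_op N N' u) u"
    using PM_integral_sections(1,2)[of \<phi>] by simp_all
qed

text \<open>By \<open>integration_by_parts\<close> for the means of state and adjoint. In \<open>p \<bullet> m'\<close> and \<open>p' \<bullet> m\<close> the terms with
  \<open>mean_A\<close> cancel, and the terms with \<open>Q\<close> and the terminal weight are those of the cost.\<close>

theorem cost_decomposition:
  assumes adj: "adjoint_solution M T W Y \<Gamma> p q qt" and u: "u1 \<in> controls M T Y" "u2 \<in> controls M T Y"
  shows "cost M T W Y \<Gamma> x0 u1 u2 = mean M p 0 \<bullet> x0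
    + (bilin (mf_op (N11 \<Gamma>) (N12 \<Gamma>) u1) u1 + bilin (\<lambda>t w. transpose (mean_B1 t) *v mean M p t) u1)
    + (bilin (mf_op (N21 \<Gamma>) (N22 \<Gamma>) u2) u2 + bilin (\<lambda>t w. transpose (mean_B2 t) *v mean M p t) u2)"
proof -
  define X where "X = state_of M T W Y \<Gamma> x0 u1 u2"
  have X: "is_state M T W Y \<Gamma> x0 u1 u2 X" unfolding X_def state_of_def by (rule someI_ex[OF state_exists[OF u]])
  note u' = controls_M2[OF u(1)] controls_M2[OF u(2)]
  have X2: "X \<in> M2_space M T F" using X S2_M2 unfolding is_state_def by blast
  have p2: "p \<in> M2_space M T F" using adj S2_M2 unfolding adjoint_solution_def by blast
  have T0: "0 \<le> T" "T \<le> T" using T by auto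
  let ?m = "mean M X" and ?P = "mean M p" and ?TM = "leb T"
  note msq = mean_sq_int[OF M2_sq[OF X2]] and psq = mean_sq_int[OF M2_sq[OF p2]]
    and usq = mean_sq_int[OF M2_sq[OF u'(1)]] mean_sq_int[OF M2_sq[OF u'(2)]]
  let ?b1 = "\<lambda>t. transpose (mean_B1 t) *v ?P t" and ?b2 = "\<lambda>t. transpose (mean_B2 t) *v ?P t"
  let ?f = "\<lambda>s. mean_A s *v ?m s + mean_B1 s *v mean M u1 s + mean_B2 s *v mean M u2 s"
  let ?g = "\<lambda>s. transpose (mean_A s) *v ?P s + Q_run \<Gamma> s"
  note bsq = sq_int_matrix[OF psq bdd_meas_transpose[OF mean_coeff_bounded(2)]] sq_int_matrix[OF psq bdd_meas_transpose[OF mean_coeff_bounded(3)]]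
  have fsq: "sq_int ?TM ?f" by (intro sq_int_add sq_int_matrix msq usq mean_coeff_bounded)
  have gsq: "sq_int ?TM ?g" by (intro sq_int_add sq_int_matrix psq Q_sq bdd_meas_transpose mean_coeff_bounded)
  note ibp = integration_by_parts[OF fsq gsq state_mean[OF u X] adjoint_deterministic(3)[OF adj] T]
  have dual: "M_term \<Gamma> \<bullet> ?m T - ?P 0 \<bullet> x0 = bilin (\<lambda>t w. ?b1 t) u1 + bilin (\<lambda>t w. ?b2 t) u2 - (\<integral>t. Q_run \<Gamma> t \<bullet> ?m t \<partial>?TM)"
  proof -
    have i: "integrable ?TM (\<lambda>t. ?P t \<bullet> ?f t)" "integrable ?TM (\<lambda>t. ?g t \<bullet> ?m t)" "integrable ?TM (\<lambda>t. ?b1 t \<bullet> mean M u1 t)"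
      "integrable ?TM (\<lambda>t. ?b2 t \<bullet> mean M u2 t)" "integrable ?TM (\<lambda>t. Q_run \<Gamma> t \<bullet> ?m t)"
      by (intro sq_int_inner fsq gsq psq msq usq bsq Q_sq)+
    have "M_term \<Gamma> \<bullet> ?m T - ?P 0 \<bullet> x0 = (\<integral>t. ?P t \<bullet> ?f t \<partial>?TM) - (\<integral>t. ?g t \<bullet> ?m t \<partial>?TM)"
      by (rule ibp)
    also have "\<dots> = (\<integral>t. ?P t \<bullet> ?f t - ?g t \<bullet> ?m t \<partial>?TM)" using i by simp
    also have "\<dots> = (\<integral>t. ?b1 t \<bullet> mean M u1 t + ?b2 t \<bullet> mean M u2 t - Q_run \<Gamma> t \<bullet> ?m t \<partial>?TM)"
      by (simp add: inner_transpose inner_add_left inner_add_right add_diff_eq)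
    also have "\<dots> = (\<integral>t. ?b1 t \<bullet> mean M u1 t \<partial>?TM) + (\<integral>t. ?b2 t \<bullet> mean M u2 t \<partial>?TM) - (\<integral>t. Q_run \<Gamma> t \<bullet> ?m t \<partial>?TM)"
      using i by simp
    finally show ?thesis unfolding bilin_deterministic[OF bsq(1) u'(1)] bilin_deterministic[OF bsq(2) u'(2)] .
  qed
  have XT: "integrable M (X T)"
    using X S2_l2_bound T0 sq_int_integrable unfolding is_state_def by metis
  have t1: "integrable M (\<lambda>w. M_term \<Gamma> \<bullet> X T w)" "(\<integral>w. M_term \<Gamma> \<bullet> X T w \<partial>M) = M_term \<Gamma> \<bullet> ?m T"
    using XT by simp_all
  note Qi = M2_inner[OF M2_deterministic[OF Q_sq] X2]
  have t2: "integrable M (\<lambda>w. LBINT s:{0..T}. Q_run \<Gamma> s \<bullet> X s w)"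
    "(\<integral>w. (LBINT s:{0..T}. Q_run \<Gamma> s \<bullet> X s w) \<partial>M) = (\<integral>t. Q_run \<Gamma> t \<bullet> ?m t \<partial>?TM)"
    using PM_integral_sections(1,2)[OF Qi] bilin_deterministic[OF Q_sq X2] by (simp_all add: bilin_def)
  note t3 = running_cost[OF coefficients_bounded(19,20) u'(1)] and t4 = running_cost[OF coefficients_bounded(21,22) u'(2)]
  have "cost M T W Y \<Gamma> x0 u1 u2 = M_term \<Gamma> \<bullet> ?m T + (\<integral>t. Q_run \<Gamma> t \<bullet> ?m t \<partial>?TM) + bilin (mf_op (N11 \<Gamma>) (N12 \<Gamma>) u1) u1 + bilin (mf_op (N21 \<Gamma>) (N22 \<Gamma>) u2) u2"
    unfolding cost_def X_def[symmetric] Let_def t1(2)[symmetric] t2(2)[symmetric] t3(2)[symmetric] t4(2)[symmetric]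
    by (simp only: Bochner_Integration.integral_add Bochner_Integration.integrable_add t1(1) t2(1) t3(1) t4(1))
  then show ?thesis using dual by simp
qed

text \<open>The filtration of the observation is itself augmented, so the abstract result applies with the
  controls as its square integrable adapted processes.\<close>

lemma control_minimum:
  fixes u :: "('a, real^'k::finite) process"
  assumes N: "bdd_meas T N" "bdd_meas T N'" "sym_valued T N" "sym_valued T N'"
    and pos: "AE t in leb T. (\<forall>v. 0 \<le> (N t *v v) \<bullet> v) \<and> (\<forall>v. 0 \<le> ((N t + N' t) *v v) \<bullet> v)"
    and b: "sq_int (leb T) b" and u: "u \<in> controls M T Y"
  shows "(\<forall>v\<in>controls M T Y. bilin (mf_op N N' u) u + bilin (\<lambda>t w. b t) u \<le> bilin (mf_op N N' v) v + bilin (\<lambda>t w. b t) v)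
    \<longleftrightarrow> (AE t in leb T. AE w in M. 2 *\<^sub>R (N t *v u t w) + 2 *\<^sub>R (N' t *v mean M u t) + b t = 0)"
proof -
  interpret nat: filtered_space M T "natural_filtration M Y"
  proof
    show "augmented M (natural_filtration M Y t)" if "t \<le> T" for t
      using natural_filtration_augmented[OF _ that] bm(2) unfolding brownian_motion_def by blast
    show "sets (natural_filtration M Y s) \<subseteq> sets (natural_filtration M Y t)" if "s \<le> t" for s t
      by (rule natural_filtration_mono[OF that])
  qed (rule T)
  show ?thesis using nat.mean_field_quadratic_minimum[OF N pos b] u unfolding controls_def by blast
qed

lemma control_maximum:
  fixes u :: "('a, real^'k::finite) process"
  assumes N: "bdd_meas T N" "bdd_meas T N'" "sym_valued T N" "sym_valued T N'"
    and neg: "AE t in leb T. (\<forall>v. (N t *v v) \<bullet> v \<le> 0) \<and> (\<forall>v. ((N t + N' t) *v v) \<bullet> v \<le> 0)"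
    and b: "sq_int (leb T) b" and u: "u \<in> controls M T Y"
  shows "(\<forall>v\<in>controls M T Y. bilin (mf_op N N' v) v + bilin (\<lambda>t w. b t) v \<le> bilin (mf_op N N' u) u + bilin (\<lambda>t w. b t) u)
    \<longleftrightarrow> (AE t in leb T. AE w in M. 2 *\<^sub>R (N t *v u t w) + 2 *\<^sub>R (N' t *v mean M u t) + b t = 0)"
proof -
  let ?n = "\<lambda>A t. (- 1 :: real) *\<^sub>R A t"
  have c: "bdd_meas T (\<lambda>_. - 1 :: real)" by (simp add: bdd_meas_def image_constant_conv)
  have sym: "sym_valued T (?n A)" if "sym_valued T A" for A :: "real \<Rightarrow> real^'k^'k"
    using that unfolding sym_valued_def by (simp add: transpose_def vec_eq_iff)
  have mv: "(?n A t) *v x = - (A t *v x)" for A :: "real \<Rightarrow> real^'k^'k" and t x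
    by (simp add: matrix_vector_mult_def vec_eq_iff sum_negf)
  have op: "mf_op (?n N) (?n N') v = (\<lambda>t w. (- 1) *\<^sub>R mf_op N N' v t w)" for v
    unfolding mf_op_def[abs_def] mv by simp
  have pos: "AE t in leb T. (\<forall>v. 0 \<le> (?n N t *v v) \<bullet> v) \<and> (\<forall>v. 0 \<le> ((?n N t + ?n N' t) *v v) \<bullet> v)"
    using neg
  proof eventually_elim
    case (elim t)
    have a: "(N t *v v) \<bullet> v \<le> 0" "(N t *v v) \<bullet> v + (N' t *v v) \<bullet> v \<le> 0" for v
      using elim by (simp_all add: matrix_vector_mult_add_rdistrib inner_add_left)
    have "0 \<le> (?n N t *v v) \<bullet> v" "0 \<le> ((?n N t + ?n N' t) *v v) \<bullet> v" for v
      unfolding matrix_vector_mult_add_rdistrib mv inner_add_left inner_minus_left using a[of v] by linarith+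
    then show ?case by blast
  qed
  have bs: "sq_int (leb T) (?n b)" by (rule sq_int_scaleR[OF b])
  have g: "2 *\<^sub>R (?n N t *v u t w) + 2 *\<^sub>R (?n N' t *v mean M u t) + ?n b t = 0
    \<longleftrightarrow> 2 *\<^sub>R (N t *v u t w) + 2 *\<^sub>R (N' t *v mean M u t) + b t = 0" for t w
    unfolding mv by (metis (no_types, lifting) add.inverse_inverse minus_add_distrib neg_equal_0_iff_equal scaleR_minus1_left scaleR_minus_right)
  have "(\<forall>v\<in>controls M T Y. bilin (mf_op N N' v) v + bilin (\<lambda>t w. b t) v \<le> bilin (mf_op N N' u) u + bilin (\<lambda>t w. b t) u)
    \<longleftrightarrow> (\<forall>v\<in>controls M T Y. bilin (mf_op (?n N) (?n N') u) u + bilin (\<lambda>t w. ?n b t) u \<le> bilin (mf_op (?n N) (?n N') v) v + bilin (\<lambda>t w. ?n b t) v)"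
    unfolding op bilin_scaleR by (intro ball_cong refl) linarith
  also have "\<dots> \<longleftrightarrow> (AE t in leb T. AE w in M. 2 *\<^sub>R (?n N t *v u t w) + 2 *\<^sub>R (?n N' t *v mean M u t) + ?n b t = 0)"
    by (rule control_minimum[OF bdd_meas_scaleR[OF c N(1)] bdd_meas_scaleR[OF c N(2)] sym[OF N(3)] sym[OF N(4)] pos bs u])
  finally show ?thesis unfolding g .
qed

lemma adjoint_conditional:
  assumes adj: "adjoint_solution M T W Y \<Gamma> p q qt"
  shows "AE t in leb T. mean M q t = 0 \<and>
    (AE w in M. vec_cond_exp M (natural_filtration M Y t) (p t) w = mean M p t \<and> vec_cond_exp M (natural_filtration M Y t) (q t) w = 0)"
  using adjoint_deterministic(2)[OF adj] AE_space
proof eventually_elim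
  case (elim t)
  then have t: "0 \<le> t" "t \<le> T" by auto
  have p2: "p \<in> M2_space M T F" and q2: "q \<in> M2_space M T F" using adj S2_M2 unfolding adjoint_solution_def by blast+
  have aug: "augmented M (natural_filtration M Y t)"
    using natural_filtration_augmented[OF _ t(2)] bm(2) unfolding brownian_motion_def by blast
  have sub: "subalgebra M (natural_filtration M Y t)" using aug unfolding augmented_def by blast
  have "mean M q t = (\<integral>w. 0 \<partial>M)" by (intro integral_cong_AE elim M2_measurable_M[OF q2 t]) simp
  moreover have "AE w in M. vec_cond_exp M (natural_filtration M Y t) (p t) w = mean M p t"
    by (rule vec_cond_exp_const[OF sub M2_measurable_M[OF p2 t] adjoint_deterministic(1)[OF adj t]])
  moreover have "AE w in M. vec_cond_exp M (natural_filtration M Y t) (q t) w = 0"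
    by (rule vec_cond_exp_const[OF sub M2_measurable_M[OF q2 t] elim(1)])
  ultimately show ?case by (simp add: AE_conj_iff)
qed

text \<open>The cost is separated in the two controls; either inequality of a saddle point involves only the
  functional of one player.\<close>

theorem saddle_characterization:
  assumes L2: "L2 T \<Gamma>" and u: "u1 \<in> controls M T Y" "u2 \<in> controls M T Y" and adj: "adjoint_solution M T W Y \<Gamma> p q qt"
  shows "open_loop_saddle M T W Y \<Gamma> x0 u1 u2 \<longleftrightarrow>
    (AE t in leb T. AE w in M. 2 *\<^sub>R (N11 \<Gamma> t *v u1 t w) + 2 *\<^sub>R (N12 \<Gamma> t *v mean M u1 t) + transpose (mean_B1 t) *v mean M p t = 0) \<and>
    (AE t in leb T. AE w in M. 2 *\<^sub>R (N21 \<Gamma> t *v u2 t w) + 2 *\<^sub>R (N22 \<Gamma> t *v mean M u2 t) + transpose (mean_B2 t) *v mean M p t = 0)"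
proof -
  obtain \<delta> where \<delta>: "0 < \<delta>" and L: "AE t in lborel. t \<in> {0..T} \<longrightarrow>
     (\<forall>u. (N11 \<Gamma> t *v u) \<bullet> u \<ge> \<delta> * (norm u)\<^sup>2 \<and> ((N11 \<Gamma> t + N12 \<Gamma> t) *v u) \<bullet> u \<ge> \<delta> * (norm u)\<^sup>2) \<and>
     (\<forall>u. (N21 \<Gamma> t *v u) \<bullet> u \<le> - \<delta> * (norm u)\<^sup>2 \<and> ((N21 \<Gamma> t + N22 \<Gamma> t) *v u) \<bullet> u \<le> - \<delta> * (norm u)\<^sup>2)"
    using L2 unfolding L2_def by blast
  have d: "0 \<le> \<delta> * (norm v)\<^sup>2" "- \<delta> * (norm v)\<^sup>2 \<le> 0" for v :: "'z::real_normed_vector" using \<delta> by auto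
  have L': "AE t in leb T.
     (\<forall>u. (N11 \<Gamma> t *v u) \<bullet> u \<ge> \<delta> * (norm u)\<^sup>2 \<and> ((N11 \<Gamma> t + N12 \<Gamma> t) *v u) \<bullet> u \<ge> \<delta> * (norm u)\<^sup>2) \<and>
     (\<forall>u. (N21 \<Gamma> t *v u) \<bullet> u \<le> - \<delta> * (norm u)\<^sup>2 \<and> ((N21 \<Gamma> t + N22 \<Gamma> t) *v u) \<bullet> u \<le> - \<delta> * (norm u)\<^sup>2)"
    using L by (subst AE_restrict_space_iff) auto
  have pos: "AE t in leb T. (\<forall>v. 0 \<le> (N11 \<Gamma> t *v v) \<bullet> v) \<and> (\<forall>v. 0 \<le> ((N11 \<Gamma> t + N12 \<Gamma> t) *v v) \<bullet> v)"
    using L' by eventually_elim (meson d(1) order_trans)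
  have neg: "AE t in leb T. (\<forall>v. (N21 \<Gamma> t *v v) \<bullet> v \<le> 0) \<and> (\<forall>v. ((N21 \<Gamma> t + N22 \<Gamma> t) *v v) \<bullet> v \<le> 0)"
    using L' by eventually_elim (meson d(2) order_trans)
  have sym: "sym_valued T (N11 \<Gamma>)" "sym_valued T (N12 \<Gamma>)" "sym_valued T (N21 \<Gamma>)" "sym_valued T (N22 \<Gamma>)"
    using L1 unfolding L1_def by blast+
  have p2: "p \<in> M2_space M T F" using adj S2_M2 unfolding adjoint_solution_def by blast
  note psq = mean_sq_int[OF M2_sq[OF p2]]
  have b: "sq_int (leb T) (\<lambda>t. transpose (mean_B1 t) *v mean M p t)" "sq_int (leb T) (\<lambda>t. transpose (mean_B2 t) *v mean M p t)"
    by (intro sq_int_matrix psq bdd_meas_transpose mean_coeff_bounded)+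
  show ?thesis
    unfolding control_minimum[OF coefficients_bounded(19,20) sym(1,2) pos b(1) u(1), symmetric]
      control_maximum[OF coefficients_bounded(21,22) sym(3,4) neg b(2) u(2), symmetric]
    unfolding open_loop_saddle_def
    using u by (auto simp: cost_decomposition[OF adj])
qed

theorem optimality_condition:
  assumes u: "u1 \<in> controls M T Y" "u2 \<in> controls M T Y" and adj: "adjoint_solution M T W Y \<Gamma> p q qt"
  shows "(AE t in lborel. t \<in> {0..T} \<longrightarrow> (AE w in M.
       2 *\<^sub>R (N11 \<Gamma> t *v u1 t w) + 2 *\<^sub>R (N12 \<Gamma> t *v mean M u1 t)
       + (transpose (B11 \<Gamma> t) - h_obs \<Gamma> t *\<^sub>R transpose (G11 \<Gamma> t))
           *v vec_cond_exp M (natural_filtration M Y t) (p t) w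
       + (transpose (B12 \<Gamma> t) - h_obs \<Gamma> t *\<^sub>R transpose (G12 \<Gamma> t)) *v mean M p t
       + transpose (D11 \<Gamma> t) *v vec_cond_exp M (natural_filtration M Y t) (q t) w
       + transpose (D12 \<Gamma> t) *v mean M q t = 0
     \<and>
       2 *\<^sub>R (N21 \<Gamma> t *v u2 t w) + 2 *\<^sub>R (N22 \<Gamma> t *v mean M u2 t)
       + (transpose (B21 \<Gamma> t) - h_obs \<Gamma> t *\<^sub>R transpose (G21 \<Gamma> t))
           *v vec_cond_exp M (natural_filtration M Y t) (p t) w
       + (transpose (B22 \<Gamma> t) - h_obs \<Gamma> t *\<^sub>R transpose (G22 \<Gamma> t)) *v mean M p t
       + transpose (D21 \<Gamma> t) *v vec_cond_exp M (natural_filtration M Y t) (q t) w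
       + transpose (D22 \<Gamma> t) *v mean M q t = 0)) \<longleftrightarrow>
    (AE t in leb T. AE w in M. 2 *\<^sub>R (N11 \<Gamma> t *v u1 t w) + 2 *\<^sub>R (N12 \<Gamma> t *v mean M u1 t) + transpose (mean_B1 t) *v mean M p t = 0) \<and>
    (AE t in leb T. AE w in M. 2 *\<^sub>R (N21 \<Gamma> t *v u2 t w) + 2 *\<^sub>R (N22 \<Gamma> t *v mean M u2 t) + transpose (mean_B2 t) *v mean M p t = 0)"
    (is "(AE t in lborel. t \<in> {0..T} \<longrightarrow> (AE w in M. ?E1 t w = 0 \<and> ?E2 t w = 0)) \<longleftrightarrow>
      (AE t in leb T. AE w in M. ?G1 t w = 0) \<and> (AE t in leb T. AE w in M. ?G2 t w = 0)")
proof -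
  have tr: "(transpose (B11 \<Gamma> t) - h_obs \<Gamma> t *\<^sub>R transpose (G11 \<Gamma> t)) + (transpose (B12 \<Gamma> t) - h_obs \<Gamma> t *\<^sub>R transpose (G12 \<Gamma> t)) = transpose (mean_B1 t)"
    "(transpose (B21 \<Gamma> t) - h_obs \<Gamma> t *\<^sub>R transpose (G21 \<Gamma> t)) + (transpose (B22 \<Gamma> t) - h_obs \<Gamma> t *\<^sub>R transpose (G22 \<Gamma> t)) = transpose (mean_B2 t)" for t
    by (simp_all add: mean_B1_def mean_B2_def transpose_def vec_eq_iff algebra_simps)
  have eq: "AE t in leb T. (AE w in M. ?E1 t w = 0 \<and> ?E2 t w = 0) \<longleftrightarrow> (AE w in M. ?G1 t w = 0) \<and> (AE w in M. ?G2 t w = 0)"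
    using adjoint_conditional[OF adj]
  proof eventually_elim
    case (elim t)
    then have q: "mean M q t = 0" and c: "AE w in M. vec_cond_exp M (natural_filtration M Y t) (p t) w = mean M p t \<and> vec_cond_exp M (natural_filtration M Y t) (q t) w = 0"
      by blast+
    have "AE w in M. (?E1 t w = 0 \<and> ?E2 t w = 0) \<longleftrightarrow> (?G1 t w = 0 \<and> ?G2 t w = 0)"
      using c by eventually_elim (simp add: q tr[symmetric] matrix_vector_mult_add_rdistrib add.assoc)
    then have "(AE w in M. ?E1 t w = 0 \<and> ?E2 t w = 0) \<longleftrightarrow> (AE w in M. ?G1 t w = 0 \<and> ?G2 t w = 0)"
      by (rule eventually_subst)
    then show ?case by (simp only: AE_conj_iff)
  qed
  have "(AE t in lborel. t \<in> {0..T} \<longrightarrow> (AE w in M. ?E1 t w = 0 \<and> ?E2 t w = 0)) \<longleftrightarrow> (AE t in leb T. AE w in M. ?E1 t w = 0 \<and> ?E2 t w = 0)"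
    by (rule AE_restrict_space_iff[symmetric]) simp
  also have "\<dots> \<longleftrightarrow> (AE t in leb T. (AE w in M. ?G1 t w = 0) \<and> (AE w in M. ?G2 t w = 0))"
    by (rule eventually_subst[OF eq])
  finally show ?thesis by (simp only: AE_conj_iff)
qed

end

theorem theorem5p4:
  fixes M :: "'a measure" and T :: real and W Y :: "real \<Rightarrow> 'a \<Rightarrow> real"
    and \<Gamma> :: "('n::finite, 'k1::finite, 'k2::finite) lq_data" and x0 :: "real^'n"
    and u1 :: "real \<Rightarrow> 'a \<Rightarrow> real^'k1" and u2 :: "real \<Rightarrow> 'a \<Rightarrow> real^'k2"
    and X p q qt :: "real \<Rightarrow> 'a \<Rightarrow> real^'n"
  assumes "0 < T"
    and "prob_space M" and "complete_measure M"
    and "brownian_motion M T W" and "brownian_motion M T Y"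
    and "independent_processes M T W Y"
    and "sets M = sets (joint_filtration M W Y T)"
    and "L1 T \<Gamma>" and "L2 T \<Gamma>"
    and "u1 \<in> controls M T Y" and "u2 \<in> controls M T Y"
    and "is_state M T W Y \<Gamma> x0 u1 u2 X"
    and "adjoint_solution M T W Y \<Gamma> p q qt"
  shows "optimal_pair M T W Y \<Gamma> x0 u1 u2 X \<longleftrightarrow>
    (AE t in lborel. t \<in> {0..T} \<longrightarrow> (AE \<omega> in M.
       2 *\<^sub>R (N11 \<Gamma> t *v u1 t \<omega>) + 2 *\<^sub>R (N12 \<Gamma> t *v mean M u1 t)
       + (transpose (B11 \<Gamma> t) - h_obs \<Gamma> t *\<^sub>R transpose (G11 \<Gamma> t))
           *v vec_cond_exp M (natural_filtration M Y t) (p t) \<omega>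
       + (transpose (B12 \<Gamma> t) - h_obs \<Gamma> t *\<^sub>R transpose (G12 \<Gamma> t)) *v mean M p t
       + transpose (D11 \<Gamma> t) *v vec_cond_exp M (natural_filtration M Y t) (q t) \<omega>
       + transpose (D12 \<Gamma> t) *v mean M q t = 0
     \<and>
       2 *\<^sub>R (N21 \<Gamma> t *v u2 t \<omega>) + 2 *\<^sub>R (N22 \<Gamma> t *v mean M u2 t)
       + (transpose (B21 \<Gamma> t) - h_obs \<Gamma> t *\<^sub>R transpose (G21 \<Gamma> t))
           *v vec_cond_exp M (natural_filtration M Y t) (p t) \<omega>
       + (transpose (B22 \<Gamma> t) - h_obs \<Gamma> t *\<^sub>R transpose (G22 \<Gamma> t)) *v mean M p t
       + transpose (D21 \<Gamma> t) *v vec_cond_exp M (natural_filtration M Y t) (q t) \<omega>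
       + transpose (D22 \<Gamma> t) *v mean M q t = 0))"
proof -
  interpret lq_game M T W Y \<Gamma>
    by (intro lq_game.intro assms)
  show ?thesis
    unfolding optimal_pair_def saddle_characterization[OF assms(9-11,13)] optimality_condition[OF assms(10,11,13)]
    using assms(12) by blast
qed

end
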